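(* Let $(\mathcal{E},\mathcal{M},\mathcal{Q})$ be a small Boolean modal category with quotients. Then there exist a graph $\mathbf{G}$ and a morphism of Boolean modal categories with quotients $F:\mathcal{E}\longrightarrow \mathrm{Rel}^{\mathbf{G}}$ (where $\mathrm{Rel}^{\mathbf{G}}$ carries its canonical structure of Boolean modal category with quotients) which is $\mathcal{M}$-conservative.
   Context: An f-regular category is a pair $(\mathcal{E},\mathcal{M})$ where $\mathcal{E}$ has finite limits and $\mathcal{M}$ is a class of monomorphisms containing all isomorphisms and regular monomorphisms, closed under composition and pullback, such that every arrow factors as $m\circ e$ with $m\in\mathcal{M}$ and $e\in\mathcal{M}^\bot$ (the class of arrows left orthogonal to every arrow of $\mathcal{M}$), with $\mathcal{M}^\bot$ stable under pullback. $\mathrm{Sub}_{\mathcal{M}}(X)$ denotes the poset of subobjects of $X$ represented by arrows of $\mathcal{M}$; for $f:X\to Y$, $f^*$ is pullback and $\exists_f$ its left adjoint (image). It is f-coherent if moreover each $\mathrm{Sub}_{\mathcal{M}}(X)$ has finite joins preserved by all $f^*$; Boolean if each $\mathrm{Sub}_{\mathcal{M}}(X)$ is a Boolean algebra. A (Boolean) modal category is such an f-coherent (Boolean) category with operators $\Diamond=\Diamond_X$ on each $\mathrm{Sub}_{\mathcal{M}}(X)$ preserving finite joins, with $\Diamond_X f^*S\le f^*\Diamond_Y S$ for all $f:X\to Y$, and $\Diamond_A\iota^*S=\iota^*\Diamond_X\exists_\iota\iota^*S$ for $\iota:A\hookrightarrow X$ in $\mathcal{M}$; $\Box=\neg\Diamond\neg$.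 A Boolean modal category with quotients is a Boolean modal category with a class $\mathcal{Q}\subseteq\mathcal{M}^\bot$ of arrows (quotients) such that for every $q:X\to Y$ in $\mathcal{Q}$, every object $Z$ and every $S\in\mathrm{Sub}_{\mathcal{M}}(Y\times Z)$, $\Diamond S\le\exists_{q\times 1_Z}\Diamond(q\times 1_Z)^*S$. A morphism of such is a functor preserving finite limits, $\mathcal{M}$, $\mathcal{M}^\bot$, finite joins of $\mathcal{M}$-subobjects and $\Diamond$ (a modal functor), and sending quotients to quotients. It is $\mathcal{M}$-conservative if it induces injective maps $\mathrm{Sub}_{\mathcal{M}}(X)\to\mathrm{Sub}_{\mathcal{M}}(FX)$. For a graph $\mathbf{G}$, $\mathrm{Rel}^{\mathbf{G}}$ is the category of relational $\mathbf{G}$-sets: an object $X$ assigns a set $X_\alpha$ to each node $\alpha$ and a relation $X_k\subseteq X_\alpha\times X_\beta$ (written $s\,k\,t$) to each edge $k:\alpha\to\beta$; a morphism $f$ is a family of functions $f_\alpha$ with $s\,k\,t\Rightarrow f(s)\,k\,f(t)$. Its $\mathcal{M}$ consists of subobjects with induced relations (componentwise injective $f$ with $s\,k\,t\iff f(s)\,k\,f(t)$); $(\Diamond S)_\alpha=\{s\in X_\alpha:\exists k:\alpha\to\beta,\ \exists t\in S_\beta,\ s\,k\,t\}$; its quotients are the $f:X\to Y$ with each $f_\alpha$ surjective and such that whenever $s\,k\,t$ in $Y$ there are $s',t'$ in $X$ with $s'\,k\,t'$, $f(s')=s$, $f(t')=t$. *)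

theory Defs
  imports "HOL-Algebra.Lattice" "HOL-Library.FuncSet" "Graph_Theory.Digraph"
begin

section \<open>Small categories and finite limits\<close>

record ('o, 'a) cat =
  Obj :: "'o set"
  Arr :: "'a set"
  Dom :: "'a \<Rightarrow> 'o"
  Cod :: "'a \<Rightarrow> 'o"
  Ident :: "'o \<Rightarrow> 'a"
  Comp :: "'a \<Rightarrow> 'a \<Rightarrow> 'a" (infixr \<open>\<cdot>\<index>\<close> 75)
    \<comment> \<open>\<open>g \<cdot> f\<close> is \<open>g\<close> after \<open>f\<close>, meaningful when \<open>Dom g = Cod f\<close>\<close>

definition Hom :: "('o, 'a, 'z) cat_scheme \<Rightarrow> 'o \<Rightarrow> 'o \<Rightarrow> 'a set" where
  "Hom C X Y = {f \<in> Arr C. Dom C f = X \<and> Cod C f = Y}"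

locale category =
  fixes C :: "('o, 'a, 'z) cat_scheme" (structure)
  assumes dom_obj: "f \<in> Arr C \<Longrightarrow> Dom C f \<in> Obj C"
    and cod_obj: "f \<in> Arr C \<Longrightarrow> Cod C f \<in> Obj C"
    and ident_hom: "X \<in> Obj C \<Longrightarrow> Ident C X \<in> Hom C X X"
    and comp_hom: "\<lbrakk>f \<in> Hom C X Y; g \<in> Hom C Y Z\<rbrakk> \<Longrightarrow> g \<cdot> f \<in> Hom C X Z"
    and ident_right: "f \<in> Hom C X Y \<Longrightarrow> f \<cdot> Ident C X = f"
    and ident_left: "f \<in> Hom C X Y \<Longrightarrow> Ident C Y \<cdot> f = f"
    and comp_assoc: "\<lbrakk>f \<in> Hom C X Y; g \<in> Hom C Y Z; h \<in> Hom C Z W\<rbrakk>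
                       \<Longrightarrow> h \<cdot> (g \<cdot> f) = (h \<cdot> g) \<cdot> f"

locale category_functor =
  source: category C + target: category D
  for C :: "('o, 'a, 'z) cat_scheme" and D :: "('p, 'b, 'y) cat_scheme" +
  fixes Fo :: "'o \<Rightarrow> 'p" and Fa :: "'a \<Rightarrow> 'b"
  assumes map_obj: "X \<in> Obj C \<Longrightarrow> Fo X \<in> Obj D"
    and map_hom: "f \<in> Hom C X Y \<Longrightarrow> Fa f \<in> Hom D (Fo X) (Fo Y)"
    and map_ident: "X \<in> Obj C \<Longrightarrow> Fa (Ident C X) = Ident D (Fo X)"
    and map_comp: "\<lbrakk>f \<in> Hom C X Y; g \<in> Hom C Y Z\<rbrakk>
                     \<Longrightarrow> Fa (g \<cdot>\<^bsub>C\<^esub> f) = Fa g \<cdot>\<^bsub>D\<^esub> Fa f"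

definition is_cone ::
  "('i, 'j, 'w) cat_scheme \<Rightarrow> ('o, 'a, 'z) cat_scheme \<Rightarrow> ('i \<Rightarrow> 'o) \<Rightarrow> ('j \<Rightarrow> 'a)
     \<Rightarrow> 'o \<Rightarrow> ('i \<Rightarrow> 'a) \<Rightarrow> bool" where
  "is_cone J C Do Da L l \<longleftrightarrow>
     L \<in> Obj C \<and> (\<forall>i\<in>Obj J. l i \<in> Hom C L (Do i)) \<and>
     (\<forall>u\<in>Arr J. Da u \<cdot>\<^bsub>C\<^esub> l (Dom J u) = l (Cod J u))"

definition is_limit ::
  "('i, 'j, 'w) cat_scheme \<Rightarrow> ('o, 'a, 'z) cat_scheme \<Rightarrow> ('i \<Rightarrow> 'o) \<Rightarrow> ('j \<Rightarrow> 'a)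
     \<Rightarrow> 'o \<Rightarrow> ('i \<Rightarrow> 'a) \<Rightarrow> bool" where
  "is_limit J C Do Da L l \<longleftrightarrow>
     is_cone J C Do Da L l \<and>
     (\<forall>X x. is_cone J C Do Da X x \<longrightarrow>
        (\<exists>!h. h \<in> Hom C X L \<and> (\<forall>i\<in>Obj J. l i \<cdot>\<^bsub>C\<^esub> h = x i)))"

text \<open>Every finite category is isomorphic to one whose objects and arrows are natural
  numbers, so finite diagrams may be indexed by the latter.\<close>

definition finite_diagram ::
  "(nat, nat) cat \<Rightarrow> ('o, 'a, 'z) cat_scheme \<Rightarrow> (nat \<Rightarrow> 'o) \<Rightarrow> (nat \<Rightarrow> 'a) \<Rightarrow> bool" where
  "finite_diagram J C Do Da \<longleftrightarrow>
     finite (Obj J) \<and> finite (Arr J) \<and> category_functor J C Do Da"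

definition has_finite_limits :: "('o, 'a, 'z) cat_scheme \<Rightarrow> bool" where
  "has_finite_limits C \<longleftrightarrow>
     (\<forall>J Do Da. finite_diagram J C Do Da \<longrightarrow> (\<exists>L l. is_limit J C Do Da L l))"

definition preserves_finite_limits ::
  "('o, 'a, 'z) cat_scheme \<Rightarrow> ('p, 'b, 'y) cat_scheme \<Rightarrow> ('o \<Rightarrow> 'p) \<Rightarrow> ('a \<Rightarrow> 'b) \<Rightarrow> bool" where
  "preserves_finite_limits C D Fo Fa \<longleftrightarrow>
     (\<forall>J Do Da L l. finite_diagram J C Do Da \<and> is_limit J C Do Da L l \<longrightarrow>
        is_limit J D (Fo \<circ> Do) (Fa \<circ> Da) (Fo L) (Fa \<circ> l))"

text \<open>\<open>is_pullback C f g p q\<close>: the square \<open>f \<cdot> p = g \<cdot> q\<close> is a pullback.\<close>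

definition is_pullback ::
  "('o, 'a, 'z) cat_scheme \<Rightarrow> 'a \<Rightarrow> 'a \<Rightarrow> 'a \<Rightarrow> 'a \<Rightarrow> bool" where
  "is_pullback C f g p q \<longleftrightarrow>
     f \<in> Arr C \<and> g \<in> Arr C \<and> Cod C f = Cod C g \<and>
     p \<in> Hom C (Dom C p) (Dom C f) \<and> q \<in> Hom C (Dom C p) (Dom C g) \<and>
     f \<cdot>\<^bsub>C\<^esub> p = g \<cdot>\<^bsub>C\<^esub> q \<and>
     (\<forall>W u v. u \<in> Hom C W (Dom C f) \<and> v \<in> Hom C W (Dom C g) \<and> f \<cdot>\<^bsub>C\<^esub> u = g \<cdot>\<^bsub>C\<^esub> v \<longrightarrow>
        (\<exists>!h. h \<in> Hom C W (Dom C p) \<and> p \<cdot>\<^bsub>C\<^esub> h = u \<and> q \<cdot>\<^bsub>C\<^esub> h = v))"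

definition is_product ::
  "('o, 'a, 'z) cat_scheme \<Rightarrow> 'o \<Rightarrow> 'o \<Rightarrow> 'o \<Rightarrow> 'a \<Rightarrow> 'a \<Rightarrow> bool" where
  "is_product C X Y P p q \<longleftrightarrow>
     X \<in> Obj C \<and> Y \<in> Obj C \<and> P \<in> Obj C \<and> p \<in> Hom C P X \<and> q \<in> Hom C P Y \<and>
     (\<forall>W u v. u \<in> Hom C W X \<and> v \<in> Hom C W Y \<longrightarrow>
        (\<exists>!h. h \<in> Hom C W P \<and> p \<cdot>\<^bsub>C\<^esub> h = u \<and> q \<cdot>\<^bsub>C\<^esub> h = v))"

definition is_iso :: "('o, 'a, 'z) cat_scheme \<Rightarrow> 'a \<Rightarrow> bool" where
  "is_iso C f \<longleftrightarrow> f \<in> Arr C \<and>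
     (\<exists>g \<in> Hom C (Cod C f) (Dom C f).
        g \<cdot>\<^bsub>C\<^esub> f = Ident C (Dom C f) \<and> f \<cdot>\<^bsub>C\<^esub> g = Ident C (Cod C f))"

definition is_mono :: "('o, 'a, 'z) cat_scheme \<Rightarrow> 'a \<Rightarrow> bool" where
  "is_mono C m \<longleftrightarrow> m \<in> Arr C \<and>
     (\<forall>W. \<forall>u \<in> Hom C W (Dom C m). \<forall>v \<in> Hom C W (Dom C m). m \<cdot>\<^bsub>C\<^esub> u = m \<cdot>\<^bsub>C\<^esub> v \<longrightarrow> u = v)"

definition is_equalizer :: "('o, 'a, 'z) cat_scheme \<Rightarrow> 'a \<Rightarrow> 'a \<Rightarrow> 'a \<Rightarrow> bool" where
  "is_equalizer C f g e \<longleftrightarrow>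
     f \<in> Arr C \<and> g \<in> Hom C (Dom C f) (Cod C f) \<and> e \<in> Hom C (Dom C e) (Dom C f) \<and>
     f \<cdot>\<^bsub>C\<^esub> e = g \<cdot>\<^bsub>C\<^esub> e \<and>
     (\<forall>W u. u \<in> Hom C W (Dom C f) \<and> f \<cdot>\<^bsub>C\<^esub> u = g \<cdot>\<^bsub>C\<^esub> u \<longrightarrow>
        (\<exists>!h. h \<in> Hom C W (Dom C e) \<and> e \<cdot>\<^bsub>C\<^esub> h = u))"

definition is_regular_mono :: "('o, 'a, 'z) cat_scheme \<Rightarrow> 'a \<Rightarrow> bool" where
  "is_regular_mono C m \<longleftrightarrow> (\<exists>f g. is_equalizer C f g m)"

definition left_orthogonal :: "('o, 'a, 'z) cat_scheme \<Rightarrow> 'a \<Rightarrow> 'a \<Rightarrow> bool" where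
  "left_orthogonal C e m \<longleftrightarrow>
     (\<forall>u v. u \<in> Hom C (Dom C e) (Dom C m) \<and> v \<in> Hom C (Cod C e) (Cod C m) \<and>
            m \<cdot>\<^bsub>C\<^esub> u = v \<cdot>\<^bsub>C\<^esub> e \<longrightarrow>
        (\<exists>!d. d \<in> Hom C (Cod C e) (Dom C m) \<and> d \<cdot>\<^bsub>C\<^esub> e = u \<and> m \<cdot>\<^bsub>C\<^esub> d = v))"

section \<open>F-regular and f-coherent categories\<close>

record ('o, 'a) mcat = "('o, 'a) cat" +
  Mon :: "'a set"

definition Mperp :: "('o, 'a, 'z) mcat_scheme \<Rightarrow> 'a set" where
  "Mperp C = {e \<in> Arr C. \<forall>m \<in> Mon C. left_orthogonal C e m}"

locale f_regular_category = category C
  for C :: "('o, 'a, 'z) mcat_scheme" (structure) +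
  assumes finite_limits: "has_finite_limits C"
    and mon_mono: "m \<in> Mon C \<Longrightarrow> is_mono C m"
    and iso_mon: "is_iso C m \<Longrightarrow> m \<in> Mon C"
    and regular_mono_mon: "is_regular_mono C m \<Longrightarrow> m \<in> Mon C"
    and comp_mon: "\<lbrakk>m \<in> Mon C; n \<in> Mon C; Dom C n = Cod C m\<rbrakk> \<Longrightarrow> n \<cdot> m \<in> Mon C"
    and pullback_mon: "\<lbrakk>m \<in> Mon C; is_pullback C f m n h\<rbrakk> \<Longrightarrow> n \<in> Mon C"
    and factorization: "f \<in> Arr C \<Longrightarrow>
          \<exists>m \<in> Mon C. \<exists>e \<in> Mperp C. Dom C m = Cod C e \<and> f = m \<cdot> e"
    and pullback_Mperp: "\<lbrakk>e \<in> Mperp C; is_pullback C f e d h\<rbrakk> \<Longrightarrow> d \<in> Mperp C"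

definition factors_through :: "('o, 'a, 'z) cat_scheme \<Rightarrow> 'a \<Rightarrow> 'a \<Rightarrow> bool" where
  "factors_through C m n \<longleftrightarrow>
     Cod C m = Cod C n \<and> (\<exists>h \<in> Hom C (Dom C m) (Dom C n). n \<cdot>\<^bsub>C\<^esub> h = m)"

text \<open>A subobject is an equivalence class of arrows in \<^const>\<open>Mon\<close>.\<close>

definition subobj :: "('o, 'a, 'z) mcat_scheme \<Rightarrow> 'a \<Rightarrow> 'a set" where
  "subobj C m = {n \<in> Mon C. factors_through C m n \<and> factors_through C n m}"

definition Sub :: "('o, 'a, 'z) mcat_scheme \<Rightarrow> 'o \<Rightarrow> 'a set gorder" where
  "Sub C X = \<lparr> carrier = {subobj C m | m. m \<in> Mon C \<and> Cod C m = X},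
               eq = (=),
               le = (\<lambda>S T. \<exists>m \<in> S. \<exists>n \<in> T. factors_through C m n) \<rparr>"

definition pull :: "('o, 'a, 'z) mcat_scheme \<Rightarrow> 'a \<Rightarrow> 'a set \<Rightarrow> 'a set" where
  "pull C f S = {n \<in> Mon C. \<exists>m \<in> S. \<exists>h. is_pullback C f m n h}"

text \<open>The left adjoint of \<^term>\<open>pull C f\<close>, evaluated at \<^term>\<open>S\<close>.\<close>

definition image_sub :: "('o, 'a, 'z) mcat_scheme \<Rightarrow> 'a \<Rightarrow> 'a set \<Rightarrow> 'a set" where
  "image_sub C f S =
     (THE T. T \<in> carrier (Sub C (Cod C f)) \<and>
        (\<forall>U \<in> carrier (Sub C (Cod C f)).
           T \<sqsubseteq>\<^bsub>Sub C (Cod C f)\<^esub> U \<longleftrightarrow> S \<sqsubseteq>\<^bsub>Sub C (Dom C f)\<^esub> pull C f U))"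

definition has_finite_joins :: "('a, 'z) gorder_scheme \<Rightarrow> bool" where
  "has_finite_joins L \<longleftrightarrow>
     (\<forall>A. finite A \<and> A \<subseteq> carrier L \<longrightarrow> (\<exists>s. least L s (Upper L A)))"

definition preserves_finite_joins ::
  "('a, 'z) gorder_scheme \<Rightarrow> ('b, 'y) gorder_scheme \<Rightarrow> ('a \<Rightarrow> 'b) \<Rightarrow> bool" where
  "preserves_finite_joins L L' \<phi> \<longleftrightarrow>
     \<phi> \<in> carrier L \<rightarrow> carrier L' \<and>
     (\<forall>A s. finite A \<and> A \<subseteq> carrier L \<and> least L s (Upper L A) \<longrightarrow>
        least L' (\<phi> s) (Upper L' (\<phi> ` A)))"

definition is_boolean_algebra :: "('a, 'z) gorder_scheme \<Rightarrow> bool" where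
  "is_boolean_algebra L \<longleftrightarrow>
     bounded_lattice L \<and>
     (\<forall>x \<in> carrier L. \<forall>y \<in> carrier L. \<forall>z \<in> carrier L.
        x \<sqinter>\<^bsub>L\<^esub> (y \<squnion>\<^bsub>L\<^esub> z) = (x \<sqinter>\<^bsub>L\<^esub> y) \<squnion>\<^bsub>L\<^esub> (x \<sqinter>\<^bsub>L\<^esub> z)) \<and>
     (\<forall>x \<in> carrier L. \<exists>y \<in> carrier L. x \<sqinter>\<^bsub>L\<^esub> y = \<bottom>\<^bsub>L\<^esub> \<and> x \<squnion>\<^bsub>L\<^esub> y = \<top>\<^bsub>L\<^esub>)"

locale f_coherent_category = f_regular_category +
  assumes finite_joins: "X \<in> Obj C \<Longrightarrow> has_finite_joins (Sub C X)"
    and pull_finite_joins: "f \<in> Hom C X Y \<Longrightarrow>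
          preserves_finite_joins (Sub C Y) (Sub C X) (pull C f)"

section \<open>Boolean modal categories with quotients\<close>

record ('o, 'a) modal_cat = "('o, 'a) mcat" +
  Dia :: "'o \<Rightarrow> 'a set \<Rightarrow> 'a set"

record ('o, 'a) modal_quot_cat = "('o, 'a) modal_cat" +
  Quo :: "'a set"

locale modal_category = f_coherent_category C
  for C :: "('o, 'a, 'z) modal_cat_scheme" (structure) +
  assumes dia_finite_joins: "X \<in> Obj C \<Longrightarrow>
          preserves_finite_joins (Sub C X) (Sub C X) (Dia C X)"
    and dia_pull: "\<lbrakk>f \<in> Hom C X Y; S \<in> carrier (Sub C Y)\<rbrakk> \<Longrightarrow>
          Dia C X (pull C f S) \<sqsubseteq>\<^bsub>Sub C X\<^esub> pull C f (Dia C Y S)"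
    and dia_mon: "\<lbrakk>\<iota> \<in> Mon C; \<iota> \<in> Hom C A X; S \<in> carrier (Sub C X)\<rbrakk> \<Longrightarrow>
          Dia C A (pull C \<iota> S) = pull C \<iota> (Dia C X (image_sub C \<iota> (pull C \<iota> S)))"

locale boolean_modal_category = modal_category +
  assumes boolean: "X \<in> Obj C \<Longrightarrow> is_boolean_algebra (Sub C X)"

text \<open>In the last axiom, \<open>XZ\<close> and \<open>YZ\<close> range over all products of \<open>X, Z\<close> and of
  \<open>Y, Z\<close>, and \<open>qZ\<close> is the arrow \<open>q \<times> 1\<close>.\<close>

locale boolean_modal_category_with_quotients = boolean_modal_category C
  for C :: "('o, 'a, 'z) modal_quot_cat_scheme" (structure) +
  assumes quo_Mperp: "Quo C \<subseteq> Mperp C"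
    and dia_quo: "\<lbrakk>q \<in> Quo C; q \<in> Hom C X Y; Z \<in> Obj C;
            is_product C X Z XZ p1 p2; is_product C Y Z YZ r1 r2;
            qZ \<in> Hom C XZ YZ; r1 \<cdot> qZ = q \<cdot> p1; r2 \<cdot> qZ = p2;
            S \<in> carrier (Sub C YZ)\<rbrakk> \<Longrightarrow>
          Dia C YZ S \<sqsubseteq>\<^bsub>Sub C YZ\<^esub> image_sub C qZ (Dia C XZ (pull C qZ S))"

definition map_sub :: "('p, 'b, 'y) mcat_scheme \<Rightarrow> ('a \<Rightarrow> 'b) \<Rightarrow> 'a set \<Rightarrow> 'b set" where
  "map_sub D Fa S = (\<Union>m \<in> S. subobj D (Fa m))"

locale modal_functor = category_functor C D Fo Fa
  for C :: "('o, 'a, 'z) modal_cat_scheme"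
    and D :: "('p, 'b, 'y) modal_cat_scheme"
    and Fo :: "'o \<Rightarrow> 'p" and Fa :: "'a \<Rightarrow> 'b" +
  assumes map_finite_limits: "preserves_finite_limits C D Fo Fa"
    and map_Mon: "Fa ` Mon C \<subseteq> Mon D"
    and map_Mperp: "Fa ` Mperp C \<subseteq> Mperp D"
    and map_finite_joins: "X \<in> Obj C \<Longrightarrow>
          preserves_finite_joins (Sub C X) (Sub D (Fo X)) (map_sub D Fa)"
    and map_dia: "\<lbrakk>X \<in> Obj C; S \<in> carrier (Sub C X)\<rbrakk> \<Longrightarrow>
          map_sub D Fa (Dia C X S) = Dia D (Fo X) (map_sub D Fa S)"

locale boolean_modal_category_with_quotients_morphism =
  source: boolean_modal_category_with_quotients C +
  target: boolean_modal_category_with_quotients D +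
  modal_functor C D Fo Fa
  for C :: "('o, 'a, 'z) modal_quot_cat_scheme"
    and D :: "('p, 'b, 'y) modal_quot_cat_scheme"
    and Fo :: "'o \<Rightarrow> 'p" and Fa :: "'a \<Rightarrow> 'b" +
  assumes map_Quo: "Fa ` Quo C \<subseteq> Quo D"

definition M_conservative ::
  "('o, 'a, 'z) mcat_scheme \<Rightarrow> ('p, 'b, 'y) mcat_scheme \<Rightarrow> ('a \<Rightarrow> 'b) \<Rightarrow> bool" where
  "M_conservative C D Fa \<longleftrightarrow>
     (\<forall>X \<in> Obj C. inj_on (map_sub D Fa) (carrier (Sub C X)))"

section \<open>Relational G-sets\<close>

text \<open>The type \<^typ>\<open>'u\<close> plays the role of the universe: the sets \<open>X\<^sub>\<alpha>\<close> are the subsets of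
  \<^typ>\<open>'u\<close>. Values at indices outside the graph and function values outside the domain are
  fixed, so that equality of objects and of arrows is the intended one.\<close>

record ('n, 'e, 'u) rset =
  pts :: "'n \<Rightarrow> 'u set"
  rel :: "'e \<Rightarrow> ('u \<times> 'u) set"

record ('n, 'e, 'u) rmap =
  src :: "('n, 'e, 'u) rset"
  trg :: "('n, 'e, 'u) rset"
  fn :: "'n \<Rightarrow> 'u \<Rightarrow> 'u"

definition rsets :: "('n, 'e) pre_digraph \<Rightarrow> ('n, 'e, 'u) rset set" where
  "rsets G = {X.
     (\<forall>\<alpha>. \<alpha> \<notin> verts G \<longrightarrow> pts X \<alpha> = {}) \<and>
     (\<forall>k. k \<notin> arcs G \<longrightarrow> rel X k = {}) \<and>
     (\<forall>k \<in> arcs G. rel X k \<subseteq> pts X (tail G k) \<times> pts X (head G k))}"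

definition rmaps :: "('n, 'e) pre_digraph \<Rightarrow> ('n, 'e, 'u) rmap set" where
  "rmaps G = {f. src f \<in> rsets G \<and> trg f \<in> rsets G \<and>
     fn f \<in> (\<Pi>\<^sub>E \<alpha> \<in> verts G. pts (src f) \<alpha> \<rightarrow>\<^sub>E pts (trg f) \<alpha>) \<and>
     (\<forall>k \<in> arcs G. \<forall>s t. (s, t) \<in> rel (src f) k \<longrightarrow>
        (fn f (tail G k) s, fn f (head G k) t) \<in> rel (trg f) k)}"

definition rmono :: "('n, 'e) pre_digraph \<Rightarrow> ('n, 'e, 'u) rmap set" where
  "rmono G = {f \<in> rmaps G.
     (\<forall>\<alpha> \<in> verts G. inj_on (fn f \<alpha>) (pts (src f) \<alpha>)) \<and>
     (\<forall>k \<in> arcs G. \<forall>s \<in> pts (src f) (tail G k). \<forall>t \<in> pts (src f) (head G k).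
        (s, t) \<in> rel (src f) k \<longleftrightarrow>
        (fn f (tail G k) s, fn f (head G k) t) \<in> rel (trg f) k)}"

definition rquot :: "('n, 'e) pre_digraph \<Rightarrow> ('n, 'e, 'u) rmap set" where
  "rquot G = {f \<in> rmaps G.
     (\<forall>\<alpha> \<in> verts G. fn f \<alpha> ` pts (src f) \<alpha> = pts (trg f) \<alpha>) \<and>
     (\<forall>k \<in> arcs G. \<forall>s t. (s, t) \<in> rel (trg f) k \<longrightarrow>
        (\<exists>s' t'. (s', t') \<in> rel (src f) k \<and>
           fn f (tail G k) s' = s \<and> fn f (head G k) t' = t))}"

definition sub_pts :: "('n, 'e, 'u) rmap set \<Rightarrow> 'n \<Rightarrow> 'u set" where
  "sub_pts S \<alpha> = (\<Union>m \<in> S. fn m \<alpha> ` pts (src m) \<alpha>)"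

definition dia_pts ::
  "('n, 'e) pre_digraph \<Rightarrow> ('n, 'e, 'u) rset \<Rightarrow> ('n \<Rightarrow> 'u set) \<Rightarrow> 'n \<Rightarrow> 'u set" where
  "dia_pts G X P \<alpha> =
     {s \<in> pts X \<alpha>. \<exists>k \<in> arcs G. tail G k = \<alpha> \<and> (\<exists>t \<in> P (head G k). (s, t) \<in> rel X k)}"

text \<open>An arrow of \<^const>\<open>rmono\<close> is determined up to isomorphism over its codomain by its
  image, so the subobject with points \<open>P\<close> is the set of all arrows in \<^const>\<open>rmono\<close> with
  image \<open>P\<close>; this is how \<^const>\<open>Dia\<close> is given below.\<close>

definition Rel :: "('n, 'e) pre_digraph \<Rightarrow>
    (('n, 'e, 'u) rset, ('n, 'e, 'u) rmap) modal_quot_cat" where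
  "Rel G = \<lparr>
     Obj = rsets G,
     Arr = rmaps G,
     Dom = src,
     Cod = trg,
     Ident = (\<lambda>X. \<lparr>src = X, trg = X, fn = (\<lambda>\<alpha> \<in> verts G. \<lambda>s \<in> pts X \<alpha>. s)\<rparr>),
     Comp = (\<lambda>g f. \<lparr>src = src f, trg = trg g,
                    fn = (\<lambda>\<alpha> \<in> verts G. compose (pts (src f) \<alpha>) (fn g \<alpha>) (fn f \<alpha>))\<rparr>),
     Mon = rmono G,
     Dia = (\<lambda>X S. {m \<in> rmono G. trg m = X \<and>
              (\<forall>\<alpha> \<in> verts G. fn m \<alpha> ` pts (src m) \<alpha> = dia_pts G X (sub_pts S) \<alpha>)}),
     Quo = rquot G \<rparr>"

text \<open>HOL cannot quantify existentially over types, so the universe over which a small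
  category with arrows in \<^typ>\<open>'a\<close> is represented has to be named. This one is infinite
  and several power sets larger than \<^typ>\<open>'a\<close>.\<close>

type_synonym 'a univ = "(nat + 'a) set set set"

end

theory Submission
  imports Defs "HOL-Library.Countable_Set"
begin

text \<open>
  A node of the graph is a functor from the category to sets that preserves finite limits, covers and joins of
  subobjects, and an arc is a relation between two such functors compatible with limits and \<open>\<M>\<close>-subobjects that
  satisfies the modality and lifts along quotients. For a countable fragment of the category such functors are
  colimits of representables along a generic sequence of objects, each step of which meets one requirement: lift an
  element along an arrow of \<open>\<M>\<^sup>\<bottom>\<close>, or decide a covering pair of subobjects. If an element \<open>a\<close> of the functor
  \<open>T\<close> satisfies \<open>\<diamond>S\<close>, an arc from \<open>T\<close> to a functor with an element satisfying \<open>S\<close> arises in the same way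
  from a generic sequence of approximations \<open>(a, h : Y \<rightarrow> X)\<close>, consistent in the sense that \<open>a\<close> satisfies
  \<open>\<diamond>(\<exists>\<^sub>h \<top>)\<close>; the axiom for quotients is exactly what keeps an approximation consistent when it is lifted along a
  quotient.

  The countability assumption is removed by an ultraproduct over the finite sets of arrows, each contained in a countable
  fragment, since all the properties required of nodes and arcs concern finitely many arrows at a time.
\<close>

section \<open>Limits of bipartite diagrams\<close>

text \<open>The other axioms on \<open>Dia\<close> also have one use each in the construction of an
  arc. Preservation of binary joins lets a model choose a side of a cover while an approximation
  stays consistent; preservation of the least subobject keeps the stages of the new tower from being
  null; \<open>dia_pull\<close> makes the finished relation satisfy the modality along every arrow;
  \<open>dia_mon\<close> lets an approximation be cut down to an \<open>Mon\<close>-subobject. The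
  last point also yields limits: agreement of two arrows on a related pair is membership in an
  equalizer, and equalizers lie in \<open>Mon\<close>.

  Countability matters because a requirement is met by refining the present condition, while an
  infinite sequence of conditions has in general no limit in the category; an enumeration of order
  type omega never meets one. A fragment chooses no limits: a limit cone of the category with legs
  in the fragment remains usable there, since solvable finite systems of equations are solvable
  inside.

  The graph carries all families of models and of relations that are good almost everywhere, so that
  no successor required by \<open>Dia\<close> has to be selected in advance.\<close>

definition shape :: "nat set \<Rightarrow> nat set \<Rightarrow> (nat \<Rightarrow> nat) \<Rightarrow> (nat \<Rightarrow> nat) \<Rightarrow> (nat, nat) cat" where
  "shape V A s t = \<lparr>Obj = V, Arr = V \<union> A, Dom = (\<lambda>a. if a \<in> V then a else s a),
     Cod = (\<lambda>a. if a \<in> V then a else t a), Ident = (\<lambda>x. x), Comp = (\<lambda>g f. if g \<in> V then f else g)\<rparr>"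

lemma shape_sel [simp]:
  "Obj (shape V A s t) = V" "Arr (shape V A s t) = V \<union> A"
  "Dom (shape V A s t) a = (if a \<in> V then a else s a)"
  "Cod (shape V A s t) a = (if a \<in> V then a else t a)"
  "Ident (shape V A s t) x = x" "g \<cdot>\<^bsub>shape V A s t\<^esub> f = (if g \<in> V then f else g)"
  by (auto simp: shape_def)

text \<open>Disjointness of sources and targets leaves no two members of \<open>A\<close>
  composable, so every composite has an identity among its factors and \<open>Comp\<close> only has
  to drop it.\<close>

lemma category_shape:
  assumes "V \<inter> A = {}" "s ` A \<subseteq> V" "t ` A \<subseteq> V" "s ` A \<inter> t ` A = {}"
  shows "category (shape V A s t)"
  using assms by unfold_locales (auto simp: Hom_def image_subset_iff split: if_splits)

context category
begin

lemma Hom_iff: "f \<in> Hom C X Y \<longleftrightarrow> f \<in> Arr C \<and> Dom C f = X \<and> Cod C f = Y"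
  by (simp add: Hom_def)

lemma comp_arr [simp]:
  assumes "f \<in> Arr C" "g \<in> Arr C" "Dom C g = Cod C f"
  shows "g \<cdot> f \<in> Arr C" "Dom C (g \<cdot> f) = Dom C f" "Cod C (g \<cdot> f) = Cod C g"
  using comp_hom[of f "Dom C f" "Cod C f" g "Cod C g"] assms by (auto simp: Hom_def)

lemma assoc [simp]:
  assumes "f \<in> Arr C" "g \<in> Arr C" "h \<in> Arr C" "Dom C g = Cod C f" "Dom C h = Cod C g"
  shows "(h \<cdot> g) \<cdot> f = h \<cdot> (g \<cdot> f)"
  using comp_assoc[of f "Dom C f" "Cod C f" g "Cod C g" h "Cod C h"] assms by (auto simp: Hom_def)

lemma ident_arr [simp]:
  assumes "X \<in> Obj C"
  shows "Ident C X \<in> Arr C" "Dom C (Ident C X) = X" "Cod C (Ident C X) = X"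
  using ident_hom[OF assms] by (auto simp: Hom_def)

lemma comp_ident [simp]:
  "f \<in> Arr C \<Longrightarrow> Cod C f = X \<Longrightarrow> Ident C X \<cdot> f = f"
  "f \<in> Arr C \<Longrightarrow> Dom C f = X \<Longrightarrow> f \<cdot> Ident C X = f"
  using ident_left[of f "Dom C f" "Cod C f"] ident_right[of f "Dom C f" "Cod C f"] by (auto simp: Hom_def)

lemma comp_reduce:
  assumes "n \<cdot> k = m" "l \<in> Arr C" "k \<in> Arr C" "n \<in> Arr C" "Dom C k = Cod C l" "Dom C n = Cod C k"
  shows "n \<cdot> (k \<cdot> l) = m \<cdot> l"
  using assoc[OF assms(2-)] unfolding assms(1) by (rule sym)

lemmas dom_cod_obj [simp] = dom_obj cod_obj

lemma factors_throughI:
  "n \<cdot> h = m \<Longrightarrow> h \<in> Arr C \<Longrightarrow> n \<in> Arr C \<Longrightarrow> Cod C h = Dom C n \<Longrightarrow> factors_through C m n"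
  by (auto simp: factors_through_def Hom_def)

lemma factors_throughE:
  assumes "factors_through C m n" "n \<in> Arr C"
  obtains h where "h \<in> Arr C" "Dom C h = Dom C m" "Cod C h = Dom C n" "n \<cdot> h = m" "Cod C m = Cod C n"
    "m \<in> Arr C"
proof -
  from assms obtain h where h: "h \<in> Hom C (Dom C m) (Dom C n)" "n \<cdot> h = m" "Cod C m = Cod C n"
    unfolding factors_through_def by blast
  moreover have "m \<in> Arr C"
    using comp_arr(1)[of h n] h assms(2) by (simp add: Hom_def)
  ultimately show ?thesis using that[of h] by (simp add: Hom_def)
qed

lemma factors_through_refl [simp]: "f \<in> Arr C \<Longrightarrow> factors_through C f f"
  by (rule factors_throughI[of _ "Ident C (Dom C f)"]) auto

lemma factors_through_trans:
  assumes "factors_through C h m" "factors_through C m n" "n \<in> Arr C"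
  shows "factors_through C h n"
proof -
  from assms(2,3) obtain k where k: "k \<in> Arr C" "Dom C k = Dom C m" "Cod C k = Dom C n" "n \<cdot> k = m" "m \<in> Arr C"
    by (rule factors_throughE)
  from assms(1) k(5) obtain l where l: "l \<in> Arr C" "Dom C l = Dom C h" "Cod C l = Dom C m" "m \<cdot> l = h"
    by (rule factors_throughE)
  show ?thesis using k l assms(3) comp_reduce[OF k(4), of l] by (intro factors_throughI[of _ "k \<cdot> l"]) simp_all
qed

lemma factors_through_comp:
  assumes "factors_through C h m" "m \<in> Arr C" "u \<in> Arr C" "Cod C u = Dom C h"
  shows "factors_through C (h \<cdot> u) m"
proof -
  from assms(1,2) obtain l where l: "l \<in> Arr C" "Dom C l = Dom C h" "Cod C l = Dom C m" "m \<cdot> l = h"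
    by (rule factors_throughE)
  then show ?thesis using assms comp_reduce[OF l(4), of u] by (intro factors_throughI[of _ "l \<cdot> u"]) simp_all
qed

lemma is_monoD:
  assumes "is_mono C m" "m \<cdot> u = m \<cdot> v" "u \<in> Arr C" "v \<in> Arr C" "Dom C u = Dom C v"
    "Cod C u = Dom C m" "Cod C v = Dom C m"
  shows "u = v"
  using assms unfolding is_mono_def by (auto simp: Hom_def)

text \<open>Identities impose nothing on a cone, so a limit over \<open>shape V A s t\<close> is a
  limit over the bare graph.\<close>

lemma shape_limit:
  fixes V A :: "nat set"
  assumes lim: "has_finite_limits C"
    and sh: "V \<inter> A = {}" "s ` A \<subseteq> V" "t ` A \<subseteq> V" "s ` A \<inter> t ` A = {}" "finite V" "finite A"
    and D: "\<And>v. v \<in> V \<Longrightarrow> Do v \<in> Obj C" "\<And>a. a \<in> A \<Longrightarrow> Da a \<in> Hom C (Do (s a)) (Do (t a))"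
  obtains L l where "L \<in> Obj C" "\<And>v. v \<in> V \<Longrightarrow> l v \<in> Hom C L (Do v)"
    "\<And>a. a \<in> A \<Longrightarrow> Da a \<cdot> l (s a) = l (t a)"
    "\<And>X x. \<lbrakk>X \<in> Obj C; \<And>v. v \<in> V \<Longrightarrow> x v \<in> Hom C X (Do v); \<And>a. a \<in> A \<Longrightarrow> Da a \<cdot> x (s a) = x (t a)\<rbrakk>
       \<Longrightarrow> \<exists>!h. h \<in> Hom C X L \<and> (\<forall>v\<in>V. l v \<cdot> h = x v)"
proof -
  let ?J = "shape V A s t"
  let ?Da = "\<lambda>a. if a \<in> V then Ident C (Do a) else Da a"
  interpret J: category ?J by (rule category_shape[OF sh(1-4)])
  have "category_functor ?J C Do ?Da"
  proof unfold_locales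
    show "X \<in> Obj ?J \<Longrightarrow> Do X \<in> Obj C" for X using D by simp
    show "?Da f \<in> Hom C (Do X) (Do Y)" if "f \<in> Hom ?J X Y" for f X Y
    proof (cases "f \<in> V")
      case True
      then show ?thesis using that D(1) by (auto simp: Hom_def)
    next
      case False
      then have "f \<in> A" "s f = X" "t f = Y" using that by (auto simp: Hom_def)
      then show ?thesis using D(2) False by auto
    qed
    show "X \<in> Obj ?J \<Longrightarrow> ?Da (Ident ?J X) = Ident C (Do X)" for X by simp
    show "?Da (g \<cdot>\<^bsub>?J\<^esub> f) = ?Da g \<cdot> ?Da f" if "f \<in> Hom ?J X Y" "g \<in> Hom ?J Y Z" for f g X Y Z
    proof -
      have D2: "a \<in> A \<Longrightarrow> Da a \<in> Arr C" "a \<in> A \<Longrightarrow> Dom C (Da a) = Do (s a)" "a \<in> A \<Longrightarrow> Cod C (Da a) = Do (t a)" for a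
        using D(2) by (auto simp: Hom_def)
      have f: "f \<in> V \<or> f \<in> A" "g \<in> V \<or> g \<in> A" using that by (auto simp: Hom_def)
      show ?thesis using f that D(1) D2 sh(1-4)
        by (auto simp: Hom_def image_subset_iff split: if_splits)
    qed
  qed
  then have "finite_diagram ?J C Do ?Da" using sh(5,6) by (simp add: finite_diagram_def)
  with lim obtain L l where L: "is_limit ?J C Do ?Da L l" unfolding has_finite_limits_def by blast
  have cone: "is_cone ?J C Do ?Da X x \<longleftrightarrow> X \<in> Obj C \<and> (\<forall>v\<in>V. x v \<in> Hom C X (Do v)) \<and> (\<forall>a\<in>A. Da a \<cdot> x (s a) = x (t a))" for X x
    using sh(1) by (auto simp: is_cone_def Hom_def disjoint_iff split: if_splits)
  from L show ?thesis unfolding is_limit_def cone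
    by (intro that[of L l]) auto
qed

lemma pullback_exists:
  assumes lim: "has_finite_limits C" and f: "f \<in> Arr C" "g \<in> Arr C" "Cod C f = Cod C g"
  obtains p q where "is_pullback C f g p q"
proof -
  \<comment> \<open>The nodes 0, 1, 2 stand for the two domains and the common codomain, the edges 3
    and 4 for \<open>f\<close> and \<open>g\<close>.\<close>
  let ?s = "\<lambda>a::nat. if a = 3 then 0 else 1::nat"
  let ?t = "\<lambda>a::nat. 2::nat"
  let ?Do = "\<lambda>i::nat. if i = 0 then Dom C f else if i = 1 then Dom C g else Cod C f"
  let ?Da = "\<lambda>a::nat. if a = 3 then f else g"
  obtain L l where L: "L \<in> Obj C" "\<And>v. v \<in> {0,1,2} \<Longrightarrow> l v \<in> Hom C L (?Do v)"
    "\<And>a. a \<in> {3,4} \<Longrightarrow> ?Da a \<cdot> l (?s a) = l (?t a)"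
    and U: "\<And>X x. \<lbrakk>X \<in> Obj C; \<And>v. v \<in> {0,1,2} \<Longrightarrow> x v \<in> Hom C X (?Do v); \<And>a. a \<in> {3,4} \<Longrightarrow> ?Da a \<cdot> x (?s a) = x (?t a)\<rbrakk>
       \<Longrightarrow> \<exists>!h. h \<in> Hom C X L \<and> (\<forall>v\<in>{0,1,2}. l v \<cdot> h = x v)"
    by (rule shape_limit[OF lim, of "{0,1,2}" "{3,4}" ?s ?t ?Do ?Da]) (use f in \<open>auto simp: Hom_def\<close>)
  have l: "l 0 \<in> Hom C L (Dom C f)" "l 1 \<in> Hom C L (Dom C g)" "f \<cdot> l 0 = l 2" "g \<cdot> l 1 = l 2"
    using L(2)[of 0] L(2)[of 1] L(3)[of 3] L(3)[of 4] by auto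
  have "\<exists>!h. h \<in> Hom C W L \<and> l 0 \<cdot> h = u \<and> l 1 \<cdot> h = v"
    if "u \<in> Hom C W (Dom C f)" "v \<in> Hom C W (Dom C g)" "f \<cdot> u = g \<cdot> v" for W u v
  proof -
    let ?x = "\<lambda>i::nat. if i = 0 then u else if i = 1 then v else f \<cdot> u"
    have "\<exists>!h. h \<in> Hom C W L \<and> (\<forall>i\<in>{0,1,2}. l i \<cdot> h = ?x i)"
      by (rule U) (use that f in \<open>auto simp: Hom_def\<close>)
    \<comment> \<open>The leg at the codomain is forced by the leg at \<open>Dom C f\<close>, so it
      disappears from the universal property.\<close>
    moreover have "l 2 \<cdot> h = f \<cdot> (l 0 \<cdot> h)" if "h \<in> Hom C W L" for h
      using l(1,2) f that by (subst l(3)[symmetric]) (auto simp: Hom_def)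
    then have "h \<in> Hom C W L \<and> (\<forall>i\<in>{0,1,2}. l i \<cdot> h = ?x i) \<longleftrightarrow> h \<in> Hom C W L \<and> l 0 \<cdot> h = u \<and> l 1 \<cdot> h = v" for h
      by auto
    ultimately show ?thesis by simp
  qed
  then have "is_pullback C f g (l 0) (l 1)"
    using l f by (auto simp: is_pullback_def Hom_def)
  then show ?thesis by (rule that)
qed

lemma product_exists:
  assumes lim: "has_finite_limits C" and XY: "X \<in> Obj C" "Y \<in> Obj C"
  obtains P p q where "is_product C X Y P p q"
proof -
  let ?Do = "\<lambda>i::nat. if i = 0 then X else Y"
  obtain L l where L: "L \<in> Obj C" "\<And>v. v \<in> {0,1} \<Longrightarrow> l v \<in> Hom C L (?Do v)"
    and U: "\<And>W x. \<lbrakk>W \<in> Obj C; \<And>v. v \<in> {0,1} \<Longrightarrow> x v \<in> Hom C W (?Do v)\<rbrakk>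
       \<Longrightarrow> \<exists>!h. h \<in> Hom C W L \<and> (\<forall>v\<in>{0,1::nat}. l v \<cdot> h = x v)"
    by (rule shape_limit[OF lim, of "{0,1}" "{}" id id ?Do "\<lambda>_. undefined"]) (use XY in auto)
  have l: "l 0 \<in> Hom C L X" "l 1 \<in> Hom C L Y" using L(2)[of 0] L(2)[of 1] by auto
  have "\<exists>!h. h \<in> Hom C W L \<and> l 0 \<cdot> h = u \<and> l 1 \<cdot> h = v"
    if "u \<in> Hom C W X" "v \<in> Hom C W Y" for W u v
  proof -
    let ?x = "\<lambda>i::nat. if i = 0 then u else v"
    have "\<exists>!h. h \<in> Hom C W L \<and> (\<forall>i\<in>{0,1}. l i \<cdot> h = ?x i)"
      by (rule U) (use that in \<open>auto simp: Hom_def\<close>)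
    then show ?thesis by simp
  qed
  then have "is_product C X Y L (l 0) (l 1)"
    using l L(1) XY by (auto simp: is_product_def)
  then show ?thesis by (rule that)
qed

lemma equalizer_exists:
  assumes lim: "has_finite_limits C" and f: "f \<in> Arr C" "g \<in> Hom C (Dom C f) (Cod C f)"
  obtains e where "is_equalizer C f g e"
proof -
  let ?Do = "\<lambda>i::nat. if i = 0 then Dom C f else Cod C f"
  let ?Da = "\<lambda>a::nat. if a = 3 then f else g"
  obtain L l where L: "L \<in> Obj C" "\<And>v. v \<in> {0,1} \<Longrightarrow> l v \<in> Hom C L (?Do v)"
    "\<And>a. a \<in> {3,4} \<Longrightarrow> ?Da a \<cdot> l 0 = l 1"
    and U: "\<And>W x. \<lbrakk>W \<in> Obj C; \<And>v. v \<in> {0,1} \<Longrightarrow> x v \<in> Hom C W (?Do v); \<And>a. a \<in> {3,4} \<Longrightarrow> ?Da a \<cdot> x 0 = x 1\<rbrakk>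
       \<Longrightarrow> \<exists>!h. h \<in> Hom C W L \<and> (\<forall>v\<in>{0,1::nat}. l v \<cdot> h = x v)"
    by (rule shape_limit[OF lim, of "{0,1}" "{3,4}" "\<lambda>_. 0" "\<lambda>_. 1" ?Do ?Da]) (use f in \<open>auto simp: Hom_def\<close>)
  have l: "l 0 \<in> Hom C L (Dom C f)" "f \<cdot> l 0 = l 1" "g \<cdot> l 0 = l 1"
    using L(2)[of 0] L(3)[of 3] L(3)[of 4] by auto
  have "\<exists>!h. h \<in> Hom C W L \<and> l 0 \<cdot> h = u"
    if "u \<in> Hom C W (Dom C f)" "f \<cdot> u = g \<cdot> u" for W u
  proof -
    let ?x = "\<lambda>i::nat. if i = 0 then u else f \<cdot> u"
    have "\<exists>!h. h \<in> Hom C W L \<and> (\<forall>i\<in>{0,1}. l i \<cdot> h = ?x i)"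
      by (rule U) (use that f in \<open>auto simp: Hom_def\<close>)
    moreover have "l 1 \<cdot> h = f \<cdot> (l 0 \<cdot> h)" if "h \<in> Hom C W L" for h
      using l(1) f that by (subst l(2)[symmetric]) (auto simp: Hom_def)
    then have "h \<in> Hom C W L \<and> (\<forall>i\<in>{0,1}. l i \<cdot> h = ?x i) \<longleftrightarrow> h \<in> Hom C W L \<and> l 0 \<cdot> h = u" for h
      by auto
    ultimately show ?thesis by simp
  qed
  then have "is_equalizer C f g (l 0)"
    using l f by (auto simp: is_equalizer_def Hom_def)
  then show ?thesis by (rule that)
qed

end

section \<open>Subobjects as sieves\<close>

text \<open>A subobject is a class of arrows without a preferred member. In terms of the arrows that
  factor through it, order, equality and pullback of subobjects become statements about composition,
  free of representatives.\<close>

definition below :: "('o, 'a, 'z) cat_scheme \<Rightarrow> 'a \<Rightarrow> 'a set \<Rightarrow> bool" where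
  "below C h S \<longleftrightarrow> (\<exists>m\<in>S. factors_through C h m)"

text \<open>The image of the top subobject under \<open>h\<close>. The choice is harmless:
  \<open>im_eq\<close> shows that all factorizations give one class.\<close>

definition im :: "('o, 'a, 'z) mcat_scheme \<Rightarrow> 'a \<Rightarrow> 'a set" where
  "im C h = subobj C (SOME m. m \<in> Mon C \<and> (\<exists>e\<in>Mperp C. Dom C m = Cod C e \<and> h = m \<cdot>\<^bsub>C\<^esub> e))"

lemma Sub_sel [simp]:
  "eq (Sub C X) = (=)" "le (Sub C X) S T \<longleftrightarrow> (\<exists>m\<in>S. \<exists>n\<in>T. factors_through C m n)"
  by (simp_all add: Sub_def)

lemma mem_subobj: "n \<in> subobj C m \<longleftrightarrow> n \<in> Mon C \<and> factors_through C m n \<and> factors_through C n m"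
  by (auto simp: subobj_def)

context category
begin

lemma is_pullbackD:
  assumes "is_pullback C f g p q"
  shows "f \<in> Arr C" "g \<in> Arr C" "p \<in> Arr C" "q \<in> Arr C" "Cod C f = Cod C g" "Cod C p = Dom C f"
    "Dom C q = Dom C p" "Cod C q = Dom C g" "f \<cdot> p = g \<cdot> q"
  using assms unfolding is_pullback_def Hom_iff by blast+

lemma is_pullback_lift:
  assumes "is_pullback C f g p q" "u \<in> Arr C" "v \<in> Arr C" "Cod C u = Dom C f" "Cod C v = Dom C g"
    "Dom C u = Dom C v" "f \<cdot> u = g \<cdot> v"
  obtains h where "h \<in> Arr C" "Dom C h = Dom C u" "Cod C h = Dom C p" "p \<cdot> h = u" "q \<cdot> h = v"
proof -
  have "u \<in> Hom C (Dom C u) (Dom C f)" "v \<in> Hom C (Dom C u) (Dom C g)"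
    using assms(2-6) by (auto simp: Hom_iff)
  then have "\<exists>!h. h \<in> Hom C (Dom C u) (Dom C p) \<and> p \<cdot> h = u \<and> q \<cdot> h = v"
    using assms(1,7) unfolding is_pullback_def by blast
  then obtain h where "h \<in> Hom C (Dom C u) (Dom C p)" "p \<cdot> h = u" "q \<cdot> h = v" by blast
  then show ?thesis using that[of h] by (simp add: Hom_iff)
qed

end

context f_regular_category
begin

lemma mon_arr [simp]: "m \<in> Mon C \<Longrightarrow> m \<in> Arr C"
  using mon_mono by (auto simp: is_mono_def)

lemma Mperp_arr [simp]: "e \<in> Mperp C \<Longrightarrow> e \<in> Arr C"
  by (auto simp: Mperp_def)

lemma mon_cancel:
  assumes "m \<in> Mon C" "m \<cdot> u = m \<cdot> v" "u \<in> Arr C" "v \<in> Arr C" "Dom C u = Dom C v"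
    "Cod C u = Dom C m" "Cod C v = Dom C m"
  shows "u = v"
  using is_monoD[OF mon_mono] assms by blast

lemma ident_mon [simp]: "X \<in> Obj C \<Longrightarrow> Ident C X \<in> Mon C"
  by (rule iso_mon) (auto simp: is_iso_def Hom_def intro!: bexI[of _ "Ident C X"])

text \<open>The factorization of \<open>f . e\<close> through \<open>m\<close>, together with
  \<open>f\<close>, forms a square; its diagonal is the factorization of \<open>f\<close>.\<close>

lemma Mperp_factor:
  assumes e: "e \<in> Mperp C" and f: "f \<in> Arr C" "Dom C f = Cod C e"
    and m: "m \<in> Mon C" and ft: "factors_through C (f \<cdot> e) m"
  shows "factors_through C f m"
proof -
  have mA: "m \<in> Arr C" using m by simp
  obtain u where u: "u \<in> Arr C" "Dom C u = Dom C (f \<cdot> e)" "Cod C u = Dom C m" "m \<cdot> u = f \<cdot> e" "Cod C (f \<cdot> e) = Cod C m"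
    using ft mA by (rule factors_throughE)
  have lo: "left_orthogonal C e m" using e m unfolding Mperp_def by blast
  have "u \<in> Hom C (Dom C e) (Dom C m)" "f \<in> Hom C (Cod C e) (Cod C m)"
    using u e f by (auto simp: Hom_def)
  with lo u(4) obtain d where "d \<in> Hom C (Cod C e) (Dom C m)" "m \<cdot> d = f"
    unfolding left_orthogonal_def by blast
  then show ?thesis using mA by (intro factors_throughI[of _ d]) (auto simp: Hom_def)
qed

lemma subobj_self [simp]: "m \<in> Mon C \<Longrightarrow> m \<in> subobj C m"
  by (simp add: mem_subobj)

lemma subobj_eqI:
  assumes "m \<in> Mon C" "n \<in> Mon C" "factors_through C m n" "factors_through C n m"
  shows "subobj C m = subobj C n"
proof -
  have "factors_through C m k \<longleftrightarrow> factors_through C n k" "factors_through C k m \<longleftrightarrow> factors_through C k n"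
    if "k \<in> Arr C" for k
    using assms that factors_through_trans mon_arr by meson+
  then show ?thesis by (auto simp: subobj_def)
qed

lemma SubI [simp]: "m \<in> Mon C \<Longrightarrow> Cod C m = X \<Longrightarrow> subobj C m \<in> carrier (Sub C X)"
  by (auto simp: Sub_def)

lemma SubE:
  assumes "S \<in> carrier (Sub C X)"
  obtains m where "m \<in> Mon C" "Cod C m = X" "S = subobj C m"
  using assms by (auto simp: Sub_def)

lemma Sub_ex:
  assumes "S \<in> carrier (Sub C X)"
  obtains m where "m \<in> S"
  using SubE[OF assms] subobj_self by metis

lemma Sub_mem:
  assumes "S \<in> carrier (Sub C X)" "m \<in> S"
  shows "m \<in> Mon C" "Cod C m = X" "subobj C m = S"
proof -
  obtain n where n: "n \<in> Mon C" "Cod C n = X" "S = subobj C n" using assms(1) by (rule SubE)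
  have m: "m \<in> Mon C" "factors_through C m n" "factors_through C n m"
    using assms(2) n by (auto simp: mem_subobj)
  show "m \<in> Mon C" by fact
  show "Cod C m = X" using m(2) n by (simp add: factors_through_def)
  show "subobj C m = S" using subobj_eqI[OF m(1) n(1) m(2,3)] n by simp
qed

lemma below_subobj: 
  assumes "m \<in> Mon C"
  shows "below C h (subobj C m) \<longleftrightarrow> factors_through C h m"
  using factors_through_trans assms by (auto simp: below_def mem_subobj)

lemma below_mem:
  assumes "S \<in> carrier (Sub C X)" "m \<in> S"
  shows "below C h S \<longleftrightarrow> factors_through C h m"
  using below_subobj[of m h] Sub_mem[OF assms] by simp

lemma below_self: "S \<in> carrier (Sub C X) \<Longrightarrow> m \<in> S \<Longrightarrow> below C m S"
  using Sub_mem by (auto simp: below_mem)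

lemma belowE:
  assumes "below C h S" "S \<in> carrier (Sub C X)" "m \<in> S"
  obtains g where "g \<in> Arr C" "Dom C g = Dom C h" "Cod C g = Dom C m" "m \<cdot> g = h"
  using assms factors_throughE[of h m] Sub_mem(1) by (metis below_mem mon_arr)

lemma below_arr:
  assumes "below C h S" "S \<in> carrier (Sub C X)"
  shows "h \<in> Arr C" "Cod C h = X"
proof -
  obtain m where "m \<in> S" using Sub_ex[OF assms(2)] .
  then have "factors_through C h m" "m \<in> Arr C" "Cod C m = X"
    using assms below_mem Sub_mem by auto
  then show "h \<in> Arr C" "Cod C h = X" by (metis factors_throughE)+
qed

lemma below_comp:
  assumes "below C h S" "S \<in> carrier (Sub C X)" "u \<in> Arr C" "Cod C u = Dom C h"
  shows "below C (h \<cdot> u) S"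
proof -
  obtain m where m: "m \<in> S" using Sub_ex[OF assms(2)] .
  then show ?thesis using assms factors_through_comp[of h m u] Sub_mem[OF assms(2) m]
    by (simp add: below_mem)
qed

lemma below_Mperp:
  assumes "below C (f \<cdot> e) S" "S \<in> carrier (Sub C X)" "e \<in> Mperp C" "f \<in> Arr C" "Dom C f = Cod C e"
  shows "below C f S"
proof -
  obtain m where m: "m \<in> S" using Sub_ex[OF assms(2)] .
  then show ?thesis using assms Mperp_factor[of e f m] Sub_mem[OF assms(2) m]
    by (simp add: below_mem)
qed

lemma Sub_le_mem:
  assumes "S \<in> carrier (Sub C X)" "T \<in> carrier (Sub C X)" "m \<in> S"
  shows "S \<sqsubseteq>\<^bsub>Sub C X\<^esub> T \<longleftrightarrow> below C m T"
proof
  assume "S \<sqsubseteq>\<^bsub>Sub C X\<^esub> T"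
  then obtain m' n where "m' \<in> S" "n \<in> T" "factors_through C m' n" by auto
  then show "below C m T"
    using assms below_mem below_self factors_through_trans Sub_mem mon_arr by metis
qed (use assms in \<open>auto simp: below_def\<close>)

lemma Sub_le_below:
  assumes "S \<in> carrier (Sub C X)" "T \<in> carrier (Sub C X)"
  shows "S \<sqsubseteq>\<^bsub>Sub C X\<^esub> T \<longleftrightarrow> (\<forall>h. below C h S \<longrightarrow> below C h T)"
proof -
  obtain m where m: "m \<in> S" using Sub_ex[OF assms(1)] .
  have *: "below C m S" using assms m below_self by blast
  have "below C h T" if mT: "below C m T" and hS: "below C h S" for h
  proof -
    obtain g where "g \<in> Arr C" "Dom C g = Dom C h" "Cod C g = Dom C m" "m \<cdot> g = h"
      using hS assms(1) m by (rule belowE)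
    then show ?thesis using below_comp[OF mT assms(2), of g] by simp
  qed
  then show ?thesis using Sub_le_mem[OF assms m] * by blast
qed

lemma Sub_eqI:
  assumes "S \<in> carrier (Sub C X)" "T \<in> carrier (Sub C X)" "\<And>h. below C h S \<longleftrightarrow> below C h T"
  shows "S = T"
proof -
  obtain m where m: "m \<in> S" using Sub_ex[OF assms(1)] .
  obtain n where n: "n \<in> T" using Sub_ex[OF assms(2)] .
  have "factors_through C m n" "factors_through C n m"
    using assms m n below_self below_mem by metis+
  then show ?thesis using subobj_eqI Sub_mem assms(1,2) m n by metis
qed

lemma Sub_antisym:
  assumes "S \<in> carrier (Sub C X)" "T \<in> carrier (Sub C X)" "S \<sqsubseteq>\<^bsub>Sub C X\<^esub> T" "T \<sqsubseteq>\<^bsub>Sub C X\<^esub> S"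
  shows "S = T"
  using Sub_eqI[OF assms(1,2)] assms(3,4) Sub_le_below assms(1,2) by blast

lemma Sub_partial_order: "partial_order (Sub C X)"
proof
  show "x .=\<^bsub>Sub C X\<^esub> y" if "x \<sqsubseteq>\<^bsub>Sub C X\<^esub> y" "y \<sqsubseteq>\<^bsub>Sub C X\<^esub> x" "x \<in> carrier (Sub C X)" "y \<in> carrier (Sub C X)" for x y
    using Sub_antisym that by simp
  show "x \<sqsubseteq>\<^bsub>Sub C X\<^esub> x" if "x \<in> carrier (Sub C X)" for x
    using that Sub_le_below by blast
  show "x \<sqsubseteq>\<^bsub>Sub C X\<^esub> z" if "x \<sqsubseteq>\<^bsub>Sub C X\<^esub> y" "y \<sqsubseteq>\<^bsub>Sub C X\<^esub> z" "x \<in> carrier (Sub C X)" "y \<in> carrier (Sub C X)" "z \<in> carrier (Sub C X)" for x y z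
    using that Sub_le_below by blast
qed auto

lemma im_eq:
  assumes "m \<in> Mon C" "e \<in> Mperp C" "Dom C m = Cod C e"
  shows "im C (m \<cdot> e) = subobj C m"
proof -
  let ?P = "\<lambda>n. n \<in> Mon C \<and> (\<exists>d\<in>Mperp C. Dom C n = Cod C d \<and> m \<cdot> e = n \<cdot> d)"
  define n where "n = (SOME n. ?P n)"
  have "?P n" unfolding n_def using assms by (intro someI[of ?P m]) auto
  then obtain d where d: "n \<in> Mon C" "d \<in> Mperp C" "Dom C n = Cod C d" "m \<cdot> e = n \<cdot> d" by blast
  have "factors_through C m n" using Mperp_factor[of e m n] assms d
    by (metis mon_arr Mperp_arr factors_throughI)
  moreover have "factors_through C n m" using Mperp_factor[of d n m] assms d
    by (metis mon_arr Mperp_arr factors_throughI)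
  ultimately show ?thesis unfolding im_def n_def[symmetric] using subobj_eqI assms(1) d(1) by blast
qed

lemma im_factor:
  assumes "h \<in> Arr C"
  obtains m e where "m \<in> Mon C" "e \<in> Mperp C" "Dom C m = Cod C e" "m \<cdot> e = h" "im C h = subobj C m"
    "Cod C m = Cod C h" "Dom C e = Dom C h"
proof -
  obtain m e where "m \<in> Mon C" "e \<in> Mperp C" "Dom C m = Cod C e" "h = m \<cdot> e"
    using factorization[OF assms] by blast
  then show ?thesis using that[of m e] im_eq[of m e] by auto
qed

lemma im_carrier [simp]: "h \<in> Arr C \<Longrightarrow> Cod C h = X \<Longrightarrow> im C h \<in> carrier (Sub C X)"
  by (metis SubI im_factor)

lemma im_le:
  assumes "h \<in> Arr C" "Cod C h = X" "T \<in> carrier (Sub C X)"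
  shows "im C h \<sqsubseteq>\<^bsub>Sub C X\<^esub> T \<longleftrightarrow> below C h T"
proof -
  obtain m e where m: "m \<in> Mon C" "e \<in> Mperp C" "Dom C m = Cod C e" "m \<cdot> e = h" "im C h = subobj C m"
    "Cod C m = Cod C h" "Dom C e = Dom C h" using assms(1) by (rule im_factor)
  have "im C h \<sqsubseteq>\<^bsub>Sub C X\<^esub> T \<longleftrightarrow> below C m T"
    using Sub_le_mem[of "im C h" X T m] assms(2,3) m(1,5,6) by (simp del: Sub_sel)
  also have "\<dots> \<longleftrightarrow> below C h T"
    unfolding m(4)[symmetric] using below_Mperp[of m e T X] below_comp[of m T X e] assms(3) m(1,2,3) mon_arr Mperp_arr
    by metis
  finally show ?thesis .
qed

lemma below_im: "h \<in> Arr C \<Longrightarrow> below C h (im C h)"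
  using im_le[of h "Cod C h" "im C h"] Sub_le_below[of "im C h" "Cod C h"] by simp

lemma im_eqI:
  assumes "h \<in> Arr C" "k \<in> Arr C" "Cod C h = X" "Cod C k = X"
    and "\<And>T. T \<in> carrier (Sub C X) \<Longrightarrow> below C h T \<longleftrightarrow> below C k T"
  shows "im C h = im C k"
  using assms by (intro Sub_antisym[of _ X]) (metis im_le below_im im_carrier)+

lemma im_comp_Mperp:
  assumes "h \<in> Arr C" "e \<in> Mperp C" "Dom C h = Cod C e"
  shows "im C (h \<cdot> e) = im C h"
  using assms by (intro im_eqI[of _ _ "Cod C h"]) (auto intro: below_Mperp below_comp)

lemma im_mon [simp]: 
  assumes "m \<in> Mon C"
  shows "im C m = subobj C m"
  using assms by (intro Sub_antisym[of _ "Cod C m"])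
    (simp_all add: im_le below_subobj Sub_le_mem[OF _ _ subobj_self] below_im del: Sub_sel)

text \<open>A factorization of \<open>f . g\<close> through \<open>m\<close> is the second
  coordinate needed to map into the pullback.\<close>

lemma pullback_ft:
  assumes pb: "is_pullback C f m n h" and m: "m \<in> Mon C"
  shows "factors_through C g n \<longleftrightarrow> g \<in> Arr C \<and> Cod C g = Dom C f \<and> factors_through C (f \<cdot> g) m"
proof -
  note a = is_pullbackD[OF pb]
  show ?thesis
  proof
    assume "factors_through C g n"
    then obtain k where k: "k \<in> Arr C" "Dom C k = Dom C g" "Cod C k = Dom C n" "n \<cdot> k = g" "Cod C g = Cod C n" "g \<in> Arr C"
      using a(3) by (rule factors_throughE)
    have "f \<cdot> g = m \<cdot> (h \<cdot> k)" using k a assoc[of k n f] assoc[of k h m] by simp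
    then show "g \<in> Arr C \<and> Cod C g = Dom C f \<and> factors_through C (f \<cdot> g) m"
      using k a by (auto intro: factors_throughI[of _ "h \<cdot> k"])
  next
    assume g: "g \<in> Arr C \<and> Cod C g = Dom C f \<and> factors_through C (f \<cdot> g) m"
    then have "factors_through C (f \<cdot> g) m" by blast
    then obtain v where v: "v \<in> Arr C" "Dom C v = Dom C (f \<cdot> g)" "Cod C v = Dom C m" "m \<cdot> v = f \<cdot> g"
      using a(2) by (rule factors_throughE)
    then obtain k where "k \<in> Arr C" "Dom C k = Dom C g" "Cod C k = Dom C n" "n \<cdot> k = g"
      using is_pullback_lift[OF pb, of g v] g a by (metis comp_arr(2,3))
    then show "factors_through C g n" using a g by (intro factors_throughI[of _ k]) auto
  qed
qed

text \<open>\<open>pull\<close> gathers the pullbacks of all representatives. They lie in a single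
  class because the same arrows factor through them; conversely that class contains nothing else,
  because an arrow isomorphic to a pullback is again a pullback.\<close>

lemma pull_eq:
  assumes pb: "is_pullback C f m n h" and m: "m \<in> Mon C"
  shows "pull C f (subobj C m) = subobj C n"
proof -
  have n: "n \<in> Mon C" using pullback_mon[OF m pb] .
  note a = is_pullbackD[OF pb]
  have "n' \<in> subobj C n" if "n' \<in> Mon C" "m' \<in> subobj C m" "is_pullback C f m' n' h'" for n' m' h'
  proof -
    have m': "m' \<in> Mon C" "factors_through C m m'" "factors_through C m' m" using that(2) by (auto simp: mem_subobj)
    have iff: "factors_through C g n' \<longleftrightarrow> factors_through C g n" for g
      unfolding pullback_ft[OF pb m] pullback_ft[OF that(3) m'(1)]
      using factors_through_trans m' m by (meson mon_arr)
    show ?thesis unfolding mem_subobj using iff[of n] iff[of n'] a(3) that(1) factors_through_refl mon_arr by blast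
  qed
  moreover have "\<exists>h'. is_pullback C f m n' h'" if "n' \<in> subobj C n" for n'
  proof -
    have n': "n' \<in> Mon C" "factors_through C n n'" "factors_through C n' n" using that by (auto simp: mem_subobj)
    obtain k where k: "k \<in> Arr C" "Dom C k = Dom C n'" "Cod C k = Dom C n" "n \<cdot> k = n'" "Cod C n' = Cod C n"
      using n'(3) a(3) by (rule factors_throughE)
    have n'A: "n' \<in> Arr C" using n' by simp
    obtain l where l: "l \<in> Arr C" "Dom C l = Dom C n" "Cod C l = Dom C n'" "n' \<cdot> l = n"
      using n'(2) n'A by (rule factors_throughE)
    have kl: "k \<cdot> l = Ident C (Dom C n)"
    proof (rule mon_cancel[OF n])
      show "n \<cdot> (k \<cdot> l) = n \<cdot> Ident C (Dom C n)" using comp_reduce[OF k(4), of l] k l a by simp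
    qed (use k l a in auto)
    have "\<exists>!x. x \<in> Hom C W (Dom C n') \<and> n' \<cdot> x = u \<and> (h \<cdot> k) \<cdot> x = v"
      if uv: "u \<in> Hom C W (Dom C f)" "v \<in> Hom C W (Dom C m)" "f \<cdot> u = m \<cdot> v" for W u v
    proof -
      obtain w where w: "w \<in> Arr C" "Dom C w = W" "Cod C w = Dom C n" "n \<cdot> w = u" "h \<cdot> w = v"
        using is_pullback_lift[OF pb, of u v] uv by (auto simp: Hom_def)
      have "n' \<cdot> (l \<cdot> w) = u" using comp_reduce[OF l(4), of w] w l n'A by simp
      moreover have "(h \<cdot> k) \<cdot> (l \<cdot> w) = v" using comp_reduce[OF kl, of w] w l k a by simp
      ultimately show ?thesis
        using w l n'A mon_cancel[OF n'(1)] by (intro ex1I[of _ "l \<cdot> w"]) (simp_all add: Hom_iff)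
    qed
    moreover have "f \<cdot> n' = m \<cdot> (h \<cdot> k)" using k a comp_reduce[OF a(9), of k] by auto
    ultimately have "is_pullback C f m n' (h \<cdot> k)"
      unfolding is_pullback_def using a k n'A by (auto simp: Hom_def)
    then show ?thesis by blast
  qed
  moreover have "subobj C n \<subseteq> Mon C" by (auto simp: mem_subobj)
  ultimately show ?thesis using subobj_self[OF m] unfolding pull_def by blast
qed

lemma pull_pullback:
  assumes "f \<in> Arr C" "S \<in> carrier (Sub C (Cod C f))" "m \<in> S"
  obtains n h where "is_pullback C f m n h" "n \<in> Mon C" "pull C f S = subobj C n" "Cod C n = Dom C f"
proof -
  have m: "m \<in> Mon C" "Cod C m = Cod C f" "subobj C m = S" using Sub_mem[OF assms(2,3)] by auto
  obtain n h where pb: "is_pullback C f m n h" using pullback_exists[OF finite_limits assms(1), of m] m by auto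
  then show ?thesis using that[OF pb] pull_eq[OF pb m(1)] pullback_mon[OF m(1) pb] m is_pullbackD[OF pb] by simp
qed

lemma pull_carrier [simp]:
  assumes "f \<in> Arr C" "S \<in> carrier (Sub C (Cod C f))" "Dom C f = X"
  shows "pull C f S \<in> carrier (Sub C X)"
  using assms by (metis Sub_ex pull_pullback SubI)

lemma below_pull:
  assumes "f \<in> Arr C" "S \<in> carrier (Sub C (Cod C f))"
  shows "below C g (pull C f S) \<longleftrightarrow> g \<in> Arr C \<and> Cod C g = Dom C f \<and> below C (f \<cdot> g) S"
proof -
  obtain m where m: "m \<in> S" using Sub_ex[OF assms(2)] .
  obtain n h where n: "is_pullback C f m n h" "n \<in> Mon C" "pull C f S = subobj C n"
    using pull_pullback[OF assms m] .
  show ?thesis unfolding n(3) below_subobj[OF n(2)] below_mem[OF assms(2) m]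
    using pullback_ft[OF n(1)] Sub_mem[OF assms(2) m] by simp
qed

text \<open>The adjunction determines its left adjoint by antisymmetry, which turns the description
  of \<open>image_sub\<close> by \<open>THE\<close> into the image of a composite.\<close>

lemma image_sub_eq:
  assumes "f \<in> Arr C" "S \<in> carrier (Sub C (Dom C f))" "m \<in> S"
  shows "image_sub C f S = im C (f \<cdot> m)"
proof -
  have m: "m \<in> Mon C" "Cod C m = Dom C f" "subobj C m = S" using Sub_mem[OF assms(2,3)] by auto
  have *: "im C (f \<cdot> m) \<sqsubseteq>\<^bsub>Sub C (Cod C f)\<^esub> U \<longleftrightarrow> S \<sqsubseteq>\<^bsub>Sub C (Dom C f)\<^esub> pull C f U"
    if "U \<in> carrier (Sub C (Cod C f))" for U
    using that assms m by (simp add: im_le below_pull Sub_le_mem[OF _ _ assms(3)] del: Sub_sel)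
  have c: "im C (f \<cdot> m) \<in> carrier (Sub C (Cod C f))" using assms m by simp
  show ?thesis unfolding image_sub_def
  proof (rule the_equality)
    fix T assume T: "T \<in> carrier (Sub C (Cod C f)) \<and>
        (\<forall>U \<in> carrier (Sub C (Cod C f)). T \<sqsubseteq>\<^bsub>Sub C (Cod C f)\<^esub> U \<longleftrightarrow> S \<sqsubseteq>\<^bsub>Sub C (Dom C f)\<^esub> pull C f U)"
    then show "T = im C (f \<cdot> m)"
      using c * Sub_le_below[of T "Cod C f" T] Sub_le_below[OF c c]
      by (intro Sub_antisym[of _ "Cod C f"]) blast+
  qed (use c * in blast)
qed

end

section \<open>Joins and the modality\<close>

text \<open>An initial object is not assumed. An object whose identity lies in every subobject, so
  that it has just one, takes the place of the empty one.\<close>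

definition null :: "('o, 'a, 'z) mcat_scheme \<Rightarrow> 'o \<Rightarrow> bool" where
  "null C Y \<longleftrightarrow> (\<forall>S\<in>carrier (Sub C Y). below C (Ident C Y) S)"

definition is_join :: "('o, 'a, 'z) mcat_scheme \<Rightarrow> 'o \<Rightarrow> 'a set \<Rightarrow> 'a set \<Rightarrow> 'a set \<Rightarrow> bool" where
  "is_join C X S T L \<longleftrightarrow> S \<in> carrier (Sub C X) \<and> T \<in> carrier (Sub C X) \<and> L \<in> carrier (Sub C X) \<and>
     (\<forall>U\<in>carrier (Sub C X). L \<sqsubseteq>\<^bsub>Sub C X\<^esub> U \<longleftrightarrow> S \<sqsubseteq>\<^bsub>Sub C X\<^esub> U \<and> T \<sqsubseteq>\<^bsub>Sub C X\<^esub> U)"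

text \<open>Disjointness is expressed by the null domains of common arrows, which avoids meets
  altogether.\<close>

definition is_compl :: "('o, 'a, 'z) mcat_scheme \<Rightarrow> 'o \<Rightarrow> 'a set \<Rightarrow> 'a set \<Rightarrow> bool" where
  "is_compl C X S T \<longleftrightarrow> is_join C X S T (subobj C (Ident C X)) \<and>
     (\<forall>h. below C h S \<and> below C h T \<longrightarrow> null C (Dom C h))"

declare Sub_sel(2) [simp del] Upper_empty [simp del]

context f_regular_category
begin

lemma Sub_refl [simp]: "S \<in> carrier (Sub C X) \<Longrightarrow> S \<sqsubseteq>\<^bsub>Sub C X\<^esub> S"
  using Sub_le_below by blast

lemma Sub_trans:
  assumes "S \<sqsubseteq>\<^bsub>Sub C X\<^esub> T" "T \<sqsubseteq>\<^bsub>Sub C X\<^esub> U"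
    "S \<in> carrier (Sub C X)" "T \<in> carrier (Sub C X)" "U \<in> carrier (Sub C X)"
  shows "S \<sqsubseteq>\<^bsub>Sub C X\<^esub> U"
  using assms Sub_le_below by blast

lemma lub_iff:
  assumes "A \<subseteq> carrier (Sub C X)"
  shows "least (Sub C X) s (Upper (Sub C X) A) \<longleftrightarrow> s \<in> carrier (Sub C X) \<and>
    (\<forall>U\<in>carrier (Sub C X). s \<sqsubseteq>\<^bsub>Sub C X\<^esub> U \<longleftrightarrow> (\<forall>a\<in>A. a \<sqsubseteq>\<^bsub>Sub C X\<^esub> U))" (is "?l \<longleftrightarrow> ?r")
proof
  assume l: ?l
  then have s: "s \<in> carrier (Sub C X)" "\<And>a. a \<in> A \<Longrightarrow> a \<sqsubseteq>\<^bsub>Sub C X\<^esub> s"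
    "\<And>U. U \<in> carrier (Sub C X) \<Longrightarrow> (\<And>a. a \<in> A \<Longrightarrow> a \<sqsubseteq>\<^bsub>Sub C X\<^esub> U) \<Longrightarrow> s \<sqsubseteq>\<^bsub>Sub C X\<^esub> U"
    using assms unfolding least_def Upper_def by blast+
  then show ?r using Sub_trans assms by blast
next
  assume ?r
  then show ?l using assms unfolding least_def Upper_def by (auto dest: Sub_refl)
qed

lemma is_join_lub:
  "is_join C X S T L \<longleftrightarrow> S \<in> carrier (Sub C X) \<and> T \<in> carrier (Sub C X) \<and> least (Sub C X) L (Upper (Sub C X) {S, T})"
  by (auto simp: is_join_def lub_iff)

lemma below_ident:
  assumes "below C (Ident C X) U" "U \<in> carrier (Sub C X)" "h \<in> Arr C" "Cod C h = X"
  shows "below C h U"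
  using below_comp[OF assms(1,2,3)] assms by auto

text \<open>Pulled back to the null object \<open>Dom C h\<close>, the subobject \<open>S\<close>
  becomes total.\<close>

lemma null_below:
  assumes "h \<in> Arr C" "null C (Dom C h)" "S \<in> carrier (Sub C (Cod C h))"
  shows "below C h S"
proof -
  have "below C (Ident C (Dom C h)) (pull C h S)" using assms unfolding null_def by simp
  then show ?thesis using assms by (simp add: below_pull)
qed

text \<open>Taking images along \<open>h\<close> is left adjoint to pullback and hence preserves
  joins: each comparison with \<open>U\<close> moves to one with \<open>pull C h U\<close> on
  \<open>Y\<close>, where the given cover decides it.\<close>

lemma join_of_im:
  assumes h: "h \<in> Arr C" "Cod C h = X" "Dom C h = Y"
    and j: "is_join C Y S T (subobj C (Ident C Y))" and m: "m \<in> S" "n \<in> T"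
  shows "is_join C X (im C (h \<cdot> m)) (im C (h \<cdot> n)) (im C h)"
proof -
  have c: "S \<in> carrier (Sub C Y)" "T \<in> carrier (Sub C Y)" using j by (auto simp: is_join_def)
  have m': "m \<in> Mon C" "n \<in> Mon C" "Cod C m = Y" "Cod C n = Y" using Sub_mem c m by auto
  have Y: "Y \<in> Obj C" using h by auto
  have "below C h U \<longleftrightarrow> below C (h \<cdot> m) U \<and> below C (h \<cdot> n) U" if U: "U \<in> carrier (Sub C X)" for U
  proof -
    have U': "U \<in> carrier (Sub C (Cod C h))" "pull C h U \<in> carrier (Sub C Y)" using U h by simp_all
    have "subobj C (Ident C Y) \<sqsubseteq>\<^bsub>Sub C Y\<^esub> pull C h U \<longleftrightarrow> S \<sqsubseteq>\<^bsub>Sub C Y\<^esub> pull C h U \<and> T \<sqsubseteq>\<^bsub>Sub C Y\<^esub> pull C h U"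
      using j U' unfolding is_join_def by blast
    moreover have "subobj C (Ident C Y) \<sqsubseteq>\<^bsub>Sub C Y\<^esub> pull C h U \<longleftrightarrow> below C (Ident C Y) (pull C h U)"
      using Y U' by (intro Sub_le_mem) simp_all
    ultimately show ?thesis using Sub_le_mem[OF c(1) U'(2) m(1)] Sub_le_mem[OF c(2) U'(2) m(2)] h m' Y U'
      by (simp add: below_pull)
  qed
  then show ?thesis unfolding is_join_def using h m' by (simp add: im_le)
qed

end

context f_coherent_category
begin

lemma pull_join:
  assumes "f \<in> Arr C" "Dom C f = Y" "Cod C f = X" "is_join C X S T L"
  shows "is_join C Y (pull C f S) (pull C f T) (pull C f L)"
proof -
  have "f \<in> Hom C Y X" using assms by (simp add: Hom_iff)
  then have "preserves_finite_joins (Sub C X) (Sub C Y) (pull C f)" by (rule pull_finite_joins)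
  moreover have "{S, T} \<subseteq> carrier (Sub C X)" "finite {S, T}" using assms by (auto simp: is_join_def)
  ultimately have "least (Sub C Y) (pull C f L) (Upper (Sub C Y) (pull C f ` {S, T}))"
    using assms(4) unfolding is_join_lub preserves_finite_joins_def by blast
  then show ?thesis using assms by (auto simp: is_join_lub)
qed

lemma pull_ident:
  assumes "f \<in> Arr C" "Dom C f = Y" "Cod C f = X"
  shows "pull C f (subobj C (Ident C X)) = subobj C (Ident C Y)"
proof (rule Sub_eqI[of _ Y])
  have X: "X \<in> Obj C" "Y \<in> Obj C" using assms by auto
  show "below C h (pull C f (subobj C (Ident C X))) = below C h (subobj C (Ident C Y))" for h
    using assms X below_ident[of X "subobj C (Ident C X)" "f \<cdot> h"] below_ident[of Y "subobj C (Ident C Y)" h]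
      below_arr[of h "subobj C (Ident C Y)" Y]
    by (auto simp: below_pull below_self)
qed (use assms in auto)

lemma pull_cover:
  assumes "f \<in> Arr C" "Dom C f = Y" "Cod C f = X" "is_join C X S T (subobj C (Ident C X))"
  shows "is_join C Y (pull C f S) (pull C f T) (subobj C (Ident C Y))"
  using pull_join[OF assms] pull_ident[OF assms(1-3)] by simp

lemma bot_ex:
  assumes "X \<in> Obj C"
  obtains B where "B \<in> carrier (Sub C X)" "\<And>U. U \<in> carrier (Sub C X) \<Longrightarrow> B \<sqsubseteq>\<^bsub>Sub C X\<^esub> U"
proof -
  obtain s where "least (Sub C X) s (Upper (Sub C X) {})"
    using finite_joins[OF assms] unfolding has_finite_joins_def by blast
  then show ?thesis using that by (auto simp: lub_iff)
qed

text \<open>Pullback preserves the empty join, so \<open>pull C h B\<close> is least on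
  \<open>Dom C h\<close>; since \<open>h\<close> factors through \<open>B\<close>, it is also
  total.\<close>

lemma bot_null:
  assumes B: "B \<in> carrier (Sub C X)" "\<And>U. U \<in> carrier (Sub C X) \<Longrightarrow> B \<sqsubseteq>\<^bsub>Sub C X\<^esub> U"
    and h: "below C h B"
  shows "null C (Dom C h)"
proof -
  have h': "h \<in> Arr C" "Cod C h = X" using below_arr[OF h B(1)] by auto
  let ?Y = "Dom C h"
  have "preserves_finite_joins (Sub C X) (Sub C ?Y) (pull C h)" 
    using h' by (intro pull_finite_joins) (simp add: Hom_iff)
  moreover have "least (Sub C X) B (Upper (Sub C X) {})" using B by (simp add: lub_iff)
  ultimately have "least (Sub C ?Y) (pull C h B) (Upper (Sub C ?Y) (pull C h ` {}))"
    unfolding preserves_finite_joins_def by blast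
  then have l: "U \<in> carrier (Sub C ?Y) \<Longrightarrow> pull C h B \<sqsubseteq>\<^bsub>Sub C ?Y\<^esub> U" for U by (simp add: lub_iff)
  have "below C (Ident C ?Y) (pull C h B)" using h h' B by (simp add: below_pull)
  moreover have "pull C h B \<in> carrier (Sub C ?Y)" using h' B by simp
  ultimately show ?thesis unfolding null_def using l Sub_le_below[of "pull C h B" ?Y] by blast
qed

text \<open>Distributivity read on arrows. After pullback along \<open>h\<close> the part
  \<open>S\<close> is null, since \<open>h\<close> lies in the complement \<open>S'\<close>; the
  join then reduces to \<open>T\<close>, and it is total because \<open>h\<close> lies in
  \<open>L\<close>.\<close>

lemma join_split:
  assumes "is_join C X S T L" "is_compl C X S S'" "below C h S'" "below C h L"
  shows "below C h T"
proof -
  have c: "S \<in> carrier (Sub C X)" "T \<in> carrier (Sub C X)" "L \<in> carrier (Sub C X)" "S' \<in> carrier (Sub C X)"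
    using assms(1,2) by (auto simp: is_join_def is_compl_def)
  have h: "h \<in> Arr C" "Cod C h = X" using below_arr[OF assms(3) c(4)] by auto
  let ?Y = "Dom C h"
  have j: "is_join C ?Y (pull C h S) (pull C h T) (pull C h L)" using pull_join[OF h(1) refl h(2) assms(1)] .
  have cp: "pull C h S \<in> carrier (Sub C ?Y)" "pull C h T \<in> carrier (Sub C ?Y)" "pull C h L \<in> carrier (Sub C ?Y)"
    using h c by simp_all
  obtain p where p: "p \<in> pull C h S" using Sub_ex[OF cp(1)] .
  have p': "p \<in> Mon C" "Cod C p = ?Y" using Sub_mem[OF cp(1) p] by auto
  have "below C (h \<cdot> p) S" using below_self[OF cp(1) p] h c by (simp add: below_pull)
  moreover have "below C (h \<cdot> p) S'" using below_comp[OF assms(3) c(4), of p] p' by simp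
  ultimately have "null C (Dom C (h \<cdot> p))" using assms(2) unfolding is_compl_def by blast
  then have "below C p (pull C h T)" using null_below[of p] p' h cp by simp
  then have "pull C h S \<sqsubseteq>\<^bsub>Sub C ?Y\<^esub> pull C h T" using Sub_le_mem[OF cp(1,2) p] by simp
  then have "pull C h L \<sqsubseteq>\<^bsub>Sub C ?Y\<^esub> pull C h T" using j cp unfolding is_join_def by simp
  moreover have "below C (Ident C ?Y) (pull C h L)" using assms(4) h c by (simp add: below_pull)
  ultimately have "below C (Ident C ?Y) (pull C h T)" using Sub_le_below[OF cp(3,2)] by blast
  then show ?thesis using h c by (simp add: below_pull)
qed

end

context modal_category
begin

lemma dia_carrier [simp]: "S \<in> carrier (Sub C X) \<Longrightarrow> X \<in> Obj C \<Longrightarrow> Dia C X S \<in> carrier (Sub C X)"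
  using dia_finite_joins[of X] by (auto simp: preserves_finite_joins_def)

lemma dia_join:
  assumes "is_join C X S T L" "X \<in> Obj C"
  shows "is_join C X (Dia C X S) (Dia C X T) (Dia C X L)"
proof -
  have c: "{S, T} \<subseteq> carrier (Sub C X)" "finite {S, T}" using assms by (auto simp: is_join_def)
  then have "least (Sub C X) (Dia C X L) (Upper (Sub C X) (Dia C X ` {S, T}))"
    using dia_finite_joins[OF assms(2)] assms(1) unfolding is_join_lub preserves_finite_joins_def by blast
  then show ?thesis using c assms(2) by (auto simp: is_join_lub)
qed

lemma dia_mono:
  assumes "S \<sqsubseteq>\<^bsub>Sub C X\<^esub> T" "S \<in> carrier (Sub C X)" "T \<in> carrier (Sub C X)" "X \<in> Obj C"
  shows "Dia C X S \<sqsubseteq>\<^bsub>Sub C X\<^esub> Dia C X T"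
proof -
  have "is_join C X S T T" using assms Sub_trans by (auto simp: is_join_def)
  from dia_join[OF this assms(4)] show ?thesis using assms unfolding is_join_def by (metis Sub_refl)
qed

text \<open>With a null domain, \<open>im C h\<close> is the empty join. \<open>Dia\<close>
  preserves it, and only null objects map into it.\<close>

lemma dia_null:
  assumes "h \<in> Arr C" "Cod C h = X" "null C (Dom C h)" "below C g (Dia C X (im C h))"
  shows "null C (Dom C g)"
proof -
  have X: "X \<in> Obj C" using assms by auto
  have "im C h \<sqsubseteq>\<^bsub>Sub C X\<^esub> U" if "U \<in> carrier (Sub C X)" for U
    using null_below[of h U] that assms by (simp add: im_le)
  then have "least (Sub C X) (im C h) (Upper (Sub C X) {})" using assms by (simp add: lub_iff)
  then have "least (Sub C X) (Dia C X (im C h)) (Upper (Sub C X) (Dia C X ` {}))"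
    using dia_finite_joins[OF X] unfolding preserves_finite_joins_def by blast
  then show ?thesis by (intro bot_null[OF _ _ assms(4)]) (auto simp: lub_iff)
qed

text \<open>The unit of the adjunction puts \<open>im C h\<close> below the pullback of
  \<open>im C (u . h)\<close> along \<open>u\<close>; monotonicity of \<open>Dia\<close> and
  \<open>dia_pull\<close> then move the modality past \<open>u\<close>.\<close>

lemma dia_im_comp:
  assumes "h \<in> Arr C" "Cod C h = X" "u \<in> Arr C" "Dom C u = X" "Cod C u = X'" "below C g (Dia C X (im C h))"
  shows "below C (u \<cdot> g) (Dia C X' (im C (u \<cdot> h)))"
proof -
  have X: "X \<in> Obj C" "X' \<in> Obj C" using assms by auto
  have c: "im C (u \<cdot> h) \<in> carrier (Sub C X')" "im C h \<in> carrier (Sub C X)" using assms by simp_all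
  have p: "pull C u (im C (u \<cdot> h)) \<in> carrier (Sub C X)" using assms c by simp
  have "im C h \<sqsubseteq>\<^bsub>Sub C X\<^esub> pull C u (im C (u \<cdot> h))"
    using assms c by (simp add: im_le below_pull below_im)
  then have "Dia C X (im C h) \<sqsubseteq>\<^bsub>Sub C X\<^esub> Dia C X (pull C u (im C (u \<cdot> h)))"
    using dia_mono[OF _ c(2) p X(1)] by blast
  moreover have "Dia C X (pull C u (im C (u \<cdot> h))) \<sqsubseteq>\<^bsub>Sub C X\<^esub> pull C u (Dia C X' (im C (u \<cdot> h)))"
    using dia_pull[of u X X'] assms c by (simp add: Hom_iff)
  moreover have "Dia C X (im C h) \<in> carrier (Sub C X)" "Dia C X (pull C u (im C (u \<cdot> h))) \<in> carrier (Sub C X)"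
    "pull C u (Dia C X' (im C (u \<cdot> h))) \<in> carrier (Sub C X)" using c p X assms by simp_all
  ultimately have "below C g (pull C u (Dia C X' (im C (u \<cdot> h))))"
    using assms(6) Sub_le_below by blast
  then show ?thesis using assms c X by (simp add: below_pull)
qed

text \<open>This is \<open>dia_mon\<close> for a subobject that already lives on \<open>B\<close>:
  since \<open>i\<close> is mono, taking the image of \<open>im C h\<close> under \<open>i\<close>
  and pulling it back along \<open>i\<close> returns \<open>im C h\<close>.\<close>

lemma dia_im_mon:
  assumes i: "i \<in> Mon C" "Dom C i = B" "Cod C i = X" and h: "h \<in> Arr C" "Cod C h = B"
  shows "below C g (Dia C B (im C h)) \<longleftrightarrow> g \<in> Arr C \<and> Cod C g = B \<and> below C (i \<cdot> g) (Dia C X (im C (i \<cdot> h)))"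
proof -
  have iA: "i \<in> Arr C" using i by simp
  have X: "X \<in> Obj C" "B \<in> Obj C" using i iA by auto
  let ?S = "im C (i \<cdot> h)"
  have c: "?S \<in> carrier (Sub C X)" "im C h \<in> carrier (Sub C B)" using i iA h by simp_all
  \<comment> \<open>Because \<open>i\<close> is mono, composing with it loses no information about
    factorizations.\<close>
  have ft: "factors_through C (i \<cdot> g) (i \<cdot> k) \<longleftrightarrow> factors_through C g k"
    if kg: "k \<in> Arr C" "Cod C k = B" "g \<in> Arr C" "Cod C g = B" for g k
  proof
    have ik: "i \<cdot> k \<in> Arr C" using that i iA by simp
    assume "factors_through C (i \<cdot> g) (i \<cdot> k)"
    then obtain l where l: "l \<in> Arr C" "Dom C l = Dom C (i \<cdot> g)" "Cod C l = Dom C (i \<cdot> k)" "(i \<cdot> k) \<cdot> l = i \<cdot> g"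
      using ik by (rule factors_throughE)
    have kl: "Cod C l = Dom C k" "Dom C l = Dom C g" using l that i iA by simp_all
    have "i \<cdot> (k \<cdot> l) = (i \<cdot> k) \<cdot> l" using kl l(1) that i iA by simp
    also note l(4)
    finally have "i \<cdot> (k \<cdot> l) = i \<cdot> g" .
    from mon_cancel[OF i(1) this] have "k \<cdot> l = g" using l(1) kl that i(2,3) by simp
    then show "factors_through C g k" using l(1) kl that iA i by (intro factors_throughI[of _ l]) simp_all
  next
    assume "factors_through C g k"
    then obtain l where l: "l \<in> Arr C" "Dom C l = Dom C g" "Cod C l = Dom C k" "k \<cdot> l = g"
      using kg(1) by (rule factors_throughE)
    then show "factors_through C (i \<cdot> g) (i \<cdot> k)" using that iA i by (intro factors_throughI[of _ l]) simp_all
  qed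
  obtain m e where m: "m \<in> Mon C" "e \<in> Mperp C" "Dom C m = Cod C e" "m \<cdot> e = h" "im C h = subobj C m"
    "Cod C m = Cod C h" "Dom C e = Dom C h" using h(1) by (rule im_factor)
  have im: "i \<cdot> m \<in> Mon C" using comp_mon[OF m(1) i(1)] i(2) m(6) h(2) by simp
  have "(i \<cdot> m) \<cdot> e = i \<cdot> h"
    using m(1,2,3,6) i h iA unfolding m(4)[symmetric] by (intro assoc) simp_all
  then have S: "?S = subobj C (i \<cdot> m)"
    using im_eq[OF im m(2)] m i iA h by simp
  have "pull C i ?S = im C h"
  proof (rule Sub_eqI[of _ B])
    show "below C g (pull C i ?S) = below C g (im C h)" for g
      using i iA c ft[of m g] m h below_arr[of g "im C h" B]
      by (auto simp: below_pull S below_subobj im below_arr)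
  qed (use c iA i in auto)
  moreover have "image_sub C i (im C h) = ?S"
    using image_sub_eq[OF iA, of "im C h" m] i m iA h c S im by simp
  ultimately have "Dia C B (im C h) = pull C i (Dia C X ?S)"
    using dia_mon[OF i(1), of B X ?S] i iA c by (simp add: Hom_iff)
  then show ?thesis using below_pull[OF iA] i c X by simp
qed

end

context boolean_modal_category
begin

text \<open>An arrow below a subobject and below its lattice complement has its image below their
  meet, which is the bottom element, so \<open>bot_null\<close> applies.\<close>

lemma compl_ex:
  assumes "S \<in> carrier (Sub C X)" "X \<in> Obj C"
  obtains T where "is_compl C X S T"
proof -
  let ?L = "Sub C X"
  have b: "is_boolean_algebra ?L" by (rule boolean) fact
  then interpret bounded_lattice ?L by (simp add: is_boolean_algebra_def)
  obtain T where T: "T \<in> carrier ?L" "S \<sqinter>\<^bsub>?L\<^esub> T = \<bottom>\<^bsub>?L\<^esub>" "S \<squnion>\<^bsub>?L\<^esub> T = \<top>\<^bsub>?L\<^esub>"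
    using b assms(1) unfolding is_boolean_algebra_def by blast
  let ?I = "subobj C (Ident C X)"
  have I: "?I \<in> carrier ?L" using assms by simp
  have "null C (Dom C h)" if "below C h S" "below C h T" for h
  proof -
    have h: "h \<in> Arr C" "Cod C h = X" using below_arr that assms by blast+
    have "im C h \<sqsubseteq>\<^bsub>?L\<^esub> S \<sqinter>\<^bsub>?L\<^esub> T"
      using that assms T h by (intro meet_le) (simp_all add: im_le)
    then have "below C h \<bottom>\<^bsub>?L\<^esub>" using h T(2) by (simp add: im_le)
    then show ?thesis by (intro bot_null[of "\<bottom>\<^bsub>?L\<^esub>" X]) simp_all
  qed
  moreover have "?I \<sqsubseteq>\<^bsub>?L\<^esub> U \<longleftrightarrow> S \<sqsubseteq>\<^bsub>?L\<^esub> U \<and> T \<sqsubseteq>\<^bsub>?L\<^esub> U" if U: "U \<in> carrier ?L" for U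
  proof
    assume a: "S \<sqsubseteq>\<^bsub>?L\<^esub> U \<and> T \<sqsubseteq>\<^bsub>?L\<^esub> U"
    have "?I \<sqsubseteq>\<^bsub>?L\<^esub> \<top>\<^bsub>?L\<^esub>" using I by (rule top_higher)
    also have "\<top>\<^bsub>?L\<^esub> \<sqsubseteq>\<^bsub>?L\<^esub> U" unfolding T(3)[symmetric] using a U assms T by (intro join_le) simp_all
    finally show "?I \<sqsubseteq>\<^bsub>?L\<^esub> U" using I U by simp
  next
    assume a: "?I \<sqsubseteq>\<^bsub>?L\<^esub> U"
    have le: "V \<sqsubseteq>\<^bsub>?L\<^esub> ?I" if V: "V \<in> carrier ?L" for V
      using Sub_le_below[OF V I] below_ident[of X ?I] below_arr[OF _ V] assms
      by (auto simp: below_self)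
    show "S \<sqsubseteq>\<^bsub>?L\<^esub> U \<and> T \<sqsubseteq>\<^bsub>?L\<^esub> U"
      using le[OF T(1)] le[OF assms(1)] Sub_trans[OF _ a] T(1) assms(1) I U by blast
  qed
  ultimately have "is_compl C X S T" using assms T I by (auto simp: is_compl_def is_join_def)
  then show ?thesis by (rule that)
qed

end

text \<open>The axiom for quotients, used at a map \<open>f : Z \<rightarrow> Y\<close> through its graph \<open>fX = \<langle>f, 1\<rangle> : Z \<rightarrow> Y \<times> Z\<close>, in terms of
  arrows only, so that a countable set of arrows can be closed under it: \<open>qZ\<close> is \<open>q \<times> 1\<close>, \<open>h'\<close> has image
  \<open>qZ\<^sup>*(\<exists>\<^sub>f\<^sub>X \<exists>\<^sub>h \<top>)\<close>, \<open>t\<close> represents \<open>\<diamond>\<close> of this image, and \<open>m\<close> the image of \<open>t\<close> under \<open>qZ\<close>.\<close>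

definition quo_step :: "('o, 'a, 'z) modal_quot_cat_scheme \<Rightarrow> 'a \<Rightarrow> 'a \<Rightarrow> 'a \<Rightarrow> 'a \<Rightarrow> 'a \<Rightarrow> 'a \<Rightarrow> 'a \<Rightarrow> 'a \<Rightarrow> 'a \<Rightarrow> 'a
    \<Rightarrow> 'a \<Rightarrow> 'a \<Rightarrow> bool" where
  "quo_step C q f h p1 p2 qZ fX m e t y h' \<longleftrightarrow>
     p1 \<in> Hom C (Dom C qZ) (Dom C q) \<and> p2 \<in> Hom C (Dom C qZ) (Dom C f) \<and> qZ \<in> Arr C \<and>
     fX \<in> Hom C (Dom C f) (Cod C qZ) \<and> m \<in> Mon C \<and> e \<in> Mperp C \<and> t \<in> Mon C \<and>
     Cod C t = Dom C qZ \<and> qZ \<cdot>\<^bsub>C\<^esub> t = m \<cdot>\<^bsub>C\<^esub> e \<and> Dom C m = Cod C e \<and> t \<in> Dia C (Dom C qZ) (im C h') \<and>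
     h' \<in> Hom C (Dom C y) (Dom C qZ) \<and> y \<in> Hom C (Dom C y) (Dom C h) \<and> qZ \<cdot>\<^bsub>C\<^esub> h' = fX \<cdot>\<^bsub>C\<^esub> (h \<cdot>\<^bsub>C\<^esub> y) \<and>
     (\<forall>g. below C g (Dia C (Dom C f) (im C h)) \<longrightarrow> below C (fX \<cdot>\<^bsub>C\<^esub> g) (subobj C m)) \<and>
     (\<forall>u v. u \<in> Arr C \<and> v \<in> Arr C \<and> Cod C u = Dom C qZ \<and> Cod C v = Dom C f \<and> qZ \<cdot>\<^bsub>C\<^esub> u = fX \<cdot>\<^bsub>C\<^esub> v \<longrightarrow>
        p2 \<cdot>\<^bsub>C\<^esub> u = v \<and> q \<cdot>\<^bsub>C\<^esub> (p1 \<cdot>\<^bsub>C\<^esub> u) = f \<cdot>\<^bsub>C\<^esub> v)"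

lemma (in category) is_product_lift:
  assumes "is_product C X Y P p q" "u \<in> Arr C" "v \<in> Arr C" "Cod C u = X" "Cod C v = Y" "Dom C u = Dom C v"
  obtains h where "h \<in> Arr C" "Dom C h = Dom C u" "Cod C h = P" "p \<cdot> h = u" "q \<cdot> h = v"
proof -
  have "u \<in> Hom C (Dom C u) X" "v \<in> Hom C (Dom C u) Y" using assms(2-6) by (auto simp: Hom_iff)
  then have "\<exists>!h. h \<in> Hom C (Dom C u) P \<and> p \<cdot> h = u \<and> q \<cdot> h = v"
    using assms(1) unfolding is_product_def by blast
  then obtain h where "h \<in> Hom C (Dom C u) P" "p \<cdot> h = u" "q \<cdot> h = v" by blast
  then show ?thesis using that[of h] by (simp add: Hom_iff)
qed

lemma (in category) is_productD:
  assumes "is_product C X Y P p q"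
  shows "p \<in> Arr C" "q \<in> Arr C" "Dom C p = P" "Dom C q = P" "Cod C p = X" "Cod C q = Y"
  using assms unfolding is_product_def Hom_iff by blast+

context f_coherent_category
begin

text \<open>Here, in \<open>cover_step\<close> and in \<open>restrict_step\<close>, the pullbacks by
  which requirements are met are recorded as facts about arrows alone, so that a set of arrows can
  be closed under them.\<close>

lemma Mperp_step:
  assumes "e \<in> Mperp C" "b \<in> Arr C" "Cod C e = Cod C b"
  shows "\<exists>y c. y \<in> Mperp C \<and> Cod C y = Dom C b \<and> c \<in> Hom C (Dom C y) (Dom C e) \<and> e \<cdot> c = b \<cdot> y"
proof -
  obtain y c where pb: "is_pullback C b e y c"
    using pullback_exists[OF finite_limits assms(2), of e] assms by auto
  note a = is_pullbackD[OF pb]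
  show ?thesis using pullback_Mperp[OF assms(1) pb] a(4,6,7,8,9)
    by (intro exI[of _ y] exI[of _ c]) (simp add: Hom_iff)
qed

lemma cover_step:
  assumes m: "m \<in> Mon C" "m' \<in> Mon C" and b: "b \<in> Arr C"
    and c: "is_join C (Cod C b) (subobj C m) (subobj C m') (subobj C (Ident C (Cod C b)))"
  shows "\<exists>n n'. n \<in> Mon C \<and> n' \<in> Mon C \<and> Cod C n = Dom C b \<and> Cod C n' = Dom C b \<and>
     is_join C (Dom C b) (subobj C n) (subobj C n') (subobj C (Ident C (Dom C b))) \<and>
     below C (b \<cdot> n) (subobj C m) \<and> below C (b \<cdot> n') (subobj C m')"
proof -
  have s: "subobj C m \<in> carrier (Sub C (Cod C b))" "subobj C m' \<in> carrier (Sub C (Cod C b))"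
    using c by (auto simp: is_join_def)
  obtain n h where n: "is_pullback C b m n h" "n \<in> Mon C" "pull C b (subobj C m) = subobj C n" "Cod C n = Dom C b"
    using pull_pullback[OF b s(1) subobj_self[OF m(1)]] .
  obtain n' h' where n': "is_pullback C b m' n' h'" "n' \<in> Mon C" "pull C b (subobj C m') = subobj C n'" "Cod C n' = Dom C b"
    using pull_pullback[OF b s(2) subobj_self[OF m(2)]] .
  have "below C n (pull C b (subobj C m))" "below C n' (pull C b (subobj C m'))"
    using n n' by (simp_all add: below_subobj)
  then have "below C (b \<cdot> n) (subobj C m)" "below C (b \<cdot> n') (subobj C m')"
    using below_pull[OF b] s by blast+
  moreover have "is_join C (Dom C b) (subobj C n) (subobj C n') (subobj C (Ident C (Dom C b)))"
    using pull_cover[OF b refl refl c] n(3) n'(3) by simp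
  ultimately show ?thesis using n n' by blast
qed

lemma restrict_step:
  assumes m: "m \<in> Mon C" and f: "f \<in> Arr C" "Cod C m = Cod C f"
  shows "\<exists>i k. i \<in> Mon C \<and> Cod C i = Dom C f \<and> k \<in> Hom C (Dom C i) (Dom C m) \<and> m \<cdot> k = f \<cdot> i \<and>
     (\<forall>g. factors_through C g i \<longleftrightarrow> g \<in> Arr C \<and> Cod C g = Dom C f \<and> factors_through C (f \<cdot> g) m)"
proof -
  obtain i k where pb: "is_pullback C f m i k"
    using pullback_exists[OF finite_limits f(1), of m] m f by auto
  note a = is_pullbackD[OF pb]
  show ?thesis using pullback_mon[OF m pb] a(4,6,7,8,9) pullback_ft[OF pb m]
    by (intro exI[of _ i] exI[of _ k]) (simp add: Hom_iff)
qed

end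

context boolean_modal_category_with_quotients
begin

lemma dia_quo_eq:
  assumes "q \<in> Quo C" "is_product C (Dom C q) Z XZ p1 p2" "is_product C (Cod C q) Z YZ r1 r2"
    "qZ \<in> Hom C XZ YZ" "r1 \<cdot> qZ = q \<cdot> p1" "r2 \<cdot> qZ = p2" "S \<in> carrier (Sub C YZ)" "t \<in> Dia C XZ (pull C qZ S)"
  shows "Dia C YZ S \<sqsubseteq>\<^bsub>Sub C YZ\<^esub> im C (qZ \<cdot> t)"
proof -
  have qA: "q \<in> Hom C (Dom C q) (Cod C q)" using assms(1) quo_Mperp by (auto simp: Hom_iff)
  have o: "Z \<in> Obj C" "XZ \<in> Obj C" using assms(2) by (auto simp: is_product_def)
  have qZ: "qZ \<in> Arr C" "Dom C qZ = XZ" "Cod C qZ = YZ" using assms(4) by (auto simp: Hom_iff)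
  have "image_sub C qZ (Dia C XZ (pull C qZ S)) = im C (qZ \<cdot> t)"
    using qZ o assms(7,8) by (intro image_sub_eq) simp_all
  then show ?thesis using dia_quo[OF assms(1) qA o(1) assms(2-7)] by simp
qed

text \<open>With \<open>Z = Dom C f\<close>, the axiom is applied to the image of \<open>h\<close>
  under the graph \<open>fX\<close> of \<open>f\<close>. The graph keeps track of the base point: an
  equation \<open>qZ . u = fX . v\<close> projects to \<open>p2 . u = v\<close> and to
  \<open>q . (p1 . u) = f . v\<close>, so a lift along \<open>q\<close> is found without changing
  the value in \<open>Z\<close>.\<close>

lemma quo_step_ex:
  assumes q: "q \<in> Quo C" and f: "f \<in> Arr C" "Cod C f = Cod C q" and h: "h \<in> Arr C" "Cod C h = Dom C f"
  shows "\<exists>p1 p2 qZ fX m e t y h'. quo_step C q f h p1 p2 qZ fX m e t y h'"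
proof -
  have qA: "q \<in> Arr C" using q quo_Mperp by auto
  have o: "Dom C q \<in> Obj C" "Cod C q \<in> Obj C" "Dom C f \<in> Obj C" using qA f by auto
  obtain CX p1 p2 where P: "is_product C (Dom C q) (Dom C f) CX p1 p2"
    using product_exists[OF finite_limits o(1,3)] .
  obtain DX r1 r2 where R: "is_product C (Cod C q) (Dom C f) DX r1 r2"
    using product_exists[OF finite_limits o(2,3)] .
  note p = is_productD[OF P] and r = is_productD[OF R]
  obtain qZ where qZ: "qZ \<in> Arr C" "Dom C qZ = CX" "Cod C qZ = DX" "r1 \<cdot> qZ = q \<cdot> p1" "r2 \<cdot> qZ = p2"
    using is_product_lift[OF R, of "q \<cdot> p1" p2] p qA by auto
  obtain fX where fX: "fX \<in> Arr C" "Dom C fX = Dom C f" "Cod C fX = DX" "r1 \<cdot> fX = f" "r2 \<cdot> fX = Ident C (Dom C f)"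
    using is_product_lift[OF R, of f "Ident C (Dom C f)"] o f by auto
  have fh: "fX \<cdot> h \<in> Arr C" "Cod C (fX \<cdot> h) = DX" "Dom C (fX \<cdot> h) = Dom C h" using fX h by auto
  obtain i e0 where i: "i \<in> Mon C" "e0 \<in> Mperp C" "Dom C i = Cod C e0" "i \<cdot> e0 = fX \<cdot> h" "im C (fX \<cdot> h) = subobj C i"
    "Cod C i = Cod C (fX \<cdot> h)" "Dom C e0 = Dom C (fX \<cdot> h)" using fh(1) by (rule im_factor)
  have ci: "Cod C i = DX" using i(6) fh by simp
  have S: "subobj C i \<in> carrier (Sub C (Cod C qZ))" "subobj C i \<in> carrier (Sub C DX)" using i(1) ci qZ by simp_all
  obtain n k where n: "is_pullback C qZ i n k" "n \<in> Mon C" "pull C qZ (subobj C i) = subobj C n" "Cod C n = Dom C qZ"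
    using pull_pullback[OF qZ(1) S(1) subobj_self[OF i(1)]] .
  note nk = is_pullbackD[OF n(1)]
  have "Cod C k = Cod C e0" using nk(8) i(3) by simp
  then obtain d y where dy: "is_pullback C k e0 d y"
    using pullback_exists[OF finite_limits nk(4), of e0] i(2) by auto
  note d = is_pullbackD[OF dy]
  have dM: "d \<in> Mperp C" using pullback_Mperp[OF i(2) dy] .
  \<comment> \<open>The arrow \<open>fX . h\<close> need not lift along \<open>qZ\<close>. Pulling
    its orthogonal part \<open>e0\<close> back along \<open>k\<close> produces \<open>d\<close> in
    \<open>Mperp C\<close>; therefore \<open>n . d\<close> has image \<open>n\<close>, and
    \<open>y\<close> compares its domain with that of \<open>h\<close>.\<close>
  define h' where "h' = n \<cdot> d"
  have dn: "Cod C d = Dom C n" using d(6) nk(7) by simp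
  have h': "h' \<in> Arr C" "Dom C h' = Dom C d" "Cod C h' = CX"
    unfolding h'_def using d(3) nk(3) dn n(4) qZ(2) by simp_all
  have imh': "im C h' = subobj C n" unfolding h'_def using im_eq[OF n(2) dM] dn by simp
  have y: "y \<in> Arr C" "Dom C y = Dom C d" "Cod C y = Dom C h" using d(4,7,8) i(7) fh(3) by simp_all
  have "CX \<in> Obj C" using qZ(1,2) by auto
  then have "Dia C CX (im C h') \<in> carrier (Sub C CX)" using h' by simp
  then obtain t where t: "t \<in> Dia C CX (im C h')" "t \<in> Mon C" "Cod C t = CX" using Sub_ex Sub_mem by metis
  have qt: "qZ \<cdot> t \<in> Arr C" "Cod C (qZ \<cdot> t) = DX" using qZ t by simp_all
  obtain m e where m: "m \<in> Mon C" "e \<in> Mperp C" "Dom C m = Cod C e" "m \<cdot> e = qZ \<cdot> t" "im C (qZ \<cdot> t) = subobj C m"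
    "Cod C m = Cod C (qZ \<cdot> t)" "Dom C e = Dom C (qZ \<cdot> t)" using qt(1) by (rule im_factor)
  have le: "Dia C DX (im C (fX \<cdot> h)) \<sqsubseteq>\<^bsub>Sub C DX\<^esub> subobj C m"
    using dia_quo_eq[OF q P R _ qZ(4,5) S(2), of t] t(1) imh' n(3) i(5) m(5) qZ(1-3) by (simp add: Hom_iff)
  have c: "Dia C DX (im C (fX \<cdot> h)) \<in> carrier (Sub C DX)" "subobj C m \<in> carrier (Sub C DX)"
    using fh m(1,6) qt(2) qZ(1,3) by auto
  have "qZ \<cdot> h' = (qZ \<cdot> n) \<cdot> d" unfolding h'_def using d(3) nk(3) dn n(4) qZ(1) by simp
  also have "\<dots> = i \<cdot> (k \<cdot> d)" unfolding nk(9) using d nk(2,3,4,7,8) dn by (intro assoc) simp_all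
  also have "\<dots> = (i \<cdot> e0) \<cdot> y" unfolding d(9) using d(8) i(2,3) d(4) mon_arr[OF i(1)] by (intro assoc[symmetric]) simp_all
  also have "\<dots> = fX \<cdot> (h \<cdot> y)" unfolding i(4) using fX(1,2) h y by (intro assoc) simp_all
  finally have eq: "qZ \<cdot> h' = fX \<cdot> (h \<cdot> y)" .
  have "below C (fX \<cdot> g) (subobj C m)" if "below C g (Dia C (Dom C f) (im C h))" for g
    using dia_im_comp[OF h fX(1-3) that] le c Sub_le_below by blast
  moreover have "p2 \<cdot> u = v \<and> q \<cdot> (p1 \<cdot> u) = f \<cdot> v" if uv: "u \<in> Arr C" "v \<in> Arr C" "Cod C u = CX"
    "Cod C v = Dom C f" "qZ \<cdot> u = fX \<cdot> v" for u v
  proof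
    have "p2 \<cdot> u = r2 \<cdot> (qZ \<cdot> u)" using comp_reduce[OF qZ(5), of u] uv(1,3) qZ(1-3) r by simp
    also have "\<dots> = Ident C (Dom C f) \<cdot> v" unfolding uv(5) using comp_reduce[OF fX(5), of v] uv(2,4) fX(1-3) r by simp
    finally show "p2 \<cdot> u = v" using uv(2,4) by simp
    have "q \<cdot> (p1 \<cdot> u) = (q \<cdot> p1) \<cdot> u" using uv(1,3) p qA by simp
    also have "\<dots> = r1 \<cdot> (qZ \<cdot> u)" using comp_reduce[OF qZ(4), of u] uv(1,3) qZ(1-3) r by simp
    also have "\<dots> = f \<cdot> v" unfolding uv(5) using comp_reduce[OF fX(4), of v] uv(2,4) fX(1-3) r by simp
    finally show "q \<cdot> (p1 \<cdot> u) = f \<cdot> v" .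
  qed
  ultimately have "quo_step C q f h p1 p2 qZ fX m e t y h'"
    unfolding quo_step_def using p qZ(1-3) fX(1-3) m(1-4) t h' y eq by (simp add: Hom_iff)
  then show ?thesis by blast
qed

end

section \<open>Countable closures and generic sequences\<close>

text \<open>A Loewenheim-Skolem closure: \<open>P k xs ys\<close> is read as "\<open>ys\<close> are
  witnesses for the arguments \<open>xs\<close> of the operation \<open>k\<close>". Adding one
  chosen list of witnesses for each finite list of arguments, omega times, stays countable.\<close>

lemma countable_closure:
  fixes P :: "nat \<Rightarrow> 'b list \<Rightarrow> 'b list \<Rightarrow> bool"
  assumes "countable A" "A \<subseteq> R" and R: "\<And>k xs ys. set xs \<subseteq> R \<Longrightarrow> P k xs ys \<Longrightarrow> set ys \<subseteq> R"
  obtains B where "A \<subseteq> B" "B \<subseteq> R" "countable B"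
    "\<And>k xs ys. set xs \<subseteq> B \<Longrightarrow> P k xs ys \<Longrightarrow> \<exists>zs. set zs \<subseteq> B \<and> P k xs zs"
proof -
  define w where "w k xs = (if \<exists>ys. P k xs ys then SOME ys. P k xs ys else [])" for k xs
  have w: "P k xs (w k xs)" if "P k xs ys" for k xs ys
    unfolding w_def using that by (auto intro: someI)
  define F where "F B = B \<union> (\<Union>(k, xs)\<in>UNIV \<times> lists B. set (w k xs))" for B
  define B where "B n = (F ^^ n) A" for n
  have B: "B 0 = A" "B (Suc n) = F (B n)" for n by (simp_all add: B_def)
  have cR: "countable (B n) \<and> B n \<subseteq> R" for n
  proof (induction n)
    case (Suc n)
    have "set (w k xs) \<subseteq> R" if "xs \<in> lists (B n)" for k xs
    proof (cases "\<exists>ys. P k xs ys")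
      case True
      moreover have "set xs \<subseteq> R" using that Suc by auto
      ultimately show ?thesis using w R by blast
    qed (simp add: w_def)
    moreover have "countable (F (B n))"
      unfolding F_def using Suc by (intro countable_Un countable_UN) (auto intro: countable_finite)
    ultimately show ?case unfolding B F_def using Suc by auto
  qed (use assms B in auto)
  have mono: "B n \<subseteq> B m" if "n \<le> m" for n m
    using that by (induction rule: dec_induct) (auto simp: B F_def)
  show ?thesis
  proof
    show "A \<subseteq> (\<Union>n. B n)" using B(1) by auto
    show "(\<Union>n. B n) \<subseteq> R" "countable (\<Union>n. B n)" using cR by auto
    fix k xs ys assume xs: "set xs \<subseteq> (\<Union>n. B n)" and P: "P k xs ys"
    have "\<exists>n. set xs \<subseteq> B n" using xs
    proof (induction xs)
      case (Cons x xs)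
      then obtain n m where "set xs \<subseteq> B n" "x \<in> B m" by auto
      then show ?case using mono[of n "max n m"] mono[of m "max n m"] by (intro exI[of _ "max n m"]) auto
    qed auto
    then obtain n where "set xs \<subseteq> B n" ..
    then have "set (w k xs) \<subseteq> B (Suc n)" unfolding B F_def by (fastforce simp: in_lists_conv_set)
    then show "\<exists>zs. set zs \<subseteq> (\<Union>n. B n) \<and> P k xs zs" using w[OF P] by blast
  qed
qed

text \<open>A sequence of conditions \<open>c\<close> with refinements \<open>T i j\<close> of \<open>c i\<close> to \<open>c j\<close>, in which every requirement \<open>t\<close> is
  met for every \<open>c i\<close> at arbitrarily late stages.\<close>

definition generic_run :: "('c \<Rightarrow> bool) \<Rightarrow> ('c \<Rightarrow> 'r \<Rightarrow> 'c \<Rightarrow> bool) \<Rightarrow> ('c \<Rightarrow> 'r) \<Rightarrow> ('r \<Rightarrow> 'r \<Rightarrow> 'r) \<Rightarrow>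
    't set \<Rightarrow> ('t \<Rightarrow> 'c \<Rightarrow> 'r \<Rightarrow> 'c \<Rightarrow> bool) \<Rightarrow> (nat \<Rightarrow> 'c) \<Rightarrow> (nat \<Rightarrow> nat \<Rightarrow> 'r) \<Rightarrow> bool" where
  "generic_run V R one cmp A tk c T \<longleftrightarrow> (\<forall>n. V (c n)) \<and> (\<forall>i j. i \<le> j \<longrightarrow> R (c i) (T i j) (c j)) \<and>
    (\<forall>i. T i i = one (c i)) \<and> (\<forall>i j k. i \<le> j \<and> j \<le> k \<longrightarrow> T i k = cmp (T i j) (T j k)) \<and>
    (\<forall>t\<in>A. \<forall>i N. \<exists>n\<ge>N. i \<le> n \<and> tk t (c i) (T i n) (c n))"

lemma generic_runD:
  assumes "generic_run V R one cmp A tk c T"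
  shows "V (c n)" "i \<le> j \<Longrightarrow> R (c i) (T i j) (c j)" "T i i = one (c i)"
    "\<lbrakk>i \<le> j; j \<le> k\<rbrakk> \<Longrightarrow> T i k = cmp (T i j) (T j k)" "t \<in> A \<Longrightarrow> \<exists>n\<ge>N. i \<le> n \<and> tk t (c i) (T i n) (c n)"
  using assms unfolding generic_run_def by blast+

text \<open>Dependent choice with bookkeeping. A stage number encodes the index of a condition, a
  task and some padding, so each pair of a condition and a task recurs at arbitrarily late stages. A
  task posed for an old condition can still be met, because the state keeps the composite refinement
  from every earlier condition to the present one.\<close>

lemma generic_sequence:
  fixes R :: "'c \<Rightarrow> 'r \<Rightarrow> 'c \<Rightarrow> bool" and tk :: "'t \<Rightarrow> 'c \<Rightarrow> 'r \<Rightarrow> 'c \<Rightarrow> bool"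
  assumes A: "countable A" "A \<noteq> {}" and c0: "V c0"
    and one: "\<And>c. V c \<Longrightarrow> R c (one c) c"
    and cmp: "\<And>c r c' r' c''. \<lbrakk>R c r c'; R c' r' c''\<rbrakk> \<Longrightarrow> R c (cmp r r') c''"
    and assoc: "\<And>c r c' r' c'' r'' c'''. \<lbrakk>R c r c'; R c' r' c''; R c'' r'' c'''\<rbrakk>
       \<Longrightarrow> cmp (cmp r r') r'' = cmp r (cmp r' r'')"
    and unit: "\<And>c r c'. R c r c' \<Longrightarrow> cmp r (one c') = r" "\<And>c r c'. R c r c' \<Longrightarrow> cmp (one c) r = r"
    and dense: "\<And>c r c' t. \<lbrakk>V c; V c'; R c r c'; t \<in> A\<rbrakk> \<Longrightarrow> \<exists>c'' r'. V c'' \<and> R c' r' c'' \<and> tk t c (cmp r r') c''"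
  shows "\<exists>c T. c 0 = c0 \<and> generic_run V R one cmp A tk c T"
proof -
  define ix where "ix n = fst (prod_decode n)" for n
  define tsk where "tsk n = from_nat_into A (fst (prod_decode (snd (prod_decode n))))" for n
  have tsk: "tsk n \<in> A" for n using A by (simp add: tsk_def from_nat_into)
  \<comment> \<open>At stage \<open>n\<close> only the entries up to \<open>n\<close> of the state
    are meaningful; \<open>snd s i\<close> is the composite refinement from the condition
    \<open>i\<close> to the condition \<open>n\<close>.\<close>
  define P where "P n s \<longleftrightarrow> (\<forall>i\<le>n. V (fst s i) \<and> R (fst s i) (snd s i) (fst s n)) \<and> snd s n = one (fst s n) \<and> fst s 0 = c0"
    for n and s :: "(nat \<Rightarrow> 'c) \<times> (nat \<Rightarrow> 'r)"
  define Q where "Q n s s' \<longleftrightarrow> (\<forall>i\<le>n. fst s' i = fst s i) \<and>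
     (\<exists>r. R (fst s n) r (fst s' (Suc n)) \<and> (\<forall>i\<le>n. snd s' i = cmp (snd s i) r)) \<and>
     (ix n \<le> n \<longrightarrow> tk (tsk n) (fst s (ix n)) (snd s' (ix n)) (fst s' (Suc n)))"
    for n and s s' :: "(nat \<Rightarrow> 'c) \<times> (nat \<Rightarrow> 'r)"
  have "\<exists>s. \<forall>n. P n (s n) \<and> Q n (s n) (s (Suc n))"
  proof (rule dependent_nat_choice)
    show "\<exists>s. P 0 s" using c0 one[OF c0] by (intro exI[of _ "(\<lambda>_. c0, \<lambda>_. one c0)"]) (simp add: P_def)
    fix s n assume P: "P n s"
    \<comment> \<open>If the stage names a condition that does not exist yet, \<open>Q\<close>
      demands nothing, and the task is met for the newest condition instead.\<close>
    let ?i = "if ix n \<le> n then ix n else n"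
    have "V (fst s ?i)" "V (fst s n)" "R (fst s ?i) (snd s ?i) (fst s n)" using P by (auto simp: P_def)
    from dense[OF this tsk[of n]] obtain d r where d: "V d" "R (fst s n) r d" "tk (tsk n) (fst s ?i) (cmp (snd s ?i) r) d" by blast
    let ?s = "((fst s)(Suc n := d), (\<lambda>i. if i \<le> n then cmp (snd s i) r else one d))"
    have "P (Suc n) ?s" using P d one[OF d(1)] cmp[OF _ d(2)] by (auto simp: P_def le_Suc_eq)
    moreover have "Q n s ?s" using d by (auto simp: Q_def split: if_splits)
    ultimately show "\<exists>y. P (Suc n) y \<and> Q n s y" by blast
  qed
  then obtain s where s: "\<And>n. P n (s n)" "\<And>n. Q n (s n) (s (Suc n))" by blast
  define c where "c n = fst (s n) n" for n
  define T where "T i j = snd (s j) i" for i j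
  have c: "fst (s j) i = c i" if "i \<le> j" for i j
    using that
  proof (induction rule: dec_induct)
    case (step j)
    then show ?case using s(2)[of j] by (simp add: Q_def)
  qed (simp add: c_def)
  have TR: "R (c i) (T i j) (c j)" if "i \<le> j" for i j
    using s(1)[of j] that c by (auto simp: P_def T_def)
  have T1: "T i i = one (c i)" for i using s(1)[of i] c by (auto simp: P_def T_def)
  have TS: "T i (Suc j) = cmp (T i j) (T j (Suc j))" if "i \<le> j" for i j
  proof -
    obtain r where r: "R (fst (s j) j) r (fst (s (Suc j)) (Suc j))" "\<And>i. i \<le> j \<Longrightarrow> snd (s (Suc j)) i = cmp (snd (s j) i) r"
      using s(2)[of j] by (auto simp: Q_def)
    have "T j (Suc j) = cmp (one (c j)) r" using r(2)[of j] T1[of j] by (simp add: T_def)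
    also have "\<dots> = r" using unit(2)[OF r(1)] c by simp
    finally show ?thesis using r(2)[OF that] by (simp add: T_def)
  qed
  have "T i k = cmp (T i j) (T j k)" if "i \<le> j" "j \<le> k" for i j k
    using that(2)
  proof (induction rule: dec_induct)
    case base
    then show ?case using unit(1)[OF TR[OF that(1)]] T1 by simp
  next
    case (step k)
    then show ?case using TS[of i k] TS[of j k] that(1) assoc[OF TR TR TR, of i j k "Suc k"] by simp
  qed
  moreover have "\<exists>n\<ge>N. i \<le> n \<and> tk t (c i) (T i n) (c n)" if t: "t \<in> A" for t i N
  proof -
    obtain k where k: "from_nat_into A k = t" using from_nat_into_surj[OF A(1) t] ..
    \<comment> \<open>The last coordinate makes the stage number at least \<open>i\<close> and
      \<open>N\<close>.\<close>
    define n where "n = prod_encode (i, prod_encode (k, max i N))"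
    have "max i N \<le> n" unfolding n_def using le_prod_encode_2 le_trans by blast
    moreover have "ix n = i" "tsk n = t" by (simp_all add: n_def ix_def tsk_def k)
    ultimately show ?thesis using s(2)[of n] c by (intro exI[of _ "Suc n"]) (auto simp: Q_def T_def)
  qed
  moreover have "c 0 = c0" "V (c n)" for n using s(1) by (auto simp: c_def P_def)
  ultimately show ?thesis using TR T1 unfolding generic_run_def by (intro exI[of _ c] exI[of _ T]) blast
qed

section \<open>Fragments\<close>

text \<open>Objects enter a fragment only through their identities. Each closure condition asks for
  some witness and never for a particular limit, so that a countable set of arrows can satisfy all
  of them. By \<open>frag_solve\<close>, limits of the ambient category can be used inside: whatever
  a universal property supplies as the solution of finitely many equations has a counterpart in
  \<open>\<Sigma>\<close>.\<close>

locale fragment = boolean_modal_category_with_quotients C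
  for C :: "('o, 'a, 'z) modal_quot_cat_scheme" (structure) +
  fixes \<Sigma> :: "'a set"
  assumes frag_sub: "\<Sigma> \<subseteq> Arr C" and frag_countable: "countable \<Sigma>"
    and frag_comp: "\<lbrakk>f \<in> \<Sigma>; g \<in> \<Sigma>; Dom C g = Cod C f\<rbrakk> \<Longrightarrow> g \<cdot> f \<in> \<Sigma>"
    and frag_ident: "f \<in> \<Sigma> \<Longrightarrow> Ident C (Dom C f) \<in> \<Sigma>" "f \<in> \<Sigma> \<Longrightarrow> Ident C (Cod C f) \<in> \<Sigma>"
    and frag_solve: "\<lbrakk>set ls \<subseteq> \<Sigma>; set gs \<subseteq> \<Sigma>; length ls = length gs; Ident C Y \<in> \<Sigma>; Ident C L \<in> \<Sigma>;
       h \<in> Hom C Y L; \<forall>(l, g)\<in>set (zip ls gs). l \<cdot> h = g\<rbrakk> \<Longrightarrow>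
       \<exists>h'\<in>\<Sigma>. h' \<in> Hom C Y L \<and> (\<forall>(l, g)\<in>set (zip ls gs). l \<cdot> h' = g)"
    and frag_factor: "f \<in> \<Sigma> \<Longrightarrow> \<exists>m\<in>\<Sigma>. \<exists>e\<in>\<Sigma>. m \<in> Mon C \<and> e \<in> Mperp C \<and> Dom C m = Cod C e \<and> m \<cdot> e = f"
    and frag_equalizer: "\<lbrakk>f \<in> \<Sigma>; g \<in> \<Sigma>; Dom C g = Dom C f; Cod C g = Cod C f\<rbrakk> \<Longrightarrow> \<exists>e\<in>\<Sigma>. is_equalizer C f g e"
    and frag_Mperp: "\<lbrakk>e \<in> \<Sigma>; b \<in> \<Sigma>; e \<in> Mperp C; Cod C e = Cod C b\<rbrakk> \<Longrightarrow>
       \<exists>y\<in>\<Sigma>. \<exists>c\<in>\<Sigma>. y \<in> Mperp C \<and> Cod C y = Dom C b \<and> c \<in> Hom C (Dom C y) (Dom C e) \<and> e \<cdot> c = b \<cdot> y"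
    and frag_cover: "\<lbrakk>m \<in> \<Sigma>; m' \<in> \<Sigma>; b \<in> \<Sigma>; m \<in> Mon C; m' \<in> Mon C;
       is_join C (Cod C b) (subobj C m) (subobj C m') (subobj C (Ident C (Cod C b)))\<rbrakk> \<Longrightarrow>
       \<exists>n\<in>\<Sigma>. \<exists>n'\<in>\<Sigma>. n \<in> Mon C \<and> n' \<in> Mon C \<and> Cod C n = Dom C b \<and> Cod C n' = Dom C b \<and>
         is_join C (Dom C b) (subobj C n) (subobj C n') (subobj C (Ident C (Dom C b))) \<and>
         below C (b \<cdot> n) (subobj C m) \<and> below C (b \<cdot> n') (subobj C m')"
    and frag_restrict: "\<lbrakk>m \<in> \<Sigma>; f \<in> \<Sigma>; m \<in> Mon C; Cod C m = Cod C f\<rbrakk> \<Longrightarrow>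
       \<exists>i\<in>\<Sigma>. \<exists>k\<in>\<Sigma>. i \<in> Mon C \<and> Cod C i = Dom C f \<and> k \<in> Hom C (Dom C i) (Dom C m) \<and> m \<cdot> k = f \<cdot> i \<and>
         (\<forall>g. factors_through C g i \<longleftrightarrow> g \<in> Arr C \<and> Cod C g = Dom C f \<and> factors_through C (f \<cdot> g) m)"
    and frag_quo: "\<lbrakk>q \<in> \<Sigma>; f \<in> \<Sigma>; h \<in> \<Sigma>; q \<in> Quo C; Cod C f = Cod C q; Cod C h = Dom C f\<rbrakk> \<Longrightarrow>
       \<exists>p1\<in>\<Sigma>. \<exists>p2\<in>\<Sigma>. \<exists>qZ\<in>\<Sigma>. \<exists>fX\<in>\<Sigma>. \<exists>m\<in>\<Sigma>. \<exists>e\<in>\<Sigma>. \<exists>t\<in>\<Sigma>. \<exists>y\<in>\<Sigma>. \<exists>h'\<in>\<Sigma>. quo_step C q f h p1 p2 qZ fX m e t y h'"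
    and frag_dia: "\<lbrakk>m \<in> \<Sigma>; m \<in> Mon C\<rbrakk> \<Longrightarrow> \<exists>d\<in>\<Sigma>. d \<in> Dia C (Cod C m) (subobj C m)"
    and frag_compl: "\<lbrakk>m \<in> \<Sigma>; m \<in> Mon C\<rbrakk> \<Longrightarrow> \<exists>n\<in>\<Sigma>. n \<in> Mon C \<and> is_compl C (Cod C m) (subobj C m) (subobj C n)"

lemma (in boolean_modal_category_with_quotients) fragment_exists:
  assumes "countable A" "A \<subseteq> Arr C"
  obtains \<Sigma> where "A \<subseteq> \<Sigma>" "fragment C \<Sigma>"
proof -
  \<comment> \<open>One clause for each closure condition, told apart by the number
    \<open>k\<close>. In clause 2 the two objects are coded by their identities and the equations by
    the concatenation of the lists of their known factors and of their right-hand sides.\<close>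
  define P where "P k xs ys \<longleftrightarrow> set ys \<subseteq> Arr C \<and>
    (k = 0 \<and> (\<exists>f g. xs = [f, g] \<and> ys = [g \<cdot> f]) \<or>
     k = 1 \<and> (\<exists>f. xs = [f] \<and> ys = [Ident C (Dom C f), Ident C (Cod C f)]) \<or>
     k = 2 \<and> (\<exists>Y L ls gs h. xs = Ident C Y # Ident C L # ls @ gs \<and> length ls = length gs \<and> ys = [h] \<and>
        Y \<in> Obj C \<and> L \<in> Obj C \<and> h \<in> Hom C Y L \<and> (\<forall>(l, g)\<in>set (zip ls gs). l \<cdot> h = g)) \<or>
     k = 3 \<and> (\<exists>m e. xs = [m \<cdot> e] \<and> ys = [m, e] \<and> m \<in> Mon C \<and> e \<in> Mperp C \<and> Dom C m = Cod C e) \<or>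
     k = 4 \<and> (\<exists>f g e. xs = [f, g] \<and> ys = [e] \<and> is_equalizer C f g e) \<or>
     k = 5 \<and> (\<exists>e b y c. xs = [e, b] \<and> ys = [y, c] \<and>
        y \<in> Mperp C \<and> Cod C y = Dom C b \<and> c \<in> Hom C (Dom C y) (Dom C e) \<and> e \<cdot> c = b \<cdot> y) \<or>
     k = 6 \<and> (\<exists>m m' b n n'. xs = [m, m', b] \<and> ys = [n, n'] \<and>
        n \<in> Mon C \<and> n' \<in> Mon C \<and> Cod C n = Dom C b \<and> Cod C n' = Dom C b \<and>
         is_join C (Dom C b) (subobj C n) (subobj C n') (subobj C (Ident C (Dom C b))) \<and>
         below C (b \<cdot> n) (subobj C m) \<and> below C (b \<cdot> n') (subobj C m')) \<or>
     k = 7 \<and> (\<exists>m f i j. xs = [m, f] \<and> ys = [i, j] \<and>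
        i \<in> Mon C \<and> Cod C i = Dom C f \<and> j \<in> Hom C (Dom C i) (Dom C m) \<and> m \<cdot> j = f \<cdot> i \<and>
         (\<forall>g. factors_through C g i \<longleftrightarrow> g \<in> Arr C \<and> Cod C g = Dom C f \<and> factors_through C (f \<cdot> g) m)) \<or>
     k = 8 \<and> (\<exists>q f h p1 p2 qZ fX m e t y h'. xs = [q, f, h] \<and> ys = [p1, p2, qZ, fX, m, e, t, y, h'] \<and>
        quo_step C q f h p1 p2 qZ fX m e t y h') \<or>
     k = 9 \<and> (\<exists>m d. xs = [m] \<and> ys = [d] \<and> d \<in> Dia C (Cod C m) (subobj C m)) \<or>
     k = 10 \<and> (\<exists>m n. xs = [m] \<and> ys = [n] \<and> n \<in> Mon C \<and> is_compl C (Cod C m) (subobj C m) (subobj C n)))"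
    for k :: nat and xs ys
  obtain B where B: "A \<subseteq> B" "B \<subseteq> Arr C" "countable B"
    and cl: "\<And>k xs ys. set xs \<subseteq> B \<Longrightarrow> P k xs ys \<Longrightarrow> \<exists>zs. set zs \<subseteq> B \<and> P k xs zs"
    by (rule countable_closure[OF assms, of P]) (auto simp: P_def)
  have "fragment C B"
  proof (unfold_locales; (rule B(2,3))?)
    fix f g assume "f \<in> B" "g \<in> B" "Dom C g = Cod C f"
    then show "g \<cdot> f \<in> B" using cl[of "[f, g]" 0 "[g \<cdot> f]"] B(2) by (auto simp: P_def subset_iff)
  next
    fix f assume "f \<in> B"
    then show "Ident C (Dom C f) \<in> B" "Ident C (Cod C f) \<in> B"
      using cl[of "[f]" 1 "[Ident C (Dom C f), Ident C (Cod C f)]"] B(2) by (auto simp: P_def subset_iff)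
  next
    fix ls gs Y L h
    assume a: "set ls \<subseteq> B" "set gs \<subseteq> B" "length ls = length gs" "Ident C Y \<in> B" "Ident C L \<in> B"
       "h \<in> Hom C Y L" "\<forall>(l, g)\<in>set (zip ls gs). l \<cdot> h = g"
    have inj: "X = X'" if "Ident C X = Ident C X'" "X \<in> Obj C" "X' \<in> Obj C" for X X'
      using that ident_arr(2) by metis
    have o: "Y \<in> Obj C" "L \<in> Obj C" using a(6) by (auto simp: Hom_iff)
    let ?xs = "Ident C Y # Ident C L # ls @ gs"
    have "P 2 ?xs [h]" unfolding P_def using a o by (auto simp: Hom_iff)
    then obtain zs where "set zs \<subseteq> B" "P 2 ?xs zs" using cl[of ?xs 2 "[h]"] a by auto
    then obtain Y' L' ls' gs' h' where z: "?xs = Ident C Y' # Ident C L' # ls' @ gs'" "length ls' = length gs'"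
      "h' \<in> B" "Y' \<in> Obj C" "L' \<in> Obj C" "h' \<in> Hom C Y' L'" "\<forall>(l, g)\<in>set (zip ls' gs'). l \<cdot> h' = g"
      unfolding P_def by auto
    \<comment> \<open>The decoded system is the given one: an identity determines its object, and
      equal lengths allow the concatenation to split in one way only.\<close>
    have YL: "Y' = Y" "L' = L" using z(1) inj[OF _ o(1) z(4)] inj[OF _ o(2) z(5)] by simp_all
    have ap: "ls @ gs = ls' @ gs'" using z(1) by simp
    then have "length ls + length gs = length ls' + length gs'" by (metis length_append)
    then have "ls' = ls \<and> gs' = gs" using a(3) z(2) ap by simp
    then show "\<exists>h'\<in>B. h' \<in> Hom C Y L \<and> (\<forall>(l, g)\<in>set (zip ls gs). l \<cdot> h' = g)"
      using z YL by blast
  next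
    fix f assume f: "f \<in> B"
    obtain m e where m: "m \<in> Mon C" "e \<in> Mperp C" "Dom C m = Cod C e" "m \<cdot> e = f"
      using im_factor[of f] f B(2) by blast
    then have "P 3 [f] [m, e]" by (auto simp: P_def)
    from cl[OF _ this] f show "\<exists>m\<in>B. \<exists>e\<in>B. m \<in> Mon C \<and> e \<in> Mperp C \<and> Dom C m = Cod C e \<and> m \<cdot> e = f"
      by (fastforce simp: P_def)
  next
    fix f g assume f: "f \<in> B" "g \<in> B" "Dom C g = Dom C f" "Cod C g = Cod C f"
    then have "f \<in> Arr C" "g \<in> Hom C (Dom C f) (Cod C f)" using B(2) by (auto simp: Hom_iff)
    then obtain e where e: "is_equalizer C f g e" using equalizer_exists[OF finite_limits] by blast
    then have "e \<in> Arr C" unfolding is_equalizer_def Hom_iff by blast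
    then have "P 4 [f, g] [e]" using e by (auto simp: P_def)
    from cl[OF _ this] f show "\<exists>e\<in>B. is_equalizer C f g e" by (fastforce simp: P_def)
  next
    fix e b assume f: "e \<in> B" "b \<in> B" "e \<in> Mperp C" "Cod C e = Cod C b"
    then have "b \<in> Arr C" using B(2) by auto
    from Mperp_step[OF f(3) this f(4)] obtain y c where yc: "y \<in> Mperp C" "Cod C y = Dom C b"
      "c \<in> Hom C (Dom C y) (Dom C e)" "e \<cdot> c = b \<cdot> y" by blast
    then have "P 5 [e, b] [y, c]" by (auto simp: P_def Hom_iff)
    from cl[OF _ this] f show "\<exists>y\<in>B. \<exists>c\<in>B. y \<in> Mperp C \<and> Cod C y = Dom C b \<and> c \<in> Hom C (Dom C y) (Dom C e) \<and> e \<cdot> c = b \<cdot> y"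
      by (fastforce simp: P_def)
  next
    fix m m' b assume f: "m \<in> B" "m' \<in> B" "b \<in> B" "m \<in> Mon C" "m' \<in> Mon C"
       "is_join C (Cod C b) (subobj C m) (subobj C m') (subobj C (Ident C (Cod C b)))"
    then have "b \<in> Arr C" using B(2) by auto
    from cover_step[OF f(4,5) this f(6)] obtain n n' where n: "n \<in> Mon C" "n' \<in> Mon C" "Cod C n = Dom C b" "Cod C n' = Dom C b"
         "is_join C (Dom C b) (subobj C n) (subobj C n') (subobj C (Ident C (Dom C b)))"
         "below C (b \<cdot> n) (subobj C m)" "below C (b \<cdot> n') (subobj C m')" by blast
    then have "P 6 [m, m', b] [n, n']" by (auto simp: P_def)
    from cl[OF _ this] f(1-3) obtain zs where "set zs \<subseteq> B" "P 6 [m, m', b] zs" by auto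
    then obtain n n' where "n \<in> B" "n' \<in> B" "n \<in> Mon C" "n' \<in> Mon C" "Cod C n = Dom C b" "Cod C n' = Dom C b"
         "is_join C (Dom C b) (subobj C n) (subobj C n') (subobj C (Ident C (Dom C b)))"
         "below C (b \<cdot> n) (subobj C m)" "below C (b \<cdot> n') (subobj C m')" unfolding P_def by auto
    then show "\<exists>n\<in>B. \<exists>n'\<in>B. n \<in> Mon C \<and> n' \<in> Mon C \<and> Cod C n = Dom C b \<and> Cod C n' = Dom C b \<and>
         is_join C (Dom C b) (subobj C n) (subobj C n') (subobj C (Ident C (Dom C b))) \<and>
         below C (b \<cdot> n) (subobj C m) \<and> below C (b \<cdot> n') (subobj C m')"
      by blast
  next
    fix m f assume f: "m \<in> B" "f \<in> B" "m \<in> Mon C" "Cod C m = Cod C f"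
    then have "f \<in> Arr C" using B(2) by auto
    from restrict_step[OF f(3) this f(4)] obtain i j where "i \<in> Mon C" "Cod C i = Dom C f" "j \<in> Hom C (Dom C i) (Dom C m)"
      "m \<cdot> j = f \<cdot> i" "\<forall>g. factors_through C g i \<longleftrightarrow> g \<in> Arr C \<and> Cod C g = Dom C f \<and> factors_through C (f \<cdot> g) m"
      by blast
    then have "P 7 [m, f] [i, j]" unfolding P_def by (auto simp: Hom_iff)
    from cl[OF _ this] f(1-3) obtain zs where "set zs \<subseteq> B" "P 7 [m, f] zs" by auto
    then obtain i j where "i \<in> B" "j \<in> B" "i \<in> Mon C" "Cod C i = Dom C f" "j \<in> Hom C (Dom C i) (Dom C m)"
      "m \<cdot> j = f \<cdot> i" "\<forall>g. factors_through C g i \<longleftrightarrow> g \<in> Arr C \<and> Cod C g = Dom C f \<and> factors_through C (f \<cdot> g) m"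
      unfolding P_def by auto
    then show "\<exists>i\<in>B. \<exists>k\<in>B. i \<in> Mon C \<and> Cod C i = Dom C f \<and> k \<in> Hom C (Dom C i) (Dom C m) \<and> m \<cdot> k = f \<cdot> i \<and>
         (\<forall>g. factors_through C g i \<longleftrightarrow> g \<in> Arr C \<and> Cod C g = Dom C f \<and> factors_through C (f \<cdot> g) m)"
      by blast
  next
    fix q f h assume f: "q \<in> B" "f \<in> B" "h \<in> B" "q \<in> Quo C" "Cod C f = Cod C q" "Cod C h = Dom C f"
    then have "f \<in> Arr C" "h \<in> Arr C" using B(2) by auto
    from quo_step_ex[OF f(4) this(1) f(5) this(2) f(6)] obtain p1 p2 qZ fX m e t y h'
      where s: "quo_step C q f h p1 p2 qZ fX m e t y h'" by blast
    then have "set [p1, p2, qZ, fX, m, e, t, y, h'] \<subseteq> Arr C"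
      unfolding quo_step_def Hom_iff using mon_arr Mperp_arr by simp
    then have "P 8 [q, f, h] [p1, p2, qZ, fX, m, e, t, y, h']" using s unfolding P_def by auto
    from cl[OF _ this] f(1-3) obtain zs where "set zs \<subseteq> B" "P 8 [q, f, h] zs" by auto
    then obtain p1 p2 qZ fX m e t y h' where "set [p1, p2, qZ, fX, m, e, t, y, h'] \<subseteq> B"
      "quo_step C q f h p1 p2 qZ fX m e t y h'" unfolding P_def by auto
    then show "\<exists>p1\<in>B. \<exists>p2\<in>B. \<exists>qZ\<in>B. \<exists>fX\<in>B. \<exists>m\<in>B. \<exists>e\<in>B. \<exists>t\<in>B. \<exists>y\<in>B. \<exists>h'\<in>B. quo_step C q f h p1 p2 qZ fX m e t y h'"
      unfolding set_simps insert_subset by blast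
  next
    fix m assume m: "m \<in> B" "m \<in> Mon C"
    have "Cod C m \<in> Obj C" using m by auto
    then have "Dia C (Cod C m) (subobj C m) \<in> carrier (Sub C (Cod C m))" using m by simp
    then obtain d where d: "d \<in> Dia C (Cod C m) (subobj C m)" "d \<in> Mon C" using Sub_ex Sub_mem(1) by metis
    then have "P 9 [m] [d]" by (auto simp: P_def)
    from cl[OF _ this] m show "\<exists>d\<in>B. d \<in> Dia C (Cod C m) (subobj C m)" by (fastforce simp: P_def)
  next
    fix m assume m: "m \<in> B" "m \<in> Mon C"
    have "Cod C m \<in> Obj C" "subobj C m \<in> carrier (Sub C (Cod C m))" using m by auto
    then obtain T where T: "is_compl C (Cod C m) (subobj C m) T" using compl_ex by blast
    then have "T \<in> carrier (Sub C (Cod C m))" by (simp add: is_compl_def is_join_def)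
    then obtain n where n: "n \<in> Mon C" "T = subobj C n" by (rule SubE)
    then have "P 10 [m] [n]" using T by (auto simp: P_def)
    from cl[OF _ this] m show "\<exists>n\<in>B. n \<in> Mon C \<and> is_compl C (Cod C m) (subobj C m) (subobj C n)" by (fastforce simp: P_def)
  qed
  with B(1) show ?thesis by (rule that)
qed

section \<open>Models as limits of towers\<close>

text \<open>A tower \<open>T\<close> is a sequence of objects \<open>Y\<^sub>n = Dom C (T n n)\<close> with compatible arrows
  \<open>T i j : Y\<^sub>j \<rightarrow> Y\<^sub>i\<close>. It presents the functor \<open>X \<mapsto> colim\<^sub>n Hom (Y\<^sub>n, X)\<close>, whose elements are
  represented by pairs \<open>(n, g)\<close> with \<open>g : Y\<^sub>n \<rightarrow> X\<close>.\<close>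

definition tower :: "('o, 'a, 'z) cat_scheme \<Rightarrow> 'a set \<Rightarrow> (nat \<Rightarrow> nat \<Rightarrow> 'a) \<Rightarrow> bool" where
  "tower C \<Sigma> T \<longleftrightarrow> (\<forall>i j. i \<le> j \<longrightarrow> T i j \<in> \<Sigma> \<and> Dom C (T i j) = Dom C (T j j) \<and> Cod C (T i j) = Dom C (T i i)) \<and>
     (\<forall>i. T i i = Ident C (Dom C (T i i))) \<and> (\<forall>i j k. i \<le> j \<and> j \<le> k \<longrightarrow> T i k = T i j \<cdot>\<^bsub>C\<^esub> T j k)"

text \<open>Meaningful only for \<open>j\<close> at or beyond \<open>fst p\<close>; later uses are
  guarded by this bound or hold eventually in \<open>j\<close>.\<close>

definition stage :: "('o, 'a, 'z) cat_scheme \<Rightarrow> (nat \<Rightarrow> nat \<Rightarrow> 'a) \<Rightarrow> nat \<times> 'a \<Rightarrow> nat \<Rightarrow> 'a" where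
  "stage C T p j = snd p \<cdot>\<^bsub>C\<^esub> T (fst p) j"

text \<open>Equality in the colimit. Agreement of two points at one late stage persists
  (\<open>peqI\<close>), so eventual agreement is the usual relation; as a filter statement it
  combines easily with other eventual facts.\<close>

definition peq :: "('o, 'a, 'z) cat_scheme \<Rightarrow> (nat \<Rightarrow> nat \<Rightarrow> 'a) \<Rightarrow> nat \<times> 'a \<Rightarrow> nat \<times> 'a \<Rightarrow> bool" where
  "peq C T p p' \<longleftrightarrow> (\<forall>\<^sub>F j in sequentially. stage C T p j = stage C T p' j)"

definition Sat :: "('o, 'a, 'z) cat_scheme \<Rightarrow> (nat \<Rightarrow> nat \<Rightarrow> 'a) \<Rightarrow> nat \<times> 'a \<Rightarrow> 'a set \<Rightarrow> bool" where
  "Sat C T p S \<longleftrightarrow> (\<forall>\<^sub>F j in sequentially. below C (stage C T p j) S)"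

definition act :: "('o, 'a, 'z) cat_scheme \<Rightarrow> 'a \<Rightarrow> nat \<times> 'a \<Rightarrow> nat \<times> 'a" where
  "act C f p = (fst p, f \<cdot>\<^bsub>C\<^esub> snd p)"

definition pnt :: "('o, 'a, 'z) cat_scheme \<Rightarrow> 'a set \<Rightarrow> (nat \<Rightarrow> nat \<Rightarrow> 'a) \<Rightarrow> 'o \<Rightarrow> nat \<times> 'a \<Rightarrow> bool" where
  "pnt C \<Sigma> T X p \<longleftrightarrow> snd p \<in> \<Sigma> \<and> Dom C (snd p) = Dom C (T (fst p) (fst p)) \<and> Cod C (snd p) = X"

text \<open>Left exactness is no clause: a tower is a filtered colimit of representables, and
  \<open>limit_lift\<close> and \<open>limit_mono\<close> hold for all towers. The clauses make the
  functor send \<open>Mperp\<close> arrows to surjections and covers to covers; the non-null stages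
  keep it empty on null objects.\<close>

definition model :: "('o, 'a, 'z) mcat_scheme \<Rightarrow> 'a set \<Rightarrow> (nat \<Rightarrow> nat \<Rightarrow> 'a) \<Rightarrow> bool" where
  "model C \<Sigma> T \<longleftrightarrow> tower C \<Sigma> T \<and>
     (\<forall>e\<in>\<Sigma>. e \<in> Mperp C \<longrightarrow> (\<forall>p. pnt C \<Sigma> T (Cod C e) p \<longrightarrow>
        (\<exists>p'. pnt C \<Sigma> T (Dom C e) p' \<and> peq C T (act C e p') p))) \<and>
     (\<forall>m\<in>\<Sigma>. \<forall>m'\<in>\<Sigma>. m \<in> Mon C \<and> m' \<in> Mon C \<and>
        is_join C (Cod C m) (subobj C m) (subobj C m') (subobj C (Ident C (Cod C m))) \<longrightarrow>
        (\<forall>p. pnt C \<Sigma> T (Cod C m) p \<longrightarrow> Sat C T p (subobj C m) \<or> Sat C T p (subobj C m'))) \<and>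
     (\<forall>n. \<not> null C (Dom C (T n n)))"

lemma peq_refl [simp]: "peq C T p p"
  by (simp add: peq_def)

lemma peq_sym: "peq C T p p' \<Longrightarrow> peq C T p' p"
  unfolding peq_def by (erule eventually_mono) simp

lemma peq_trans: "peq C T p p' \<Longrightarrow> peq C T p' p'' \<Longrightarrow> peq C T p p''"
  unfolding peq_def by (erule eventually_elim2) simp_all

lemma Sat_peq: "peq C T p p' \<Longrightarrow> Sat C T p S \<Longrightarrow> Sat C T p' S"
  unfolding peq_def Sat_def by (erule eventually_rev_mp, erule eventually_mono) simp

lemma fst_act [simp]: "fst (act C f p) = fst p"
  by (simp add: act_def)

context fragment
begin

lemma frag_arr: "f \<in> \<Sigma> \<Longrightarrow> f \<in> Arr C"
  using frag_sub by blast

lemma towerD: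
  assumes "tower C \<Sigma> T" "i \<le> j"
  shows "T i j \<in> \<Sigma>" "T i j \<in> Arr C" "Dom C (T i j) = Dom C (T j j)" "Cod C (T i j) = Dom C (T i i)"
  using assms frag_sub unfolding tower_def by blast+

lemma tower_comp: "tower C \<Sigma> T \<Longrightarrow> i \<le> j \<Longrightarrow> j \<le> k \<Longrightarrow> T i k = T i j \<cdot> T j k"
  unfolding tower_def by blast

lemma pntD:
  assumes "pnt C \<Sigma> T X p"
  shows "snd p \<in> \<Sigma>" "snd p \<in> Arr C" "Dom C (snd p) = Dom C (T (fst p) (fst p))" "Cod C (snd p) = X" "X \<in> Obj C"
  using assms frag_arr cod_obj unfolding pnt_def by blast+

lemma stage_in:
  assumes "tower C \<Sigma> T" "pnt C \<Sigma> T X p" "fst p \<le> j"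
  shows "stage C T p j \<in> \<Sigma>" "stage C T p j \<in> Arr C" "Dom C (stage C T p j) = Dom C (T j j)" "Cod C (stage C T p j) = X"
  using towerD[OF assms(1,3)] pntD[OF assms(2)] unfolding stage_def by (auto intro: frag_comp)

lemma stage_trans:
  assumes "tower C \<Sigma> T" "pnt C \<Sigma> T X p" "fst p \<le> j" "j \<le> k"
  shows "stage C T p k = stage C T p j \<cdot> T j k"
  using towerD[OF assms(1,3)] towerD[OF assms(1,4)] pntD[OF assms(2)] tower_comp[OF assms(1,3,4)]
  unfolding stage_def by simp

lemma stage_act:
  assumes "tower C \<Sigma> T" "pnt C \<Sigma> T X p" "fst p \<le> j" "f \<in> Arr C" "Dom C f = X"
  shows "stage C T (act C f p) j = f \<cdot> stage C T p j"
  using towerD[OF assms(1,3)] pntD[OF assms(2)] assms(4,5) by (simp add: stage_def act_def)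

lemma stage_pnt:
  assumes "tower C \<Sigma> T" "pnt C \<Sigma> T X p" "fst p \<le> j"
  shows "pnt C \<Sigma> T X (j, stage C T p j)"
  using stage_in[OF assms] by (simp add: pnt_def)

lemma stage_stage:
  assumes "tower C \<Sigma> T" "pnt C \<Sigma> T X p" "fst p \<le> j" "j \<le> k"
  shows "stage C T (j, stage C T p j) k = stage C T p k"
  using stage_trans[OF assms] by (simp add: stage_def[of C T "(j, stage C T p j)"])

lemma act_pnt:
  assumes "pnt C \<Sigma> T X p" "f \<in> \<Sigma>" "Dom C f = X"
  shows "pnt C \<Sigma> T (Cod C f) (act C f p)"
  using pntD[OF assms(1)] assms frag_arr[OF assms(2)] by (auto simp: pnt_def act_def intro: frag_comp)

lemma act_comp:
  assumes "pnt C \<Sigma> T X p" "f \<in> Arr C" "Dom C f = X" "g \<in> Arr C" "Dom C g = Cod C f"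
  shows "act C (g \<cdot> f) p = act C g (act C f p)"
  using pntD[OF assms(1)] assms by (simp add: act_def)

lemma act_ident: "pnt C \<Sigma> T X p \<Longrightarrow> act C (Ident C X) p = p"
  using pntD[of T X p] by (simp add: act_def prod_eq_iff)

lemma act_peq:
  assumes T: "tower C \<Sigma> T" and p: "pnt C \<Sigma> T X p" "pnt C \<Sigma> T X p'" "peq C T p p'" and f: "f \<in> Arr C" "Dom C f = X"
  shows "peq C T (act C f p) (act C f p')"
  using p(3) eventually_ge_at_top[of "max (fst p) (fst p')"] unfolding peq_def
  by eventually_elim (simp add: stage_act[OF T p(1) _ f] stage_act[OF T p(2) _ f])

lemma peqI:
  assumes "tower C \<Sigma> T" "pnt C \<Sigma> T X p" "pnt C \<Sigma> T X p'" "fst p \<le> j" "fst p' \<le> j" "stage C T p j = stage C T p' j"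
  shows "peq C T p p'"
  unfolding peq_def using eventually_ge_at_top[of j]
proof eventually_elim
  case (elim k)
  show ?case unfolding stage_trans[OF assms(1,2,4) elim] stage_trans[OF assms(1,3,5) elim] assms(6) ..
qed

lemma SatI:
  assumes "tower C \<Sigma> T" "pnt C \<Sigma> T X p" "fst p \<le> j" "below C (stage C T p j) S" "S \<in> carrier (Sub C X)"
  shows "Sat C T p S"
  unfolding Sat_def using eventually_ge_at_top[of j]
proof eventually_elim
  case (elim k)
  then show ?case using below_comp[OF assms(4,5), of "T j k"] towerD[OF assms(1) elim] stage_in[OF assms(1-3)]
    by (simp add: stage_trans[OF assms(1-3) elim])
qed

lemma SatE:
  assumes "Sat C T p S"
  obtains j where "n \<le> j" "below C (stage C T p j) S"
  using eventually_conj[OF assms[unfolded Sat_def] eventually_ge_at_top[of n]]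
  by (auto simp: eventually_sequentially)

lemma mon_peq:
  assumes T: "tower C \<Sigma> T" and m: "m \<in> Mon C" and p: "pnt C \<Sigma> T (Dom C m) p" "pnt C \<Sigma> T (Dom C m) p'"
    and eq: "peq C T (act C m p) (act C m p')"
  shows "peq C T p p'"
  using eq eventually_ge_at_top[of "max (fst p) (fst p')"] unfolding peq_def
proof eventually_elim
  case (elim j)
  then have j: "fst p \<le> j" "fst p' \<le> j" by auto
  then have "m \<cdot> stage C T p j = m \<cdot> stage C T p' j"
    using elim(1) m by (simp add: stage_act[OF T p(1)] stage_act[OF T p(2)])
  from mon_cancel[OF m this] show ?case using stage_in[OF T p(1) j(1)] stage_in[OF T p(2) j(2)] by simp
qed

text \<open>A solution \<open>h\<close> supplied by the category may lie outside
  \<open>\<Sigma>\<close>; \<open>frag_solve\<close> replaces it by one inside.\<close>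

lemma solve1:
  assumes "m \<in> \<Sigma>" "g \<in> \<Sigma>" "h \<in> Arr C" "Cod C h = Dom C m" "m \<cdot> h = g"
  shows "\<exists>h'\<in>\<Sigma>. Dom C h' = Dom C g \<and> Cod C h' = Dom C m \<and> m \<cdot> h' = g"
proof -
  have mA: "m \<in> Arr C" using frag_arr assms(1) by simp
  then have "h \<in> Hom C (Dom C g) (Dom C m)" using assms(3,4) unfolding assms(5)[symmetric] by (simp add: Hom_iff)
  then show ?thesis using frag_solve[of "[m]" "[g]" "Dom C g" "Dom C m" h] assms(1,2,5) frag_ident
    by (auto simp: Hom_iff)
qed

text \<open>A factorization through \<open>m\<close> at a single late stage, moved into
  \<open>\<Sigma>\<close>, already represents the preimage.\<close>

lemma Sat_lift:
  assumes T: "tower C \<Sigma> T" and m: "m \<in> Mon C" "m \<in> \<Sigma>" and p: "pnt C \<Sigma> T (Cod C m) p"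
    and S: "Sat C T p (subobj C m)"
  shows "\<exists>p'. pnt C \<Sigma> T (Dom C m) p' \<and> peq C T (act C m p') p"
proof -
  obtain j where j: "fst p \<le> j" "below C (stage C T p j) (subobj C m)" using SatE[OF S] .
  note a = stage_in[OF T p j(1)]
  have "factors_through C (stage C T p j) m" using j(2) m by (simp add: below_subobj)
  then obtain h where h: "h \<in> Arr C" "Cod C h = Dom C m" "m \<cdot> h = stage C T p j"
    using mon_arr[OF m(1)] by (rule factors_throughE)
  obtain h' where h': "h' \<in> \<Sigma>" "Dom C h' = Dom C (stage C T p j)" "Cod C h' = Dom C m" "m \<cdot> h' = stage C T p j"
    using solve1[OF m(2) a(1) h] by blast
  have q: "pnt C \<Sigma> T (Dom C m) (j, h')" using h' a by (simp add: pnt_def)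
  have "act C m (j, h') = (j, stage C T p j)" using h' by (simp add: act_def)
  moreover have "peq C T (j, stage C T p j) p"
    using stage_stage[OF T p j(1) order_refl] j(1) by (intro peqI[OF T stage_pnt[OF T p j(1)] p, of j]) simp_all
  ultimately show ?thesis using q by metis
qed

lemma Sat_act_mon:
  assumes T: "tower C \<Sigma> T" and m: "m \<in> Mon C" and p: "pnt C \<Sigma> T (Dom C m) p"
  shows "Sat C T (act C m p) (subobj C m)"
  unfolding Sat_def using eventually_ge_at_top[of "fst p"]
proof eventually_elim
  case (elim j)
  show ?case using stage_in[OF T p elim] m
    by (auto simp: stage_act[OF T p elim] below_subobj intro: factors_throughI)
qed

lemma Sat_act:
  assumes T: "tower C \<Sigma> T" and p: "pnt C \<Sigma> T X p" and f: "f \<in> Arr C" "Dom C f = X"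
    and S: "Sat C T p S" "\<And>g. below C g S \<Longrightarrow> below C (f \<cdot> g) S'"
  shows "Sat C T (act C f p) S'"
  using S(1) eventually_ge_at_top[of "fst p"] unfolding Sat_def
  by eventually_elim (simp add: stage_act[OF T p _ f] S(2))

text \<open>Finitely many compatibilities that hold eventually hold at one common stage
  \<open>j\<close>. There the representatives form a genuine cone with vertex
  \<open>Dom C (T j j)\<close>, and its mediating arrow, moved into \<open>\<Sigma>\<close>,
  represents the element sought.\<close>

lemma limit_lift:
  assumes T: "tower C \<Sigma> T" and J: "finite_diagram J C Do Da" and lim: "is_limit J C Do Da L l"
    and \<Sigma>: "Ident C L \<in> \<Sigma>" "\<And>i. i \<in> Obj J \<Longrightarrow> l i \<in> \<Sigma>"
    and z: "\<And>i. i \<in> Obj J \<Longrightarrow> pnt C \<Sigma> T (Do i) (z i)"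
    and eq: "\<And>u. u \<in> Arr J \<Longrightarrow> peq C T (act C (Da u) (z (Dom J u))) (z (Cod J u))"
  shows "\<exists>p. pnt C \<Sigma> T L p \<and> (\<forall>i\<in>Obj J. peq C T (act C (l i) p) (z i))"
proof -
  interpret F: category_functor J C Do Da using J by (simp add: finite_diagram_def)
  have fin: "finite (Obj J)" "finite (Arr J)" using J by (auto simp: finite_diagram_def)
  have "\<forall>\<^sub>F j in sequentially. (\<forall>i\<in>Obj J. fst (z i) \<le> j) \<and>
      (\<forall>u\<in>Arr J. stage C T (act C (Da u) (z (Dom J u))) j = stage C T (z (Cod J u)) j)"
    using eq fin by (intro eventually_conj eventually_ball_finite) (auto simp: eventually_ge_at_top peq_def)
  then obtain j where j: "\<And>i. i \<in> Obj J \<Longrightarrow> fst (z i) \<le> j"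
    "\<And>u. u \<in> Arr J \<Longrightarrow> stage C T (act C (Da u) (z (Dom J u))) j = stage C T (z (Cod J u)) j"
    by (auto simp: eventually_sequentially)
  define x where "x i = stage C T (z i) j" for i
  have x: "x i \<in> \<Sigma>" "x i \<in> Hom C (Dom C (T j j)) (Do i)" if "i \<in> Obj J" for i
    using stage_in[OF T z[OF that] j(1)[OF that]] by (auto simp: x_def Hom_iff)
  have TA: "T j j \<in> Arr C" "T j j \<in> \<Sigma>" using towerD[OF T, of j j] by auto
  have Da: "Da u \<in> Hom C (Do (Dom J u)) (Do (Cod J u))" "Dom J u \<in> Obj J" if "u \<in> Arr J" for u
    using F.map_hom[of u "Dom J u" "Cod J u"] that F.source.dom_obj by (auto simp: Hom_def)
  have "Da u \<cdot> x (Dom J u) = x (Cod J u)" if "u \<in> Arr J" for u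
    using j(2)[OF that] Da[OF that] unfolding x_def
    by (subst (asm) stage_act[OF T z]) (auto simp: Hom_iff j(1))
  then have "is_cone J C Do Da (Dom C (T j j)) x" using x TA unfolding is_cone_def by auto
  then obtain h where h: "h \<in> Hom C (Dom C (T j j)) L" "\<forall>i\<in>Obj J. l i \<cdot> h = x i"
    using lim unfolding is_limit_def by blast
  \<comment> \<open>\<open>frag_solve\<close> takes its equations as lists, so the finitely many
    nodes of the diagram are enumerated.\<close>
  obtain js where js: "set js = Obj J" using finite_list[OF fin(1)] by blast
  have zip: "set (zip (map l js) (map x js)) = (\<lambda>i. (l i, x i)) ` Obj J"
    unfolding js[symmetric] by (simp add: zip_map_map zip_same_conv_map)
  have "\<exists>h'\<in>\<Sigma>. h' \<in> Hom C (Dom C (T j j)) L \<and> (\<forall>(k, g)\<in>set (zip (map l js) (map x js)). k \<cdot> h' = g)"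
    using \<Sigma> x js h frag_ident[OF TA(2)] zip by (intro frag_solve[of _ _ _ _ h]) auto
  then obtain h' where h': "h' \<in> \<Sigma>" "h' \<in> Hom C (Dom C (T j j)) L" "\<forall>i\<in>Obj J. l i \<cdot> h' = x i"
    unfolding zip by auto
  have p: "pnt C \<Sigma> T L (j, h')" using h' by (simp add: pnt_def Hom_iff)
  have "peq C T (act C (l i) (j, h')) (z i)" if i: "i \<in> Obj J" for i
  proof (rule peq_trans)
    have "act C (l i) (j, h') = (j, stage C T (z i) j)" using h' i by (simp add: act_def x_def)
    then show "peq C T (act C (l i) (j, h')) (j, stage C T (z i) j)" by simp
    show "peq C T (j, stage C T (z i) j) (z i)"
      using stage_stage[OF T z[OF i] j(1)[OF i] order_refl] j(1)[OF i]
      by (intro peqI[OF T stage_pnt[OF T z[OF i] j(1)[OF i]] z[OF i], of j]) simp_all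
  qed
  then show ?thesis using p by blast
qed

text \<open>At a stage where all components agree, both elements are mediating arrows of the same
  cone.\<close>

lemma limit_mono:
  assumes T: "tower C \<Sigma> T" and J: "finite_diagram J C Do Da" and lim: "is_limit J C Do Da L l"
    and z: "pnt C \<Sigma> T L p" "pnt C \<Sigma> T L p'" "\<And>i. i \<in> Obj J \<Longrightarrow> peq C T (act C (l i) p) (act C (l i) p')"
  shows "peq C T p p'"
proof -
  interpret F: category_functor J C Do Da using J by (simp add: finite_diagram_def)
  have fin: "finite (Obj J)" using J by (auto simp: finite_diagram_def)
  have l: "l i \<in> Hom C L (Do i)" if "i \<in> Obj J" for i using lim that by (auto simp: is_limit_def is_cone_def)
  have lc: "Da u \<cdot> l (Dom J u) = l (Cod J u)" if "u \<in> Arr J" for u using lim that by (auto simp: is_limit_def is_cone_def)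
  have Da: "Da u \<in> Hom C (Do (Dom J u)) (Do (Cod J u))" "Dom J u \<in> Obj J" "Cod J u \<in> Obj J" if "u \<in> Arr J" for u
    using F.map_hom[of u "Dom J u" "Cod J u"] that F.source.dom_obj F.source.cod_obj by (auto simp: Hom_def)
  have "\<forall>\<^sub>F j in sequentially. (\<forall>i\<in>Obj J. stage C T (act C (l i) p) j = stage C T (act C (l i) p') j)"
    using z(3) fin by (intro eventually_ball_finite) (auto simp: peq_def)
  then show ?thesis using eventually_ge_at_top[of "max (fst p) (fst p')"] unfolding peq_def
  proof eventually_elim
    case (elim j)
    then have j: "fst p \<le> j" "fst p' \<le> j" by auto
    note a = stage_in[OF T z(1) j(1)] and a' = stage_in[OF T z(2) j(2)]
    have *: "l i \<cdot> stage C T p j = l i \<cdot> stage C T p' j" if "i \<in> Obj J" for i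
      using elim(1) l[OF that] that stage_act[OF T z(1) j(1), of "l i"] stage_act[OF T z(2) j(2), of "l i"] by (simp add: Hom_iff)
    have "Da u \<cdot> (l (Dom J u) \<cdot> stage C T p j) = l (Cod J u) \<cdot> stage C T p j" if "u \<in> Arr J" for u
      using comp_reduce[OF lc[OF that], of "stage C T p j"] a Da[OF that] l by (simp add: Hom_iff)
    then have "is_cone J C Do Da (Dom C (T j j)) (\<lambda>i. l i \<cdot> stage C T p j)"
      using a l towerD(2)[OF T, of j j] unfolding is_cone_def by (auto simp: Hom_iff)
    then have "\<exists>!h. h \<in> Hom C (Dom C (T j j)) L \<and> (\<forall>i\<in>Obj J. l i \<cdot> h = l i \<cdot> stage C T p j)"
      using lim unfolding is_limit_def by blast
    moreover have "stage C T p j \<in> Hom C (Dom C (T j j)) L" "stage C T p' j \<in> Hom C (Dom C (T j j)) L"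
      using a a' by (simp_all add: Hom_iff)
    ultimately show ?case using * by metis
  qed
qed

lemma modelD:
  assumes "model C \<Sigma> T"
  shows "tower C \<Sigma> T"
    "\<lbrakk>e \<in> \<Sigma>; e \<in> Mperp C; pnt C \<Sigma> T (Cod C e) p\<rbrakk> \<Longrightarrow> \<exists>p'. pnt C \<Sigma> T (Dom C e) p' \<and> peq C T (act C e p') p"
    "\<lbrakk>m \<in> \<Sigma>; m' \<in> \<Sigma>; m \<in> Mon C; m' \<in> Mon C; pnt C \<Sigma> T (Cod C m) p;
       is_join C (Cod C m) (subobj C m) (subobj C m') (subobj C (Ident C (Cod C m)))\<rbrakk> \<Longrightarrow>
       Sat C T p (subobj C m) \<or> Sat C T p (subobj C m')"
    "\<not> null C (Dom C (T n n))"
  using assms unfolding model_def by blast+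

text \<open>Models decide covers by definition. An arbitrary join is reduced to the cover by
  \<open>m\<close> and its complement \<open>n\<close>: if the model decides for \<open>n\<close>,
  then \<open>join_split\<close> pushes the element into \<open>S\<close>.\<close>

lemma Sat_join:
  assumes M: "model C \<Sigma> T" and j: "is_join C X (subobj C m) S L" and m: "m \<in> Mon C" "m \<in> \<Sigma>"
    and p: "pnt C \<Sigma> T X p" and L: "Sat C T p L"
  shows "Sat C T p (subobj C m) \<or> Sat C T p S"
proof -
  have X: "Cod C m = X" using Sub_mem(2)[of "subobj C m" X m] j m(1) by (simp add: is_join_def)
  obtain n where n: "n \<in> \<Sigma>" "n \<in> Mon C" "is_compl C X (subobj C m) (subobj C n)"
    using frag_compl[OF m(2,1)] X by blast
  have "Sat C T p (subobj C m) \<or> Sat C T p (subobj C n)"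
    using modelD(3)[OF M m(2) n(1) m(1) n(2)] p n(3) X by (simp add: is_compl_def)
  moreover have "Sat C T p S" if "Sat C T p (subobj C n)"
    using that L unfolding Sat_def by eventually_elim (rule join_split[OF j n(3)])
  ultimately show ?thesis by blast
qed

text \<open>Otherwise a stage of \<open>T\<close> would map into \<open>Dia\<close> of an empty join
  and thus be null.\<close>

lemma Sat_dia_not_null:
  assumes M: "model C \<Sigma> T" and p: "pnt C \<Sigma> T X p" and h: "h \<in> Arr C" "Cod C h = X"
    and S: "Sat C T p (Dia C X (im C h))"
  shows "\<not> null C (Dom C h)"
proof
  assume n: "null C (Dom C h)"
  obtain j where j: "fst p \<le> j" "below C (stage C T p j) (Dia C X (im C h))" using SatE[OF S] .
  show False using dia_null[OF h n j(2)] stage_in[OF modelD(1)[OF M] p j(1)] modelD(4)[OF M] by simp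
qed

text \<open>\<open>im C h\<close> is the join of the images of its two parts and \<open>Dia\<close>
  preserves this join, so the model chooses one of them. \<open>Sat_join\<close> wants a
  representative in \<open>\<Sigma>\<close> for one side; it is obtained by factoring
  \<open>h . m\<close> and then representing \<open>Dia\<close> of its image.\<close>

lemma Sat_dia_split:
  assumes M: "model C \<Sigma> T" and p: "pnt C \<Sigma> T X p" and h: "h \<in> \<Sigma>" "Cod C h = X"
    and m: "m \<in> \<Sigma>" "m \<in> Mon C" "n \<in> Mon C" 
      "is_join C (Dom C h) (subobj C m) (subobj C n) (subobj C (Ident C (Dom C h)))"
    and S: "Sat C T p (Dia C X (im C h))"
  shows "Sat C T p (Dia C X (im C (h \<cdot> m))) \<or> Sat C T p (Dia C X (im C (h \<cdot> n)))"
proof -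
  have hA: "h \<in> Arr C" using frag_arr h by simp
  have X: "X \<in> Obj C" using hA h by auto
  have mc: "Cod C m = Dom C h" using Sub_mem(2)[of "subobj C m" "Dom C h" m] m by (simp add: is_join_def)
  have "h \<cdot> m \<in> \<Sigma>" using frag_comp[OF m(1) h(1)] mc by simp
  then obtain i e where i: "i \<in> \<Sigma>" "i \<in> Mon C" "e \<in> Mperp C" "Dom C i = Cod C e" "i \<cdot> e = h \<cdot> m"
    using frag_factor by blast
  have "Cod C (i \<cdot> e) = X" unfolding i(5) using hA h(2) m(2) mc by simp
  then have iX: "Cod C i = X" using comp_arr(3)[of e i] i(2-4) by simp
  obtain d where d: "d \<in> \<Sigma>" "d \<in> Dia C X (subobj C i)" using frag_dia[OF i(1,2)] iX by blast
  have "im C (h \<cdot> m) = subobj C i" using im_eq[OF i(2,3,4)] i(5) by simp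
  moreover have "Dia C X (subobj C i) \<in> carrier (Sub C X)" using i(2) iX X by simp
  ultimately have d': "Dia C X (im C (h \<cdot> m)) = subobj C d" "d \<in> Mon C" using Sub_mem d(2) by auto
  have "is_join C X (im C (h \<cdot> m)) (im C (h \<cdot> n)) (im C h)"
    using join_of_im[OF hA h(2) refl m(4)] m by simp
  from dia_join[OF this X] Sat_join[OF M _ d'(2) d(1) p S] show ?thesis unfolding d'(1) by blast
qed

end

section \<open>Existence of models and of modal relations between them\<close>

text \<open>In a task \<open>(k, m, m', b)\<close> the number \<open>k\<close> is the kind of requirement: lifting along \<open>m\<close> in \<open>\<M>\<^sup>\<bottom>\<close> (1), deciding a
  cover (2), and for relations also restriction to \<open>\<M>\<close>-subobjects (4) and lifting along quotients (5).\<close>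

definition task :: "('o, 'a, 'z) mcat_scheme \<Rightarrow> 'a set \<Rightarrow> nat \<times> 'a \<times> 'a \<times> 'a \<Rightarrow> 'o \<Rightarrow> 'a \<Rightarrow> 'o \<Rightarrow> bool" where
  "task C \<Sigma> t Y r Y' \<longleftrightarrow> (case t of (k, m, m', b) \<Rightarrow>
     (k = 1 \<longrightarrow> m \<in> Mperp C \<longrightarrow> Cod C b = Cod C m \<longrightarrow> Dom C b = Y \<longrightarrow>
        (\<exists>c\<in>\<Sigma>. Dom C c = Y' \<and> Cod C c = Dom C m \<and> m \<cdot>\<^bsub>C\<^esub> c = b \<cdot>\<^bsub>C\<^esub> r)) \<and>
     (k = 2 \<longrightarrow> m \<in> Mon C \<longrightarrow> m' \<in> Mon C \<longrightarrow> Dom C b = Y \<longrightarrow>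
        is_join C (Cod C b) (subobj C m) (subobj C m') (subobj C (Ident C (Cod C b))) \<longrightarrow>
        below C (b \<cdot>\<^bsub>C\<^esub> r) (subobj C m) \<or> below C (b \<cdot>\<^bsub>C\<^esub> r) (subobj C m')))"

context fragment
begin

definition tasks :: "(nat \<times> 'a \<times> 'a \<times> 'a) set" where
  "tasks = UNIV \<times> \<Sigma> \<times> \<Sigma> \<times> \<Sigma>"

lemma countable_tasks: "countable tasks"
  unfolding tasks_def using frag_countable by simp

text \<open>Shared by models and relations: \<open>good y\<close> abstracts that refining along
  \<open>y\<close> keeps a condition consistent. A task is met by pulling the lifting problem or the
  cover back along \<open>b . r\<close>; a task that does not apply is met by the identity, hence
  the assumption on \<open>Ident C Y'\<close>.\<close>

lemma task_dense:
  assumes r: "r \<in> \<Sigma>" "Dom C r = Y'" "Cod C r = Y" and t: "t \<in> tasks"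
    and g1: "\<And>y. \<lbrakk>y \<in> \<Sigma>; y \<in> Mperp C; Cod C y = Y'\<rbrakk> \<Longrightarrow> good y"
    and g2: "\<And>n n'. \<lbrakk>n \<in> \<Sigma>; n' \<in> \<Sigma>; n \<in> Mon C; n' \<in> Mon C; Cod C n = Y'; Cod C n' = Y';
       is_join C Y' (subobj C n) (subobj C n') (subobj C (Ident C Y'))\<rbrakk> \<Longrightarrow> good n \<or> good n'"
    and g3: "good (Ident C Y')"
  obtains y where "y \<in> \<Sigma>" "Cod C y = Y'" "good y" "task C \<Sigma> t Y (r \<cdot> y) (Dom C y)"
proof -
  obtain k m m' b where t': "t = (k, m, m', b)" "m \<in> \<Sigma>" "m' \<in> \<Sigma>" "b \<in> \<Sigma>" using t by (auto simp: tasks_def)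
  have A: "r \<in> Arr C" "b \<in> Arr C" using r t' frag_arr by auto
  have I: "Ident C Y' \<in> \<Sigma>" "Y' \<in> Obj C" using frag_ident(1)[OF r(1)] r A by auto
  consider "k = 1" "m \<in> Mperp C" "Cod C b = Cod C m" "Dom C b = Y"
    | "k = 2" "m \<in> Mon C" "m' \<in> Mon C" "Dom C b = Y"
      "is_join C (Cod C b) (subobj C m) (subobj C m') (subobj C (Ident C (Cod C b)))"
    | "task C \<Sigma> t Y (r \<cdot> Ident C Y') Y'"
    unfolding t' task_def by auto
  then show ?thesis
  proof cases
    case 1
    have br: "b \<cdot> r \<in> \<Sigma>" "Cod C (b \<cdot> r) = Cod C m" "Dom C (b \<cdot> r) = Y'" using A r t' 1 frag_comp by auto
    obtain y c where y: "y \<in> \<Sigma>" "c \<in> \<Sigma>" "y \<in> Mperp C" "Cod C y = Y'" "c \<in> Hom C (Dom C y) (Dom C m)" "m \<cdot> c = (b \<cdot> r) \<cdot> y"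
      using frag_Mperp[OF t'(2) br(1) 1(2)] br by auto
    have "(b \<cdot> r) \<cdot> y = b \<cdot> (r \<cdot> y)" using y r A 1 frag_arr[OF y(1)] by (intro assoc) auto
    then have "task C \<Sigma> t Y (r \<cdot> y) (Dom C y)" using y 1 unfolding t' task_def by (auto simp: Hom_iff)
    then show ?thesis using that y g1 by blast
  next
    case 2
    have br: "b \<cdot> r \<in> \<Sigma>" "Cod C (b \<cdot> r) = Cod C b" "Dom C (b \<cdot> r) = Y'" using A r t' 2 frag_comp by auto
    obtain n n' where n: "n \<in> \<Sigma>" "n' \<in> \<Sigma>" "n \<in> Mon C" "n' \<in> Mon C" "Cod C n = Y'" "Cod C n' = Y'"
      "is_join C Y' (subobj C n) (subobj C n') (subobj C (Ident C Y'))"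
      "below C ((b \<cdot> r) \<cdot> n) (subobj C m)" "below C ((b \<cdot> r) \<cdot> n') (subobj C m')"
      using frag_cover[OF t'(2,3) br(1) 2(2,3)] 2(5) unfolding br(2,3) by blast
    have "(b \<cdot> r) \<cdot> n = b \<cdot> (r \<cdot> n)" using n(5) r A 2(4) frag_arr[OF n(1)] by (intro assoc) auto
    moreover have "(b \<cdot> r) \<cdot> n' = b \<cdot> (r \<cdot> n')" using n(6) r A 2(4) frag_arr[OF n(2)] by (intro assoc) auto
    ultimately have "task C \<Sigma> t Y (r \<cdot> n) (Dom C n)" "task C \<Sigma> t Y (r \<cdot> n') (Dom C n')"
      using n(8,9) 2(1) unfolding t' task_def by auto
    then show ?thesis using that n g2[OF n(1-7)] by blast
  next
    case 3
    then show ?thesis using that[of "Ident C Y'"] I g3 by simp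
  qed
qed

text \<open>The representative of an element is an arrow out of some \<open>Dom C (T i i)\<close>,
  so a requirement on elements becomes a task for the condition \<open>i\<close> with this arrow as
  its last entry.\<close>

lemma model_of_tasks:
  assumes T: "tower C \<Sigma> T" and nn: "\<And>n. \<not> null C (Dom C (T n n))"
    and tk: "\<And>t i. t \<in> tasks \<Longrightarrow> \<exists>n\<ge>i. task C \<Sigma> t (Dom C (T i i)) (T i n) (Dom C (T n n))"
  shows "model C \<Sigma> T"
  unfolding model_def
proof (intro conjI ballI impI allI)
  fix e p assume e: "e \<in> \<Sigma>" "e \<in> Mperp C" and p: "pnt C \<Sigma> T (Cod C e) p"
  have "(1, e, e, snd p) \<in> tasks" using e pntD(1)[OF p] by (simp add: tasks_def)
  from tk[OF this, of "fst p"] obtain n where n: "fst p \<le> n" "task C \<Sigma> (1, e, e, snd p) (Dom C (T (fst p) (fst p))) (T (fst p) n) (Dom C (T n n))" by blast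
  then obtain c where c: "c \<in> \<Sigma>" "Dom C c = Dom C (T n n)" "Cod C c = Dom C e" "e \<cdot> c = stage C T p n"
    using e pntD(3,4)[OF p] unfolding task_def stage_def by auto
  have "act C e (n, c) = (n, stage C T p n)" using c by (simp add: act_def)
  moreover have "peq C T (n, stage C T p n) p"
    using stage_stage[OF T p n(1) order_refl] n(1) by (intro peqI[OF T stage_pnt[OF T p n(1)] p, of n]) simp_all
  ultimately show "\<exists>p'. pnt C \<Sigma> T (Dom C e) p' \<and> peq C T (act C e p') p"
    using c by (intro exI[of _ "(n, c)"]) (simp add: pnt_def)
next
  fix m m' p assume m: "m \<in> \<Sigma>" "m' \<in> \<Sigma>" and m': "m \<in> Mon C \<and> m' \<in> Mon C \<and>
    is_join C (Cod C m) (subobj C m) (subobj C m') (subobj C (Ident C (Cod C m)))" and p: "pnt C \<Sigma> T (Cod C m) p"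
  have "(2, m, m', snd p) \<in> tasks" using m pntD(1)[OF p] by (simp add: tasks_def)
  from tk[OF this, of "fst p"] obtain n where n: "fst p \<le> n" "task C \<Sigma> (2, m, m', snd p) (Dom C (T (fst p) (fst p))) (T (fst p) n) (Dom C (T n n))" by blast
  then have "below C (stage C T p n) (subobj C m) \<or> below C (stage C T p n) (subobj C m')"
    using m' pntD(3,4)[OF p] unfolding task_def stage_def by simp
  then show "Sat C T p (subobj C m) \<or> Sat C T p (subobj C m')"
    using SatI[OF T p n(1)] m' unfolding is_join_def by blast
qed (use T nn in auto)

lemma null_Mperp:
  assumes "y \<in> Mperp C" "null C (Dom C y)"
  shows "null C (Cod C y)"
  unfolding null_def
proof
  fix S assume S: "S \<in> carrier (Sub C (Cod C y))"
  have "below C y S" using null_below[of y S] assms S by simp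
  then show "below C (Ident C (Cod C y)) S" using below_Mperp[of "Ident C (Cod C y)" y S "Cod C y"] S assms by simp
qed

text \<open>Conditions are the non-null objects of the fragment, refined by arrows into them. The
  domain of an \<open>Mperp\<close> arrow into a non-null object is non-null by orthogonality. If
  both parts of a cover had null domains, every subobject would contain both parts and hence
  everything, so one part can always be kept.\<close>

lemma model_exists:
  assumes Y: "Ident C Y \<in> \<Sigma>" "Y \<in> Obj C" "\<not> null C Y"
  obtains T where "model C \<Sigma> T" "Dom C (T 0 0) = Y"
proof -
  let ?V = "\<lambda>Y. Ident C Y \<in> \<Sigma> \<and> Y \<in> Obj C \<and> \<not> null C Y"
  let ?R = "\<lambda>Y y Y'. y \<in> \<Sigma> \<and> Dom C y = Y' \<and> Cod C y = Y"
  have dense: "\<exists>c'' r'. ?V c'' \<and> ?R c' r' c'' \<and> task C \<Sigma> t c (r \<cdot> r') c''"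
    if V: "?V c" "?V c'" and R: "?R c r c'" and t: "t \<in> tasks" for c r c' t
  proof -
    have g2: "\<not> null C (Dom C n) \<or> \<not> null C (Dom C n')"
      if n: "n \<in> \<Sigma>" "n' \<in> \<Sigma>" "n \<in> Mon C" "n' \<in> Mon C" "Cod C n = c'" "Cod C n' = c'"
       and j: "is_join C c' (subobj C n) (subobj C n') (subobj C (Ident C c'))" for n n'
    proof (rule ccontr)
      assume "\<not> ?thesis"
      then have nn: "null C (Dom C n)" "null C (Dom C n')" by auto
      have "below C (Ident C c') S" if S: "S \<in> carrier (Sub C c')" for S
      proof -
        have "below C n S" "below C n' S" using null_below[of n S] null_below[of n' S] nn n S by auto
        then have "subobj C n \<sqsubseteq>\<^bsub>Sub C c'\<^esub> S" "subobj C n' \<sqsubseteq>\<^bsub>Sub C c'\<^esub> S"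
          using Sub_le_mem[OF _ S subobj_self] n by simp_all
        then have "subobj C (Ident C c') \<sqsubseteq>\<^bsub>Sub C c'\<^esub> S" using j S unfolding is_join_def by blast
        then show ?thesis using Sub_le_mem[OF _ S subobj_self] V by simp
      qed
      then show False using V by (simp add: null_def)
    qed
    obtain y where y: "y \<in> \<Sigma>" "Cod C y = c'" "\<not> null C (Dom C y)" "task C \<Sigma> t c (r \<cdot> y) (Dom C y)"
    proof (rule task_dense[of r c' c t "\<lambda>y. \<not> null C (Dom C y)"])
      show "\<not> null C (Dom C y)" if "y \<in> Mperp C" "Cod C y = c'" for y
        using null_Mperp[OF that(1)] that(2) V(2) by blast
      show "\<not> null C (Dom C (Ident C c'))" using V by simp
    qed (use R t g2 in blast)+
    then have "?V (Dom C y)" using frag_ident(1) frag_arr by auto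
    then show ?thesis using y by blast
  qed
  have A: "tasks \<noteq> {}" using Y(1) by (auto simp: tasks_def)
  have "\<exists>c T. c 0 = Y \<and> generic_run ?V ?R (Ident C) (\<cdot>) tasks (task C \<Sigma>) c T"
  proof (rule generic_sequence)
    show "?V Y" using Y by simp
    show "?R c r c' \<Longrightarrow> ?R c' r' c'' \<Longrightarrow> ?R c (r \<cdot> r') c''" for c r c' r' c''
      using frag_comp[of r' r] frag_arr by auto
    show "?R c r c' \<Longrightarrow> ?R c' r' c'' \<Longrightarrow> ?R c'' r'' c''' \<Longrightarrow> (r \<cdot> r') \<cdot> r'' = r \<cdot> (r' \<cdot> r'')" for c r c' r' c'' r'' c'''
      using frag_arr by (intro assoc) auto
    show "?V c \<Longrightarrow> ?R c (Ident C c) c" for c by simp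
    show "?R c r c' \<Longrightarrow> r \<cdot> Ident C c' = r" "?R c r c' \<Longrightarrow> Ident C c \<cdot> r = r" for c r c'
      using frag_arr by auto
    show "\<exists>c'' r'. ?V c'' \<and> ?R c' r' c'' \<and> task C \<Sigma> t c (r \<cdot> r') c''"
      if "?V c" "?V c'" "?R c r c'" "t \<in> tasks" for c r c' t
      using that by (rule dense)
  qed (fact countable_tasks, fact A)
  then obtain c T where c: "c 0 = Y" and g: "generic_run ?V ?R (Ident C) (\<cdot>) tasks (task C \<Sigma>) c T" by blast
  note V = generic_runD(1)[OF g] and R = generic_runD(2)[OF g] and T = generic_runD(3,4)[OF g] and tk = generic_runD(5)[OF g]
  have D: "Dom C (T i i) = c i" for i using R[of i i] by simp
  have "tower C \<Sigma> T" unfolding tower_def D using R T by blast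
  then have "model C \<Sigma> T"
    by (rule model_of_tasks) (use V tk D in \<open>auto, blast\<close>)
  then show ?thesis using that D[of 0] c by simp
qed

end

text \<open>A pair of sequences \<open>a\<close>, \<open>h\<close>, where \<open>a n\<close> is an element of \<open>X\<^sub>n = Cod C (h n)\<close> in the model \<open>T\<close> and
  \<open>h n : Y\<^sub>n \<rightarrow> X\<^sub>n\<close> with \<open>Y\<^sub>n\<close> the tower of \<open>T'\<close>, presents a relation between the models \<open>T\<close> and \<open>T'\<close>.\<close>

definition rl :: "('o, 'a, 'z) cat_scheme \<Rightarrow> 'a set \<Rightarrow> (nat \<Rightarrow> nat \<Rightarrow> 'a) \<Rightarrow> (nat \<Rightarrow> nat \<Rightarrow> 'a) \<Rightarrow> (nat \<Rightarrow> nat \<times> 'a) \<times> (nat \<Rightarrow> 'a)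
    \<Rightarrow> 'o \<Rightarrow> nat \<times> 'a \<Rightarrow> nat \<times> 'a \<Rightarrow> bool" where
  "rl C \<Sigma> T T' \<kappa> X p p' \<longleftrightarrow> (\<exists>n. \<exists>f\<in>\<Sigma>. Dom C f = Cod C (snd \<kappa> n) \<and> Cod C f = X \<and>
     peq C T p (act C f (fst \<kappa> n)) \<and> peq C T' p' (n, f \<cdot>\<^bsub>C\<^esub> snd \<kappa> n))"

text \<open>Closure under the action of arrows is no clause, since \<open>rl\<close> has it by
  construction: the parameter \<open>f\<close> is composed with the arrow. The modality clause gives
  one half of the equation for \<open>Dia\<close>; the other half is the existence statement
  \<open>edge_exists\<close>. The limit clause is confined to diagrams inside
  \<open>\<Sigma>\<close>, because its proof forms equalizers from arrows of the diagram within the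
  fragment.\<close>

definition edge :: "('o, 'a, 'z) modal_quot_cat_scheme \<Rightarrow> 'a set \<Rightarrow> (nat \<Rightarrow> nat \<Rightarrow> 'a) \<Rightarrow> (nat \<Rightarrow> nat \<Rightarrow> 'a) \<Rightarrow>
    (nat \<Rightarrow> nat \<times> 'a) \<times> (nat \<Rightarrow> 'a) \<Rightarrow> bool" where
  "edge C \<Sigma> T T' \<kappa> \<longleftrightarrow> (\<forall>n. pnt C \<Sigma> T (Cod C (snd \<kappa> n)) (fst \<kappa> n)) \<and>
     (\<forall>n. snd \<kappa> n \<in> \<Sigma> \<and> Dom C (snd \<kappa> n) = Dom C (T' n n)) \<and>
     (\<forall>X p p' S. rl C \<Sigma> T T' \<kappa> X p p' \<and> S \<in> carrier (Sub C X) \<and> Sat C T' p' S \<longrightarrow> Sat C T p (Dia C X S)) \<and>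
     (\<forall>m\<in>\<Sigma>. \<forall>p p'. m \<in> Mon C \<and> pnt C \<Sigma> T (Dom C m) p \<and> pnt C \<Sigma> T' (Dom C m) p' \<and>
        rl C \<Sigma> T T' \<kappa> (Cod C m) (act C m p) (act C m p') \<longrightarrow> rl C \<Sigma> T T' \<kappa> (Dom C m) p p') \<and>
     (\<forall>q\<in>\<Sigma>. \<forall>p p'. q \<in> Quo C \<and> rl C \<Sigma> T T' \<kappa> (Cod C q) p p' \<longrightarrow>
        (\<exists>s s'. pnt C \<Sigma> T (Dom C q) s \<and> pnt C \<Sigma> T' (Dom C q) s' \<and> rl C \<Sigma> T T' \<kappa> (Dom C q) s s' \<and>
           peq C T (act C q s) p \<and> peq C T' (act C q s') p')) \<and>
     (\<forall>J Do Da L l p p'. finite_diagram J C Do Da \<and> is_limit J C Do Da L l \<and> Da ` Arr J \<subseteq> \<Sigma> \<and> l ` Obj J \<subseteq> \<Sigma> \<and>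
        Ident C L \<in> \<Sigma> \<and> pnt C \<Sigma> T L p \<and> pnt C \<Sigma> T' L p' \<and>
        (\<forall>i\<in>Obj J. rl C \<Sigma> T T' \<kappa> (Do i) (act C (l i) p) (act C (l i) p')) \<longrightarrow> rl C \<Sigma> T T' \<kappa> L p p')"

lemma rl_peq: "rl C \<Sigma> T T' \<kappa> X p p' \<Longrightarrow> peq C T p q \<Longrightarrow> peq C T' p' q' \<Longrightarrow> rl C \<Sigma> T T' \<kappa> X q q'"
  unfolding rl_def by (meson peq_sym peq_trans)

section \<open>Generic construction of relations between models\<close>

context fragment
begin

text \<open>A condition is a single pair \<open>(a, h)\<close>, refined by \<open>(x, y)\<close> to \<open>(a', h')\<close> if \<open>x a' = a\<close> and \<open>x h' = h y\<close>.\<close>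

definition ref :: "(nat \<Rightarrow> nat \<Rightarrow> 'a) \<Rightarrow> (nat \<times> 'a) \<times> 'a \<Rightarrow> 'a \<times> 'a \<Rightarrow> (nat \<times> 'a) \<times> 'a \<Rightarrow> bool" where
  "ref T c r c' \<longleftrightarrow> snd c \<in> \<Sigma> \<and> snd c' \<in> \<Sigma> \<and> pnt C \<Sigma> T (Cod C (snd c)) (fst c) \<and> pnt C \<Sigma> T (Cod C (snd c')) (fst c') \<and>
     fst r \<in> \<Sigma> \<and> snd r \<in> \<Sigma> \<and> Dom C (fst r) = Cod C (snd c') \<and> Cod C (fst r) = Cod C (snd c) \<and>
     Dom C (snd r) = Dom C (snd c') \<and> Cod C (snd r) = Dom C (snd c) \<and> snd c \<cdot> snd r = fst r \<cdot> snd c' \<and>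
     peq C T (act C (fst r) (fst c')) (fst c)"

definition con :: "(nat \<Rightarrow> nat \<Rightarrow> 'a) \<Rightarrow> (nat \<times> 'a) \<times> 'a \<Rightarrow> bool" where
  "con T c \<longleftrightarrow> snd c \<in> \<Sigma> \<and> pnt C \<Sigma> T (Cod C (snd c)) (fst c) \<and> Sat C T (fst c) (Dia C (Cod C (snd c)) (im C (snd c)))"

text \<open>Kind 4 forces the relation on an \<open>Mon\<close>-subobject to be the induced one:
  once both coordinates of a related pair lie in \<open>m\<close>, the parameter \<open>b\<close>
  itself has to factor through \<open>m\<close> after refinement. Kind 5 asks for a parameter
  \<open>g\<close> into \<open>Dom C m\<close> whose pair lies over the pair given by
  \<open>b\<close>. Second coordinates are compared as arrows, first coordinates only by
  \<open>peq\<close>, since they live in the finished model \<open>T\<close>.\<close>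

definition etask :: "(nat \<Rightarrow> nat \<Rightarrow> 'a) \<Rightarrow> nat \<times> 'a \<times> 'a \<times> 'a \<Rightarrow> (nat \<times> 'a) \<times> 'a \<Rightarrow> 'a \<times> 'a \<Rightarrow> (nat \<times> 'a) \<times> 'a \<Rightarrow> bool" where
  "etask T t c r c' \<longleftrightarrow> task C \<Sigma> t (Dom C (snd c)) (snd r) (Dom C (snd c')) \<and> (case t of (k, m, m', b) \<Rightarrow>
     (k = 4 \<longrightarrow> m \<in> Mon C \<longrightarrow> Dom C b = Cod C (snd c) \<longrightarrow> Cod C b = Cod C m \<longrightarrow> Sat C T (act C b (fst c)) (subobj C m) \<longrightarrow>
        below C (b \<cdot> (snd c \<cdot> snd r)) (subobj C m) \<longrightarrow>
        (\<exists>g\<in>\<Sigma>. Dom C g = Cod C (snd c') \<and> Cod C g = Dom C m \<and> m \<cdot> g = b \<cdot> fst r)) \<and>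
     (k = 5 \<longrightarrow> m \<in> Quo C \<longrightarrow> Dom C b = Cod C (snd c) \<longrightarrow> Cod C b = Cod C m \<longrightarrow>
        (\<exists>g\<in>\<Sigma>. Dom C g = Cod C (snd c') \<and> Cod C g = Dom C m \<and>
           peq C T (act C (m \<cdot> g) (fst c')) (act C b (fst c)) \<and> m \<cdot> (g \<cdot> snd c') = b \<cdot> (snd c \<cdot> snd r))))"

lemma refD:
  assumes "ref T (a, h) (x, y) (a', h')"
  shows "h \<in> \<Sigma>" "h' \<in> \<Sigma>" "pnt C \<Sigma> T (Cod C h) a" "pnt C \<Sigma> T (Cod C h') a'" "x \<in> \<Sigma>" "y \<in> \<Sigma>"
    "Dom C x = Cod C h'" "Cod C x = Cod C h" "Dom C y = Dom C h'" "Cod C y = Dom C h" "h \<cdot> y = x \<cdot> h'"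
    "peq C T (act C x a') a"
  using assms unfolding ref_def by simp_all

lemma refI:
  assumes "h \<in> \<Sigma>" "h' \<in> \<Sigma>" "pnt C \<Sigma> T (Cod C h) a" "pnt C \<Sigma> T (Cod C h') a'" "x \<in> \<Sigma>" "y \<in> \<Sigma>"
    "Dom C x = Cod C h'" "Cod C x = Cod C h" "Dom C y = Dom C h'" "Cod C y = Dom C h" "h \<cdot> y = x \<cdot> h'"
    "peq C T (act C x a') a"
  shows "ref T (a, h) (x, y) (a', h')"
  using assms unfolding ref_def by simp

lemma ref_one:
  assumes "con T (a, h)"
  shows "ref T (a, h) (Ident C (Cod C h), Ident C (Dom C h)) (a, h)"
proof -
  have h: "h \<in> \<Sigma>" "h \<in> Arr C" "pnt C \<Sigma> T (Cod C h) a" using assms frag_arr by (auto simp: con_def)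
  show ?thesis using h frag_ident[OF h(1)] act_ident[OF h(3)] by (intro refI) simp_all
qed

lemma ref_comp:
  assumes T: "tower C \<Sigma> T" and r: "ref T (a, h) (x, y) (a', h')" "ref T (a', h') (x', y') (a'', h'')"
  shows "ref T (a, h) (x \<cdot> x', y \<cdot> y') (a'', h'')"
proof -
  note d = refD[OF r(1)] and d' = refD[OF r(2)]
  have A: "h \<in> Arr C" "h' \<in> Arr C" "h'' \<in> Arr C" "x \<in> Arr C" "x' \<in> Arr C" "y \<in> Arr C" "y' \<in> Arr C"
    using d d' frag_arr by blast+
  have ty: "Dom C x = Cod C x'" "Dom C y = Cod C y'" using d d' by simp_all
  have "h \<cdot> (y \<cdot> y') = (h \<cdot> y) \<cdot> y'" using A d ty by (intro assoc[symmetric]) simp_all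
  also have "\<dots> = x \<cdot> (h' \<cdot> y')" unfolding d(11) using A d d' by (intro assoc) simp_all
  also have "\<dots> = (x \<cdot> x') \<cdot> h''" unfolding d'(11) using A d' ty by (intro assoc[symmetric]) simp_all
  finally have eq: "h \<cdot> (y \<cdot> y') = (x \<cdot> x') \<cdot> h''" .
  have "act C (x \<cdot> x') a'' = act C x (act C x' a'')" using act_comp[OF d'(4) A(5) d'(7) A(4) ty(1)] .
  moreover have "peq C T (act C x (act C x' a'')) (act C x a')"
    using act_peq[OF T _ d(4) d'(12) A(4) d(7)] act_pnt[OF d'(4,5,7)] d'(8) by simp
  ultimately have "peq C T (act C (x \<cdot> x') a'') a" using d(12) peq_trans by metis
  then show ?thesis using d d' A ty eq frag_comp by (intro refI) simp_all
qed

lemma con_act_Mperp: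
  assumes "con T (a, h)" "y \<in> Mperp C" "y \<in> \<Sigma>" "Cod C y = Dom C h"
  shows "con T (a, h \<cdot> y)"
proof -
  have h: "h \<in> \<Sigma>" "h \<in> Arr C" using assms frag_arr by (auto simp: con_def)
  then show ?thesis using assms frag_comp[of y h] im_comp_Mperp[of h y] by (simp add: con_def)
qed

text \<open>Only the second coordinate is refined; \<open>a\<close> is kept and moves along an
  identity. Lifting leaves the image of \<open>h\<close> unchanged, and for a cover
  \<open>Sat_dia_split\<close> names a part that remains consistent.\<close>

lemma etask_dense_task:
  assumes M: "model C \<Sigma> T" and c: "con T (a, h)" and r: "ref T (a0, h0) (x, y) (a, h)"
    and t: "t \<in> tasks" "fst t \<noteq> 4" "fst t \<noteq> 5"
  shows "\<exists>c'' r'. con T c'' \<and> ref T (a, h) r' c'' \<and> etask T t (a0, h0) (x \<cdot> fst r', y \<cdot> snd r') c''"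
proof -
  note d = refD[OF r]
  have A: "h \<in> Arr C" using frag_arr d by blast
  have S: "Sat C T a (Dia C (Cod C h) (im C h))" using c by (simp add: con_def)
  obtain y' where y': "y' \<in> \<Sigma>" "Cod C y' = Dom C h" "con T (a, h \<cdot> y')" "task C \<Sigma> t (Dom C h0) (y \<cdot> y') (Dom C y')"
  proof (rule task_dense[of y "Dom C h" "Dom C h0" t "\<lambda>y'. con T (a, h \<cdot> y')"])
    show "con T (a, h \<cdot> y)" if "y \<in> \<Sigma>" "y \<in> Mperp C" "Cod C y = Dom C h" for y
      using con_act_Mperp[OF c that(2,1,3)] .
    show "con T (a, h \<cdot> n) \<or> con T (a, h \<cdot> n')" if n: "n \<in> \<Sigma>" "n' \<in> \<Sigma>" "n \<in> Mon C" "n' \<in> Mon C" "Cod C n = Dom C h" "Cod C n' = Dom C h"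
       "is_join C (Dom C h) (subobj C n) (subobj C n') (subobj C (Ident C (Dom C h)))" for n n'
      using Sat_dia_split[OF M d(4,2) refl n(1,3,4,7) S] n d(4) A frag_comp[OF n(1) d(2)] frag_comp[OF n(2) d(2)]
      by (simp add: con_def)
    show "con T (a, h \<cdot> Ident C (Dom C h))" using c A by simp
  qed (use d t in auto)
  have I: "Ident C (Cod C h) \<in> \<Sigma>" using frag_ident(2) d(2) .
  have yA: "y' \<in> Arr C" using frag_arr y'(1) .
  have "ref T (a, h) (Ident C (Cod C h), y') (a, h \<cdot> y')"
    using d y' yA A I act_ident[OF d(4)] frag_comp[OF y'(1) d(2)] by (intro refI) simp_all
  moreover have "etask T t (a0, h0) (x \<cdot> Ident C (Cod C h), y \<cdot> y') (a, h \<cdot> y')"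
    using y'(4) t(2,3) A yA y'(2) unfolding etask_def by (cases t) simp
  ultimately show ?thesis using y'(3) by (intro exI[of _ "(a, h \<cdot> y')"] exI[of _ "(Ident C (Cod C h), y')"]) simp
qed

lemma etask_trivial:
  assumes c: "con T (a, h)" and r: "ref T (a0, h0) (x, y) (a, h)" and t: "etask T t (a0, h0) (x, y) (a, h)"
  shows "\<exists>c'' r'. con T c'' \<and> ref T (a, h) r' c'' \<and> etask T t (a0, h0) (x \<cdot> fst r', y \<cdot> snd r') c''"
proof -
  note d = refD[OF r]
  have "x \<cdot> Ident C (Cod C h) = x" "y \<cdot> Ident C (Dom C h) = y" using d frag_arr by auto
  then show ?thesis using ref_one[OF c] c t
    by (intro exI[of _ "(a, h)"] exI[of _ "(Ident C (Cod C h), Ident C (Dom C h))"]) simp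
qed

text \<open>When the task applies, the condition is restricted to the pullback \<open>i\<close> of
  \<open>m\<close> along \<open>b . x\<close>: \<open>a\<close> lifts to \<open>i\<close> because
  its value lies in \<open>m\<close>, and \<open>h\<close> factors through \<open>i\<close> for the
  same reason. Consistency is transported by \<open>dia_im_mon\<close>, hence by the axiom
  \<open>dia_mon\<close>.\<close>

lemma etask_dense_mon:
  assumes M: "model C \<Sigma> T" and c: "con T (a, h)" and r: "ref T (a0, h0) (x, y) (a, h)"
    and t: "(4, m, m', b) \<in> tasks"
  shows "\<exists>c'' r'. con T c'' \<and> ref T (a, h) r' c'' \<and> etask T (4, m, m', b) (a0, h0) (x \<cdot> fst r', y \<cdot> snd r') c''"
proof (cases "m \<in> Mon C \<and> Dom C b = Cod C h0 \<and> Cod C b = Cod C m \<and> Sat C T (act C b a0) (subobj C m) \<and>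
    below C (b \<cdot> (h0 \<cdot> y)) (subobj C m)")
  case False
  then have "etask T (4, m, m', b) (a0, h0) (x, y) (a, h)" by (auto simp: etask_def task_def)
  then show ?thesis by (rule etask_trivial[OF c r])
next
  case True
  then have m: "m \<in> Mon C" "Dom C b = Cod C h0" "Cod C b = Cod C m" "Sat C T (act C b a0) (subobj C m)"
    "below C (b \<cdot> (h0 \<cdot> y)) (subobj C m)" by auto
  have T: "tower C \<Sigma> T" using modelD(1)[OF M] .
  note d = refD[OF r]
  have \<Sigma>: "m \<in> \<Sigma>" "b \<in> \<Sigma>" using t by (auto simp: tasks_def)
  have A: "h \<in> Arr C" "h0 \<in> Arr C" "x \<in> Arr C" "y \<in> Arr C" "b \<in> Arr C" using frag_arr d \<Sigma> by blast+
  have bx: "b \<cdot> x \<in> \<Sigma>" "Dom C (b \<cdot> x) = Cod C h" "Cod C (b \<cdot> x) = Cod C m"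
    using frag_comp[OF d(5) \<Sigma>(2)] A d m by simp_all
  have "act C (b \<cdot> x) a = act C b (act C x a)" using act_comp[OF d(4) A(3) d(7) A(5)] m(2) d(8) by simp
  moreover have "peq C T (act C b (act C x a)) (act C b a0)"
    using act_peq[OF T _ d(3) d(12) A(5) m(2)] act_pnt[OF d(4,5,7)] d(8) by simp
  ultimately have S: "Sat C T (act C (b \<cdot> x) a) (subobj C m)" using Sat_peq[OF peq_sym m(4)] by metis
  obtain i k where i: "i \<in> \<Sigma>" "k \<in> \<Sigma>" "i \<in> Mon C" "Cod C i = Cod C h" "k \<in> Hom C (Dom C i) (Dom C m)" "m \<cdot> k = (b \<cdot> x) \<cdot> i"
    and ft: "\<And>g. factors_through C g i \<longleftrightarrow> g \<in> Arr C \<and> Cod C g = Cod C h \<and> factors_through C ((b \<cdot> x) \<cdot> g) m"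
    using frag_restrict[OF \<Sigma>(1) bx(1) m(1)] bx(2,3) by auto
  have iA: "i \<in> Arr C" using i(3) by simp
  have "Sat C T a (subobj C i)"
    using S eventually_ge_at_top[of "fst a"] unfolding Sat_def
  proof eventually_elim
    case (elim j)
    then show ?case using stage_in[OF T d(4) elim(2)] stage_act[OF T d(4) elim(2) frag_arr[OF bx(1)] bx(2)] i(3) m(1) ft
      by (simp add: below_subobj)
  qed
  then obtain a'' where a'': "pnt C \<Sigma> T (Dom C i) a''" "peq C T (act C i a'') a"
    using Sat_lift[OF T i(3,1), of a] d(4) i(4) by auto
  have "b \<cdot> (h0 \<cdot> y) = (b \<cdot> x) \<cdot> h" unfolding d(11) using A d m by (intro assoc[symmetric]) simp_all
  then have "factors_through C h i" using m(1,5) A ft by (simp add: below_subobj)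
  then obtain l where l: "l \<in> Arr C" "Cod C l = Dom C i" "i \<cdot> l = h" using iA by (rule factors_throughE)
  obtain h'' where h'': "h'' \<in> \<Sigma>" "Dom C h'' = Dom C h" "Cod C h'' = Dom C i" "i \<cdot> h'' = h"
    using solve1[OF i(1) d(2) l] by blast
  have hA: "h'' \<in> Arr C" using frag_arr h'' by blast
  have "Sat C T a (Dia C (Cod C h) (im C h))" using c by (simp add: con_def)
  then have "Sat C T (act C i a'') (Dia C (Cod C h) (im C h))" by (rule Sat_peq[OF peq_sym[OF a''(2)]])
  then have "Sat C T a'' (Dia C (Dom C i) (im C h''))"
    using eventually_ge_at_top[of "fst a''"] unfolding Sat_def
  proof eventually_elim
    case (elim j)
    then show ?case unfolding dia_im_mon[OF i(3) refl i(4) hA h''(3)] h''(4) 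
      using stage_in[OF T a''(1) elim(2)] stage_act[OF T a''(1) elim(2) iA refl] by simp
  qed
  then have con: "con T (a'', h'')" using h'' a'' by (simp add: con_def)
  have I: "Ident C (Dom C h) \<in> \<Sigma>" using frag_ident(1) d(2) .
  have "ref T (a, h) (i, Ident C (Dom C h)) (a'', h'')"
    using d h'' A i I a'' by (intro refI) simp_all
  moreover have "m \<cdot> k = b \<cdot> (x \<cdot> i)" unfolding i(6) using A iA i(4) m d by (intro assoc) simp_all
  then have "etask T (4, m, m', b) (a0, h0) (x \<cdot> i, y \<cdot> Ident C (Dom C h)) (a'', h'')"
    unfolding etask_def task_def split_conv fst_conv snd_conv using i(2,5) h''(3) unfolding Hom_iff
    by (intro conjI impI) (simp_all, blast)
  ultimately show ?thesis using con by (intro exI[of _ "(a'', h'')"] exI[of _ "(i, Ident C (Dom C h))"]) simp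
qed

text \<open>Put \<open>f = b . x\<close>. Consistency of \<open>a\<close> places
  \<open>fX . a\<close> in the image \<open>m\<close> of \<open>t\<close> under \<open>qZ\<close>,
  so the model lifts it to an element \<open>a''\<close> of \<open>t\<close>. This is an element of
  the product whose second projection is \<open>a\<close> and whose first projection is the lift
  along \<open>q\<close>. The pair \<open>(a'', h')\<close> is consistent because \<open>t\<close>
  represents \<open>Dia\<close> of the image of \<open>h'\<close>.\<close>

lemma etask_dense_quo:
  assumes M: "model C \<Sigma> T" and c: "con T (a, h)" and r: "ref T (a0, h0) (x, y) (a, h)"
    and t: "(5, q, m', b) \<in> tasks"
  shows "\<exists>c'' r'. con T c'' \<and> ref T (a, h) r' c'' \<and> etask T (5, q, m', b) (a0, h0) (x \<cdot> fst r', y \<cdot> snd r') c''"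
proof (cases "q \<in> Quo C \<and> Dom C b = Cod C h0 \<and> Cod C b = Cod C q")
  case False
  then have "etask T (5, q, m', b) (a0, h0) (x, y) (a, h)" by (auto simp: etask_def task_def)
  then show ?thesis by (rule etask_trivial[OF c r])
next
  case True
  then have q: "q \<in> Quo C" "Dom C b = Cod C h0" "Cod C b = Cod C q" by auto
  have T: "tower C \<Sigma> T" using modelD(1)[OF M] .
  note d = refD[OF r]
  have \<Sigma>: "q \<in> \<Sigma>" "b \<in> \<Sigma>" using t by (auto simp: tasks_def)
  have A: "h \<in> Arr C" "h0 \<in> Arr C" "x \<in> Arr C" "y \<in> Arr C" "b \<in> Arr C" "q \<in> Arr C" using frag_arr d \<Sigma> by blast+
  define f where "f = b \<cdot> x"
  have f: "f \<in> \<Sigma>" "Dom C f = Cod C h" "Cod C f = Cod C q" "f \<in> Arr C"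
    unfolding f_def using frag_comp[OF d(5) \<Sigma>(2)] A d q by simp_all
  obtain p1 p2 qZ fX m e t y' h' where qs: "quo_step C q f h p1 p2 qZ fX m e t y' h'"
    and s: "p1 \<in> \<Sigma>" "p2 \<in> \<Sigma>" "qZ \<in> \<Sigma>" "fX \<in> \<Sigma>" "m \<in> \<Sigma>" "e \<in> \<Sigma>" "t \<in> \<Sigma>" "y' \<in> \<Sigma>" "h' \<in> \<Sigma>"
    using frag_quo[OF \<Sigma>(1) f(1) d(2) q(1) f(3) f(2)[symmetric]] by (elim bexE) (rule that)
  have p: "p1 \<in> Arr C" "Dom C p1 = Dom C qZ" "Cod C p1 = Dom C q" "p2 \<in> Arr C" "Dom C p2 = Dom C qZ" "Cod C p2 = Cod C h"
    "qZ \<in> Arr C" "fX \<in> Arr C" "Dom C fX = Cod C h" "Cod C fX = Cod C qZ"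
    and m: "m \<in> Mon C" "e \<in> Mperp C" "t \<in> Mon C" "Cod C t = Dom C qZ" "qZ \<cdot> t = m \<cdot> e" "Dom C m = Cod C e"
    and t: "t \<in> Dia C (Dom C qZ) (im C h')"
    and h': "h' \<in> Arr C" "Dom C h' = Dom C y'" "Cod C h' = Dom C qZ" "y' \<in> Arr C" "Cod C y' = Dom C h" "qZ \<cdot> h' = fX \<cdot> (h \<cdot> y')"
    and be: "\<And>g. below C g (Dia C (Cod C h) (im C h)) \<Longrightarrow> below C (fX \<cdot> g) (subobj C m)"
    and key: "\<And>u v. \<lbrakk>u \<in> Arr C; v \<in> Arr C; Cod C u = Dom C qZ; Cod C v = Cod C h; qZ \<cdot> u = fX \<cdot> v\<rbrakk> \<Longrightarrow>
        p2 \<cdot> u = v \<and> q \<cdot> (p1 \<cdot> u) = f \<cdot> v"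
    using qs unfolding quo_step_def Hom_iff f(2) by blast+
  have mA: "m \<in> Arr C" "e \<in> Arr C" "t \<in> Arr C" using m by simp_all
  have dt: "Dom C e = Dom C t" "Cod C m = Cod C qZ"
    using arg_cong[OF m(5), of "Dom C"] arg_cong[OF m(5), of "Cod C"] m(4,6) p mA by simp_all
  have "Sat C T a (Dia C (Cod C h) (im C h))" using c by (simp add: con_def)
  then have "Sat C T (act C fX a) (subobj C m)" by (rule Sat_act[OF T d(4) p(8,9)]) (rule be)
  \<comment> \<open>The lift to \<open>Dom C t\<close> has two steps: through \<open>m\<close>,
    where membership is known, and through \<open>e\<close>, which a model makes surjective.\<close>
  then obtain w where w: "pnt C \<Sigma> T (Dom C m) w" "peq C T (act C m w) (act C fX a)"
    using Sat_lift[OF T m(1) s(5), of "act C fX a"] act_pnt[OF d(4) s(4) p(9)] dt p(10) by auto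
  obtain v where v: "pnt C \<Sigma> T (Dom C e) v" "peq C T (act C e v) w"
    using modelD(2)[OF M s(6) m(2), of w] w(1) m(6) by auto
  define a'' where "a'' = act C t v"
  have vt: "pnt C \<Sigma> T (Dom C t) v" using v(1) dt by simp
  have a'': "pnt C \<Sigma> T (Dom C qZ) a''" using act_pnt[OF vt s(7) refl] m(4) by (simp add: a''_def)
  have "act C qZ a'' = act C m (act C e v)"
    using act_comp[OF vt mA(3) refl p(7)] act_comp[OF v(1) mA(2) refl mA(1)] m(4,5,6) by (simp add: a''_def)
  moreover have "peq C T (act C m (act C e v)) (act C m w)"
    using act_peq[OF T _ w(1) v(2) mA(1) refl] act_pnt[OF v(1) s(6) refl] m(6) by simp
  ultimately have eq: "peq C T (act C qZ a'') (act C fX a)" using w(2) peq_trans by metis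
  \<comment> \<open>The equality of \<open>qZ . a''\<close> and \<open>fX . a\<close> in the model
    is an equation of arrows at late stages, where \<open>key\<close> splits it into its two
    projections.\<close>
  have ev: "\<forall>\<^sub>F j in sequentially. p2 \<cdot> stage C T a'' j = stage C T a j \<and> q \<cdot> (p1 \<cdot> stage C T a'' j) = f \<cdot> stage C T a j"
    using eq eventually_ge_at_top[of "max (fst a) (fst a'')"] unfolding peq_def
  proof eventually_elim
    case (elim j)
    then have j: "fst a \<le> j" "fst a'' \<le> j" by auto
    show ?case using elim(1) stage_in[OF T d(4) j(1)] stage_in[OF T a'' j(2)]
      stage_act[OF T a'' j(2) p(7) refl] stage_act[OF T d(4) j(1) p(8,9)] by (intro key) simp_all
  qed
  have peq2: "peq C T (act C p2 a'') a"
    using ev eventually_ge_at_top[of "fst a''"] unfolding peq_def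
    by eventually_elim (simp add: stage_act[OF T a'' _ p(4,5)])
  have qp: "q \<cdot> p1 \<in> Arr C" "Dom C (q \<cdot> p1) = Dom C qZ" using p A by simp_all
  have "peq C T (act C (q \<cdot> p1) a'') (act C f a)"
    using ev eventually_ge_at_top[of "max (fst a) (fst a'')"] unfolding peq_def
  proof eventually_elim
    case (elim j)
    then have j: "fst a \<le> j" "fst a'' \<le> j" by auto
    have "(q \<cdot> p1) \<cdot> stage C T a'' j = q \<cdot> (p1 \<cdot> stage C T a'' j)"
      using stage_in[OF T a'' j(2)] p A by simp
    then show ?case using elim(1) stage_act[OF T a'' j(2) qp] stage_act[OF T d(4) j(1) f(4,2)] by simp
  qed
  moreover have "act C f a = act C b (act C x a)" unfolding f_def using act_comp[OF d(4) A(3) d(7) A(5)] q(2) d(8) by simp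
  moreover have "peq C T (act C b (act C x a)) (act C b a0)"
    using act_peq[OF T _ d(3) d(12) A(5) q(2)] act_pnt[OF d(4,5,7)] d(8) by simp
  ultimately have eq5: "peq C T (act C (q \<cdot> p1) a'') (act C b a0)" using peq_trans by metis
  have key': "p2 \<cdot> h' = h \<cdot> y' \<and> q \<cdot> (p1 \<cdot> h') = f \<cdot> (h \<cdot> y')"
    using h' A by (intro key) simp_all
  have X: "Dom C qZ \<in> Obj C" using p by simp
  have "Dia C (Dom C qZ) (im C h') \<in> carrier (Sub C (Dom C qZ))" using h' X by simp
  from Sub_mem(3)[OF this t] have "Dia C (Dom C qZ) (im C h') = subobj C t" ..
  then have "Sat C T a'' (Dia C (Dom C qZ) (im C h'))" using Sat_act_mon[OF T m(3) vt] by (simp add: a''_def)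
  then have con: "con T (a'', h')" using s a'' h'(3) by (simp add: con_def)
  have "ref T (a, h) (p2, y') (a'', h')"
    using d s a'' h' p peq2 key' by (intro refI) simp_all
  moreover have "q \<cdot> (p1 \<cdot> h') = b \<cdot> (h0 \<cdot> (y \<cdot> y'))"
  proof -
    have "h0 \<cdot> (y \<cdot> y') = (h0 \<cdot> y) \<cdot> y'" using A d h' by (intro assoc[symmetric]) simp_all
    also have "\<dots> = x \<cdot> (h \<cdot> y')" unfolding d(11) using A d h' by (intro assoc) simp_all
    finally have "b \<cdot> (h0 \<cdot> (y \<cdot> y')) = f \<cdot> (h \<cdot> y')" unfolding f_def using A d h' q by simp
    then show ?thesis using key' by simp
  qed
  then have "etask T (5, q, m', b) (a0, h0) (x \<cdot> p2, y \<cdot> y') (a'', h')"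
    unfolding etask_def task_def split_conv fst_conv snd_conv using s(1) p h'(3) eq5
    by (intro conjI impI) (simp_all, blast)
  ultimately show ?thesis using con by (intro exI[of _ "(a'', h')"] exI[of _ "(p2, y')"]) simp
qed

text \<open>Refinements compose like arrows in both coordinates, so associativity and the unit laws
  hold only along composable refinements; \<open>generic_sequence\<close> asks for no more.\<close>

lemma edge_run:
  assumes M: "model C \<Sigma> T" and c0: "con T c0"
  shows "\<exists>c R. c 0 = c0 \<and> generic_run (con T) (ref T) (\<lambda>c. (Ident C (Cod C (snd c)), Ident C (Dom C (snd c))))
    (\<lambda>r r'. (fst r \<cdot> fst r', snd r \<cdot> snd r')) tasks (etask T) c R"
proof (rule generic_sequence)
  have T: "tower C \<Sigma> T" using modelD(1)[OF M] .
  show "con T c0" "countable tasks" by (fact c0, fact countable_tasks)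
  show "tasks \<noteq> {}" using c0 by (auto simp: tasks_def con_def)
  show "ref T c (Ident C (Cod C (snd c)), Ident C (Dom C (snd c))) c" if "con T c" for c
    using ref_one[of T "fst c" "snd c"] that by simp
  show "ref T c (fst r \<cdot> fst r', snd r \<cdot> snd r') c''" if "ref T c r c'" "ref T c' r' c''" for c r c' r' c''
    using ref_comp[OF T, of "fst c" "snd c" "fst r" "snd r" "fst c'" "snd c'" "fst r'" "snd r'" "fst c''" "snd c''"] that by simp
  show "(fst (fst r \<cdot> fst r', snd r \<cdot> snd r') \<cdot> fst r'', snd (fst r \<cdot> fst r', snd r \<cdot> snd r') \<cdot> snd r'') =
      (fst r \<cdot> fst (fst r' \<cdot> fst r'', snd r' \<cdot> snd r''), snd r \<cdot> snd (fst r' \<cdot> fst r'', snd r' \<cdot> snd r''))"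
    if "ref T c r c'" "ref T c' r' c''" "ref T c'' r'' c'''" for c r c' r' c'' r'' c'''
  proof -
    have "fst r \<in> Arr C" "fst r' \<in> Arr C" "fst r'' \<in> Arr C" "snd r \<in> Arr C" "snd r' \<in> Arr C" "snd r'' \<in> Arr C"
      using that frag_arr unfolding ref_def by blast+
    moreover have "Dom C (fst r) = Cod C (fst r')" "Dom C (fst r') = Cod C (fst r'')"
      "Dom C (snd r) = Cod C (snd r')" "Dom C (snd r') = Cod C (snd r'')" using that unfolding ref_def by simp_all
    ultimately show ?thesis by simp
  qed
  show "(fst r \<cdot> fst (Ident C (Cod C (snd c')), Ident C (Dom C (snd c'))), snd r \<cdot> snd (Ident C (Cod C (snd c')), Ident C (Dom C (snd c')))) = r"
    "(fst (Ident C (Cod C (snd c)), Ident C (Dom C (snd c))) \<cdot> fst r, snd (Ident C (Cod C (snd c)), Ident C (Dom C (snd c))) \<cdot> snd r) = r"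
    if "ref T c r c'" for c r c'
  proof -
    have "fst r \<in> Arr C" "snd r \<in> Arr C" using that frag_arr unfolding ref_def by blast+
    then show "(fst r \<cdot> fst (Ident C (Cod C (snd c')), Ident C (Dom C (snd c'))), snd r \<cdot> snd (Ident C (Cod C (snd c')), Ident C (Dom C (snd c')))) = r"
      "(fst (Ident C (Cod C (snd c)), Ident C (Dom C (snd c))) \<cdot> fst r, snd (Ident C (Cod C (snd c)), Ident C (Dom C (snd c))) \<cdot> snd r) = r"
      using that unfolding ref_def by simp_all
  qed
  show "\<exists>c'' r'. con T c'' \<and> ref T c' r' c'' \<and> etask T t c (fst r \<cdot> fst r', snd r \<cdot> snd r') c''"
    if "con T c" "con T c'" "ref T c r c'" "t \<in> tasks" for c r c' t
  proof -
    obtain a0 h0 x y a h where [simp]: "c = (a0, h0)" "r = (x, y)" "c' = (a, h)" by (metis surj_pair)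
    obtain k m m' b where t: "t = (k, m, m', b)" by (metis surj_pair)
    consider "k = 4" | "k = 5" | "k \<noteq> 4" "k \<noteq> 5" by blast
    then show ?thesis
    proof cases
      case 1
      show ?thesis using etask_dense_mon[OF M, of a h a0 h0 x y m m' b] that t 1 by simp
    next
      case 2
      show ?thesis using etask_dense_quo[OF M, of a h a0 h0 x y m m' b] that t 2 by simp
    next
      case 3
      show ?thesis using etask_dense_task[OF M, of a h a0 h0 x y t] that t 3 by simp
    qed
  qed
qed

lemma rlI:
  assumes "f \<in> \<Sigma>" "Dom C f = Cod C (h n)" "peq C T p (act C f (a n))" "peq C T' p' (n, f \<cdot> h n)" "Cod C f = X"
  shows "rl C \<Sigma> T T' (a, h) X p p'"
  unfolding rl_def using assms by auto

text \<open>The generic sequence starts at \<open>(p0, m0)\<close>, which is consistent by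
  hypothesis. The tower of the second coordinates is the new model; its element \<open>p'\<close> is
  the identity of \<open>Dom C m0\<close> at stage 0, and the initial condition itself relates
  \<open>p0\<close> to the image of \<open>p'\<close> under \<open>m0\<close>.\<close>

lemma edge_exists:
  assumes M: "model C \<Sigma> T" and m0: "m0 \<in> Mon C" "m0 \<in> \<Sigma>" and p0: "pnt C \<Sigma> T (Cod C m0) p0"
    and S0: "Sat C T p0 (Dia C (Cod C m0) (subobj C m0))"
  shows "\<exists>T' \<kappa> p'. model C \<Sigma> T' \<and> edge C \<Sigma> T T' \<kappa> \<and> pnt C \<Sigma> T' (Dom C m0) p' \<and>
    rl C \<Sigma> T T' \<kappa> (Cod C m0) p0 (act C m0 p')"
proof -
  have T: "tower C \<Sigma> T" using modelD(1)[OF M] .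
  have "con T (p0, m0)" using m0 p0 S0 by (simp add: con_def)
  from edge_run[OF M this] obtain c R where c0: "c 0 = (p0, m0)" and
    g: "generic_run (con T) (ref T) (\<lambda>c. (Ident C (Cod C (snd c)), Ident C (Dom C (snd c))))
    (\<lambda>r r'. (fst r \<cdot> fst r', snd r \<cdot> snd r')) tasks (etask T) c R" by blast
  define a where "a n = fst (c n)" for n
  define h where "h n = snd (c n)" for n
  define X where "X i j = fst (R i j)" for i j
  define T' where "T' i j = snd (R i j)" for i j
  have con: "con T (a n, h n)" for n using generic_runD(1)[OF g, of n] by (simp add: a_def h_def)
  have "ref T (a i, h i) (X i j, T' i j) (a j, h j)" if "i \<le> j" for i j
    using generic_runD(2)[OF g that] by (simp add: a_def h_def X_def T'_def)
  note r = refD[OF this]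
  have X1: "X i i = Ident C (Cod C (h i))" and T1: "T' i i = Ident C (Dom C (h i))" for i
    using generic_runD(3)[OF g, of i] by (simp_all add: X_def T'_def h_def)
  have X2: "X i k = X i j \<cdot> X j k" and T2: "T' i k = T' i j \<cdot> T' j k" if "i \<le> j" "j \<le> k" for i j k
    using generic_runD(4)[OF g that] by (simp_all add: X_def T'_def)
  have h: "h n \<in> \<Sigma>" "h n \<in> Arr C" "pnt C \<Sigma> T (Cod C (h n)) (a n)" for n
    using con[of n] frag_arr by (auto simp: con_def)
  have XA: "X i j \<in> Arr C" "T' i j \<in> Arr C" if "i \<le> j" for i j using r[OF that] frag_arr by blast+
  have D: "Dom C (T' n n) = Dom C (h n)" for n using r(9)[of n n] by simp
  have tk: "\<exists>n\<ge>N. i \<le> n \<and> etask T t (a i, h i) (X i n, T' i n) (a n, h n)" if "t \<in> tasks" for t i N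
    using generic_runD(5)[OF g that, of N i] by (simp add: a_def h_def X_def T'_def)
  have tow: "tower C \<Sigma> T'" unfolding tower_def D using r(6,9,10) T1 T2 by blast
  have M': "model C \<Sigma> T'"
  proof (rule model_of_tasks[OF tow])
    show "\<not> null C (Dom C (T' n n))" for n
      unfolding D using Sat_dia_not_null[OF M h(3,2) refl] con[of n] by (simp add: con_def)
    show "\<exists>n\<ge>i. task C \<Sigma> t (Dom C (T' i i)) (T' i n) (Dom C (T' n n))" if "t \<in> tasks" for t i
      unfolding D using tk[OF that, of i i] unfolding etask_def by auto
  qed
  \<comment> \<open>A parameter \<open>f\<close> at stage \<open>n\<close> may be replaced by
    \<open>f . X n j\<close> at any later stage \<open>j\<close> without changing the related pair.
    The clauses of \<open>edge\<close> are proved by moving to a stage that is late enough.\<close>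
  have move: "f \<cdot> X n j \<in> \<Sigma>" "Dom C (f \<cdot> X n j) = Cod C (h j)" "Cod C (f \<cdot> X n j) = Cod C f"
      "peq C T (act C (f \<cdot> X n j) (a j)) (act C f (a n))"
      "(f \<cdot> X n j) \<cdot> h j = stage C T' (n, f \<cdot> h n) j" "peq C T' (j, (f \<cdot> X n j) \<cdot> h j) (n, f \<cdot> h n)"
      "pnt C \<Sigma> T' (Cod C f) (n, f \<cdot> h n)" "(f \<cdot> X n j) \<cdot> h j = f \<cdot> (h n \<cdot> T' n j)"
    if nj: "n \<le> j" and f: "f \<in> \<Sigma>" "Dom C f = Cod C (h n)" for f n j
  proof -
    note rr = r[OF nj]
    have A: "f \<in> Arr C" "X n j \<in> Arr C" "T' n j \<in> Arr C" using frag_arr f XA nj by blast+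
    show 1: "f \<cdot> X n j \<in> \<Sigma>" "Dom C (f \<cdot> X n j) = Cod C (h j)" "Cod C (f \<cdot> X n j) = Cod C f"
      using frag_comp[OF rr(5) f(1)] A f rr by simp_all
    have "act C (f \<cdot> X n j) (a j) = act C f (act C (X n j) (a j))"
      using act_comp[OF h(3) A(2) rr(7) A(1)] f rr by simp
    moreover have "peq C T (act C f (act C (X n j) (a j))) (act C f (a n))"
      using act_peq[OF T _ h(3) rr(12) A(1) f(2)] act_pnt[OF h(3) rr(5,7)] rr(8) by simp
    ultimately show "peq C T (act C (f \<cdot> X n j) (a j)) (act C f (a n))" by simp
    have "(f \<cdot> X n j) \<cdot> h j = f \<cdot> (X n j \<cdot> h j)" using A f rr h by (intro assoc) simp_all
    then show 3: "(f \<cdot> X n j) \<cdot> h j = f \<cdot> (h n \<cdot> T' n j)" using rr(11) by simp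
    also have "\<dots> = (f \<cdot> h n) \<cdot> T' n j" using A f rr h by (intro assoc[symmetric]) simp_all
    finally show 2: "(f \<cdot> X n j) \<cdot> h j = stage C T' (n, f \<cdot> h n) j" by (simp add: stage_def)
    show p: "pnt C \<Sigma> T' (Cod C f) (n, f \<cdot> h n)"
      unfolding pnt_def fst_conv snd_conv D using frag_comp[OF h(1) f(1)] A f h by simp
    have nj': "fst (n, f \<cdot> h n) \<le> j" using nj by simp
    show "peq C T' (j, (f \<cdot> X n j) \<cdot> h j) (n, f \<cdot> h n)" unfolding 2
      by (rule peqI[OF tow stage_pnt[OF tow p nj'] p _ _ stage_stage[OF tow p nj' order_refl]]) (use nj in auto)
  qed
  let ?rl = "rl C \<Sigma> T T' (a, h)"
  have rlE: "\<exists>f\<in>\<Sigma>. Dom C f = Cod C (h n) \<and> Cod C f = Z \<and> peq C T p (act C f (a n)) \<and> peq C T' p' (n, f \<cdot> h n)"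
    if "f \<in> \<Sigma>" "Dom C f = Cod C (h i)" "Cod C f = Z" "peq C T p (act C f (a i))" "peq C T' p' (i, f \<cdot> h i)" "i \<le> n"
    for Z p p' i f n
    using move[OF that(6,1,2)] that by (intro bexI[of _ "f \<cdot> X i n"]) (auto intro: peq_trans peq_sym)
  \<comment> \<open>Requirement 4 with \<open>b = f\<close>. The stage has to lie beyond the
    \<open>N\<close> after which \<open>f . h n\<close> stays in \<open>m\<close>, which is possible
    because tasks are met at arbitrarily late stages.\<close>
  have task4: "\<exists>j\<ge>n. \<exists>k\<in>\<Sigma>. Dom C k = Cod C (h j) \<and> Cod C k = Dom C m \<and> m \<cdot> k = f \<cdot> X n j"
    if m: "m \<in> Mon C" "m \<in> \<Sigma>" and f: "f \<in> \<Sigma>" "Dom C f = Cod C (h n)" "Cod C f = Cod C m"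
      and S: "Sat C T (act C f (a n)) (subobj C m)" and S': "Sat C T' (n, f \<cdot> h n) (subobj C m)" for m f n
  proof -
    obtain N where N: "\<And>j. N \<le> j \<Longrightarrow> below C (stage C T' (n, f \<cdot> h n) j) (subobj C m)"
      using S' unfolding Sat_def eventually_sequentially by blast
    have "(4, m, m, f) \<in> tasks" using m f by (simp add: tasks_def)
    from tk[OF this, of N n] obtain j where j: "N \<le> j" "n \<le> j" "etask T (4, m, m, f) (a n, h n) (X n j, T' n j) (a j, h j)"
      by blast
    have "below C (f \<cdot> (h n \<cdot> T' n j)) (subobj C m)" using N[OF j(1)] move(5,8)[OF j(2) f(1,2)] by simp
    then show ?thesis using j m f S unfolding etask_def by auto
  qed
  \<comment> \<open>At a stage where the second element lies in \<open>S\<close>, the subobject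
    \<open>S\<close> contains the whole image of \<open>f' . h j\<close>; consistency of the
    condition \<open>j\<close> then yields \<open>Dia\<close> of it for the first element.\<close>
  have e_dia: "Sat C T p (Dia C Z S)" if rl: "?rl Z p p'" and S: "S \<in> carrier (Sub C Z)" "Sat C T' p' S" for Z p p' S
  proof -
    obtain n f where f: "f \<in> \<Sigma>" "Dom C f = Cod C (h n)" "Cod C f = Z" "peq C T p (act C f (a n))" "peq C T' p' (n, f \<cdot> h n)"
      using rl unfolding rl_def by auto
    obtain j where j: "n \<le> j" "below C (stage C T' (n, f \<cdot> h n) j) S" using SatE[OF Sat_peq[OF f(5) S(2)]] .
    note mv = move[OF j(1) f(1,2)]
    define f' where "f' = f \<cdot> X n j"
    have f': "f' \<in> Arr C" "Dom C f' = Cod C (h j)" "Cod C f' = Z" "below C (f' \<cdot> h j) S"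
      using mv(1,2,3,5) f(3) j(2) frag_arr by (auto simp: f'_def)
    have Z: "Z \<in> Obj C" using f' by auto
    have fh: "f' \<cdot> h j \<in> Arr C" "Cod C (f' \<cdot> h j) = Z" using f' h by simp_all
    have "im C (f' \<cdot> h j) \<sqsubseteq>\<^bsub>Sub C Z\<^esub> S" using im_le[OF fh S(1)] f'(4) by simp
    then have "Dia C Z (im C (f' \<cdot> h j)) \<sqsubseteq>\<^bsub>Sub C Z\<^esub> Dia C Z S"
      using dia_mono[OF _ im_carrier[OF fh] S(1) Z] by blast
    then have le: "below C g (Dia C Z (im C (f' \<cdot> h j))) \<Longrightarrow> below C g (Dia C Z S)" for g
      using Sub_le_below[OF dia_carrier[OF im_carrier[OF fh] Z] dia_carrier[OF S(1) Z]] by blast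
    have "Sat C T (a j) (Dia C (Cod C (h j)) (im C (h j)))" using con[of j] by (simp add: con_def)
    then have "Sat C T (act C f' (a j)) (Dia C Z S)"
      by (rule Sat_act[OF T h(3) f'(1,2)]) (rule le, rule dia_im_comp[OF h(2) refl f'(1-3)])
    moreover have "peq C T (act C f' (a j)) p" unfolding f'_def by (rule peq_trans[OF mv(4) peq_sym[OF f(4)]])
    ultimately show ?thesis using Sat_peq by blast
  qed
  have e_mon: "?rl (Dom C m) p p'" if m: "m \<in> \<Sigma>" "m \<in> Mon C" and p: "pnt C \<Sigma> T (Dom C m) p" "pnt C \<Sigma> T' (Dom C m) p'"
    and rl: "?rl (Cod C m) (act C m p) (act C m p')" for m p p'
  proof -
    have mA: "m \<in> Arr C" using m by simp
    obtain n f where f: "f \<in> \<Sigma>" "Dom C f = Cod C (h n)" "Cod C f = Cod C m" "peq C T (act C m p) (act C f (a n))"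
      "peq C T' (act C m p') (n, f \<cdot> h n)" using rl unfolding rl_def by auto
    obtain j k where k: "n \<le> j" "k \<in> \<Sigma>" "Dom C k = Cod C (h j)" "Cod C k = Dom C m" "m \<cdot> k = f \<cdot> X n j"
      using task4[OF m(2,1) f(1-3) Sat_peq[OF f(4) Sat_act_mon[OF T m(2) p(1)]] Sat_peq[OF f(5) Sat_act_mon[OF tow m(2) p(2)]]]
      by blast
    note mv = move[OF k(1) f(1,2)]
    have kA: "k \<in> Arr C" using k frag_arr by blast
    have "act C m (act C k (a j)) = act C (f \<cdot> X n j) (a j)" using act_comp[OF h(3) kA k(3) mA] k by simp
    then have "peq C T (act C m p) (act C m (act C k (a j)))" using peq_trans[OF f(4) peq_sym[OF mv(4)]] by simp
    then have 1: "peq C T p (act C k (a j))" using mon_peq[OF T m(2) p(1)] act_pnt[OF h(3) k(2,3)] k(4) by simp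
    have "m \<cdot> (k \<cdot> h j) = (m \<cdot> k) \<cdot> h j" using mA kA k(3,4) h by (intro assoc[symmetric]) simp_all
    then have "act C m (j, k \<cdot> h j) = (j, (m \<cdot> k) \<cdot> h j)" by (simp add: act_def)
    then have "peq C T' (act C m p') (act C m (j, k \<cdot> h j))" unfolding k(5) using peq_trans[OF f(5) peq_sym[OF mv(6)]] by simp
    moreover have "pnt C \<Sigma> T' (Dom C m) (j, k \<cdot> h j)" 
      unfolding pnt_def fst_conv snd_conv D using frag_comp[OF h(1) k(2)] kA k h by simp
    ultimately have "peq C T' p' (j, k \<cdot> h j)" using mon_peq[OF tow m(2) p(2)] by blast
    with 1 k show ?thesis by (intro rlI[of k]) simp_all
  qed
  have e_quo: "\<exists>s s'. pnt C \<Sigma> T (Dom C q) s \<and> pnt C \<Sigma> T' (Dom C q) s' \<and> ?rl (Dom C q) s s' \<and>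
      peq C T (act C q s) p \<and> peq C T' (act C q s') p'"
    if q: "q \<in> \<Sigma>" "q \<in> Quo C" and rl: "?rl (Cod C q) p p'" for q p p'
  proof -
    have qA: "q \<in> Arr C" using q frag_arr by blast
    obtain n f where f: "f \<in> \<Sigma>" "Dom C f = Cod C (h n)" "Cod C f = Cod C q" "peq C T p (act C f (a n))"
      "peq C T' p' (n, f \<cdot> h n)" using rl unfolding rl_def by auto
    have "(5, q, q, f) \<in> tasks" using q f by (simp add: tasks_def)
    from tk[OF this, of n n] obtain j where j: "n \<le> j" "etask T (5, q, q, f) (a n, h n) (X n j, T' n j) (a j, h j)" by blast
    then obtain k where k: "k \<in> \<Sigma>" "Dom C k = Cod C (h j)" "Cod C k = Dom C q" "peq C T (act C (q \<cdot> k) (a j)) (act C f (a n))"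
      "q \<cdot> (k \<cdot> h j) = f \<cdot> (h n \<cdot> T' n j)" using q f unfolding etask_def by auto
    note mv = move[OF j(1) f(1,2)]
    have kA: "k \<in> Arr C" using k frag_arr by blast
    have "pnt C \<Sigma> T (Dom C q) (act C k (a j))" using act_pnt[OF h(3) k(1,2)] k(3) by simp
    moreover have "pnt C \<Sigma> T' (Dom C q) (j, k \<cdot> h j)"
      unfolding pnt_def fst_conv snd_conv D using frag_comp[OF h(1) k(1)] kA k h by simp
    moreover have "?rl (Dom C q) (act C k (a j)) (j, k \<cdot> h j)" by (rule rlI[of k h j, OF k(1,2) peq_refl peq_refl k(3)])
    moreover have "peq C T (act C q (act C k (a j))) p"
      using act_comp[OF h(3) kA k(2) qA] k(3) peq_trans[OF k(4) peq_sym[OF f(4)]] by simp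
    moreover have "act C q (j, k \<cdot> h j) = (j, (f \<cdot> X n j) \<cdot> h j)" using k(5) mv(8) by (simp add: act_def)
    then have "peq C T' (act C q (j, k \<cdot> h j)) p'" using peq_trans[OF mv(6) peq_sym[OF f(5)]] by simp
    ultimately show ?thesis by blast
  qed
  have e_lim: "?rl L p p'" if J: "finite_diagram J C Do Da" and lim: "is_limit J C Do Da L l"
    and Da\<Sigma>: "Da ` Arr J \<subseteq> \<Sigma>" and l\<Sigma>: "l ` Obj J \<subseteq> \<Sigma>" and L\<Sigma>: "Ident C L \<in> \<Sigma>" and p: "pnt C \<Sigma> T L p" "pnt C \<Sigma> T' L p'"
    and rl: "\<forall>i\<in>Obj J. ?rl (Do i) (act C (l i) p) (act C (l i) p')" for J Do Da L l p p'
  proof -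
    interpret F: category_functor J C Do Da using J by (simp add: finite_diagram_def)
    have fin: "finite (Obj J)" "finite (Arr J)" using J by (auto simp: finite_diagram_def)
    have l: "l i \<in> \<Sigma>" "l i \<in> Arr C" "Dom C (l i) = L" "Cod C (l i) = Do i" if "i \<in> Obj J" for i
      using lim l\<Sigma> that by (auto simp: is_limit_def is_cone_def Hom_iff)
    have lc: "Da u \<cdot> l (Dom J u) = l (Cod J u)" if "u \<in> Arr J" for u using lim that by (auto simp: is_limit_def is_cone_def)
    have Jo: "Dom J u \<in> Obj J" "Cod J u \<in> Obj J" if "u \<in> Arr J" for u
      using that F.source.dom_obj F.source.cod_obj by auto
    have Da: "Da u \<in> \<Sigma>" "Da u \<in> Arr C" "Dom C (Da u) = Do (Dom J u)" "Cod C (Da u) = Do (Cod J u)" if "u \<in> Arr J" for u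
      using F.map_hom[of u "Dom J u" "Cod J u"] that Da\<Sigma> by (auto simp: Hom_def)
    have "\<forall>i\<in>Obj J. \<exists>n. \<exists>f\<in>\<Sigma>. Dom C f = Cod C (h n) \<and> Cod C f = Do i \<and> peq C T (act C (l i) p) (act C f (a n)) \<and>
        peq C T' (act C (l i) p') (n, f \<cdot> h n)" using rl unfolding rl_def by simp
    then obtain n0 f0 where f0: "\<And>i. i \<in> Obj J \<Longrightarrow> f0 i \<in> \<Sigma> \<and> Dom C (f0 i) = Cod C (h (n0 i)) \<and> Cod C (f0 i) = Do i \<and>
        peq C T (act C (l i) p) (act C (f0 i) (a (n0 i))) \<and> peq C T' (act C (l i) p') (n0 i, f0 i \<cdot> h (n0 i))" by metis
    obtain n where n: "\<And>i. i \<in> Obj J \<Longrightarrow> n0 i \<le> n"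
      using finite_nat_set_iff_bounded_le[of "n0 ` Obj J"] fin by auto
    have "\<forall>i\<in>Obj J. \<exists>f\<in>\<Sigma>. Dom C f = Cod C (h n) \<and> Cod C f = Do i \<and> peq C T (act C (l i) p) (act C f (a n)) \<and>
        peq C T' (act C (l i) p') (n, f \<cdot> h n)" using rlE f0 n by blast
    then obtain f where f: "\<And>i. i \<in> Obj J \<Longrightarrow> f i \<in> \<Sigma>" "\<And>i. i \<in> Obj J \<Longrightarrow> Dom C (f i) = Cod C (h n)"
      "\<And>i. i \<in> Obj J \<Longrightarrow> Cod C (f i) = Do i" "\<And>i. i \<in> Obj J \<Longrightarrow> peq C T (act C (l i) p) (act C (f i) (a n))"
      "\<And>i. i \<in> Obj J \<Longrightarrow> peq C T' (act C (l i) p') (n, f i \<cdot> h n)" by metis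
    \<comment> \<open>The parameters of the components satisfy the equations of the diagram only
      after evaluation at \<open>a n\<close> and \<open>h n\<close>, so they need not form a cone
      yet. The evaluated equation says that the pair lies in the equalizer \<open>e\<close>, which
      belongs to \<open>Mon\<close>; requirement 4 makes \<open>X n j\<close> factor through
      \<open>e\<close>, and from then on the parameters satisfy the equation as arrows.\<close>
    have eqn: "\<exists>j\<ge>n. \<forall>k\<ge>j. Da u \<cdot> (f (Dom J u) \<cdot> X n k) = f (Cod J u) \<cdot> X n k" if u: "u \<in> Arr J" for u
    proof -
      let ?i = "Dom J u" and ?j = "Cod J u"
      note ij = Jo[OF u] and D1 = Da[OF u]
      have fA: "f ?i \<in> Arr C" "f ?j \<in> Arr C" using f(1) ij frag_arr by blast+
      define g where "g = Da u \<cdot> f ?i"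
      have g: "g \<in> \<Sigma>" "g \<in> Arr C" "Dom C g = Cod C (h n)" "Cod C g = Do ?j"
        unfolding g_def using frag_comp[OF f(1)[OF ij(1)] D1(1)] D1 fA f(2,3) ij by simp_all
      obtain e where e: "e \<in> \<Sigma>" "is_equalizer C g (f ?j) e"
        using frag_equalizer[OF g(1) f(1)[OF ij(2)]] f(2,3) ij g by auto
      have eM: "e \<in> Mon C" using regular_mono_mon e(2) unfolding is_regular_mono_def by blast
      have ee: "e \<in> Arr C" "Cod C e = Cod C (h n)" "g \<cdot> e = f ?j \<cdot> e"
        using e(2) unfolding is_equalizer_def Hom_iff g(3) by blast+
      have eq: "below C s (subobj C e)" if s: "s \<in> Arr C" "Cod C s = Cod C (h n)" "g \<cdot> s = f ?j \<cdot> s" for s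
      proof -
        have "s \<in> Hom C (Dom C s) (Dom C g)" using s g by (simp add: Hom_iff)
        then obtain s' where "s' \<in> Hom C (Dom C s) (Dom C e)" "e \<cdot> s' = s"
          using e(2) s(3) unfolding is_equalizer_def by blast
        then show ?thesis using ee eM by (auto simp: below_subobj Hom_iff intro: factors_throughI)
      qed
      have I: "Ident C (Cod C (h n)) \<in> \<Sigma>" "Dom C (Ident C (Cod C (h n))) = Cod C (h n)"
        "Cod C (Ident C (Cod C (h n))) = Cod C (h n)" using frag_ident(2)[OF h(1)[of n]] h(2)[of n] by auto
      have lp: "act C (Da u) (act C (l ?i) p) = act C (l ?j) p"
        using act_comp[OF p(1) l(2,3)[OF ij(1)] D1(2)] D1(3) l(4)[OF ij(1)] lc[OF u] by simp
      have lp': "act C (Da u) (act C (l ?i) p') = act C (l ?j) p'"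
        using act_comp[OF p(2) l(2,3)[OF ij(1)] D1(2)] D1(3) l(4)[OF ij(1)] lc[OF u] by simp
      have "act C g (a n) = act C (Da u) (act C (f ?i) (a n))"
        unfolding g_def using act_comp[OF h(3) fA(1) f(2)[OF ij(1)] D1(2)] D1(3) f(3)[OF ij(1)] by simp
      moreover have "peq C T (act C (Da u) (act C (f ?i) (a n))) (act C (Da u) (act C (l ?i) p))"
        using act_peq[OF T _ _ peq_sym[OF f(4)[OF ij(1)]] D1(2,3)] act_pnt[OF h(3) f(1,2)[OF ij(1)]]
          act_pnt[OF p(1) l(1,3)[OF ij(1)]] f(3)[OF ij(1)] l(4)[OF ij(1)] by simp
      ultimately have "peq C T (act C g (a n)) (act C (f ?j) (a n))"
        unfolding lp using peq_trans f(4)[OF ij(2)] by metis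
      then have S1: "Sat C T (a n) (subobj C e)"
        using eventually_ge_at_top[of "fst (a n)"] unfolding peq_def Sat_def
      proof eventually_elim
        case (elim k)
        show ?case using elim(1) stage_in[OF T h(3) elim(2)] stage_act[OF T h(3) elim(2) g(2,3)]
          stage_act[OF T h(3) elim(2) fA(2) f(2)[OF ij(2)]] by (intro eq) simp_all
      qed
      have fh: "pnt C \<Sigma> T' (Do ?i) (n, f ?i \<cdot> h n)" "pnt C \<Sigma> T' (Do ?j) (n, f ?j \<cdot> h n)"
        using move(7)[OF order_refl f(1,2)] f(3) ij by metis+
      have "act C (Da u) (n, f ?i \<cdot> h n) = (n, g \<cdot> h n)"
        unfolding g_def act_def using D1 fA f(2,3)[OF ij(1)] h by simp
      moreover have "peq C T' (act C (Da u) (n, f ?i \<cdot> h n)) (act C (Da u) (act C (l ?i) p'))"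
        using act_peq[OF tow fh(1) _ peq_sym[OF f(5)[OF ij(1)]] D1(2,3)] act_pnt[OF p(2) l(1,3)[OF ij(1)]]
          l(4)[OF ij(1)] by simp
      ultimately have "peq C T' (n, g \<cdot> h n) (n, f ?j \<cdot> h n)"
        unfolding lp' using peq_trans f(5)[OF ij(2)] by metis
      then have S2: "Sat C T' (n, Ident C (Cod C (h n)) \<cdot> h n) (subobj C e)"
        using eventually_ge_at_top[of n] unfolding peq_def Sat_def
      proof eventually_elim
        case (elim k)
        note rr = r[OF elim(2)]
        have A: "T' n k \<in> Arr C" "Cod C (T' n k) = Dom C (h n)" using XA[OF elim(2)] rr by simp_all
        have "g \<cdot> (h n \<cdot> T' n k) = f ?j \<cdot> (h n \<cdot> T' n k)"
          using elim(1) A g fA(2) f(2)[OF ij(2)] h by (simp add: stage_def)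
        then show ?case using A h unfolding stage_def by (simp add: eq)
      qed
      \<comment> \<open>The task is posed for the identity of \<open>Cod C (h n)\<close>, so that
        \<open>X n j\<close> itself factors through \<open>e\<close>.\<close>
      obtain j k where k: "n \<le> j" "k \<in> \<Sigma>" "Dom C k = Cod C (h j)" "Cod C k = Dom C e" "e \<cdot> k = Ident C (Cod C (h n)) \<cdot> X n j"
        using task4[OF eM e(1) I(1,2) _ _ S2] I(3) ee(2) S1 act_ident[OF h(3)] by auto
      have XD: "Cod C (X n j) = Cod C (h n)" "X n j \<in> Arr C" using r(8)[OF k(1)] XA[OF k(1)] by auto
      have ek: "e \<cdot> k = X n j" using k(5) XD by simp
      have kA: "k \<in> Arr C" using k frag_arr by blast
      have "Da u \<cdot> (f ?i \<cdot> X n j) = g \<cdot> X n j"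
        unfolding g_def using D1 fA f(2,3)[OF ij(1)] XD by (intro assoc[symmetric]) simp_all
      also have "\<dots> = (g \<cdot> e) \<cdot> k" unfolding ek[symmetric] using g ee kA k by (intro assoc[symmetric]) simp_all
      also have "\<dots> = f ?j \<cdot> (e \<cdot> k)" unfolding ee(3) using fA f(2)[OF ij(2)] ee kA k by (intro assoc) simp_all
      finally have base: "Da u \<cdot> (f ?i \<cdot> X n j) = f ?j \<cdot> X n j" unfolding ek .
      have "Da u \<cdot> (f ?i \<cdot> X n k) = f ?j \<cdot> X n k" if jk: "j \<le> k" for k
      proof -
        note Y = r[OF jk] XA[OF jk]
        have XX: "X n k = X n j \<cdot> X j k" "Dom C (X n j) = Cod C (X j k)" using X2[OF k(1) jk] r(7)[OF k(1)] Y by simp_all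
        have "Da u \<cdot> (f ?i \<cdot> X n k) = (Da u \<cdot> (f ?i \<cdot> X n j)) \<cdot> X j k"
          unfolding XX(1) using D1 fA f(2,3)[OF ij(1)] XD XX(2) Y(13) by simp
        also have "\<dots> = f ?j \<cdot> X n k" unfolding base XX(1) using fA f(2)[OF ij(2)] XD XX(2) Y(13) by simp
        finally show ?thesis .
      qed
      then show ?thesis using k(1) by blast
    qed
    have "\<forall>u\<in>Arr J. \<exists>j. n \<le> j \<and> (\<forall>k\<ge>j. Da u \<cdot> (f (Dom J u) \<cdot> X n k) = f (Cod J u) \<cdot> X n k)" using eqn by blast
    then obtain ju where ju: "\<And>u k. u \<in> Arr J \<Longrightarrow> ju u \<le> k \<Longrightarrow> Da u \<cdot> (f (Dom J u) \<cdot> X n k) = f (Cod J u) \<cdot> X n k" by metis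
    obtain j0 where "\<And>u. u \<in> Arr J \<Longrightarrow> ju u \<le> j0"
      using finite_nat_set_iff_bounded_le[of "ju ` Arr J"] fin by auto
    then have j: "n \<le> max n j0" "\<And>u. u \<in> Arr J \<Longrightarrow> Da u \<cdot> (f (Dom J u) \<cdot> X n (max n j0)) = f (Cod J u) \<cdot> X n (max n j0)"
      using ju by (simp, metis max.coboundedI2)
    define j where "j = max n j0"
    \<comment> \<open>Beyond all these stages the parameters form a cone over the diagram; its
      mediating arrow is the parameter for the limit.\<close>
    define x where "x i = f i \<cdot> X n j" for i
    note j = j[folded j_def]
    have x: "x i \<in> \<Sigma>" "Dom C (x i) = Cod C (h j)" "Cod C (x i) = Do i" "peq C T (act C (l i) p) (act C (x i) (a j))"
      "peq C T' (act C (l i) p') (j, x i \<cdot> h j)" if "i \<in> Obj J" for i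
      using move[OF j(1) f(1,2)[OF that]] f(3,4,5)[OF that] unfolding x_def by (auto intro: peq_trans peq_sym)
    have "Cod C (h j) \<in> Obj C" using h(2)[of j] by auto
    then have "is_cone J C Do Da (Cod C (h j)) x" unfolding is_cone_def using x(1-3) frag_arr j(2) by (auto simp: Hom_iff x_def)
    then obtain k0 where k0: "k0 \<in> Hom C (Cod C (h j)) L" "\<forall>i\<in>Obj J. l i \<cdot> k0 = x i"
      using lim unfolding is_limit_def by blast
    obtain js where js: "set js = Obj J" using finite_list[OF fin(1)] by blast
    have zip: "set (zip (map l js) (map x js)) = (\<lambda>i. (l i, x i)) ` Obj J"
      unfolding js[symmetric] by (simp add: zip_map_map zip_same_conv_map)
    have "\<exists>k\<in>\<Sigma>. k \<in> Hom C (Cod C (h j)) L \<and> (\<forall>(l, g)\<in>set (zip (map l js) (map x js)). l \<cdot> k = g)"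
      using L\<Sigma> l(1) x(1) js k0 frag_ident(2)[OF h(1)[of j]] zip by (intro frag_solve[of _ _ _ _ k0]) auto
    then obtain k where k: "k \<in> \<Sigma>" "k \<in> Hom C (Cod C (h j)) L" "\<forall>i\<in>Obj J. l i \<cdot> k = x i" unfolding zip by auto
    have k': "k \<in> Arr C" "Dom C k = Cod C (h j)" "Cod C k = L" using k(2) by (auto simp: Hom_iff)
    have pk: "pnt C \<Sigma> T L (act C k (a j))" using act_pnt[OF h(3) k(1) k'(2)] k'(3) by simp
    have "peq C T (act C (l i) p) (act C (l i) (act C k (a j)))" if "i \<in> Obj J" for i
      using x(4)[OF that] act_comp[OF h(3) k'(1,2) l(2)[OF that]] l(3)[OF that] k'(3) k(3) that by simp
    then have 1: "peq C T p (act C k (a j))" by (rule limit_mono[OF T J lim p(1) pk])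
    have pk': "pnt C \<Sigma> T' L (j, k \<cdot> h j)"
      unfolding pnt_def fst_conv snd_conv D using frag_comp[OF h(1) k(1)] k' h by simp
    have "act C (l i) (j, k \<cdot> h j) = (j, x i \<cdot> h j)" if "i \<in> Obj J" for i
    proof -
      have "l i \<cdot> (k \<cdot> h j) = (l i \<cdot> k) \<cdot> h j" using l[OF that] k' h by (intro assoc[symmetric]) simp_all
      then show ?thesis using k(3) that by (simp add: act_def)
    qed
    then have "peq C T' (act C (l i) p') (act C (l i) (j, k \<cdot> h j))" if "i \<in> Obj J" for i using x(5)[OF that] that by simp
    then have "peq C T' p' (j, k \<cdot> h j)" by (rule limit_mono[OF tow J lim p(2) pk'])
    with 1 show ?thesis using k k' by (intro rlI[of k]) simp_all
  qed
  have "edge C \<Sigma> T T' (a, h)"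
    unfolding edge_def fst_conv snd_conv D
  proof (intro conjI allI ballI impI)
    show "pnt C \<Sigma> T (Cod C (h n)) (a n)" "h n \<in> \<Sigma>" "Dom C (h n) = Dom C (h n)" for n using h by auto
  qed (elim conjE, rule e_dia, assumption+, elim conjE, rule e_mon, assumption+, elim conjE, rule e_quo, assumption+,
      elim conjE, rule e_lim, assumption+)
  moreover have h0: "h 0 = m0" "a 0 = p0" using c0 by (simp_all add: h_def a_def)
  have m0A: "m0 \<in> Arr C" using m0 by simp
  have "pnt C \<Sigma> T' (Dom C m0) (0, Ident C (Dom C m0))"
    unfolding pnt_def fst_conv snd_conv D h0 using frag_ident(1)[OF m0(2)] m0A by simp
  moreover have "?rl (Cod C m0) p0 (act C m0 (0, Ident C (Dom C m0)))"
    using frag_ident(2)[OF m0(2)] m0A h0 act_ident[OF p0]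
    by (intro rlI[of "Ident C (Cod C m0)" _ 0]) (simp_all add: act_def)
  ultimately show ?thesis using M' by blast
qed

end

section \<open>Ultraproducts\<close>

text \<open>Zorn's lemma for the proper filters below \<open>F\<close>, ordered by refinement;
  infima of chains stay proper by \<open>eventually_Inf_base\<close>. A minimal \<open>U\<close>
  decides \<open>P\<close>: its meet with the principal filter of \<open>P\<close> is either trivial
  or \<open>U\<close> itself.\<close>

lemma ultrafilter_below:
  fixes F :: "'i filter"
  assumes "F \<noteq> bot"
  obtains U where "U \<le> F" "U \<noteq> bot" "\<And>P. eventually P U \<or> eventually (\<lambda>x. \<not> P x) U"
proof -
  define A where "A = {G. G \<le> F \<and> G \<noteq> bot}"
  have "\<exists>m\<in>A. \<forall>a\<in>A. a \<le> m \<longrightarrow> a = m"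
  proof (rule predicate_Zorn[of A "\<lambda>x y. y \<le> x"])
    show "partial_order_on A (relation_of (\<lambda>x y. y \<le> x) A)"
      unfolding partial_order_on_def preorder_on_def by (auto simp: relation_of_def refl_on_def trans_def antisym_def)
    fix D assume D: "D \<in> Chains (relation_of (\<lambda>x y. y \<le> x) A)"
    then have DA: "D \<subseteq> A" and ch: "\<And>G H. G \<in> D \<Longrightarrow> H \<in> D \<Longrightarrow> G \<le> H \<or> H \<le> G"
      by (auto simp: Chains_def relation_of_def)
    show "\<exists>u\<in>A. \<forall>a\<in>D. u \<le> a"
    proof (cases "D = {}")
      case True
      then show ?thesis using assms by (auto simp: A_def)
    next
      case False
      have "\<exists>x\<in>D. x \<le> inf G H" if "G \<in> D" "H \<in> D" for G H
        using ch[OF that] that by (auto simp: le_inf_iff)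
      then have "eventually P (Inf D) \<longleftrightarrow> (\<exists>b\<in>D. eventually P b)" for P
        using eventually_Inf_base[OF False] by blast
      then have "Inf D \<noteq> bot" using DA by (auto simp: A_def trivial_limit_def)
      moreover have "Inf D \<le> F" using False DA by (auto simp: A_def intro: Inf_lower2)
      ultimately show ?thesis by (auto simp: A_def intro!: bexI[of _ "Inf D"] Inf_lower)
    qed
  qed
  then obtain U where U: "U \<in> A" and min: "\<And>a. a \<in> A \<Longrightarrow> a \<le> U \<Longrightarrow> a = U" by blast
  have "eventually P U \<or> eventually (\<lambda>x. \<not> P x) U" for P
  proof (cases "inf U (principal {x. P x}) = bot")
    case True
    then have "eventually (\<lambda>x. False) (inf U (principal {x. P x}))" by (simp add: trivial_limit_def)
    then show ?thesis by (simp add: eventually_inf_principal)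
  next
    case False
    then have "inf U (principal {x. P x}) \<in> A" using U by (auto simp: A_def intro: le_infI1)
    then have eq: "inf U (principal {x. P x}) = U" by (intro min) simp_all
    have "eventually P (inf U (principal {x. P x}))" by (simp add: eventually_inf_principal)
    then show ?thesis unfolding eq by blast
  qed
  then show ?thesis using U that by (auto simp: A_def)
qed

text \<open>Points are families indexed by \<open>'i\<close>, and only their behaviour at almost all
  indices counts; no quotient is formed yet, \<open>ueq\<close> takes its role. By
  \<open>U_in\<close> any finite set of arrows lies in almost all fragments, which suffices to
  transfer each statement.\<close>

locale ultra = boolean_modal_category_with_quotients C
  for C :: "('o, 'a, 'z) modal_quot_cat_scheme" (structure) +
  fixes U :: "'i filter" and Sg :: "'i \<Rightarrow> 'a set"
  assumes U_bot: "U \<noteq> bot" and U_ultra: "eventually P U \<or> eventually (\<lambda>x. \<not> P x) U"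
    and U_frag: "\<forall>\<^sub>F i in U. fragment C (Sg i)" and U_in: "f \<in> Arr C \<Longrightarrow> \<forall>\<^sub>F i in U. f \<in> Sg i"
begin

definition unode :: "('i \<Rightarrow> nat \<Rightarrow> nat \<Rightarrow> 'a) \<Rightarrow> bool" where
  "unode \<alpha> \<longleftrightarrow> (\<forall>\<^sub>F i in U. model C (Sg i) (\<alpha> i))"

definition upnt :: "('i \<Rightarrow> nat \<Rightarrow> nat \<Rightarrow> 'a) \<Rightarrow> 'o \<Rightarrow> ('i \<Rightarrow> nat \<times> 'a) \<Rightarrow> bool" where
  "upnt \<alpha> X p \<longleftrightarrow> (\<forall>\<^sub>F i in U. pnt C (Sg i) (\<alpha> i) X (p i))"

definition ueq :: "('i \<Rightarrow> nat \<Rightarrow> nat \<Rightarrow> 'a) \<Rightarrow> ('i \<Rightarrow> nat \<times> 'a) \<Rightarrow> ('i \<Rightarrow> nat \<times> 'a) \<Rightarrow> bool" where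
  "ueq \<alpha> p p' \<longleftrightarrow> (\<forall>\<^sub>F i in U. peq C (\<alpha> i) (p i) (p' i))"

definition uact :: "'a \<Rightarrow> ('i \<Rightarrow> nat \<times> 'a) \<Rightarrow> 'i \<Rightarrow> nat \<times> 'a" where
  "uact f p i = act C f (p i)"

definition USat :: "('i \<Rightarrow> nat \<Rightarrow> nat \<Rightarrow> 'a) \<Rightarrow> ('i \<Rightarrow> nat \<times> 'a) \<Rightarrow> 'a set \<Rightarrow> bool" where
  "USat \<alpha> p S \<longleftrightarrow> (\<forall>\<^sub>F i in U. Sat C (\<alpha> i) (p i) S)"

definition uedge where
  "uedge \<alpha> \<beta> \<kappa> \<longleftrightarrow> (\<forall>\<^sub>F i in U. edge C (Sg i) (\<alpha> i) (\<beta> i) (\<kappa> i))"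

definition url where
  "url \<alpha> \<beta> \<kappa> X p p' \<longleftrightarrow> (\<forall>\<^sub>F i in U. rl C (Sg i) (\<alpha> i) (\<beta> i) (\<kappa> i) X (p i) (p' i))"

lemma ueq_refl [simp]: "ueq \<alpha> p p"
  by (simp add: ueq_def)

lemma ueq_sym: "ueq \<alpha> p p' \<Longrightarrow> ueq \<alpha> p' p"
  unfolding ueq_def by (erule eventually_mono) (rule peq_sym)

lemma ueq_trans: "ueq \<alpha> p p' \<Longrightarrow> ueq \<alpha> p' p'' \<Longrightarrow> ueq \<alpha> p p''"
  unfolding ueq_def by (erule eventually_rev_mp, erule eventually_mono) (blast intro: peq_trans)

lemma url_ueq:
  assumes "url \<alpha> \<beta> \<kappa> X p p'" "ueq \<alpha> p q" "ueq \<beta> p' q'"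
  shows "url \<alpha> \<beta> \<kappa> X q q'"
  using assms unfolding url_def ueq_def by eventually_elim (rule rl_peq)

lemma U_in2:
  assumes "finite B" "B \<subseteq> Arr C"
  shows "\<forall>\<^sub>F i in U. B \<subseteq> Sg i"
proof -
  have "\<forall>f\<in>B. \<forall>\<^sub>F i in U. f \<in> Sg i" using U_in assms(2) by blast
  from eventually_ball_finite[OF assms(1) this] show ?thesis unfolding subset_eq .
qed

lemma uact_pnt:
  assumes "upnt \<alpha> X p" "f \<in> Arr C" "Dom C f = X"
  shows "upnt \<alpha> (Cod C f) (uact f p)"
  using assms(1) U_frag U_in[OF assms(2)] unfolding upnt_def uact_def
  by eventually_elim (rule fragment.act_pnt[OF _ _ _ assms(3)])

lemma uact_eq:
  assumes "unode \<alpha>" "upnt \<alpha> X p" "upnt \<alpha> X p'" "ueq \<alpha> p p'" "f \<in> Arr C" "Dom C f = X"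
  shows "ueq \<alpha> (uact f p) (uact f p')"
  using assms(1-4) U_frag unfolding unode_def upnt_def ueq_def uact_def
  by eventually_elim (rule fragment.act_peq[OF _ fragment.modelD(1) _ _ _ assms(5,6)])

lemma uact_ident:
  assumes "upnt \<alpha> X p"
  shows "ueq \<alpha> (uact (Ident C X) p) p"
  using assms U_frag unfolding upnt_def ueq_def uact_def
  by eventually_elim (simp add: fragment.act_ident)

lemma uact_comp:
  assumes "upnt \<alpha> X p" "f \<in> Arr C" "Dom C f = X" "g \<in> Arr C" "Dom C g = Cod C f"
  shows "ueq \<alpha> (uact (g \<cdot> f) p) (uact g (uact f p))"
  using assms(1) U_frag unfolding upnt_def ueq_def uact_def
  by eventually_elim (simp add: fragment.act_comp[OF _ _ assms(2-5)])

text \<open>Preimages under \<open>m\<close> exist at almost all indices;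
  \<open>eventually_ex\<close> collects them into one family. The later existence statements pass to
  the ultraproduct in the same way.\<close>

lemma u_lift:
  assumes a: "unode \<alpha>" and p: "upnt \<alpha> X p" and S: "S \<in> carrier (Sub C X)" "m \<in> S"
  shows "USat \<alpha> p S \<longleftrightarrow> (\<exists>p'. upnt \<alpha> (Dom C m) p' \<and> ueq \<alpha> (uact m p') p)"
proof -
  have m: "m \<in> Mon C" "Cod C m = X" "subobj C m = S" using Sub_mem[OF S] by auto
  have mA: "m \<in> Arr C" using m by simp
  show ?thesis
  proof
    assume "USat \<alpha> p S"
    then have "\<forall>\<^sub>F i in U. \<exists>p'. pnt C (Sg i) (\<alpha> i) (Dom C m) p' \<and> peq C (\<alpha> i) (act C m p') (p i)"
      using a p U_frag U_in[OF mA] unfolding USat_def unode_def upnt_def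
    proof eventually_elim
      case (elim i)
      interpret F: fragment C "Sg i" by fact
      show ?case using F.Sat_lift[OF F.modelD(1)[OF elim(2)] m(1) elim(5)] elim m by simp
    qed
    then show "\<exists>p'. upnt \<alpha> (Dom C m) p' \<and> ueq \<alpha> (uact m p') p"
      unfolding eventually_ex eventually_conj_iff upnt_def ueq_def uact_def .
  next
    assume "\<exists>p'. upnt \<alpha> (Dom C m) p' \<and> ueq \<alpha> (uact m p') p"
    then obtain p' where p': "upnt \<alpha> (Dom C m) p'" "ueq \<alpha> (uact m p') p" by blast
    show "USat \<alpha> p S" using p' a U_frag unfolding USat_def unode_def upnt_def ueq_def uact_def
    proof eventually_elim
      case (elim i)
      interpret F: fragment C "Sg i" by fact
      show ?case using Sat_peq[OF elim(2) F.Sat_act_mon[OF F.modelD(1)[OF elim(3)] m(1) elim(1)]] m by simp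
    qed
  qed
qed

lemma u_perp:
  assumes "unode \<alpha>" "e \<in> Mperp C" "upnt \<alpha> (Cod C e) p"
  shows "\<exists>p'. upnt \<alpha> (Dom C e) p' \<and> ueq \<alpha> (uact e p') p"
proof -
  have "\<forall>\<^sub>F i in U. \<exists>p'. pnt C (Sg i) (\<alpha> i) (Dom C e) p' \<and> peq C (\<alpha> i) (act C e p') (p i)"
    using assms(1,3) U_frag U_in[OF Mperp_arr[OF assms(2)]] unfolding unode_def upnt_def
    by eventually_elim (rule fragment.modelD(2)[OF _ _ _ assms(2)])
  then show ?thesis unfolding eventually_ex eventually_conj_iff upnt_def ueq_def uact_def .
qed

lemma u_mon:
  assumes "unode \<alpha>" "m \<in> Mon C" "upnt \<alpha> (Dom C m) p" "upnt \<alpha> (Dom C m) p'" "ueq \<alpha> (uact m p) (uact m p')"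
  shows "ueq \<alpha> p p'"
  using assms(1,3-5) U_frag unfolding unode_def upnt_def ueq_def uact_def
  by eventually_elim (rule fragment.mon_peq[OF _ fragment.modelD(1) assms(2)])

text \<open>At almost all indices one of the two alternatives holds; maximality of \<open>U\<close>
  is needed to find one alternative that holds at almost all of them.\<close>

lemma u_join:
  assumes a: "unode \<alpha>" and j: "is_join C X S T L" and p: "upnt \<alpha> X p" and L: "USat \<alpha> p L"
  shows "USat \<alpha> p S \<or> USat \<alpha> p T"
proof -
  have "S \<in> carrier (Sub C X)" using j by (simp add: is_join_def)
  then obtain m where m: "m \<in> Mon C" "S = subobj C m" by (rule SubE)
  have mA: "m \<in> Arr C" using m by simp
  have "\<forall>\<^sub>F i in U. Sat C (\<alpha> i) (p i) S \<or> Sat C (\<alpha> i) (p i) T"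
    using a p L U_frag U_in[OF mA] unfolding USat_def unode_def upnt_def
  proof eventually_elim
    case (elim i)
    interpret F: fragment C "Sg i" by fact
    show ?case using F.Sat_join[OF elim(1) j[unfolded m] m(1) elim(5,2,3)] m by simp
  qed
  moreover have "(\<forall>\<^sub>F i in U. Sat C (\<alpha> i) (p i) S) \<or> (\<forall>\<^sub>F i in U. \<not> Sat C (\<alpha> i) (p i) S)" by (rule U_ultra)
  ultimately show ?thesis unfolding USat_def
    by (elim disjE) (simp, intro disjI2, erule eventually_rev_mp, erule eventually_mono, blast)
qed

text \<open>A point of \<open>X\<close> is represented by an arrow from a stage of the tower into
  \<open>X\<close>. With \<open>X\<close> null, that arrow factors through the least subobject,
  which makes the stage null.\<close>

lemma u_null:
  assumes "unode \<alpha>" "null C X" "upnt \<alpha> X p"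
  shows False
proof -
  have "\<forall>\<^sub>F i in U. False"
    using assms(1,3) U_frag unfolding unode_def upnt_def
  proof eventually_elim
    case (elim i)
    interpret F: fragment C "Sg i" by fact
    have g: "snd (p i) \<in> Arr C" "Cod C (snd (p i)) = X" "Dom C (snd (p i)) = Dom C (\<alpha> i (fst (p i)) (fst (p i)))"
      using F.pntD[OF elim(2)] by auto
    have "null C (Dom C (snd (p i)))"
      unfolding null_def
    proof
      fix S assume S: "S \<in> carrier (Sub C (Dom C (snd (p i))))"
      have "below C (snd (p i)) B" if "B \<in> carrier (Sub C X)" for B
        using below_comp[of "Ident C X" B X "snd (p i)"] that assms(2) g unfolding null_def by auto
      obtain B where B: "B \<in> carrier (Sub C X)" "\<And>V. V \<in> carrier (Sub C X) \<Longrightarrow> B \<sqsubseteq>\<^bsub>Sub C X\<^esub> V"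
        using bot_ex[of X] g by (metis cod_obj)
      have "below C (snd (p i)) B" by (rule \<open>\<And>B. B \<in> carrier (Sub C X) \<Longrightarrow> below C (snd (p i)) B\<close>[OF B(1)])
      then show "below C (Ident C (Dom C (snd (p i)))) S" using bot_null[OF B] S unfolding null_def by blast
    qed
    then show ?case using F.modelD(4)[OF elim(1)] g by simp
  qed
  then show False using U_bot by simp
qed

lemma u_disj:
  assumes "unode \<alpha>" "upnt \<alpha> X p" "is_compl C X S T" "USat \<alpha> p S" "USat \<alpha> p T"
  shows False
proof -
  have "\<forall>\<^sub>F i in U. False"
    using assms(1,2,4,5) U_frag unfolding unode_def upnt_def USat_def
  proof eventually_elim
    case (elim i)
    interpret F: fragment C "Sg i" by fact
    have "\<forall>\<^sub>F j in sequentially. fst (p i) \<le> j \<and> below C (stage C (\<alpha> i) (p i) j) S \<and> below C (stage C (\<alpha> i) (p i) j) T"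
      using elim(3,4) eventually_ge_at_top[of "fst (p i)"] unfolding Sat_def by eventually_elim blast
    then obtain j where j: "fst (p i) \<le> j" "below C (stage C (\<alpha> i) (p i) j) S" "below C (stage C (\<alpha> i) (p i) j) T"
      unfolding eventually_sequentially by blast
    then have "null C (Dom C (stage C (\<alpha> i) (p i) j))" using assms(3) unfolding is_compl_def by blast
    then show ?case using F.stage_in(3)[OF F.modelD(1)[OF elim(1)] elim(2) j(1)] F.modelD(4)[OF elim(1)] by simp
  qed
  then show False using U_bot by simp
qed

text \<open>The diagram is finite, so almost all fragments contain the legs of the limit cone, and
  the finitely many compatibilities hold there at once.\<close>

lemma u_limit:
  assumes a: "unode \<alpha>" and J: "finite_diagram J C Do Da" and lim: "is_limit J C Do Da L l"
    and z: "\<And>i. i \<in> Obj J \<Longrightarrow> upnt \<alpha> (Do i) (z i)"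
    and eq: "\<And>u. u \<in> Arr J \<Longrightarrow> ueq \<alpha> (uact (Da u) (z (Dom J u))) (z (Cod J u))"
  shows "\<exists>p. upnt \<alpha> L p \<and> (\<forall>i\<in>Obj J. ueq \<alpha> (uact (l i) p) (z i))"
proof -
  have fin: "finite (Obj J)" "finite (Arr J)" using J by (auto simp: finite_diagram_def)
  have l: "l i \<in> Arr C" if "i \<in> Obj J" for i using lim that by (auto simp: is_limit_def is_cone_def Hom_iff)
  have lA: "l ` Obj J \<subseteq> Arr C" using l by blast
  have L: "Ident C L \<in> Arr C" using lim by (auto simp: is_limit_def is_cone_def)
  have 1: "\<forall>\<^sub>F k in U. \<forall>i\<in>Obj J. pnt C (Sg k) (\<alpha> k) (Do i) (z i k)"
    using z fin by (intro eventually_ball_finite) (auto simp: upnt_def)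
  have 2: "\<forall>\<^sub>F k in U. \<forall>u\<in>Arr J. peq C (\<alpha> k) (act C (Da u) (z (Dom J u) k)) (z (Cod J u) k)"
    using eq fin by (intro eventually_ball_finite) (auto simp: ueq_def uact_def)
  have "\<forall>\<^sub>F k in U. \<exists>p. pnt C (Sg k) (\<alpha> k) L p \<and> (\<forall>i\<in>Obj J. peq C (\<alpha> k) (act C (l i) p) (z i k))"
    using a U_frag U_in[OF L] U_in2[OF finite_imageI[OF fin(1)] lA] 1 2 unfolding unode_def
  proof eventually_elim
    case (elim k)
    interpret F: fragment C "Sg k" by fact
    show ?case using elim(4,5,6)
      by (intro F.limit_lift[OF F.modelD(1)[OF elim(1)] J lim elim(3)]) auto
  qed
  then show ?thesis unfolding eventually_ex eventually_conj_iff upnt_def ueq_def uact_def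
    by (simp add: eventually_ball_finite_distrib[OF fin(1)])
qed

lemma u_limit_mono:
  assumes a: "unode \<alpha>" and J: "finite_diagram J C Do Da" and lim: "is_limit J C Do Da L l"
    and p: "upnt \<alpha> L p" "upnt \<alpha> L p'" "\<And>i. i \<in> Obj J \<Longrightarrow> ueq \<alpha> (uact (l i) p) (uact (l i) p')"
  shows "ueq \<alpha> p p'"
proof -
  have fin: "finite (Obj J)" using J by (auto simp: finite_diagram_def)
  have "\<forall>\<^sub>F k in U. \<forall>i\<in>Obj J. peq C (\<alpha> k) (act C (l i) (p k)) (act C (l i) (p' k))"
    using p(3) fin by (intro eventually_ball_finite) (auto simp: ueq_def uact_def)
  then show ?thesis using a U_frag p(1,2) unfolding unode_def upnt_def ueq_def
  proof eventually_elim
    case (elim k)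
    interpret F: fragment C "Sg k" by fact
    show ?case using elim(1) by (intro F.limit_mono[OF F.modelD(1)[OF elim(2)] J lim elim(4,5)]) auto
  qed
qed

text \<open>The new tower, relation and point are found index by index with
  \<open>edge_exists\<close>, applied to a representative of \<open>S\<close> that lies in almost
  all fragments.\<close>

lemma u_dia:
  assumes a: "unode \<alpha>" and p: "upnt \<alpha> X p" and S: "S \<in> carrier (Sub C X)" and D: "USat \<alpha> p (Dia C X S)"
  shows "\<exists>\<beta> \<kappa> p'. unode \<beta> \<and> uedge \<alpha> \<beta> \<kappa> \<and> upnt \<beta> X p' \<and> USat \<beta> p' S \<and> url \<alpha> \<beta> \<kappa> X p p'"
proof -
  obtain m where m: "m \<in> Mon C" "Cod C m = X" "S = subobj C m" using S by (rule SubE)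
  have mA: "m \<in> Arr C" using m by simp
  have "\<forall>\<^sub>F i in U. \<exists>T' \<kappa> p'. model C (Sg i) T' \<and> edge C (Sg i) (\<alpha> i) T' \<kappa> \<and> pnt C (Sg i) T' X p' \<and>
    Sat C T' p' S \<and> rl C (Sg i) (\<alpha> i) T' \<kappa> X (p i) p'"
    using a p D U_frag U_in[OF mA] unfolding USat_def unode_def upnt_def
  proof eventually_elim
    case (elim i)
    interpret F: fragment C "Sg i" by fact
    obtain T' \<kappa> p' where *: "model C (Sg i) T'" "edge C (Sg i) (\<alpha> i) T' \<kappa>" "pnt C (Sg i) T' (Dom C m) p'"
      "rl C (Sg i) (\<alpha> i) T' \<kappa> X (p i) (act C m p')"
      using F.edge_exists[OF elim(1) m(1) elim(5), of "p i"] elim(2,3) m(2,3) by blast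
    then show ?case using F.act_pnt[OF *(3) elim(5) refl] F.Sat_act_mon[OF F.modelD(1)[OF *(1)] m(1) *(3)] m(2,3) by blast
  qed
  then show ?thesis unfolding eventually_ex eventually_conj_iff unode_def uedge_def upnt_def USat_def url_def .
qed

lemma u_dia_converse:
  assumes "uedge \<alpha> \<beta> \<kappa>" "S \<in> carrier (Sub C X)" "USat \<beta> p' S" "url \<alpha> \<beta> \<kappa> X p p'"
  shows "USat \<alpha> p (Dia C X S)"
  using assms(1,3,4) unfolding USat_def uedge_def url_def
proof eventually_elim
  case (elim i)
  then show ?case using assms(2) unfolding edge_def by blast
qed

lemma u_rel_mon:
  assumes "uedge \<alpha> \<beta> \<kappa>" "m \<in> Mon C" "upnt \<alpha> (Dom C m) p" "upnt \<beta> (Dom C m) p'"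
    "url \<alpha> \<beta> \<kappa> (Cod C m) (uact m p) (uact m p')"
  shows "url \<alpha> \<beta> \<kappa> (Dom C m) p p'"
  using assms(1,3-5) U_in[OF mon_arr[OF assms(2)]] unfolding uedge_def url_def upnt_def uact_def
proof eventually_elim
  case (elim i)
  then show ?case using assms(2) unfolding edge_def by blast
qed

lemma u_rel_quo:
  assumes "uedge \<alpha> \<beta> \<kappa>" "q \<in> Quo C" "url \<alpha> \<beta> \<kappa> (Cod C q) p p'"
  shows "\<exists>s s'. upnt \<alpha> (Dom C q) s \<and> upnt \<beta> (Dom C q) s' \<and> url \<alpha> \<beta> \<kappa> (Dom C q) s s' \<and>
    ueq \<alpha> (uact q s) p \<and> ueq \<beta> (uact q s') p'"
proof -
  have q: "q \<in> Arr C" using assms(2) quo_Mperp by auto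
  have "\<forall>\<^sub>F i in U. \<exists>s s'. pnt C (Sg i) (\<alpha> i) (Dom C q) s \<and> pnt C (Sg i) (\<beta> i) (Dom C q) s' \<and>
    rl C (Sg i) (\<alpha> i) (\<beta> i) (\<kappa> i) (Dom C q) s s' \<and> peq C (\<alpha> i) (act C q s) (p i) \<and> peq C (\<beta> i) (act C q s') (p' i)"
    using assms(1,3) U_in[OF q] unfolding uedge_def url_def
  proof eventually_elim
    case (elim i)
    then show ?case using assms(2) unfolding edge_def by blast
  qed
  then show ?thesis unfolding eventually_ex eventually_conj_iff upnt_def url_def ueq_def uact_def .
qed

lemma u_rel_limit:
  assumes e: "uedge \<alpha> \<beta> \<kappa>" and J: "finite_diagram J C Do Da" and lim: "is_limit J C Do Da L l"
    and p: "upnt \<alpha> L p" "upnt \<beta> L p'" "\<And>i. i \<in> Obj J \<Longrightarrow> url \<alpha> \<beta> \<kappa> (Do i) (uact (l i) p) (uact (l i) p')"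
  shows "url \<alpha> \<beta> \<kappa> L p p'"
proof -
  interpret F: category_functor J C Do Da using J by (simp add: finite_diagram_def)
  have fin: "finite (Obj J)" "finite (Arr J)" using J by (auto simp: finite_diagram_def)
  have l: "l ` Obj J \<subseteq> Arr C" using lim by (auto simp: is_limit_def is_cone_def Hom_iff)
  have Da: "Da ` Arr J \<subseteq> Arr C" using F.map_hom by (auto simp: Hom_def)
  have L: "Ident C L \<in> Arr C" using lim by (auto simp: is_limit_def is_cone_def)
  have "\<forall>\<^sub>F k in U. \<forall>i\<in>Obj J. rl C (Sg k) (\<alpha> k) (\<beta> k) (\<kappa> k) (Do i) (act C (l i) (p k)) (act C (l i) (p' k))"
    using p(3) fin by (intro eventually_ball_finite) (auto simp: url_def uact_def)
  then show ?thesis using e p(1,2) U_in[OF L] U_in2[OF finite_imageI[OF fin(1)] l] U_in2[OF finite_imageI[OF fin(2)] Da]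
    unfolding uedge_def url_def upnt_def
  proof eventually_elim
    case (elim k)
    have "finite_diagram J C Do Da \<and> is_limit J C Do Da L l \<and> Da ` Arr J \<subseteq> Sg k \<and> l ` Obj J \<subseteq> Sg k \<and>
        Ident C L \<in> Sg k \<and> pnt C (Sg k) (\<alpha> k) L (p k) \<and> pnt C (Sg k) (\<beta> k) L (p' k) \<and>
        (\<forall>i\<in>Obj J. rl C (Sg k) (\<alpha> k) (\<beta> k) (\<kappa> k) (Do i) (act C (l i) (p k)) (act C (l i) (p' k)))"
      using J lim elim by blast
    moreover note elim(2)[unfolded edge_def, THEN conjunct2, THEN conjunct2, THEN conjunct2, THEN conjunct2, THEN conjunct2]
    ultimately show ?case by metis
  qed
qed

text \<open>A related pair is the image of a condition under a parameter \<open>g\<close>; its image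
  under \<open>f\<close> has the parameter \<open>f . g\<close>.\<close>

lemma u_rel_act:
  assumes "uedge \<alpha> \<beta> \<kappa>" "unode \<alpha>" "unode \<beta>" "upnt \<alpha> X p" "upnt \<beta> X p'" "url \<alpha> \<beta> \<kappa> X p p'" "f \<in> Arr C" "Dom C f = X"
  shows "url \<alpha> \<beta> \<kappa> (Cod C f) (uact f p) (uact f p')"
  using assms(1-6) U_frag U_in[OF assms(7)] unfolding uedge_def unode_def url_def upnt_def uact_def
proof eventually_elim
  case (elim i)
  interpret F: fragment C "Sg i" by fact
  obtain n g where g: "g \<in> Sg i" "Dom C g = Cod C (snd (\<kappa> i) n)" "Cod C g = X"
    "peq C (\<alpha> i) (p i) (act C g (fst (\<kappa> i) n))" "peq C (\<beta> i) (p' i) (n, g \<cdot> snd (\<kappa> i) n)"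
    using elim(6) unfolding rl_def by blast
  have e: "pnt C (Sg i) (\<alpha> i) (Cod C (snd (\<kappa> i) n)) (fst (\<kappa> i) n)" "snd (\<kappa> i) n \<in> Sg i"
    "Dom C (snd (\<kappa> i) n) = Dom C (\<beta> i n n)" using elim(1) unfolding edge_def by blast+
  have A: "g \<in> Arr C" "snd (\<kappa> i) n \<in> Arr C" using F.frag_arr g(1) e(2) by blast+
  have pg: "pnt C (Sg i) (\<alpha> i) X (act C g (fst (\<kappa> i) n))" using F.act_pnt[OF e(1) g(1,2)] g(3) by simp
  have "pnt C (Sg i) (\<beta> i) X (n, g \<cdot> snd (\<kappa> i) n)"
    using F.frag_comp[OF e(2) g(1)] A g e by (simp add: pnt_def)
  from F.act_peq[OF F.modelD(1)[OF elim(3)] elim(5) this g(5) assms(7,8)]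
  have 2: "peq C (\<beta> i) (act C f (p' i)) (n, (f \<cdot> g) \<cdot> snd (\<kappa> i) n)"
    using A g assms(7,8) by (simp add: act_def)
  have 1: "peq C (\<alpha> i) (act C f (p i)) (act C (f \<cdot> g) (fst (\<kappa> i) n))"
    using F.act_peq[OF F.modelD(1)[OF elim(2)] elim(4) pg g(4) assms(7,8)]
      F.act_comp[OF e(1) A(1) g(2) assms(7)] assms(8) g(3) by simp
  have "f \<cdot> g \<in> Sg i" "Dom C (f \<cdot> g) = Cod C (snd (\<kappa> i) n)" "Cod C (f \<cdot> g) = Cod C f"
    using F.frag_comp[OF g(1) elim(8)] assms(7,8) A g by simp_all
  then show ?case using 1 2 unfolding rl_def by blast
qed

text \<open>A tower may start at any non-null object; the point is the identity of \<open>Y\<close>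
  at stage 0.\<close>

lemma u_conservative:
  assumes "Y \<in> Obj C" "\<not> null C Y"
  shows "\<exists>\<alpha> p. unode \<alpha> \<and> upnt \<alpha> Y p"
proof -
  have I: "Ident C Y \<in> Arr C" using assms by simp
  have "\<forall>\<^sub>F i in U. \<exists>T p. model C (Sg i) T \<and> pnt C (Sg i) T Y p"
    using U_frag U_in[OF I]
  proof eventually_elim
    case (elim i)
    interpret F: fragment C "Sg i" by fact
    obtain T where "model C (Sg i) T" "Dom C (T 0 0) = Y" using F.model_exists[OF elim(2) assms] .
    then show ?case using elim(2) assms by (intro exI[of _ T] exI[of _ "(0, Ident C Y)"]) (simp add: pnt_def)
  qed
  then show ?thesis unfolding eventually_ex eventually_conj_iff unode_def upnt_def .
qed

end

section \<open>Relational sets form a Boolean modal category with quotients\<close>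

lemma Rel_sel [simp]:
  "Obj (Rel G) = rsets G" "Arr (Rel G) = rmaps G" "Dom (Rel G) = src" "Cod (Rel G) = trg"
  "Mon (Rel G) = rmono G" "Quo (Rel G) = rquot G"
  by (simp_all add: Rel_def)

definition mk :: "('n, 'e) pre_digraph \<Rightarrow> ('n, 'e, 'u) rset \<Rightarrow> ('n, 'e, 'u) rset \<Rightarrow> ('n \<Rightarrow> 'u \<Rightarrow> 'u) \<Rightarrow> ('n, 'e, 'u) rmap" where
  "mk G X Y \<phi> = \<lparr>src = X, trg = Y, fn = (\<lambda>\<alpha>\<in>verts G. \<lambda>x\<in>pts X \<alpha>. \<phi> \<alpha> x)\<rparr>"

definition img :: "('n, 'e, 'u) rmap \<Rightarrow> 'n \<Rightarrow> 'u set" where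
  "img m \<alpha> = fn m \<alpha> ` pts (src m) \<alpha>"

definition ofp :: "('n, 'e) pre_digraph \<Rightarrow> ('n, 'e, 'u) rset \<Rightarrow> ('n \<Rightarrow> 'u set) \<Rightarrow> ('n, 'e, 'u) rmap set" where
  "ofp G X P = {m \<in> rmono G. trg m = X \<and> (\<forall>\<alpha>\<in>verts G. fn m \<alpha> ` pts (src m) \<alpha> = P \<alpha>)}"

definition restr :: "('n, 'e) pre_digraph \<Rightarrow> ('n, 'e, 'u) rset \<Rightarrow> ('n \<Rightarrow> 'u set) \<Rightarrow> ('n, 'e, 'u) rset" where
  "restr G X P = \<lparr>pts = P, rel = (\<lambda>k. if k \<in> arcs G then rel X k \<inter> P (tail G k) \<times> P (head G k) else {})\<rparr>"

definition incl :: "('n, 'e) pre_digraph \<Rightarrow> ('n, 'e, 'u) rset \<Rightarrow> ('n \<Rightarrow> 'u set) \<Rightarrow> ('n, 'e, 'u) rmap" where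
  "incl G X P = mk G (restr G X P) X (\<lambda>\<alpha> x. x)"

definition ptob :: "'n \<Rightarrow> 'u \<Rightarrow> ('n, 'e, 'u) rset" where
  "ptob \<alpha> a = \<lparr>pts = (\<lambda>\<beta>. if \<beta> = \<alpha> then {a} else {}), rel = (\<lambda>_. {})\<rparr>"

text \<open>The walking edge \<open>k\<close>, which represents related pairs. Over a loop both
  endpoints belong to one carrier, which is why the two elements used for it, \<open>pa\<close> and
  \<open>pb\<close>, are kept distinct.\<close>

definition edob :: "('n, 'e) pre_digraph \<Rightarrow> 'e \<Rightarrow> 'u \<Rightarrow> 'u \<Rightarrow> ('n, 'e, 'u) rset" where
  "edob G k a b = \<lparr>pts = (\<lambda>\<beta>. {x. (\<beta> = tail G k \<and> x = a) \<or> (\<beta> = head G k \<and> x = b)}),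
     rel = (\<lambda>k'. if k' = k then {(a, b)} else {})\<rparr>"

text \<open>The coding \<open>tup\<close> of sequences of elements puts finite limits into the universe \<^typ>\<open>'u\<close>.\<close>

locale relcat = wf_digraph G for G :: "('n, 'e) pre_digraph" +
  fixes tup :: "(nat \<Rightarrow> 'u) \<Rightarrow> 'u" and pa pb :: 'u
  assumes tup_inj: "inj tup" and pab: "pa \<noteq> pb"
begin

abbreviation RR :: "(('n, 'e, 'u) rset, ('n, 'e, 'u) rmap) modal_quot_cat" where
  "RR \<equiv> Rel G"

lemma rsetsI:
  assumes "\<And>\<alpha>. \<alpha> \<notin> verts G \<Longrightarrow> pts X \<alpha> = {}" "\<And>k. k \<notin> arcs G \<Longrightarrow> rel X k = {}"
    "\<And>k s t. k \<in> arcs G \<Longrightarrow> (s, t) \<in> rel X k \<Longrightarrow> s \<in> pts X (tail G k) \<and> t \<in> pts X (head G k)"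
  shows "X \<in> rsets G"
  using assms by (auto simp: rsets_def)

lemma rsetsD:
  assumes "X \<in> rsets G"
  shows "x \<in> pts X \<alpha> \<Longrightarrow> \<alpha> \<in> verts G" "(s, t) \<in> rel X k \<Longrightarrow> k \<in> arcs G"
    "(s, t) \<in> rel X k \<Longrightarrow> s \<in> pts X (tail G k)" "(s, t) \<in> rel X k \<Longrightarrow> t \<in> pts X (head G k)"
  using assms by (auto simp: rsets_def)

lemma rmapsD:
  assumes "f \<in> rmaps G"
  shows "src f \<in> rsets G" "trg f \<in> rsets G" "x \<in> pts (src f) \<alpha> \<Longrightarrow> fn f \<alpha> x \<in> pts (trg f) \<alpha>"
    "(s, t) \<in> rel (src f) k \<Longrightarrow> (fn f (tail G k) s, fn f (head G k) t) \<in> rel (trg f) k"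
proof -
  show 1: "src f \<in> rsets G" "trg f \<in> rsets G" using assms by (auto simp: rmaps_def)
  show "fn f \<alpha> x \<in> pts (trg f) \<alpha>" if "x \<in> pts (src f) \<alpha>"
    using assms rsetsD(1)[OF 1(1) that] that by (auto simp: rmaps_def PiE_iff)
  show "(fn f (tail G k) s, fn f (head G k) t) \<in> rel (trg f) k" if "(s, t) \<in> rel (src f) k"
    using assms rsetsD(2)[OF 1(1) that] that by (auto simp: rmaps_def)
qed

lemma rmap_eqI:
  assumes f: "f \<in> rmaps G" and g: "g \<in> rmaps G" and "src f = src g" "trg f = trg g"
    and eq: "\<And>\<alpha> x. x \<in> pts (src f) \<alpha> \<Longrightarrow> fn f \<alpha> x = fn g \<alpha> x"
  shows "f = g"
proof -
  have P: "fn h \<in> (\<Pi>\<^sub>E \<alpha> \<in> verts G. pts (src h) \<alpha> \<rightarrow>\<^sub>E pts (trg h) \<alpha>)" if "h \<in> rmaps G" for h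
    using that by (simp add: rmaps_def)
  note Pf = P[OF f] and Pg = P[OF g, folded assms(3,4)]
  have "fn f = fn g"
    using Pf Pg by (rule PiE_ext) (rule PiE_ext[OF PiE_mem[OF Pf] PiE_mem[OF Pg]], assumption+, rule eq)
  then show ?thesis using assms(3,4) by simp
qed

lemma mk_sel [simp]: "src (mk G X Y \<phi>) = X" "trg (mk G X Y \<phi>) = Y"
  by (simp_all add: mk_def)

lemma mk_fn: "X \<in> rsets G \<Longrightarrow> x \<in> pts X \<alpha> \<Longrightarrow> fn (mk G X Y \<phi>) \<alpha> x = \<phi> \<alpha> x"
  using rsetsD(1)[of X x \<alpha>] by (simp add: mk_def)

lemma mk_rmaps:
  assumes "X \<in> rsets G" "Y \<in> rsets G" "\<And>\<alpha> x. x \<in> pts X \<alpha> \<Longrightarrow> \<phi> \<alpha> x \<in> pts Y \<alpha>"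
    "\<And>k s t. (s, t) \<in> rel X k \<Longrightarrow> (\<phi> (tail G k) s, \<phi> (head G k) t) \<in> rel Y k"
  shows "mk G X Y \<phi> \<in> rmaps G"
proof -
  have "(fn (mk G X Y \<phi>) (tail G k) s, fn (mk G X Y \<phi>) (head G k) t) \<in> rel Y k" if "(s, t) \<in> rel X k" for k s t
    using assms(4)[OF that] mk_fn[OF assms(1) rsetsD(3)[OF assms(1) that]] mk_fn[OF assms(1) rsetsD(4)[OF assms(1) that]]
    by simp
  moreover have "fn (mk G X Y \<phi>) \<in> (\<Pi>\<^sub>E \<alpha> \<in> verts G. pts X \<alpha> \<rightarrow>\<^sub>E pts Y \<alpha>)"
    using assms(3) unfolding mk_def by (auto simp: PiE_iff extensional_def)
  ultimately show ?thesis using assms(1,2) by (simp add: rmaps_def)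
qed

lemma Comp_mk: "g \<cdot>\<^bsub>RR\<^esub> f = mk G (src f) (trg g) (\<lambda>\<alpha> x. fn g \<alpha> (fn f \<alpha> x))"
  by (simp add: Rel_def mk_def compose_def)

lemma Ident_mk: "Ident RR X = mk G X X (\<lambda>\<alpha> x. x)"
  by (simp add: Rel_def mk_def)

lemma Comp_rmaps:
  assumes "f \<in> rmaps G" "g \<in> rmaps G" "trg f = src g"
  shows "g \<cdot>\<^bsub>RR\<^esub> f \<in> rmaps G"
  unfolding Comp_mk using assms rmapsD[OF assms(1)] rmapsD[OF assms(2)] by (intro mk_rmaps) simp_all

lemma Comp_sel [simp]: "src (g \<cdot>\<^bsub>RR\<^esub> f) = src f" "trg (g \<cdot>\<^bsub>RR\<^esub> f) = trg g"
  by (simp_all add: Comp_mk)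

lemma Comp_fn: "f \<in> rmaps G \<Longrightarrow> x \<in> pts (src f) \<alpha> \<Longrightarrow> fn (g \<cdot>\<^bsub>RR\<^esub> f) \<alpha> x = fn g \<alpha> (fn f \<alpha> x)"
  unfolding Comp_mk by (simp add: mk_fn rmapsD(1))

lemma Ident_rmaps: "X \<in> rsets G \<Longrightarrow> Ident RR X \<in> rmaps G"
  unfolding Ident_mk by (rule mk_rmaps) simp_all

lemma Ident_sel [simp]: "src (Ident RR X) = X" "trg (Ident RR X) = X"
  by (simp_all add: Ident_mk)

lemma Ident_fn: "X \<in> rsets G \<Longrightarrow> x \<in> pts X \<alpha> \<Longrightarrow> fn (Ident RR X) \<alpha> x = x"
  unfolding Ident_mk by (simp add: mk_fn)

lemma category_Rel: "category RR"
proof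
  fix f g h :: "('n, 'e, 'u) rmap" and X Y Z W
  show "f \<in> Arr RR \<Longrightarrow> Dom RR f \<in> Obj RR" "f \<in> Arr RR \<Longrightarrow> Cod RR f \<in> Obj RR" using rmapsD by auto
  show "X \<in> Obj RR \<Longrightarrow> Ident RR X \<in> Hom RR X X" using Ident_rmaps by (simp add: Hom_def)
  show "g \<cdot>\<^bsub>RR\<^esub> f \<in> Hom RR X Z" if "f \<in> Hom RR X Y" "g \<in> Hom RR Y Z"
    using that Comp_rmaps by (auto simp: Hom_def)
  show "f \<cdot>\<^bsub>RR\<^esub> Ident RR X = f" if "f \<in> Hom RR X Y"
  proof -
    have f: "f \<in> rmaps G" "src f = X" using that by (auto simp: Hom_def)
    have X: "X \<in> rsets G" using rmapsD(1)[OF f(1)] f(2) by simp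
    show ?thesis using f X Ident_rmaps[OF X] Comp_rmaps[OF Ident_rmaps[OF X] f(1)]
      by (intro rmap_eqI) (simp_all add: Comp_fn Ident_fn)
  qed
  show "Ident RR Y \<cdot>\<^bsub>RR\<^esub> f = f" if "f \<in> Hom RR X Y"
  proof -
    have f: "f \<in> rmaps G" "trg f = Y" using that by (auto simp: Hom_def)
    have Y: "Y \<in> rsets G" using rmapsD(2)[OF f(1)] f(2) by simp
    show ?thesis using f Y Ident_rmaps[OF Y] Comp_rmaps[OF f(1) Ident_rmaps[OF Y]] rmapsD(3)[OF f(1)]
      by (intro rmap_eqI) (simp_all add: Comp_fn Ident_fn)
  qed
  show "h \<cdot>\<^bsub>RR\<^esub> (g \<cdot>\<^bsub>RR\<^esub> f) = (h \<cdot>\<^bsub>RR\<^esub> g) \<cdot>\<^bsub>RR\<^esub> f" if "f \<in> Hom RR X Y" "g \<in> Hom RR Y Z" "h \<in> Hom RR Z W"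
  proof -
    have a: "f \<in> rmaps G" "g \<in> rmaps G" "h \<in> rmaps G" "trg f = src g" "trg g = src h" using that by (auto simp: Hom_def)
    show ?thesis using a Comp_rmaps rmapsD(3)[OF a(1)]
      by (intro rmap_eqI) (simp_all add: Comp_fn)
  qed
qed

sublocale R: category RR by (rule category_Rel)

lemma Rel_Comp_eqD:
  assumes "f \<cdot>\<^bsub>RR\<^esub> u = g \<cdot>\<^bsub>RR\<^esub> v" "u \<in> rmaps G" "v \<in> rmaps G" "x \<in> pts (src u) \<alpha>" "src u = src v"
  shows "fn f \<alpha> (fn u \<alpha> x) = fn g \<alpha> (fn v \<alpha> x)"
  using assms Comp_fn[OF assms(2,4), of f] Comp_fn[OF assms(3), of x \<alpha> g] by simp

definition ptm :: "'n \<Rightarrow> ('n, 'e, 'u) rset \<Rightarrow> 'u \<Rightarrow> ('n, 'e, 'u) rmap" where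
  "ptm \<alpha> X s = mk G (ptob \<alpha> pa) X (\<lambda>_ _. s)"

definition edm :: "'e \<Rightarrow> ('n, 'e, 'u) rset \<Rightarrow> 'u \<Rightarrow> 'u \<Rightarrow> ('n, 'e, 'u) rmap" where
  "edm k X s t = mk G (edob G k pa pb) X (\<lambda>_ x. if x = pa then s else t)"

lemma ptob_rset [simp]: "\<alpha> \<in> verts G \<Longrightarrow> ptob \<alpha> a \<in> rsets G"
  by (rule rsetsI) (auto simp: ptob_def)

lemma edob_rset [simp]: "k \<in> arcs G \<Longrightarrow> edob G k a b \<in> rsets G"
  by (rule rsetsI) (auto simp: edob_def split: if_splits)

lemma ptm:
  assumes "X \<in> rsets G" "s \<in> pts X \<alpha>"
  shows "ptm \<alpha> X s \<in> rmaps G" "src (ptm \<alpha> X s) = ptob \<alpha> pa" "trg (ptm \<alpha> X s) = X" "fn (ptm \<alpha> X s) \<alpha> pa = s"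
    "\<And>\<beta> x. x \<in> pts (ptob \<alpha> pa :: ('n, 'e, 'u) rset) \<beta> \<longleftrightarrow> x = pa \<and> \<beta> = \<alpha>"
proof -
  have \<alpha>: "\<alpha> \<in> verts G" using rsetsD(1) assms .
  show "ptm \<alpha> X s \<in> rmaps G" unfolding ptm_def using assms \<alpha>
    by (intro mk_rmaps ptob_rset) (auto simp: ptob_def split: if_splits)
  show "fn (ptm \<alpha> X s) \<alpha> pa = s" 
    unfolding ptm_def by (rule mk_fn[OF ptob_rset[OF \<alpha>]]) (simp add: ptob_def)
qed (auto simp: ptm_def ptob_def split: if_splits)

lemma edm:
  assumes "X \<in> rsets G" "(s, t) \<in> rel X k"
  shows "edm k X s t \<in> rmaps G" "src (edm k X s t) = edob G k pa pb" "trg (edm k X s t) = X"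
    "fn (edm k X s t) (tail G k) pa = s" "fn (edm k X s t) (head G k) pb = t"
    "pa \<in> pts (edob G k pa pb) (tail G k)" "pb \<in> pts (edob G k pa pb) (head G k)" "(pa, pb) \<in> rel (edob G k pa pb) k"
    "\<And>\<beta> x. x \<in> pts (edob G k pa pb) \<beta> \<longleftrightarrow> x = pa \<and> \<beta> = tail G k \<or> x = pb \<and> \<beta> = head G k"
proof -
  have k: "k \<in> arcs G" "s \<in> pts X (tail G k)" "t \<in> pts X (head G k)" using rsetsD[OF assms(1)] assms(2) by blast+
  show 1: "pa \<in> pts (edob G k pa pb) (tail G k)" "pb \<in> pts (edob G k pa pb) (head G k)" "(pa, pb) \<in> rel (edob G k pa pb) k"
    by (auto simp: edob_def)
  show "edm k X s t \<in> rmaps G" unfolding edm_def using assms k pab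
    by (intro mk_rmaps edob_rset) (auto simp: edob_def split: if_splits)
  show "fn (edm k X s t) (tail G k) pa = s" "fn (edm k X s t) (head G k) pb = t"
    unfolding edm_def using mk_fn[OF edob_rset[OF k(1)] 1(1)] mk_fn[OF edob_rset[OF k(1)] 1(2)] pab by simp_all
qed (auto simp: edm_def edob_def)

lemma ptm_Comp:
  assumes "f \<in> rmaps G" "s \<in> pts (src f) \<alpha>"
  shows "f \<cdot>\<^bsub>RR\<^esub> ptm \<alpha> (src f) s = ptm \<alpha> (trg f) (fn f \<alpha> s)"
proof -
  note p = ptm[OF rmapsD(1)[OF assms(1)] assms(2)] and q = ptm[OF rmapsD(2)[OF assms(1)] rmapsD(3)[OF assms]]
  show ?thesis using p q assms(1) Comp_rmaps[OF p(1) assms(1)] 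
    by (intro rmap_eqI) (auto simp: Comp_fn)
qed

lemma edm_Comp:
  assumes "f \<in> rmaps G" "(s, t) \<in> rel (src f) k"
  shows "f \<cdot>\<^bsub>RR\<^esub> edm k (src f) s t = edm k (trg f) (fn f (tail G k) s) (fn f (head G k) t)"
proof -
  note p = edm[OF rmapsD(1)[OF assms(1)] assms(2)] and q = edm[OF rmapsD(2)[OF assms(1)] rmapsD(4)[OF assms]]
  show ?thesis using p q assms(1) Comp_rmaps[OF p(1) assms(1)]
    by (intro rmap_eqI) (auto simp: Comp_fn)
qed

lemma ptm_inj: "\<lbrakk>ptm \<alpha> X s = ptm \<alpha> X t; X \<in> rsets G; s \<in> pts X \<alpha>; t \<in> pts X \<alpha>\<rbrakk> \<Longrightarrow> s = t"
  using ptm(4) by metis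

lemma ptm_surj:
  assumes "h \<in> rmaps G" "src h = ptob \<alpha> pa" "\<alpha> \<in> verts G"
  obtains z where "z \<in> pts (trg h) \<alpha>" "h = ptm \<alpha> (trg h) z"
proof -
  have "pa \<in> pts (src h) \<alpha>" unfolding assms(2) by (simp add: ptob_def)
  then have z: "fn h \<alpha> pa \<in> pts (trg h) \<alpha>" using rmapsD(3)[OF assms(1)] by blast
  note p = ptm[OF rmapsD(2)[OF assms(1)] z]
  have "h = ptm \<alpha> (trg h) (fn h \<alpha> pa)"
    using p assms by (intro rmap_eqI) auto
  then show ?thesis using that z by blast
qed

lemma edm_surj:
  assumes "h \<in> rmaps G" "src h = edob G k pa pb" "k \<in> arcs G"
  obtains z w where "(z, w) \<in> rel (trg h) k" "h = edm k (trg h) z w"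
proof -
  have "(pa, pb) \<in> rel (src h) k" unfolding assms(2) by (simp add: edob_def)
  then have z: "(fn h (tail G k) pa, fn h (head G k) pb) \<in> rel (trg h) k" using rmapsD(4)[OF assms(1)] by blast
  note p = edm[OF rmapsD(2)[OF assms(1)] z]
  have "h = edm k (trg h) (fn h (tail G k) pa) (fn h (head G k) pb)"
    using p assms by (intro rmap_eqI) auto
  then show ?thesis using that z by blast
qed

text \<open>Test objects, a single point and a single arc, turn universal properties into statements about elements.\<close>

lemma lift_points:
  assumes inj: "\<And>W u v. \<lbrakk>u \<in> Hom RR W (src p); v \<in> Hom RR W (src p); p \<cdot>\<^bsub>RR\<^esub> u = p \<cdot>\<^bsub>RR\<^esub> v; q \<cdot>\<^bsub>RR\<^esub> u = q \<cdot>\<^bsub>RR\<^esub> v\<rbrakk> \<Longrightarrow> u = v"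
    and p: "p \<in> rmaps G" "q \<in> rmaps G" "src q = src p"
    and z: "z \<in> pts (src p) \<alpha>" "z' \<in> pts (src p) \<alpha>" "fn p \<alpha> z = fn p \<alpha> z'" "fn q \<alpha> z = fn q \<alpha> z'"
  shows "z = z'"
proof -
  have P: "src p \<in> rsets G" using rmapsD(1) p(1) .
  have "ptm \<alpha> (src p) z = ptm \<alpha> (src p) z'"
  proof (rule inj)
    show "ptm \<alpha> (src p) z \<in> Hom RR (ptob \<alpha> pa) (src p)" "ptm \<alpha> (src p) z' \<in> Hom RR (ptob \<alpha> pa) (src p)"
      using ptm[OF P z(1)] ptm[OF P z(2)] by (simp_all add: Hom_def)
    show "p \<cdot>\<^bsub>RR\<^esub> ptm \<alpha> (src p) z = p \<cdot>\<^bsub>RR\<^esub> ptm \<alpha> (src p) z'"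
      using ptm_Comp[OF p(1) z(1)] ptm_Comp[OF p(1) z(2)] z(3) by simp
    show "q \<cdot>\<^bsub>RR\<^esub> ptm \<alpha> (src p) z = q \<cdot>\<^bsub>RR\<^esub> ptm \<alpha> (src p) z'"
      using ptm_Comp[OF p(2), of z \<alpha>] ptm_Comp[OF p(2), of z' \<alpha>] z p(3) by simp
  qed
  then show ?thesis using ptm_inj P z by blast
qed

text \<open>For the last clause, the edge object lifts to some related pair with the same
  projections as \<open>(z, w)\<close>, and joint injectivity identifies the two; a pullback thus
  carries the largest relation that its projections allow.\<close>

lemma pullback_points:
  assumes pb: "is_pullback RR f g p q"
  shows "\<lbrakk>s \<in> pts (src f) \<alpha>; t \<in> pts (src g) \<alpha>; fn f \<alpha> s = fn g \<alpha> t\<rbrakk> \<Longrightarrow>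
      \<exists>z\<in>pts (src p) \<alpha>. fn p \<alpha> z = s \<and> fn q \<alpha> z = t"
    and "\<lbrakk>z \<in> pts (src p) \<alpha>; z' \<in> pts (src p) \<alpha>; fn p \<alpha> z = fn p \<alpha> z'; fn q \<alpha> z = fn q \<alpha> z'\<rbrakk> \<Longrightarrow> z = z'"
    and "\<lbrakk>z \<in> pts (src p) (tail G k); w \<in> pts (src p) (head G k); (fn p (tail G k) z, fn p (head G k) w) \<in> rel (src f) k;
      (fn q (tail G k) z, fn q (head G k) w) \<in> rel (src g) k\<rbrakk> \<Longrightarrow> (z, w) \<in> rel (src p) k"
proof -
  note a = R.is_pullbackD[OF pb, simplified]
  have S: "src f \<in> rsets G" "src g \<in> rsets G" using rmapsD(1) a by auto
  have uni: "u = v" if "u \<in> Hom RR W (src p)" "v \<in> Hom RR W (src p)" "p \<cdot>\<^bsub>RR\<^esub> u = p \<cdot>\<^bsub>RR\<^esub> v" "q \<cdot>\<^bsub>RR\<^esub> u = q \<cdot>\<^bsub>RR\<^esub> v" for W u v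
  proof -
    have u: "u \<in> rmaps G" "v \<in> rmaps G" "src u = W" "src v = W" "trg u = src p" "trg v = src p" using that by (auto simp: Hom_def)
    have "f \<cdot>\<^bsub>RR\<^esub> (p \<cdot>\<^bsub>RR\<^esub> u) = (f \<cdot>\<^bsub>RR\<^esub> p) \<cdot>\<^bsub>RR\<^esub> u" "g \<cdot>\<^bsub>RR\<^esub> (q \<cdot>\<^bsub>RR\<^esub> u) = (g \<cdot>\<^bsub>RR\<^esub> q) \<cdot>\<^bsub>RR\<^esub> u"
      by (rule R.assoc[symmetric]; use a u in simp)+
    then have "f \<cdot>\<^bsub>RR\<^esub> (p \<cdot>\<^bsub>RR\<^esub> u) = g \<cdot>\<^bsub>RR\<^esub> (q \<cdot>\<^bsub>RR\<^esub> u)" using a(9) by simp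
    moreover have "p \<cdot>\<^bsub>RR\<^esub> u \<in> Hom RR W (src f)" "q \<cdot>\<^bsub>RR\<^esub> u \<in> Hom RR W (src g)"
      using u a Comp_rmaps by (auto simp: Hom_def)
    ultimately have "\<exists>!h. h \<in> Hom RR W (Dom RR p) \<and> p \<cdot>\<^bsub>RR\<^esub> h = p \<cdot>\<^bsub>RR\<^esub> u \<and> q \<cdot>\<^bsub>RR\<^esub> h = q \<cdot>\<^bsub>RR\<^esub> u"
      using pb unfolding is_pullback_def Rel_sel by blast
    then show ?thesis using that by (metis Rel_sel(3))
  qed
  show inj: "z = z'" if "z \<in> pts (src p) \<alpha>" "z' \<in> pts (src p) \<alpha>" "fn p \<alpha> z = fn p \<alpha> z'" "fn q \<alpha> z = fn q \<alpha> z'" for z z' \<alpha>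
  proof (rule lift_points[of p q z \<alpha> z'])
    show "u = v" if "u \<in> Hom RR W (src p)" "v \<in> Hom RR W (src p)" "p \<cdot>\<^bsub>RR\<^esub> u = p \<cdot>\<^bsub>RR\<^esub> v" "q \<cdot>\<^bsub>RR\<^esub> u = q \<cdot>\<^bsub>RR\<^esub> v" for W u v
      using that by (rule uni)
  qed (use that a in simp_all)
  show "\<exists>z\<in>pts (src p) \<alpha>. fn p \<alpha> z = s \<and> fn q \<alpha> z = t" if s: "s \<in> pts (src f) \<alpha>" "t \<in> pts (src g) \<alpha>" "fn f \<alpha> s = fn g \<alpha> t"
  proof -
    note u = ptm[OF S(1) s(1)] and v = ptm[OF S(2) s(2)]
    have "f \<cdot>\<^bsub>RR\<^esub> ptm \<alpha> (src f) s = g \<cdot>\<^bsub>RR\<^esub> ptm \<alpha> (src g) t"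
      using ptm_Comp[of f s \<alpha>] ptm_Comp[of g t \<alpha>] a s by simp
    then obtain h where h: "h \<in> rmaps G" "src h = ptob \<alpha> pa" "trg h = src p"
      "p \<cdot>\<^bsub>RR\<^esub> h = ptm \<alpha> (src f) s" "q \<cdot>\<^bsub>RR\<^esub> h = ptm \<alpha> (src g) t"
      using R.is_pullback_lift[OF pb, of "ptm \<alpha> (src f) s" "ptm \<alpha> (src g) t"] u v by auto
    obtain z where z: "z \<in> pts (src p) \<alpha>" "h = ptm \<alpha> (src p) z" using ptm_surj[OF h(1,2) rsetsD(1)[OF S(1) s(1)]] h(3) by auto
    have "fn p \<alpha> z = s" using ptm_Comp[of p z \<alpha>] z h(4) a s ptm_inj S(1) rmapsD(3)[of p z \<alpha>] by metis
    moreover have "fn q \<alpha> z = t" using ptm_Comp[of q z \<alpha>] z h(5) a s ptm_inj S(2) rmapsD(3)[of q z \<alpha>] by metis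
    ultimately show ?thesis using z(1) by blast
  qed
  show "(z, w) \<in> rel (src p) k" if z: "z \<in> pts (src p) (tail G k)" "w \<in> pts (src p) (head G k)"
    "(fn p (tail G k) z, fn p (head G k) w) \<in> rel (src f) k" "(fn q (tail G k) z, fn q (head G k) w) \<in> rel (src g) k"
  proof -
    note u = edm[OF S(1) z(3)] and v = edm[OF S(2) z(4)]
    let ?u = "edm k (src f) (fn p (tail G k) z) (fn p (head G k) w)" and ?v = "edm k (src g) (fn q (tail G k) z) (fn q (head G k) w)"
    have k: "k \<in> arcs G" using rsetsD(2)[OF S(1) z(3)] .
    have "fn f (tail G k) (fn p (tail G k) z) = fn g (tail G k) (fn q (tail G k) z)"
      "fn f (head G k) (fn p (head G k) w) = fn g (head G k) (fn q (head G k) w)"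
      using Rel_Comp_eqD[OF a(9) a(3,4) z(1) a(7)[symmetric]] Rel_Comp_eqD[OF a(9) a(3,4) z(2) a(7)[symmetric]] .
    then have "f \<cdot>\<^bsub>RR\<^esub> ?u = g \<cdot>\<^bsub>RR\<^esub> ?v" using edm_Comp[OF a(1) z(3)] edm_Comp[OF a(2) z(4)] a(5) by simp
    then obtain h where h: "h \<in> rmaps G" "src h = edob G k pa pb" "trg h = src p" "p \<cdot>\<^bsub>RR\<^esub> h = ?u" "q \<cdot>\<^bsub>RR\<^esub> h = ?v"
      using R.is_pullback_lift[OF pb, of ?u ?v] u v by auto
    obtain z' w' where z': "(z', w') \<in> rel (src p) k" "h = edm k (src p) z' w'" using edm_surj[OF h(1,2) k] h(3) by auto
    have P: "src p \<in> rsets G" using rmapsD(1) a by blast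
    have zw: "z' \<in> pts (src p) (tail G k)" "w' \<in> pts (src p) (head G k)" using rsetsD[OF P] z'(1) by blast+
    have "edm k (trg p) (fn p (tail G k) z') (fn p (head G k) w') = ?u" using edm_Comp[OF a(3) z'(1)] h(4) z'(2) by simp
    then have 1: "fn p (tail G k) z' = fn p (tail G k) z" "fn p (head G k) w' = fn p (head G k) w"
      using edm(4,5)[OF rmapsD(2)[OF a(3)] rmapsD(4)[OF a(3) z'(1)]] u(4,5) by simp_all
    have "edm k (trg q) (fn q (tail G k) z') (fn q (head G k) w') = ?v" using edm_Comp[OF a(4), of z' w' k] h(5) z' a by simp
    then have 2: "fn q (tail G k) z' = fn q (tail G k) z" "fn q (head G k) w' = fn q (head G k) w"
      using edm(4,5)[OF rmapsD(2)[OF a(4)] rmapsD(4)[OF a(4)], of z' w' k] z'(1) a u v(4,5) by simp_all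
    show ?thesis using inj[OF zw(1) z(1) 1(1) 2(1)] inj[OF zw(2) z(2) 1(2) 2(2)] z'(1) by simp
  qed
qed

text \<open>The argument is that for pullbacks: the edge object combines related pairs of the
  factors into a related pair of the product.\<close>

lemma product_points:
  assumes pb: "is_product RR X Y P p q"
  shows "\<lbrakk>z \<in> pts P \<alpha>; z' \<in> pts P \<alpha>; fn p \<alpha> z = fn p \<alpha> z'; fn q \<alpha> z = fn q \<alpha> z'\<rbrakk> \<Longrightarrow> z = z'"
    and "\<lbrakk>(x, x') \<in> rel X k; (y, y') \<in> rel Y k\<rbrakk> \<Longrightarrow>
      \<exists>z w. (z, w) \<in> rel P k \<and> fn p (tail G k) z = x \<and> fn p (head G k) w = x' \<and> fn q (tail G k) z = y \<and> fn q (head G k) w = y'"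
proof -
  note a = R.is_productD[OF pb, simplified]
  have S: "X \<in> rsets G" "Y \<in> rsets G" using pb by (auto simp: is_product_def)
  have uni: "u = v" if "u \<in> Hom RR W (src p)" "v \<in> Hom RR W (src p)" "p \<cdot>\<^bsub>RR\<^esub> u = p \<cdot>\<^bsub>RR\<^esub> v" "q \<cdot>\<^bsub>RR\<^esub> u = q \<cdot>\<^bsub>RR\<^esub> v" for W u v
  proof -
    have u: "u \<in> rmaps G" "src u = W" "trg u = src p" using that by (auto simp: Hom_def)
    have "p \<cdot>\<^bsub>RR\<^esub> u \<in> Hom RR W X" "q \<cdot>\<^bsub>RR\<^esub> u \<in> Hom RR W Y"
      using u a Comp_rmaps by (auto simp: Hom_def)
    then have "\<exists>!h. h \<in> Hom RR W P \<and> p \<cdot>\<^bsub>RR\<^esub> h = p \<cdot>\<^bsub>RR\<^esub> u \<and> q \<cdot>\<^bsub>RR\<^esub> h = q \<cdot>\<^bsub>RR\<^esub> u"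
      using pb unfolding is_product_def by blast
    then show ?thesis using that a by metis
  qed
  show "z = z'" if "z \<in> pts P \<alpha>" "z' \<in> pts P \<alpha>" "fn p \<alpha> z = fn p \<alpha> z'" "fn q \<alpha> z = fn q \<alpha> z'"
  proof (rule lift_points[of p q z \<alpha> z'])
    show "u = v" if "u \<in> Hom RR W (src p)" "v \<in> Hom RR W (src p)" "p \<cdot>\<^bsub>RR\<^esub> u = p \<cdot>\<^bsub>RR\<^esub> v" "q \<cdot>\<^bsub>RR\<^esub> u = q \<cdot>\<^bsub>RR\<^esub> v" for W u v
      using that by (rule uni)
  qed (use that a in simp_all)
  show "\<exists>z w. (z, w) \<in> rel P k \<and> fn p (tail G k) z = x \<and> fn p (head G k) w = x' \<and> fn q (tail G k) z = y \<and> fn q (head G k) w = y'"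
    if z: "(x, x') \<in> rel X k" "(y, y') \<in> rel Y k"
  proof -
    note u = edm[OF S(1) z(1)] and v = edm[OF S(2) z(2)]
    have k: "k \<in> arcs G" using rsetsD(2)[OF S(1) z(1)] .
    obtain h where h: "h \<in> rmaps G" "src h = edob G k pa pb" "trg h = P" "p \<cdot>\<^bsub>RR\<^esub> h = edm k X x x'" "q \<cdot>\<^bsub>RR\<^esub> h = edm k Y y y'"
      using R.is_product_lift[OF pb, of "edm k X x x'" "edm k Y y y'"] u v by auto
    obtain z' w' where z': "(z', w') \<in> rel P k" "h = edm k P z' w'" using edm_surj[OF h(1,2) k] h(3) by auto
    have zp: "(z', w') \<in> rel (src p) k" "(z', w') \<in> rel (src q) k" using z' a by simp_all
    have "edm k X (fn p (tail G k) z') (fn p (head G k) w') = edm k X x x'" using edm_Comp[OF a(1) zp(1)] h(4) z'(2) a by simp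
    then have 1: "fn p (tail G k) z' = x" "fn p (head G k) w' = x'"
      using edm(4,5)[OF rmapsD(2)[OF a(1)] rmapsD(4)[OF a(1) zp(1)]] u(4,5) a by simp_all
    have "edm k Y (fn q (tail G k) z') (fn q (head G k) w') = edm k Y y y'" using edm_Comp[OF a(2) zp(2)] h(5) z'(2) a by simp
    then have 2: "fn q (tail G k) z' = y" "fn q (head G k) w' = y'"
      using edm(4,5)[OF rmapsD(2)[OF a(2)] rmapsD(4)[OF a(2) zp(2)]] v(4,5) a by simp_all
    show ?thesis using z'(1) 1 2 by blast
  qed
qed

end

section \<open>Factorizations, finite limits and f-regularity of relational sets\<close>

context relcat
begin

lemma rmonoD:
  assumes "m \<in> rmono G"
  shows "m \<in> rmaps G" "\<lbrakk>x \<in> pts (src m) \<alpha>; y \<in> pts (src m) \<alpha>; fn m \<alpha> x = fn m \<alpha> y\<rbrakk> \<Longrightarrow> x = y"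
    "\<lbrakk>s \<in> pts (src m) (tail G k); t \<in> pts (src m) (head G k); (fn m (tail G k) s, fn m (head G k) t) \<in> rel (trg m) k\<rbrakk>
      \<Longrightarrow> (s, t) \<in> rel (src m) k"
proof -
  show m: "m \<in> rmaps G" using assms by (simp add: rmono_def)
  show "x = y" if "x \<in> pts (src m) \<alpha>" "y \<in> pts (src m) \<alpha>" "fn m \<alpha> x = fn m \<alpha> y"
    using assms that rsetsD(1)[OF rmapsD(1)[OF m] that(1)] by (auto simp: rmono_def dest: inj_onD)
  show "(s, t) \<in> rel (src m) k" if "s \<in> pts (src m) (tail G k)" "t \<in> pts (src m) (head G k)"
      "(fn m (tail G k) s, fn m (head G k) t) \<in> rel (trg m) k"
    using assms that rsetsD(2)[OF rmapsD(2)[OF m] that(3)] by (auto simp: rmono_def)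
qed

lemma rmonoI:
  assumes "m \<in> rmaps G" "\<And>\<alpha> x y. \<lbrakk>x \<in> pts (src m) \<alpha>; y \<in> pts (src m) \<alpha>; fn m \<alpha> x = fn m \<alpha> y\<rbrakk> \<Longrightarrow> x = y"
    "\<And>k s t. \<lbrakk>s \<in> pts (src m) (tail G k); t \<in> pts (src m) (head G k); (fn m (tail G k) s, fn m (head G k) t) \<in> rel (trg m) k\<rbrakk>
      \<Longrightarrow> (s, t) \<in> rel (src m) k"
  shows "m \<in> rmono G"
  unfolding rmono_def using assms(1) rmapsD(4)[OF assms(1)] by (auto intro!: inj_onI intro: assms(2,3))

lemma img_sub: "m \<in> rmaps G \<Longrightarrow> img m \<alpha> \<subseteq> pts (trg m) \<alpha>"
  using rmapsD(3) by (auto simp: img_def)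

lemma restr_rset:
  assumes "X \<in> rsets G" "\<And>\<alpha>. P \<alpha> \<subseteq> pts X \<alpha>"
  shows "restr G X P \<in> rsets G"
  using assms(2) rsetsD(1)[OF assms(1)] by (intro rsetsI) (auto simp: restr_def)

lemma incl:
  assumes "X \<in> rsets G" "\<And>\<alpha>. P \<alpha> \<subseteq> pts X \<alpha>"
  shows "incl G X P \<in> rmono G" "src (incl G X P) = restr G X P" "trg (incl G X P) = X" "img (incl G X P) \<alpha> = P \<alpha>"
    "x \<in> P \<alpha> \<Longrightarrow> fn (incl G X P) \<alpha> x = x"
proof -
  have r: "restr G X P \<in> rsets G" using restr_rset assms .
  have pr: "pts (restr G X P) = P" by (simp add: restr_def)
  show f: "x \<in> P \<alpha> \<Longrightarrow> fn (incl G X P) \<alpha> x = x" for x \<alpha>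
    unfolding incl_def using mk_fn[OF r] pr by simp
  show s: "src (incl G X P) = restr G X P" "trg (incl G X P) = X" by (simp_all add: incl_def)
  show "img (incl G X P) \<alpha> = P \<alpha>" unfolding img_def s pr using f by force
  have m: "incl G X P \<in> rmaps G"
    unfolding incl_def using assms r by (intro mk_rmaps) (auto simp: restr_def split: if_splits)
  show "incl G X P \<in> rmono G"
    by (rule rmonoI[OF m]) (use s pr f rsetsD(2)[OF assms(1)] in \<open>auto simp: restr_def\<close>)
qed

lemma rmono_is_mono:
  assumes "m \<in> rmono G"
  shows "is_mono RR m"
  unfolding is_mono_def
proof (intro conjI allI ballI impI)
  show "m \<in> Arr RR" using rmonoD(1)[OF assms] by simp
  fix W u v assume uv: "u \<in> Hom RR W (Dom RR m)" "v \<in> Hom RR W (Dom RR m)" "m \<cdot>\<^bsub>RR\<^esub> u = m \<cdot>\<^bsub>RR\<^esub> v"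
  then have u: "u \<in> rmaps G" "v \<in> rmaps G" "src u = W" "src v = W" "trg u = src m" "trg v = src m" by (auto simp: Hom_def)
  show "u = v"
  proof (rule rmap_eqI[OF u(1,2)])
    fix \<alpha> x assume x: "x \<in> pts (src u) \<alpha>"
    have "src u = src v" using u by simp
    note eq = Rel_Comp_eqD[OF uv(3) u(1,2) x this]
    have "fn u \<alpha> x \<in> pts (src m) \<alpha>" "fn v \<alpha> x \<in> pts (src m) \<alpha>"
      using rmapsD(3)[OF u(1) x] rmapsD(3)[OF u(2), of x \<alpha>] x u(3-6) by simp_all
    from rmonoD(2)[OF assms this eq] show "fn u \<alpha> x = fn v \<alpha> x" .
  qed (use u in simp_all)
qed

text \<open>Inverting the injection \<open>n\<close> on points gives the factor; it is a morphism
  because \<open>n\<close> reflects relations.\<close>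

lemma factors_iff:
  assumes n: "n \<in> rmono G" and h: "h \<in> rmaps G"
  shows "factors_through RR h n \<longleftrightarrow> trg h = trg n \<and> (\<forall>\<alpha>. img h \<alpha> \<subseteq> img n \<alpha>)"
proof
  assume "factors_through RR h n"
  then obtain k where k: "k \<in> rmaps G" "src k = src h" "trg k = src n" "n \<cdot>\<^bsub>RR\<^esub> k = h" "trg h = trg n"
    unfolding factors_through_def by (auto simp: Hom_def)
  have "fn h \<alpha> x \<in> img n \<alpha>" if "x \<in> pts (src h) \<alpha>" for \<alpha> x
    using Comp_fn[OF k(1), of x \<alpha> n] k rmapsD(3)[OF k(1), of x \<alpha>] that by (auto simp: img_def)
  then show "trg h = trg n \<and> (\<forall>\<alpha>. img h \<alpha> \<subseteq> img n \<alpha>)" using k by (auto simp: img_def)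
next
  assume a: "trg h = trg n \<and> (\<forall>\<alpha>. img h \<alpha> \<subseteq> img n \<alpha>)"
  note nm = rmonoD(1)[OF n]
  define \<phi> where "\<phi> \<alpha> x = inv_into (pts (src n) \<alpha>) (fn n \<alpha>) (fn h \<alpha> x)" for \<alpha> x
  have \<phi>: "\<phi> \<alpha> x \<in> pts (src n) \<alpha>" "fn n \<alpha> (\<phi> \<alpha> x) = fn h \<alpha> x" if "x \<in> pts (src h) \<alpha>" for \<alpha> x
  proof -
    have "fn h \<alpha> x \<in> fn n \<alpha> ` pts (src n) \<alpha>" using a that by (auto simp: img_def)
    then show "\<phi> \<alpha> x \<in> pts (src n) \<alpha>" "fn n \<alpha> (\<phi> \<alpha> x) = fn h \<alpha> x"
      unfolding \<phi>_def by (rule inv_into_into, rule f_inv_into_f)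
  qed
  define k where "k = mk G (src h) (src n) \<phi>"
  have k: "k \<in> rmaps G" "src k = src h" "trg k = src n"
    unfolding k_def
  proof (rule mk_rmaps)
    fix e s t assume st: "(s, t) \<in> rel (src h) e"
    note p = rsetsD(3,4)[OF rmapsD(1)[OF h] st]
    show "(\<phi> (tail G e) s, \<phi> (head G e) t) \<in> rel (src n) e"
      using rmonoD(3)[OF n \<phi>(1)[OF p(1)] \<phi>(1)[OF p(2)]] \<phi>(2)[OF p(1)] \<phi>(2)[OF p(2)] rmapsD(4)[OF h st] a by simp
  qed (use rmapsD(1)[OF h] rmapsD(1)[OF nm] \<phi> in simp_all)
  have "n \<cdot>\<^bsub>RR\<^esub> k = h"
    using k a h nm Comp_rmaps[OF k(1) nm k(3)] \<phi> mk_fn[OF rmapsD(1)[OF h]]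
    by (intro rmap_eqI) (simp_all add: Comp_fn k_def)
  then show "factors_through RR h n" using a k unfolding factors_through_def by (auto simp: Hom_def)
qed

text \<open>The middle object is the image with the relation induced from the target, which may
  exceed the image of the relation; so the first factor is only surjective on points.\<close>

lemma image_factor:
  assumes "h \<in> rmaps G"
  obtains m e where "m \<in> rmono G" "e \<in> rmaps G" "trg e = src m" "m \<cdot>\<^bsub>RR\<^esub> e = h" "\<And>\<alpha>. img e \<alpha> = pts (trg e) \<alpha>"
    "\<And>\<alpha>. img m \<alpha> = img h \<alpha>"
proof -
  note T = rmapsD(2)[OF assms] and S = rmapsD(1)[OF assms]
  note i = incl[OF T img_sub[OF assms]]
  define e where "e = mk G (src h) (restr G (trg h) (img h)) (fn h)"
  have e: "e \<in> rmaps G" "src e = src h" "trg e = restr G (trg h) (img h)"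
    unfolding e_def
  proof (rule mk_rmaps[OF S restr_rset[OF T img_sub[OF assms]]])
    show "fn h \<alpha> x \<in> pts (restr G (trg h) (img h)) \<alpha>" if "x \<in> pts (src h) \<alpha>" for \<alpha> x
      using that by (simp add: restr_def img_def)
    show "(fn h (tail G k) s, fn h (head G k) t) \<in> rel (restr G (trg h) (img h)) k" if "(s, t) \<in> rel (src h) k" for k s t
      using rmapsD(4)[OF assms that] rsetsD(2,3,4)[OF S that] by (simp add: restr_def img_def)
  qed simp_all
  have ef: "fn e \<alpha> x = fn h \<alpha> x" if "x \<in> pts (src h) \<alpha>" for \<alpha> x unfolding e_def using mk_fn[OF S that] .
  have "incl G (trg h) (img h) \<cdot>\<^bsub>RR\<^esub> e = h"
  proof (rule rmap_eqI[OF Comp_rmaps[OF e(1) rmonoD(1)[OF i(1)]] assms])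
    fix \<alpha> x assume "x \<in> pts (src (incl G (trg h) (img h) \<cdot>\<^bsub>RR\<^esub> e)) \<alpha>"
    then have x: "x \<in> pts (src h) \<alpha>" using e(2) by simp
    then have "fn h \<alpha> x \<in> img h \<alpha>" by (simp add: img_def)
    then show "fn (incl G (trg h) (img h) \<cdot>\<^bsub>RR\<^esub> e) \<alpha> x = fn h \<alpha> x"
      using Comp_fn[OF e(1), of x \<alpha>] e(2) x ef[OF x] i(5) by simp
  qed (use e i in simp_all)
  moreover have "img e \<alpha> = pts (trg e) \<alpha>" for \<alpha> using ef e by (auto simp: img_def restr_def)
  ultimately show ?thesis using that[OF i(1) e(1)] i e by simp
qed

text \<open>Orthogonality to \<open>Mon\<close> sees points only. For necessity, filling the square
  from the image factorization of \<open>e\<close> to the identity of its target splits the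
  inclusion of the image. For sufficiency, surjectivity puts the image of \<open>v\<close> inside
  that of \<open>m\<close>, and \<open>factors_iff\<close> supplies the diagonal.\<close>

lemma Mperp_iff: "e \<in> Mperp RR \<longleftrightarrow> e \<in> rmaps G \<and> (\<forall>\<alpha>. img e \<alpha> = pts (trg e) \<alpha>)"
proof
  assume e: "e \<in> Mperp RR"
  then have eA: "e \<in> rmaps G" by (auto simp: Mperp_def)
  obtain m e0 where m: "m \<in> rmono G" "e0 \<in> rmaps G" "trg e0 = src m" "m \<cdot>\<^bsub>RR\<^esub> e0 = e" "\<And>\<alpha>. img e0 \<alpha> = pts (trg e0) \<alpha>"
    "\<And>\<alpha>. img m \<alpha> = img e \<alpha>" using image_factor[OF eA] by blast
  note mA = rmonoD(1)[OF m(1)]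
  have t: "trg m = trg e" "src e0 = src e" using m(4) by auto
  have I: "Ident RR (trg e) \<in> rmaps G" using Ident_rmaps rmapsD(2)[OF eA] by blast
  have "Ident RR (trg e) \<cdot>\<^bsub>RR\<^esub> e = e" using eA by simp
  then have eq: "m \<cdot>\<^bsub>RR\<^esub> e0 = Ident RR (trg e) \<cdot>\<^bsub>RR\<^esub> e" using m(4) by simp
  have lo: "left_orthogonal RR e m" using e m(1) by (simp add: Mperp_def)
  have "e0 \<in> Hom RR (Dom RR e) (Dom RR m) \<and> Ident RR (trg e) \<in> Hom RR (Cod RR e) (Cod RR m) \<and>
      m \<cdot>\<^bsub>RR\<^esub> e0 = Ident RR (trg e) \<cdot>\<^bsub>RR\<^esub> e" using m(2,3) t I eq by (simp add: Hom_def)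
  with lo obtain d where "d \<in> Hom RR (Cod RR e) (Dom RR m)" and d2: "m \<cdot>\<^bsub>RR\<^esub> d = Ident RR (trg e)"
    unfolding left_orthogonal_def by blast
  then have d: "d \<in> Hom RR (trg e) (src m)" "m \<cdot>\<^bsub>RR\<^esub> d = Ident RR (trg e)" by simp_all
  have "x \<in> img e \<alpha>" if x: "x \<in> pts (trg e) \<alpha>" for \<alpha> x
  proof -
    have d': "d \<in> rmaps G" "src d = trg e" "trg d = src m" using d(1) by (auto simp: Hom_def)
    have "fn m \<alpha> (fn d \<alpha> x) = x" using Comp_fn[OF d'(1), of x \<alpha> m] d(2) d' x Ident_fn[OF rmapsD(2)[OF eA] x] by simp
    then have "x \<in> img m \<alpha>" unfolding img_def using rmapsD(3)[OF d'(1), of x \<alpha>] d' x by (metis imageI)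
    then show ?thesis using m(6) by simp
  qed
  then show "e \<in> rmaps G \<and> (\<forall>\<alpha>. img e \<alpha> = pts (trg e) \<alpha>)" using eA img_sub[OF eA] by blast
next
  assume "e \<in> rmaps G \<and> (\<forall>\<alpha>. img e \<alpha> = pts (trg e) \<alpha>)"
  then have e: "e \<in> rmaps G" "\<And>\<alpha>. img e \<alpha> = pts (trg e) \<alpha>" by auto
  have "left_orthogonal RR e m" if m: "m \<in> rmono G" for m
    unfolding left_orthogonal_def
  proof (intro allI impI)
    fix u v assume a: "u \<in> Hom RR (Dom RR e) (Dom RR m) \<and> v \<in> Hom RR (Cod RR e) (Cod RR m) \<and> m \<cdot>\<^bsub>RR\<^esub> u = v \<cdot>\<^bsub>RR\<^esub> e"
    then have u: "u \<in> rmaps G" "src u = src e" "trg u = src m" and v: "v \<in> rmaps G" "src v = trg e" "trg v = trg m"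
      and eq: "m \<cdot>\<^bsub>RR\<^esub> u = v \<cdot>\<^bsub>RR\<^esub> e" by (auto simp: Hom_def)
    note mA = rmonoD(1)[OF m]
    have "fn v \<alpha> y \<in> img m \<alpha>" if y: "y \<in> pts (src v) \<alpha>" for \<alpha> y
    proof -
      obtain x where x: "x \<in> pts (src e) \<alpha>" "y = fn e \<alpha> x" using y e(2)[of \<alpha>] v(2) by (auto simp: img_def)
      then have "fn m \<alpha> (fn u \<alpha> x) = fn v \<alpha> y" using Rel_Comp_eqD[OF eq u(1) e(1)] u by simp
      then show ?thesis using rmapsD(3)[OF u(1), of x \<alpha>] x u unfolding img_def by (metis imageI)
    qed
    then have "factors_through RR v m" unfolding factors_iff[OF m v(1)] using v by (auto simp: img_def)
    then obtain d where d: "d \<in> Hom RR (trg e) (src m)" "m \<cdot>\<^bsub>RR\<^esub> d = v"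
      unfolding factors_through_def using v by (auto simp: Hom_def)
    have d': "d \<in> rmaps G" "src d = trg e" "trg d = src m" using d by (auto simp: Hom_def)
    have de: "d \<cdot>\<^bsub>RR\<^esub> e \<in> rmaps G" "src (d \<cdot>\<^bsub>RR\<^esub> e) = src u" "trg (d \<cdot>\<^bsub>RR\<^esub> e) = src m"
      using Comp_rmaps[OF e(1) d'(1)] d' u by simp_all
    have "m \<cdot>\<^bsub>RR\<^esub> (d \<cdot>\<^bsub>RR\<^esub> e) = (m \<cdot>\<^bsub>RR\<^esub> d) \<cdot>\<^bsub>RR\<^esub> e"
      by (rule R.assoc[symmetric]) (use mA d' e in simp_all)
    then have "m \<cdot>\<^bsub>RR\<^esub> (d \<cdot>\<^bsub>RR\<^esub> e) = m \<cdot>\<^bsub>RR\<^esub> u" using d(2) eq by simp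
    then have "d \<cdot>\<^bsub>RR\<^esub> e = u" by (rule R.is_monoD[OF rmono_is_mono[OF m]]) (use de u in simp_all)
    moreover have "d2 = d" if "d2 \<in> Hom RR (trg e) (src m)" "m \<cdot>\<^bsub>RR\<^esub> d2 = v" for d2
      by (rule R.is_monoD[OF rmono_is_mono[OF m]]) (use that d in \<open>auto simp: Hom_def\<close>)
    ultimately show "\<exists>!d. d \<in> Hom RR (Cod RR e) (Dom RR m) \<and> d \<cdot>\<^bsub>RR\<^esub> e = u \<and> m \<cdot>\<^bsub>RR\<^esub> d = v"
      unfolding Rel_sel using d by blast
  qed
  then show "e \<in> Mperp RR" using e by (auto simp: Mperp_def)
qed

text \<open>The limit consists of compatible families of points, related when all their components
  are; \<open>tup\<close> codes a family as a single element of the universe.\<close>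

lemma has_finite_limits_Rel: "has_finite_limits RR"
  unfolding has_finite_limits_def
proof (intro allI impI)
  fix J :: "(nat, nat) cat" and Do :: "nat \<Rightarrow> ('n, 'e, 'u) rset" and Da
  assume "finite_diagram J RR Do Da"
  then interpret F: category_functor J RR Do Da by (simp add: finite_diagram_def)
  have Do: "Do i \<in> rsets G" if "i \<in> Obj J" for i using F.map_obj[OF that] by simp
  have Da: "Da u \<in> rmaps G" "src (Da u) = Do (Dom J u)" "trg (Da u) = Do (Cod J u)" "Dom J u \<in> Obj J" "Cod J u \<in> Obj J"
    if "u \<in> Arr J" for u
    using F.map_hom[of u "Dom J u" "Cod J u"] that F.source.dom_obj F.source.cod_obj by (auto simp: Hom_def)
  \<comment> \<open>The default \<open>pa\<close> outside \<open>Obj J\<close> makes a family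
    determined by its components, as uniqueness of the mediating arrow requires.\<close>
  define V where "V \<alpha> = {z. (\<forall>i\<in>Obj J. z i \<in> pts (Do i) \<alpha>) \<and> (\<forall>i. i \<notin> Obj J \<longrightarrow> z i = pa) \<and>
     (\<forall>u\<in>Arr J. fn (Da u) \<alpha> (z (Dom J u)) = z (Cod J u))}" for \<alpha>
  define L where "L = \<lparr>pts = (\<lambda>\<alpha>. if \<alpha> \<in> verts G then tup ` V \<alpha> else {}),
     rel = (\<lambda>k. if k \<in> arcs G then {(tup z, tup w) | z w. z \<in> V (tail G k) \<and> w \<in> V (head G k) \<and> (\<forall>i\<in>Obj J. (z i, w i) \<in> rel (Do i) k)} else {})\<rparr>"
  define l where "l i = mk G L (Do i) (\<lambda>_ x. inv tup x i)" for i
  have inv [simp]: "inv tup (tup z) = z" for z using tup_inj by simp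
  have L: "L \<in> rsets G"
    by (rule rsetsI) (auto simp: L_def)
  have Lp: "x \<in> pts L \<alpha> \<longleftrightarrow> \<alpha> \<in> verts G \<and> (\<exists>z\<in>V \<alpha>. x = tup z)" for x \<alpha> by (auto simp: L_def)
  have l: "l i \<in> rmaps G" "src (l i) = L" "trg (l i) = Do i" if "i \<in> Obj J" for i
    unfolding l_def by (rule mk_rmaps) (use L Do[OF that] that in \<open>auto simp: Lp L_def V_def split: if_splits\<close>)
  have lf: "fn (l i) \<alpha> (tup z) = z i" if "z \<in> V \<alpha>" "\<alpha> \<in> verts G" for i \<alpha> z
  proof -
    have "tup z \<in> pts L \<alpha>" using that by (auto simp: Lp)
    from mk_fn[OF L this] show ?thesis unfolding l_def by simp
  qed
  have "is_limit J RR Do Da L l"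
    unfolding is_limit_def
  proof (intro conjI allI impI)
    show "is_cone J RR Do Da L l"
      unfolding is_cone_def
    proof (intro conjI ballI)
      fix u assume u: "u \<in> Arr J"
      note D = Da[OF u]
      have "fn (Da u) \<alpha> (fn (l (Dom J u)) \<alpha> x) = fn (l (Cod J u)) \<alpha> x" if "x \<in> pts L \<alpha>" for x \<alpha>
        using that u lf by (auto simp: Lp V_def)
      then show "Da u \<cdot>\<^bsub>RR\<^esub> l (Dom J u) = l (Cod J u)"
        using D l[OF D(4)] l[OF D(5)] Comp_rmaps by (intro rmap_eqI) (simp_all add: Comp_fn)
    qed (use L l in \<open>auto simp: Hom_def\<close>)
    fix X x assume "is_cone J RR Do Da X x"
    then have X: "X \<in> rsets G" and x: "\<And>i. i \<in> Obj J \<Longrightarrow> x i \<in> rmaps G" "\<And>i. i \<in> Obj J \<Longrightarrow> src (x i) = X" "\<And>i. i \<in> Obj J \<Longrightarrow> trg (x i) = Do i"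
      and c: "\<And>u. u \<in> Arr J \<Longrightarrow> Da u \<cdot>\<^bsub>RR\<^esub> x (Dom J u) = x (Cod J u)" by (auto simp: is_cone_def Hom_def)
    define z where "z \<alpha> a i = (if i \<in> Obj J then fn (x i) \<alpha> a else pa)" for \<alpha> a i
    have z: "z \<alpha> a \<in> V \<alpha>" if a: "a \<in> pts X \<alpha>" for \<alpha> a
    proof -
      have "fn (Da u) \<alpha> (fn (x (Dom J u)) \<alpha> a) = fn (x (Cod J u)) \<alpha> a" if u: "u \<in> Arr J" for u
        using Comp_fn[OF x(1)[OF Da(4)[OF u]], of a \<alpha> "Da u"] c[OF u] x(2)[OF Da(4)[OF u]] a by simp
      moreover have "fn (x i) \<alpha> a \<in> pts (Do i) \<alpha>" if "i \<in> Obj J" for i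
        using rmapsD(3)[OF x(1)[OF that], of a \<alpha>] x(2,3)[OF that] a by simp
      ultimately show ?thesis using Da by (auto simp: V_def z_def)
    qed
    define h where "h = mk G X L (\<lambda>\<alpha> a. tup (z \<alpha> a))"
    have h: "h \<in> rmaps G" "src h = X" "trg h = L"
      unfolding h_def
    proof (rule mk_rmaps[OF X L])
      show "tup (z \<alpha> a) \<in> pts L \<alpha>" if "a \<in> pts X \<alpha>" for \<alpha> a using z[OF that] rsetsD(1)[OF X that] by (auto simp: Lp)
      fix k s t assume st: "(s, t) \<in> rel X k"
      note p = rsetsD(2,3,4)[OF X st]
      have "(z (tail G k) s i, z (head G k) t i) \<in> rel (Do i) k" if i: "i \<in> Obj J" for i
        using rmapsD(4)[OF x(1)[OF i], of s t k] x(2,3)[OF i] st i by (simp add: z_def)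
      then show "(tup (z (tail G k) s), tup (z (head G k) t)) \<in> rel L k"
        using p z[OF p(2)] z[OF p(3)] by (auto simp: L_def)
    qed simp_all
    have hf: "fn h \<alpha> a = tup (z \<alpha> a)" if "a \<in> pts X \<alpha>" for \<alpha> a unfolding h_def using mk_fn[OF X that] .
    show "\<exists>!h. h \<in> Hom RR X L \<and> (\<forall>i\<in>Obj J. l i \<cdot>\<^bsub>RR\<^esub> h = x i)"
    proof (rule ex1I[of _ h])
      have "l i \<cdot>\<^bsub>RR\<^esub> h = x i" if i: "i \<in> Obj J" for i
      proof (rule rmap_eqI)
        fix \<alpha> a assume "a \<in> pts (src (l i \<cdot>\<^bsub>RR\<^esub> h)) \<alpha>"
        then have a: "a \<in> pts X \<alpha>" using h by simp
        show "fn (l i \<cdot>\<^bsub>RR\<^esub> h) \<alpha> a = fn (x i) \<alpha> a"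
          using Comp_fn[OF h(1), of a \<alpha> "l i"] h(2) a hf[OF a] lf[OF z[OF a] rsetsD(1)[OF X a]] i by (simp add: z_def)
      qed (use h l[OF i] x i Comp_rmaps in simp_all)
      then show "h \<in> Hom RR X L \<and> (\<forall>i\<in>Obj J. l i \<cdot>\<^bsub>RR\<^esub> h = x i)" using h by (simp add: Hom_def)
      fix h' assume h': "h' \<in> Hom RR X L \<and> (\<forall>i\<in>Obj J. l i \<cdot>\<^bsub>RR\<^esub> h' = x i)"
      then have h'': "h' \<in> rmaps G" "src h' = X" "trg h' = L" by (auto simp: Hom_def)
      show "h' = h"
      proof (rule rmap_eqI[OF h''(1) h(1)])
        fix \<alpha> a assume "a \<in> pts (src h') \<alpha>"
        then have a: "a \<in> pts X \<alpha>" using h'' by simp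
        have "fn h' \<alpha> a \<in> pts L \<alpha>" using rmapsD(3)[OF h''(1)] h'' a by simp
        then obtain w where w: "w \<in> V \<alpha>" "fn h' \<alpha> a = tup w" by (auto simp: Lp)
        have "w i = z \<alpha> a i" for i
        proof (cases "i \<in> Obj J")
          case True
          then have "fn (l i) \<alpha> (fn h' \<alpha> a) = fn (x i) \<alpha> a" using Comp_fn[OF h''(1), of a \<alpha> "l i"] h' h'' a by simp
          then show ?thesis using w lf[OF w(1) rsetsD(1)[OF X a]] True by (simp add: z_def)
        next
          case False
          then show ?thesis using w(1) by (simp add: V_def z_def)
        qed
        then have "w = z \<alpha> a" by blast
        then show "fn h' \<alpha> a = fn h \<alpha> a" using w hf[OF a] by simp
      qed (use h h'' in simp_all)
    qed
  qed
  then show "\<exists>L l. is_limit J RR Do Da L l" by blast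
qed

lemma f_regular_Rel: "f_regular_category RR"
proof
  fix m n f e d h :: "('n, 'e, 'u) rmap"
  show "has_finite_limits RR" by (rule has_finite_limits_Rel)
  show "m \<in> Mon RR \<Longrightarrow> is_mono RR m" using rmono_is_mono by simp
  show "m \<in> Mon RR" if iso: "is_iso RR m"
  proof -
    obtain g where m: "m \<in> rmaps G" and g: "g \<in> rmaps G" "src g = trg m" "trg g = src m" "g \<cdot>\<^bsub>RR\<^esub> m = Ident RR (src m)"
      using iso unfolding is_iso_def by (auto simp: Hom_def)
    have S: "src m \<in> rsets G" using rmapsD(1)[OF m] .
    have gm: "fn g \<alpha> (fn m \<alpha> x) = x" if "x \<in> pts (src m) \<alpha>" for \<alpha> x
      using Comp_fn[OF m that, of g] g(4) Ident_fn[OF S that] by simp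
    have "m \<in> rmono G"
    proof (rule rmonoI[OF m])
      show "x = y" if "x \<in> pts (src m) \<alpha>" "y \<in> pts (src m) \<alpha>" "fn m \<alpha> x = fn m \<alpha> y" for \<alpha> x y
        using gm[OF that(1)] gm[OF that(2)] that(3) by metis
      show "(s, t) \<in> rel (src m) k" if "s \<in> pts (src m) (tail G k)" "t \<in> pts (src m) (head G k)"
        "(fn m (tail G k) s, fn m (head G k) t) \<in> rel (trg m) k" for k s t
        using rmapsD(4)[OF g(1), of "fn m (tail G k) s" "fn m (head G k) t" k] that gm g(2,3) by simp
    qed
    then show ?thesis by simp
  qed
  show "m \<in> Mon RR" if eq: "is_regular_mono RR m"
  proof -
    obtain f g where e: "is_equalizer RR f g m" using eq unfolding is_regular_mono_def by blast
    have a: "f \<in> rmaps G" "g \<in> rmaps G" "src g = src f" "trg g = trg f" "m \<in> rmaps G" "trg m = src f" "f \<cdot>\<^bsub>RR\<^esub> m = g \<cdot>\<^bsub>RR\<^esub> m"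
      using e unfolding is_equalizer_def by (auto simp: Hom_def)
    have uni: "\<exists>!h. h \<in> Hom RR W (src m) \<and> m \<cdot>\<^bsub>RR\<^esub> h = u" if "u \<in> Hom RR W (src f)" "f \<cdot>\<^bsub>RR\<^esub> u = g \<cdot>\<^bsub>RR\<^esub> u" for W u
      using e that unfolding is_equalizer_def by simp
    have uni2: "u = v" if "u \<in> Hom RR W (src m)" "v \<in> Hom RR W (src m)" "m \<cdot>\<^bsub>RR\<^esub> u = m \<cdot>\<^bsub>RR\<^esub> v" for W u v
    proof -
      have u: "u \<in> rmaps G" "src u = W" "trg u = src m" using that by (auto simp: Hom_def)
      have "f \<cdot>\<^bsub>RR\<^esub> (m \<cdot>\<^bsub>RR\<^esub> u) = (f \<cdot>\<^bsub>RR\<^esub> m) \<cdot>\<^bsub>RR\<^esub> u" "g \<cdot>\<^bsub>RR\<^esub> (m \<cdot>\<^bsub>RR\<^esub> u) = (g \<cdot>\<^bsub>RR\<^esub> m) \<cdot>\<^bsub>RR\<^esub> u"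
        by (rule R.assoc[symmetric]; use a(1-6) u in simp)+
      then have "f \<cdot>\<^bsub>RR\<^esub> (m \<cdot>\<^bsub>RR\<^esub> u) = g \<cdot>\<^bsub>RR\<^esub> (m \<cdot>\<^bsub>RR\<^esub> u)" using a(7) by simp
      moreover have "m \<cdot>\<^bsub>RR\<^esub> u \<in> Hom RR W (src f)" using u a(5,6) Comp_rmaps by (auto simp: Hom_def)
      ultimately show ?thesis using uni that by metis
    qed
    have inj: "x = y" if "x \<in> pts (src m) \<alpha>" "y \<in> pts (src m) \<alpha>" "fn m \<alpha> x = fn m \<alpha> y" for \<alpha> x y
    proof (rule lift_points[of m m])
      show "u = v" if "u \<in> Hom RR W (src m)" "v \<in> Hom RR W (src m)" "m \<cdot>\<^bsub>RR\<^esub> u = m \<cdot>\<^bsub>RR\<^esub> v" for W u v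
        using that by (rule uni2)
    qed (use that a in simp_all)
    \<comment> \<open>Reflection of relations comes from the edge object: a related pair of the
      target between points of \<open>m\<close> equalizes \<open>f\<close> and \<open>g\<close>, so
      it lifts to a related pair of the source, which injectivity identifies with the given
      points.\<close>
    have "m \<in> rmono G"
    proof (rule rmonoI[OF a(5) inj])
      fix k s t assume z: "s \<in> pts (src m) (tail G k)" "t \<in> pts (src m) (head G k)" "(fn m (tail G k) s, fn m (head G k) t) \<in> rel (trg m) k"
      note S = rmapsD(2)[OF a(5)]
      note u = edm[OF S z(3)]
      let ?u = "edm k (trg m) (fn m (tail G k) s) (fn m (head G k) t)"
      have k: "k \<in> arcs G" using rsetsD(2)[OF S z(3)] .
      have "fn f (tail G k) (fn m (tail G k) s) = fn g (tail G k) (fn m (tail G k) s)"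
        "fn f (head G k) (fn m (head G k) t) = fn g (head G k) (fn m (head G k) t)"
        using Rel_Comp_eqD[OF a(7) a(5,5) z(1)] Rel_Comp_eqD[OF a(7) a(5,5) z(2)] by simp_all
      then have "f \<cdot>\<^bsub>RR\<^esub> ?u = g \<cdot>\<^bsub>RR\<^esub> ?u"
        using edm_Comp[OF a(1), of "fn m (tail G k) s" "fn m (head G k) t" k] edm_Comp[OF a(2), of "fn m (tail G k) s" "fn m (head G k) t" k] a(3,4,6) z(3)
        by simp
      then obtain h where h: "h \<in> Hom RR (edob G k pa pb) (src m)" "m \<cdot>\<^bsub>RR\<^esub> h = ?u"
        using uni[of ?u "edob G k pa pb"] u a(6) by (auto simp: Hom_def)
      have h': "h \<in> rmaps G" "src h = edob G k pa pb" "trg h = src m" using h(1) by (auto simp: Hom_def)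
      obtain z' w' where z': "(z', w') \<in> rel (src m) k" "h = edm k (src m) z' w'" using edm_surj[OF h'(1,2) k] h'(3) by auto
      have zw: "z' \<in> pts (src m) (tail G k)" "w' \<in> pts (src m) (head G k)" using rsetsD[OF rmapsD(1)[OF a(5)]] z'(1) by blast+
      have "edm k (trg m) (fn m (tail G k) z') (fn m (head G k) w') = ?u" using edm_Comp[OF a(5) z'(1)] h(2) z'(2) by simp
      then have "fn m (tail G k) z' = fn m (tail G k) s" "fn m (head G k) w' = fn m (head G k) t"
        using edm(4,5)[OF S rmapsD(4)[OF a(5) z'(1)]] u(4,5) by simp_all
      then show "(s, t) \<in> rel (src m) k" using inj[OF zw(1) z(1)] inj[OF zw(2) z(2)] z'(1) by simp
    qed
    then show ?thesis by simp
  qed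
  show "n \<cdot>\<^bsub>RR\<^esub> m \<in> Mon RR" if "m \<in> Mon RR" "n \<in> Mon RR" "Dom RR n = Cod RR m"
  proof -
    have m: "m \<in> rmono G" "n \<in> rmono G" "src n = trg m" using that by auto
    note mA = rmonoD(1)[OF m(1)] and nA = rmonoD(1)[OF m(2)]
    have "n \<cdot>\<^bsub>RR\<^esub> m \<in> rmono G"
    proof (rule rmonoI)
      show "n \<cdot>\<^bsub>RR\<^esub> m \<in> rmaps G" using Comp_rmaps mA nA m(3) by simp
      show "x = y" if "x \<in> pts (src (n \<cdot>\<^bsub>RR\<^esub> m)) \<alpha>" "y \<in> pts (src (n \<cdot>\<^bsub>RR\<^esub> m)) \<alpha>" "fn (n \<cdot>\<^bsub>RR\<^esub> m) \<alpha> x = fn (n \<cdot>\<^bsub>RR\<^esub> m) \<alpha> y" for \<alpha> x y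
        using that mA rmapsD(3)[OF mA] m(3) rmonoD(2)[OF m(2), of "fn m \<alpha> x" \<alpha> "fn m \<alpha> y"] rmonoD(2)[OF m(1), of x \<alpha> y]
        by (simp add: Comp_fn)
      show "(s, t) \<in> rel (src (n \<cdot>\<^bsub>RR\<^esub> m)) k" if "s \<in> pts (src (n \<cdot>\<^bsub>RR\<^esub> m)) (tail G k)" "t \<in> pts (src (n \<cdot>\<^bsub>RR\<^esub> m)) (head G k)"
        "(fn (n \<cdot>\<^bsub>RR\<^esub> m) (tail G k) s, fn (n \<cdot>\<^bsub>RR\<^esub> m) (head G k) t) \<in> rel (trg (n \<cdot>\<^bsub>RR\<^esub> m)) k" for k s t
        using that mA rmapsD(3)[OF mA] m(3) rmonoD(3)[OF m(2), of "fn m (tail G k) s" k "fn m (head G k) t"] rmonoD(3)[OF m(1), of s k t]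
        by (simp add: Comp_fn)
    qed
    then show ?thesis by simp
  qed
  show "n \<in> Mon RR" if m: "m \<in> Mon RR" and pb: "is_pullback RR f m n h"
  proof -
    note a = R.is_pullbackD[OF pb, unfolded Rel_sel] and p = pullback_points[OF pb]
    have mm: "m \<in> rmono G" using m by simp
    have c: "fn f \<alpha> (fn n \<alpha> z) = fn m \<alpha> (fn h \<alpha> z)" if "z \<in> pts (src n) \<alpha>" for z \<alpha>
      using Rel_Comp_eqD[OF a(9) a(3,4) that a(7)[symmetric]] .
    have hz: "fn h \<alpha> z \<in> pts (src m) \<alpha>" if "z \<in> pts (src n) \<alpha>" for z \<alpha>
      using rmapsD(3)[OF a(4), of z \<alpha>] that a(7,8) by simp
    have "n \<in> rmono G"
    proof (rule rmonoI[OF a(3)])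
      show "x = y" if xy: "x \<in> pts (src n) \<alpha>" "y \<in> pts (src n) \<alpha>" "fn n \<alpha> x = fn n \<alpha> y" for \<alpha> x y
      proof -
        have "fn m \<alpha> (fn h \<alpha> x) = fn m \<alpha> (fn h \<alpha> y)" unfolding c[OF xy(1), symmetric] c[OF xy(2), symmetric] xy(3) ..
        from p(2)[OF xy rmonoD(2)[OF mm hz[OF xy(1)] hz[OF xy(2)] this]] show ?thesis .
      qed
      show "(s, t) \<in> rel (src n) k" if st: "s \<in> pts (src n) (tail G k)" "t \<in> pts (src n) (head G k)"
        "(fn n (tail G k) s, fn n (head G k) t) \<in> rel (trg n) k" for k s t
      proof -
        have "(fn n (tail G k) s, fn n (head G k) t) \<in> rel (src f) k" using st(3) a(6) by simp
        moreover from rmapsD(4)[OF a(1) this] have "(fn h (tail G k) s, fn h (head G k) t) \<in> rel (src m) k"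
          using rmonoD(3)[OF mm hz[OF st(1)] hz[OF st(2)]] c[OF st(1)] c[OF st(2)] a(5) by simp
        ultimately show ?thesis using p(3)[OF st(1,2)] by blast
      qed
    qed
    then show ?thesis by simp
  qed
  show "\<exists>m\<in>Mon RR. \<exists>e\<in>Mperp RR. Dom RR m = Cod RR e \<and> f = m \<cdot>\<^bsub>RR\<^esub> e" if "f \<in> Arr RR"
  proof -
    have "f \<in> rmaps G" using that by simp
    then obtain m e where m: "m \<in> rmono G" "e \<in> rmaps G" "trg e = src m" "m \<cdot>\<^bsub>RR\<^esub> e = f" "\<And>\<alpha>. img e \<alpha> = pts (trg e) \<alpha>"
      "\<And>\<alpha>. img m \<alpha> = img f \<alpha>" by (rule image_factor) (rule that; assumption)
    have "e \<in> Mperp RR" unfolding Mperp_iff by (intro conjI allI m(2,5))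
    moreover have "m \<in> Mon RR" "Dom RR m = Cod RR e" using m(1,3) by simp_all
    moreover note m(4)[symmetric]
    ultimately show ?thesis by (intro bexI conjI)
  qed
  show "d \<in> Mperp RR" if e: "e \<in> Mperp RR" and pb: "is_pullback RR f e d h"
  proof -
    note a = R.is_pullbackD[OF pb, unfolded Rel_sel] and p = pullback_points[OF pb]
    have "x \<in> img d \<alpha>" if x: "x \<in> pts (trg d) \<alpha>" for x \<alpha>
    proof -
      have x': "x \<in> pts (src f) \<alpha>" using x a(6) by simp
      then have "fn f \<alpha> x \<in> img e \<alpha>" using e rmapsD(3)[OF a(1)] a(5) by (auto simp: Mperp_iff)
      then obtain y where "y \<in> pts (src e) \<alpha>" "fn f \<alpha> x = fn e \<alpha> y" by (auto simp: img_def)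
      then show ?thesis using p(1)[OF x'] by (auto simp: img_def)
    qed
    then show ?thesis using a(3) img_sub[OF a(3)] by (auto simp: Mperp_iff)
  qed
qed

end

sublocale relcat \<subseteq> R: f_regular_category RR by (rule f_regular_Rel)

section \<open>Subobjects of relational sets as families of subsets\<close>

context relcat
begin

text \<open>Equivalent representatives have the same image, so the union in \<open>sub_pts\<close>
  is taken over equal sets.\<close>

lemma sub_pts_mem:
  assumes S: "S \<in> carrier (Sub RR X)" and m: "m \<in> S"
  shows "sub_pts S \<alpha> = img m \<alpha>"
proof -
  have "img n \<alpha> = img m \<alpha>" if n: "n \<in> S" for n
  proof -
    have nm: "n \<in> rmono G" "m \<in> rmono G" using R.Sub_mem(1)[OF S n] R.Sub_mem(1)[OF S m] by simp_all
    have "factors_through RR n m" "factors_through RR m n"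
      using R.below_self[OF S n] R.below_self[OF S m] R.below_mem[OF S] n m by blast+
    then show ?thesis using factors_iff nm rmonoD(1) by blast
  qed
  then show ?thesis using m unfolding sub_pts_def img_def[symmetric] by blast
qed

lemma below_pts:
  assumes S: "S \<in> carrier (Sub RR X)" and h: "h \<in> rmaps G" "trg h = X"
  shows "below RR h S \<longleftrightarrow> (\<forall>\<alpha>. img h \<alpha> \<subseteq> sub_pts S \<alpha>)"
proof -
  obtain m where m: "m \<in> S" using R.Sub_ex[OF S] .
  have m': "m \<in> rmono G" "trg m = X" using R.Sub_mem[OF S m] by simp_all
  show ?thesis unfolding R.below_mem[OF S m] factors_iff[OF m'(1) h(1)] sub_pts_mem[OF S m] using m'(2) h(2) by simp
qed

lemma Sub_le_pts:
  assumes "S \<in> carrier (Sub RR X)" "T \<in> carrier (Sub RR X)"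
  shows "S \<sqsubseteq>\<^bsub>Sub RR X\<^esub> T \<longleftrightarrow> (\<forall>\<alpha>. sub_pts S \<alpha> \<subseteq> sub_pts T \<alpha>)"
proof -
  obtain m where m: "m \<in> S" using R.Sub_ex[OF assms(1)] .
  have m': "m \<in> rmono G" "trg m = X" using R.Sub_mem[OF assms(1) m] by simp_all
  show ?thesis unfolding R.Sub_le_mem[OF assms m] below_pts[OF assms(2) rmonoD(1)[OF m'(1)] m'(2)] sub_pts_mem[OF assms(1) m] ..
qed

lemma Sub_eq_pts:
  assumes "S \<in> carrier (Sub RR X)" "T \<in> carrier (Sub RR X)" "\<And>\<alpha>. sub_pts S \<alpha> = sub_pts T \<alpha>"
  shows "S = T"
  using R.Sub_antisym[OF assms(1,2)] Sub_le_pts[OF assms(1,2)] Sub_le_pts[OF assms(2,1)] assms(3) by simp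

lemma Sub_pts_obj:
  assumes S: "S \<in> carrier (Sub RR X)"
  shows "X \<in> rsets G" "sub_pts S \<alpha> \<subseteq> pts X \<alpha>"
proof -
  obtain m where m: "m \<in> S" using R.Sub_ex[OF S] .
  have m': "m \<in> rmono G" "trg m = X" using R.Sub_mem[OF S m] by simp_all
  show "X \<in> rsets G" using rmapsD(2)[OF rmonoD(1)[OF m'(1)]] m'(2) by simp
  show "sub_pts S \<alpha> \<subseteq> pts X \<alpha>" unfolding sub_pts_mem[OF S m] using img_sub[OF rmonoD(1)[OF m'(1)]] m'(2) by simp
qed

text \<open>Together with \<open>Sub_le_pts\<close>, this identifies the subobjects of
  \<open>X\<close> with families of subsets of its carriers. The class is that of the inclusion
  \<open>incl\<close>, since \<open>factors_iff\<close> compares images only; at indices outside the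
  graph all images are empty.\<close>

lemma ofp:
  assumes X: "X \<in> rsets G" and P: "\<And>\<alpha>. P \<alpha> \<subseteq> pts X \<alpha>"
  shows "ofp G X P \<in> carrier (Sub RR X)" "sub_pts (ofp G X P) \<alpha> = P \<alpha>"
proof -
  note i = incl[OF X P]
  have "n \<in> ofp G X P \<longleftrightarrow> n \<in> subobj RR (incl G X P)" for n
  proof -
    have "(\<forall>\<alpha>\<in>verts G. fn n \<alpha> ` pts (src n) \<alpha> = P \<alpha>) \<longleftrightarrow> (\<forall>\<alpha>. img n \<alpha> = P \<alpha>)" if "n \<in> rmono G"
    proof -
      have "img n \<alpha> = P \<alpha>" if "\<alpha> \<notin> verts G" for \<alpha>
        using P[of \<alpha>] that rsetsD(1)[OF X] rsetsD(1)[OF rmapsD(1)[OF rmonoD(1)[OF \<open>n \<in> rmono G\<close>]], of _ \<alpha>]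
        by (auto simp: img_def)
      then show ?thesis unfolding img_def by blast
    qed
    moreover have "factors_through RR n (incl G X P) \<longleftrightarrow> trg n = X \<and> (\<forall>\<alpha>. img n \<alpha> \<subseteq> P \<alpha>)" if "n \<in> rmono G"
      using factors_iff[OF i(1) rmonoD(1)[OF that]] unfolding i(3,4) .
    moreover have "factors_through RR (incl G X P) n \<longleftrightarrow> X = trg n \<and> (\<forall>\<alpha>. P \<alpha> \<subseteq> img n \<alpha>)" if "n \<in> rmono G"
      using factors_iff[OF that rmonoD(1)[OF i(1)]] unfolding i(3,4) .
    ultimately show ?thesis
      unfolding ofp_def mem_subobj Rel_sel mem_Collect_eq set_eq_subset by blast
  qed
  then have eq: "ofp G X P = subobj RR (incl G X P)" by blast
  have m: "incl G X P \<in> Mon RR" "Cod RR (incl G X P) = X" using i by simp_all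
  show c: "ofp G X P \<in> carrier (Sub RR X)" unfolding eq using m by (rule R.SubI)
  have "incl G X P \<in> ofp G X P" unfolding eq using m(1) by (rule R.subobj_self)
  from sub_pts_mem[OF c this] show "sub_pts (ofp G X P) \<alpha> = P \<alpha>" using i(4) by simp
qed

lemma lub_pts:
  assumes A: "A \<subseteq> carrier (Sub RR X)" and X: "X \<in> rsets G"
  shows "least (Sub RR X) s (Upper (Sub RR X) A) \<longleftrightarrow> s \<in> carrier (Sub RR X) \<and> (\<forall>\<alpha>. sub_pts s \<alpha> = (\<Union>S\<in>A. sub_pts S \<alpha>))"
proof
  let ?P = "\<lambda>\<alpha>. \<Union>S\<in>A. sub_pts S \<alpha>"
  have "?P \<alpha> \<subseteq> pts X \<alpha>" for \<alpha> using A Sub_pts_obj(2) by blast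
  note t = ofp[OF X this]
  assume "least (Sub RR X) s (Upper (Sub RR X) A)"
  then have s: "s \<in> carrier (Sub RR X)"
    and l: "\<And>U. U \<in> carrier (Sub RR X) \<Longrightarrow> s \<sqsubseteq>\<^bsub>Sub RR X\<^esub> U \<longleftrightarrow> (\<forall>a\<in>A. a \<sqsubseteq>\<^bsub>Sub RR X\<^esub> U)"
    using R.lub_iff[OF A] by blast+
  have "sub_pts a \<alpha> \<subseteq> sub_pts s \<alpha>" if "a \<in> A" for a \<alpha>
    using l[OF s] R.Sub_refl[OF s] that Sub_le_pts[OF _ s] A by blast
  moreover have "\<forall>a\<in>A. a \<sqsubseteq>\<^bsub>Sub RR X\<^esub> ofp G X ?P"
    using Sub_le_pts[OF _ t(1)] A unfolding t(2) by blast
  then have "s \<sqsubseteq>\<^bsub>Sub RR X\<^esub> ofp G X ?P" using l[OF t(1)] by blast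
  then have "sub_pts s \<alpha> \<subseteq> ?P \<alpha>" for \<alpha> using Sub_le_pts[OF s t(1)] unfolding t(2) by blast
  ultimately show "s \<in> carrier (Sub RR X) \<and> (\<forall>\<alpha>. sub_pts s \<alpha> = ?P \<alpha>)" using s by blast
next
  assume s: "s \<in> carrier (Sub RR X) \<and> (\<forall>\<alpha>. sub_pts s \<alpha> = (\<Union>S\<in>A. sub_pts S \<alpha>))"
  have "s \<sqsubseteq>\<^bsub>Sub RR X\<^esub> V \<longleftrightarrow> (\<forall>a\<in>A. a \<sqsubseteq>\<^bsub>Sub RR X\<^esub> V)" if V: "V \<in> carrier (Sub RR X)" for V
  proof -
    have "(\<forall>a\<in>A. a \<sqsubseteq>\<^bsub>Sub RR X\<^esub> V) \<longleftrightarrow> (\<forall>a\<in>A. \<forall>\<alpha>. sub_pts a \<alpha> \<subseteq> sub_pts V \<alpha>)" using Sub_le_pts[OF _ V] A by blast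
    then show ?thesis using s Sub_le_pts[OF _ V, of s] by blast
  qed
  then show "least (Sub RR X) s (Upper (Sub RR X) A)" unfolding R.lub_iff[OF A] using s by blast
qed

text \<open>The points of an abstract pullback are known from \<open>pullback_points\<close>, so no
  concrete pullback has to be built.\<close>

lemma pull_pts:
  assumes f: "f \<in> rmaps G" and S: "S \<in> carrier (Sub RR (trg f))"
  shows "pull RR f S \<in> carrier (Sub RR (src f))" "sub_pts (pull RR f S) \<alpha> = {x \<in> pts (src f) \<alpha>. fn f \<alpha> x \<in> sub_pts S \<alpha>}"
proof -
  have f': "f \<in> Arr RR" "S \<in> carrier (Sub RR (Cod RR f))" using f S by simp_all
  show c: "pull RR f S \<in> carrier (Sub RR (src f))" using R.pull_carrier[OF f'] by simp
  obtain m where m: "m \<in> S" using R.Sub_ex[OF S] .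
  obtain n h where n: "is_pullback RR f m n h" "n \<in> Mon RR" "pull RR f S = subobj RR n" "Cod RR n = Dom RR f"
    using R.pull_pullback[OF f' m] .
  note a = R.is_pullbackD[OF n(1), unfolded Rel_sel]
  have "n \<in> pull RR f S" using n(2,3) by simp
  then have "sub_pts (pull RR f S) \<alpha> = img n \<alpha>" by (rule sub_pts_mem[OF c])
  also have "\<dots> = {x \<in> pts (src f) \<alpha>. fn f \<alpha> x \<in> img m \<alpha>}" (is "_ = ?r")
  proof
    show "img n \<alpha> \<subseteq> ?r"
    proof
      fix y assume "y \<in> img n \<alpha>"
      then obtain z where z: "z \<in> pts (src n) \<alpha>" "y = fn n \<alpha> z" by (auto simp: img_def)
      have "fn f \<alpha> y = fn m \<alpha> (fn h \<alpha> z)" unfolding z(2) using Rel_Comp_eqD[OF a(9) a(3,4) z(1) a(7)[symmetric]] .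
      moreover have "fn h \<alpha> z \<in> pts (src m) \<alpha>" using rmapsD(3)[OF a(4), of z \<alpha>] z(1) a(7,8) by simp
      moreover have "y \<in> pts (src f) \<alpha>" unfolding z(2) using rmapsD(3)[OF a(3) z(1)] a(6) by simp
      ultimately show "y \<in> ?r" unfolding img_def by blast
    qed
    show "?r \<subseteq> img n \<alpha>" using pullback_points(1)[OF n(1)] unfolding img_def by blast
  qed
  finally show "sub_pts (pull RR f S) \<alpha> = {x \<in> pts (src f) \<alpha>. fn f \<alpha> x \<in> sub_pts S \<alpha>}" unfolding sub_pts_mem[OF S m] .
qed

lemma im_pts:
  assumes h: "h \<in> rmaps G"
  shows "im RR h \<in> carrier (Sub RR (trg h))" "sub_pts (im RR h) \<alpha> = img h \<alpha>"
proof -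
  have h': "h \<in> Arr RR" using h by simp
  show c: "im RR h \<in> carrier (Sub RR (trg h))" using R.im_carrier[OF h'] by simp
  obtain m e where m: "m \<in> Mon RR" "e \<in> Mperp RR" "Dom RR m = Cod RR e" "m \<cdot>\<^bsub>RR\<^esub> e = h" "im RR h = subobj RR m"
    "Cod RR m = Cod RR h" "Dom RR e = Dom RR h" using h' by (rule R.im_factor)
  have "m \<in> im RR h" using m(1,5) by simp
  then have "sub_pts (im RR h) \<alpha> = img m \<alpha>" by (rule sub_pts_mem[OF c])
  also have "\<dots> = img h \<alpha>"
  proof -
    have e: "e \<in> rmaps G" "img e \<alpha> = pts (src m) \<alpha>" using m(2,3) by (auto simp: Mperp_iff)
    have "fn h \<alpha> x = fn m \<alpha> (fn e \<alpha> x)" if "x \<in> pts (src e) \<alpha>" for x using Comp_fn[OF e(1) that, of m] m(4) by simp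
    moreover have "src h = src e" using m(7) by simp
    ultimately have "img h \<alpha> = fn m \<alpha> ` img e \<alpha>" unfolding img_def by force
    then show ?thesis by (simp add: e(2) img_def[of m])
  qed
  finally show "sub_pts (im RR h) \<alpha> = img h \<alpha>" .
qed

lemma image_pts:
  assumes f: "f \<in> rmaps G" and S: "S \<in> carrier (Sub RR (src f))"
  shows "image_sub RR f S \<in> carrier (Sub RR (trg f))" "sub_pts (image_sub RR f S) \<alpha> = fn f \<alpha> ` sub_pts S \<alpha>"
proof -
  obtain m where m: "m \<in> S" using R.Sub_ex[OF S] .
  have m': "m \<in> rmono G" "trg m = src f" using R.Sub_mem[OF S m] by simp_all
  note mA = rmonoD(1)[OF m'(1)]
  have eq: "image_sub RR f S = im RR (f \<cdot>\<^bsub>RR\<^esub> m)" using R.image_sub_eq[of f S m] f S m by simp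
  have c: "f \<cdot>\<^bsub>RR\<^esub> m \<in> rmaps G" using Comp_rmaps[OF mA f m'(2)] .
  show "image_sub RR f S \<in> carrier (Sub RR (trg f))" unfolding eq using im_pts(1)[OF c] by simp
  have "img (f \<cdot>\<^bsub>RR\<^esub> m) \<alpha> = fn f \<alpha> ` img m \<alpha>" unfolding img_def using Comp_fn[OF mA, of _ \<alpha> f] by force
  then show "sub_pts (image_sub RR f S) \<alpha> = fn f \<alpha> ` sub_pts S \<alpha>"
    unfolding eq im_pts(2)[OF c] sub_pts_mem[OF S m] .
qed

lemma Dia_pts:
  assumes S: "S \<in> carrier (Sub RR X)"
  shows "Dia RR X S \<in> carrier (Sub RR X)" "sub_pts (Dia RR X S) \<alpha> = dia_pts G X (sub_pts S) \<alpha>"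
proof -
  have D: "Dia RR X S = ofp G X (dia_pts G X (sub_pts S))" by (simp add: Rel_def ofp_def)
  have s: "dia_pts G X (sub_pts S) \<alpha> \<subseteq> pts X \<alpha>" for \<alpha> by (auto simp: dia_pts_def)
  show "Dia RR X S \<in> carrier (Sub RR X)" "sub_pts (Dia RR X S) \<alpha> = dia_pts G X (sub_pts S) \<alpha>"
    unfolding D using ofp[OF Sub_pts_obj(1)[OF S] s] by simp_all
qed

lemma top_pts:
  assumes "X \<in> rsets G"
  shows "ofp G X (pts X) \<in> carrier (Sub RR X)" "sub_pts (ofp G X (pts X)) \<alpha> = pts X \<alpha>"
  using ofp[OF assms, of "pts X"] by simp_all

lemma boolean_Rel:
  assumes X: "X \<in> rsets G"
  shows "is_boolean_algebra (Sub RR X)"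
proof -
  let ?L = "Sub RR X"
  have uni: "(\<lambda>\<alpha>. sub_pts x \<alpha> \<union> sub_pts y \<alpha>) \<alpha> \<subseteq> pts X \<alpha>" "(\<lambda>\<alpha>. sub_pts x \<alpha> \<inter> sub_pts y \<alpha>) \<alpha> \<subseteq> pts X \<alpha>"
    if "x \<in> carrier ?L" "y \<in> carrier ?L" for x y \<alpha>
    using Sub_pts_obj(2) that by blast+
  note U = ofp[OF X uni(1)] and I = ofp[OF X uni(2)]
  interpret partial_order ?L by (rule R.Sub_partial_order)
  have bot: "(\<lambda>\<alpha>. {}) \<alpha> \<subseteq> pts X \<alpha>" for \<alpha> by simp
  note B = ofp[OF X bot]
  note T = top_pts[OF X]
  interpret bl: bounded_lattice ?L
  proof
    show "\<exists>s. least ?L s (Upper ?L {x, y})" if "x \<in> carrier ?L" "y \<in> carrier ?L" for x y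
      using lub_pts[of "{x, y}" X] U[OF that] that X by (intro exI[of _ "ofp G X (\<lambda>\<alpha>. sub_pts x \<alpha> \<union> sub_pts y \<alpha>)"]) simp
    show "\<exists>s. greatest ?L s (Lower ?L {x, y})" if xy: "x \<in> carrier ?L" "y \<in> carrier ?L" for x y
    proof -
      have "ofp G X (\<lambda>\<alpha>. sub_pts x \<alpha> \<inter> sub_pts y \<alpha>) \<sqsubseteq>\<^bsub>?L\<^esub> x" "ofp G X (\<lambda>\<alpha>. sub_pts x \<alpha> \<inter> sub_pts y \<alpha>) \<sqsubseteq>\<^bsub>?L\<^esub> y"
        using Sub_le_pts[OF I(1)[OF xy]] xy unfolding I(2)[OF xy] by blast+
      moreover have "z \<sqsubseteq>\<^bsub>?L\<^esub> ofp G X (\<lambda>\<alpha>. sub_pts x \<alpha> \<inter> sub_pts y \<alpha>)" if "z \<in> carrier ?L" "z \<sqsubseteq>\<^bsub>?L\<^esub> x" "z \<sqsubseteq>\<^bsub>?L\<^esub> y" for z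
        using Sub_le_pts[OF that(1) I(1)[OF xy]] Sub_le_pts[OF that(1) xy(1)] Sub_le_pts[OF that(1) xy(2)] that(2,3)
        unfolding I(2)[OF xy] by blast
      ultimately show ?thesis using I(1)[OF xy] xy
        by (intro exI[of _ "ofp G X (\<lambda>\<alpha>. sub_pts x \<alpha> \<inter> sub_pts y \<alpha>)"]) (auto simp: greatest_def Lower_def)
    qed
    show "\<exists>x. least ?L x (carrier ?L)"
      using B(1) Sub_le_pts[OF B(1)] unfolding B(2) by (intro exI[of _ "ofp G X (\<lambda>\<alpha>. {})"]) (auto simp: least_def)
    show "\<exists>x. greatest ?L x (carrier ?L)"
      using T(1) Sub_le_pts[OF _ T(1)] Sub_pts_obj(2) unfolding T(2)
      by (intro exI[of _ "ofp G X (pts X)"]) (auto simp: greatest_def)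
  qed
  have join: "sub_pts (x \<squnion>\<^bsub>?L\<^esub> y) \<alpha> = sub_pts x \<alpha> \<union> sub_pts y \<alpha>" if xy: "x \<in> carrier ?L" "y \<in> carrier ?L" for x y \<alpha>
  proof -
    have c: "x \<squnion>\<^bsub>?L\<^esub> y \<in> carrier ?L" using xy by simp
    have "x \<squnion>\<^bsub>?L\<^esub> y \<sqsubseteq>\<^bsub>?L\<^esub> ofp G X (\<lambda>\<alpha>. sub_pts x \<alpha> \<union> sub_pts y \<alpha>)"
      using Sub_le_pts[OF _ U(1)[OF xy]] xy U(1)[OF xy] unfolding U(2)[OF xy] by (intro bl.join_le) auto
    then have "sub_pts (x \<squnion>\<^bsub>?L\<^esub> y) \<alpha> \<subseteq> sub_pts x \<alpha> \<union> sub_pts y \<alpha>"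
      using Sub_le_pts[OF c U(1)[OF xy]] unfolding U(2)[OF xy] by blast
    then show ?thesis using bl.join_left[OF xy] bl.join_right[OF xy] Sub_le_pts[OF xy(1) c] Sub_le_pts[OF xy(2) c] by blast
  qed
  have meet: "sub_pts (x \<sqinter>\<^bsub>?L\<^esub> y) \<alpha> = sub_pts x \<alpha> \<inter> sub_pts y \<alpha>" if xy: "x \<in> carrier ?L" "y \<in> carrier ?L" for x y \<alpha>
  proof -
    have c: "x \<sqinter>\<^bsub>?L\<^esub> y \<in> carrier ?L" using xy by simp
    have "ofp G X (\<lambda>\<alpha>. sub_pts x \<alpha> \<inter> sub_pts y \<alpha>) \<sqsubseteq>\<^bsub>?L\<^esub> x \<sqinter>\<^bsub>?L\<^esub> y"
      using Sub_le_pts[OF I(1)[OF xy]] xy I(1)[OF xy] unfolding I(2)[OF xy] by (intro bl.meet_le) auto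
    then have "sub_pts x \<alpha> \<inter> sub_pts y \<alpha> \<subseteq> sub_pts (x \<sqinter>\<^bsub>?L\<^esub> y) \<alpha>"
      using Sub_le_pts[OF I(1)[OF xy] c] unfolding I(2)[OF xy] by blast
    then show ?thesis using bl.meet_left[OF xy] bl.meet_right[OF xy] Sub_le_pts[OF c xy(1)] Sub_le_pts[OF c xy(2)] by blast
  qed
  have bt: "sub_pts \<bottom>\<^bsub>?L\<^esub> \<alpha> = {}" for \<alpha>
    using bl.bottom_lower[OF B(1)] Sub_le_pts[OF bl.bottom_closed B(1)] unfolding B(2) by blast
  have tp: "sub_pts \<top>\<^bsub>?L\<^esub> \<alpha> = pts X \<alpha>" for \<alpha>
    using bl.top_higher[OF T(1)] Sub_le_pts[OF T(1) bl.top_closed] Sub_pts_obj(2)[OF bl.top_closed] unfolding T(2) by blast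
  show ?thesis unfolding is_boolean_algebra_def
  proof (intro conjI ballI)
    show "bounded_lattice ?L" by unfold_locales
    show "x \<sqinter>\<^bsub>?L\<^esub> (y \<squnion>\<^bsub>?L\<^esub> z) = (x \<sqinter>\<^bsub>?L\<^esub> y) \<squnion>\<^bsub>?L\<^esub> (x \<sqinter>\<^bsub>?L\<^esub> z)"
      if "x \<in> carrier ?L" "y \<in> carrier ?L" "z \<in> carrier ?L" for x y z
      using that by (intro Sub_eq_pts[of _ X]) (auto simp: meet join)
    show "\<exists>y\<in>carrier ?L. x \<sqinter>\<^bsub>?L\<^esub> y = \<bottom>\<^bsub>?L\<^esub> \<and> x \<squnion>\<^bsub>?L\<^esub> y = \<top>\<^bsub>?L\<^esub>" if x: "x \<in> carrier ?L" for x
    proof -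
      have "(\<lambda>\<alpha>. pts X \<alpha> - sub_pts x \<alpha>) \<alpha> \<subseteq> pts X \<alpha>" for \<alpha> by blast
      note C = ofp[OF X this]
      have "x \<sqinter>\<^bsub>?L\<^esub> ofp G X (\<lambda>\<alpha>. pts X \<alpha> - sub_pts x \<alpha>) = \<bottom>\<^bsub>?L\<^esub>"
        using x C by (intro Sub_eq_pts[of _ X]) (auto simp: meet bt)
      moreover have "x \<squnion>\<^bsub>?L\<^esub> ofp G X (\<lambda>\<alpha>. pts X \<alpha> - sub_pts x \<alpha>) = \<top>\<^bsub>?L\<^esub>"
        using x C Sub_pts_obj(2)[OF x] by (intro Sub_eq_pts[of _ X]) (auto simp: join tp)
      ultimately show ?thesis using C(1) by blast
    qed
  qed
qed

theorem Rel_bmcq: "boolean_modal_category_with_quotients RR"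
proof
  fix X Y Z XZ YZ and f i q p1 p2 r1 r2 qZ :: "('n, 'e, 'u) rmap" and S :: "('n, 'e, 'u) rmap set" and A
  show "has_finite_joins (Sub RR X)" if "X \<in> Obj RR"
    unfolding has_finite_joins_def
  proof (intro allI impI)
    fix B assume B: "finite B \<and> B \<subseteq> carrier (Sub RR X)"
    have X: "X \<in> rsets G" using that by simp
    have "(\<Union>S\<in>B. sub_pts S \<alpha>) \<subseteq> pts X \<alpha>" for \<alpha> using B Sub_pts_obj(2) by blast
    from ofp[OF X this] show "\<exists>s. least (Sub RR X) s (Upper (Sub RR X) B)"
      using lub_pts[of B X] B X by blast
  qed
  show "preserves_finite_joins (Sub RR Y) (Sub RR X) (pull RR f)" if "f \<in> Hom RR X Y"
  proof -
    have f: "f \<in> rmaps G" "src f = X" "trg f = Y" using that by (auto simp: Hom_def)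
    have XY: "X \<in> rsets G" "Y \<in> rsets G" using rmapsD(1,2)[OF f(1)] f by simp_all
    note p = pull_pts[OF f(1), unfolded f(2,3)]
    show ?thesis unfolding preserves_finite_joins_def
    proof (intro conjI allI impI)
      show "pull RR f \<in> carrier (Sub RR Y) \<rightarrow> carrier (Sub RR X)" using p(1) by blast
      fix B s assume B: "finite B \<and> B \<subseteq> carrier (Sub RR Y) \<and> least (Sub RR Y) s (Upper (Sub RR Y) B)"
      then have s: "s \<in> carrier (Sub RR Y)" "\<And>\<alpha>. sub_pts s \<alpha> = (\<Union>S\<in>B. sub_pts S \<alpha>)" using lub_pts[OF _ XY(2)] by blast+
      have im: "pull RR f ` B \<subseteq> carrier (Sub RR X)" using B p(1) by blast
      have "sub_pts (pull RR f s) \<alpha> = (\<Union>S\<in>pull RR f ` B. sub_pts S \<alpha>)" for \<alpha>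
      proof -
        have "sub_pts (pull RR f S) \<alpha> = {x \<in> pts X \<alpha>. fn f \<alpha> x \<in> sub_pts S \<alpha>}" if "S \<in> B" for S
          using p(2) B that by blast
        then have "(\<Union>S\<in>pull RR f ` B. sub_pts S \<alpha>) = (\<Union>S\<in>B. {x \<in> pts X \<alpha>. fn f \<alpha> x \<in> sub_pts S \<alpha>})"
          by simp
        then show ?thesis unfolding p(2)[OF s(1)] s(2) by blast
      qed
      then show "least (Sub RR X) (pull RR f s) (Upper (Sub RR X) (pull RR f ` B))"
        unfolding lub_pts[OF im XY(1)] using p(1)[OF s(1)] by blast
    qed
  qed
  show "preserves_finite_joins (Sub RR X) (Sub RR X) (Dia RR X)" if "X \<in> Obj RR"
  proof -
    have X: "X \<in> rsets G" using that by simp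
    show ?thesis unfolding preserves_finite_joins_def
    proof (intro conjI allI impI)
      show "Dia RR X \<in> carrier (Sub RR X) \<rightarrow> carrier (Sub RR X)" using Dia_pts(1) by blast
      fix B s assume B: "finite B \<and> B \<subseteq> carrier (Sub RR X) \<and> least (Sub RR X) s (Upper (Sub RR X) B)"
      then have s: "s \<in> carrier (Sub RR X)" "\<And>\<alpha>. sub_pts s \<alpha> = (\<Union>S\<in>B. sub_pts S \<alpha>)" using lub_pts[OF _ X] by blast+
      have im: "Dia RR X ` B \<subseteq> carrier (Sub RR X)" using B Dia_pts(1) by blast
      have "sub_pts (Dia RR X s) \<alpha> = (\<Union>S\<in>Dia RR X ` B. sub_pts S \<alpha>)" for \<alpha>
      proof -
        have "(\<Union>S\<in>Dia RR X ` B. sub_pts S \<alpha>) = (\<Union>S\<in>B. dia_pts G X (sub_pts S) \<alpha>)"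
          using Dia_pts(2) B by (auto simp: subset_iff)
        then show ?thesis unfolding Dia_pts(2)[OF s(1)] using s(2) by (auto simp: dia_pts_def)
      qed
      then show "least (Sub RR X) (Dia RR X s) (Upper (Sub RR X) (Dia RR X ` B))"
        unfolding lub_pts[OF im X] using Dia_pts(1)[OF s(1)] by blast
    qed
  qed
  show "Dia RR X (pull RR f S) \<sqsubseteq>\<^bsub>Sub RR X\<^esub> pull RR f (Dia RR Y S)" if "f \<in> Hom RR X Y" "S \<in> carrier (Sub RR Y)"
  proof -
    have f: "f \<in> rmaps G" "src f = X" "trg f = Y" using that(1) by (auto simp: Hom_def)
    note p = pull_pts[OF f(1), unfolded f(2,3)]
    note D = Dia_pts[OF that(2)]
    show ?thesis
      unfolding Sub_le_pts[OF Dia_pts(1)[OF p(1)[OF that(2)]] p(1)[OF D(1)]] Dia_pts(2)[OF p(1)[OF that(2)]] p(2)[OF D(1)] D(2)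
      using p(2)[OF that(2)] rmapsD(3,4)[OF f(1)] f(2,3) by (fastforce simp: dia_pts_def)
  qed
  show "Dia RR A (pull RR i S) = pull RR i (Dia RR X (image_sub RR i (pull RR i S)))"
    if "i \<in> Mon RR" "i \<in> Hom RR A X" "S \<in> carrier (Sub RR X)"
  proof -
    have i: "i \<in> rmono G" "i \<in> rmaps G" "src i = A" "trg i = X" using that(1,2) by (auto simp: Hom_def)
    note p = pull_pts[OF i(2), unfolded i(3,4)]
    note P = p(1)[OF that(3)]
    note I = image_pts[OF i(2), unfolded i(3,4), OF P]
    note D = Dia_pts[OF I(1)]
    have "sub_pts (Dia RR A (pull RR i S)) \<alpha> = sub_pts (pull RR i (Dia RR X (image_sub RR i (pull RR i S)))) \<alpha>" for \<alpha>
      unfolding Dia_pts(2)[OF P] p(2)[OF D(1)] D(2)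
    proof (intro equalityI subsetI)
      fix s assume "s \<in> dia_pts G A (sub_pts (pull RR i S)) \<alpha>"
      then obtain k t where s: "s \<in> pts A \<alpha>" "k \<in> arcs G" "tail G k = \<alpha>" "t \<in> sub_pts (pull RR i S) (head G k)" "(s, t) \<in> rel A k"
        by (auto simp: dia_pts_def)
      then show "s \<in> {x \<in> pts A \<alpha>. fn i \<alpha> x \<in> dia_pts G X (sub_pts (image_sub RR i (pull RR i S))) \<alpha>}"
        using rmapsD(3,4)[OF i(2)] i(3,4) I(2) unfolding dia_pts_def by blast
    next
      fix s assume "s \<in> {x \<in> pts A \<alpha>. fn i \<alpha> x \<in> dia_pts G X (sub_pts (image_sub RR i (pull RR i S))) \<alpha>}"
      then obtain k t where s: "s \<in> pts A \<alpha>" "k \<in> arcs G" "tail G k = \<alpha>" "t \<in> sub_pts (pull RR i S) (head G k)"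
        "(fn i \<alpha> s, fn i (head G k) t) \<in> rel X k"
        unfolding dia_pts_def I(2) by blast
      have "t \<in> pts A (head G k)" using Sub_pts_obj(2)[OF P] s(4) by blast
      \<comment> \<open>Here the relation on \<open>A\<close> has to be the one induced from
        \<open>X\<close>.\<close>
      then have "(s, t) \<in> rel A k" using rmonoD(3)[OF i(1), of s k t] s i(3,4) by simp
      then show "s \<in> dia_pts G A (sub_pts (pull RR i S)) \<alpha>" using s unfolding dia_pts_def by blast
    qed
    then show ?thesis by (intro Sub_eq_pts[OF Dia_pts(1)[OF P] p(1)[OF D(1)]])
  qed
  show "is_boolean_algebra (Sub RR X)" if "X \<in> Obj RR" using boolean_Rel that by simp
  show "Quo RR \<subseteq> Mperp RR"
  proof
    fix e assume "e \<in> Quo RR"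
    then have e: "e \<in> rmaps G" "\<forall>\<alpha>\<in>verts G. fn e \<alpha> ` pts (src e) \<alpha> = pts (trg e) \<alpha>" by (auto simp: rquot_def)
    have "pts (trg e) \<alpha> \<subseteq> img e \<alpha>" for \<alpha> using e(2) rsetsD(1)[OF rmapsD(2)[OF e(1)], of _ \<alpha>] by (auto simp: img_def)
    then show "e \<in> Mperp RR" using e(1) img_sub[OF e(1)] unfolding Mperp_iff by blast
  qed
  show "Dia RR YZ S \<sqsubseteq>\<^bsub>Sub RR YZ\<^esub> image_sub RR qZ (Dia RR XZ (pull RR qZ S))"
    if q: "q \<in> Quo RR" "q \<in> Hom RR X Y" and "Z \<in> Obj RR" and pr: "is_product RR X Z XZ p1 p2" "is_product RR Y Z YZ r1 r2"
      and qZ: "qZ \<in> Hom RR XZ YZ" and eq: "r1 \<cdot>\<^bsub>RR\<^esub> qZ = q \<cdot>\<^bsub>RR\<^esub> p1" "r2 \<cdot>\<^bsub>RR\<^esub> qZ = p2" and S: "S \<in> carrier (Sub RR YZ)"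
  proof -
    have q': "q \<in> rmaps G" "src q = X" "trg q = Y" using q by (auto simp: Hom_def)
    have qZ': "qZ \<in> rmaps G" "src qZ = XZ" "trg qZ = YZ" using qZ by (auto simp: Hom_def)
    note p = R.is_productD[OF pr(1), unfolded Rel_sel] and r = R.is_productD[OF pr(2), unfolded Rel_sel]
    note P = pull_pts[OF qZ'(1), unfolded qZ'(2,3), OF S]
    note D = Dia_pts[OF P(1)]
    note I = image_pts[OF qZ'(1), unfolded qZ'(2,3), OF D(1)]
    \<comment> \<open>Products with \<open>Z\<close> preserve quotients: the first components of a
      related pair lift along \<open>q\<close>, the second components are kept, and the product
      contains the combined related pair.\<close>
    have lift: "\<exists>z w. (z, w) \<in> rel XZ k \<and> fn qZ (tail G k) z = s \<and> fn qZ (head G k) w = t" if st: "(s, t) \<in> rel YZ k" for s t k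
    proof -
      have YZ: "YZ \<in> rsets G" using rmapsD(2)[OF qZ'(1)] qZ'(3) by simp
      have k: "k \<in> arcs G" using rsetsD(2)[OF YZ st] .
      have "(fn r1 (tail G k) s, fn r1 (head G k) t) \<in> rel Y k" "(fn r2 (tail G k) s, fn r2 (head G k) t) \<in> rel Z k"
        using rmapsD(4)[OF r(1), of s t k] rmapsD(4)[OF r(2), of s t k] st r(3-6) by simp_all
      moreover from this obtain x x' where x: "(x, x') \<in> rel X k" "fn q (tail G k) x = fn r1 (tail G k) s" "fn q (head G k) x' = fn r1 (head G k) t"
        using q(1) q' k unfolding rquot_def Rel_sel by blast
      ultimately obtain z w where z: "(z, w) \<in> rel XZ k" "fn p1 (tail G k) z = x" "fn p1 (head G k) w = x'"
        "fn p2 (tail G k) z = fn r2 (tail G k) s" "fn p2 (head G k) w = fn r2 (head G k) t"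
        using product_points(2)[OF pr(1)] by blast
      have XZ: "XZ \<in> rsets G" using rmapsD(1)[OF qZ'(1)] qZ'(2) by simp
      note zp = rsetsD(3,4)[OF XZ z(1)] and sp = rsetsD(3,4)[OF YZ st]
      have a1: "fn r1 \<beta> (fn qZ \<beta> y) = fn q \<beta> (fn p1 \<beta> y)" "fn r2 \<beta> (fn qZ \<beta> y) = fn p2 \<beta> y" "fn qZ \<beta> y \<in> pts YZ \<beta>"
        if "y \<in> pts XZ \<beta>" for \<beta> y
        using Rel_Comp_eqD[OF eq(1) qZ'(1) p(1), of y \<beta>] Comp_fn[OF qZ'(1), of y \<beta> r2] eq(2) that qZ'(2,3) p(3) rmapsD(3)[OF qZ'(1), of y \<beta>]
        by simp_all
      have "fn qZ (tail G k) z = s"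
        using product_points(1)[OF pr(2) a1(3)[OF zp(1)] sp(1)] a1(1,2)[OF zp(1)] x z by simp
      moreover have "fn qZ (head G k) w = t"
        using product_points(1)[OF pr(2) a1(3)[OF zp(2)] sp(2)] a1(1,2)[OF zp(2)] x z by simp
      ultimately show ?thesis using z(1) by blast
    qed
    show ?thesis
      unfolding Sub_le_pts[OF Dia_pts(1)[OF S] I(1)] Dia_pts(2)[OF S] I(2) D(2)
    proof (intro allI subsetI)
      fix \<alpha> s assume "s \<in> dia_pts G YZ (sub_pts S) \<alpha>"
      then obtain k t where s: "k \<in> arcs G" "tail G k = \<alpha>" "t \<in> sub_pts S (head G k)" "(s, t) \<in> rel YZ k"
        by (auto simp: dia_pts_def)
      obtain z w where z: "(z, w) \<in> rel XZ k" "fn qZ \<alpha> z = s" "fn qZ (head G k) w = t" using lift[OF s(4)] s(2) by blast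
      have XZ: "XZ \<in> rsets G" using rmapsD(1)[OF qZ'(1)] qZ'(2) by simp
      note zp = rsetsD(3,4)[OF XZ z(1)]
      have "w \<in> sub_pts (pull RR qZ S) (head G k)" unfolding P(2) using zp(2) z(3) s(3) by blast
      then have "z \<in> dia_pts G XZ (sub_pts (pull RR qZ S)) \<alpha>" using s(1,2) z(1) zp(1) unfolding dia_pts_def by blast
      then show "s \<in> fn qZ \<alpha> ` dia_pts G XZ (sub_pts (pull RR qZ S)) \<alpha>" using z(2) by blast
    qed
  qed
qed

end

section \<open>From families of models to functors\<close>

text \<open>The interface between models and \<open>Rel G\<close>: \<open>P\<close> and
  \<open>A\<close> give a functor to sets at each node, and \<open>R\<close> gives at each arc a
  subfunctor of the product of the functors at its ends. All assumptions speak of elements, so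
  towers and ultraproducts do not enter the categorical part.\<close>

locale rep = relcat G tup pa pb + E: boolean_modal_category_with_quotients C
  for G :: "('n, 'e) pre_digraph" and tup :: "(nat \<Rightarrow> 'u) \<Rightarrow> 'u" and pa pb :: 'u
    and C :: "('o, 'a) modal_quot_cat" (structure) +
  fixes P :: "'n \<Rightarrow> 'o \<Rightarrow> 'u set" and A :: "'n \<Rightarrow> 'a \<Rightarrow> 'u \<Rightarrow> 'u" and R :: "'e \<Rightarrow> 'o \<Rightarrow> ('u \<times> 'u) set"
  assumes A_in: "\<lbrakk>\<nu> \<in> verts G; f \<in> Arr C; x \<in> P \<nu> (Dom C f)\<rbrakk> \<Longrightarrow> A \<nu> f x \<in> P \<nu> (Cod C f)"
    and A_ident: "\<lbrakk>\<nu> \<in> verts G; X \<in> Obj C; x \<in> P \<nu> X\<rbrakk> \<Longrightarrow> A \<nu> (Ident C X) x = x"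
    and A_comp: "\<lbrakk>\<nu> \<in> verts G; f \<in> Arr C; g \<in> Arr C; Dom C g = Cod C f; x \<in> P \<nu> (Dom C f)\<rbrakk> \<Longrightarrow> A \<nu> (g \<cdot> f) x = A \<nu> g (A \<nu> f x)"
    and R_sub: "\<lbrakk>k \<in> arcs G; (x, y) \<in> R k X\<rbrakk> \<Longrightarrow> x \<in> P (tail G k) X \<and> y \<in> P (head G k) X"
    and R_A: "\<lbrakk>k \<in> arcs G; f \<in> Arr C; (x, y) \<in> R k (Dom C f)\<rbrakk> \<Longrightarrow> (A (tail G k) f x, A (head G k) f y) \<in> R k (Cod C f)"
    and P_lim: "\<lbrakk>\<nu> \<in> verts G; finite_diagram (J :: (nat, nat) cat) C Do Da; is_limit J C Do Da L l; \<forall>i\<in>Obj J. z i \<in> P \<nu> (Do i);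
       \<forall>u\<in>Arr J. A \<nu> (Da u) (z (Dom J u)) = z (Cod J u)\<rbrakk> \<Longrightarrow> \<exists>x\<in>P \<nu> L. \<forall>i\<in>Obj J. A \<nu> (l i) x = z i"
    and P_lim_uniq: "\<lbrakk>\<nu> \<in> verts G; finite_diagram (J :: (nat, nat) cat) C Do Da; is_limit J C Do Da L l; x \<in> P \<nu> L; y \<in> P \<nu> L;
       \<forall>i\<in>Obj J. A \<nu> (l i) x = A \<nu> (l i) y\<rbrakk> \<Longrightarrow> x = y"
    and R_lim: "\<lbrakk>k \<in> arcs G; finite_diagram (J :: (nat, nat) cat) C Do Da; is_limit J C Do Da L l; x \<in> P (tail G k) L; y \<in> P (head G k) L;
       \<forall>i\<in>Obj J. (A (tail G k) (l i) x, A (head G k) (l i) y) \<in> R k (Do i)\<rbrakk> \<Longrightarrow> (x, y) \<in> R k L"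
    and P_perp: "\<lbrakk>\<nu> \<in> verts G; e \<in> Mperp C; x \<in> P \<nu> (Cod C e)\<rbrakk> \<Longrightarrow> \<exists>y\<in>P \<nu> (Dom C e). A \<nu> e y = x"
    and P_mon: "\<lbrakk>\<nu> \<in> verts G; m \<in> Mon C; x \<in> P \<nu> (Dom C m); y \<in> P \<nu> (Dom C m); A \<nu> m x = A \<nu> m y\<rbrakk> \<Longrightarrow> x = y"
    and R_mon: "\<lbrakk>k \<in> arcs G; m \<in> Mon C; x \<in> P (tail G k) (Dom C m); y \<in> P (head G k) (Dom C m);
       (A (tail G k) m x, A (head G k) m y) \<in> R k (Cod C m)\<rbrakk> \<Longrightarrow> (x, y) \<in> R k (Dom C m)"
    and P_join: "\<lbrakk>\<nu> \<in> verts G; is_join C X (subobj C m1) (subobj C m2) (subobj C m); m1 \<in> Mon C; m2 \<in> Mon C; m \<in> Mon C; x \<in> P \<nu> (Dom C m)\<rbrakk>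
       \<Longrightarrow> A \<nu> m x \<in> A \<nu> m1 ` P \<nu> (Dom C m1) \<union> A \<nu> m2 ` P \<nu> (Dom C m2)"
    and P_disj: "\<lbrakk>\<nu> \<in> verts G; is_compl C X (subobj C m1) (subobj C m2); m1 \<in> Mon C; m2 \<in> Mon C; x \<in> P \<nu> (Dom C m1); y \<in> P \<nu> (Dom C m2)\<rbrakk>
       \<Longrightarrow> A \<nu> m1 x \<noteq> A \<nu> m2 y"
    and P_null: "\<lbrakk>\<nu> \<in> verts G; null C X\<rbrakk> \<Longrightarrow> P \<nu> X = {}"
    and P_dia: "\<lbrakk>\<nu> \<in> verts G; m \<in> Mon C; d \<in> Dia C (Cod C m) (subobj C m)\<rbrakk> \<Longrightarrow> A \<nu> d ` P \<nu> (Dom C d) =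
       {x \<in> P \<nu> (Cod C m). \<exists>k\<in>arcs G. tail G k = \<nu> \<and> (\<exists>y\<in>P (head G k) (Dom C m). (x, A (head G k) m y) \<in> R k (Cod C m))}"
    and R_quo: "\<lbrakk>k \<in> arcs G; q \<in> Quo C; (x, y) \<in> R k (Cod C q)\<rbrakk> \<Longrightarrow>
       \<exists>x' y'. (x', y') \<in> R k (Dom C q) \<and> A (tail G k) q x' = x \<and> A (head G k) q y' = y"
    and P_conservative: "\<lbrakk>X \<in> Obj C; \<not> null C X\<rbrakk> \<Longrightarrow> \<exists>\<nu>\<in>verts G. P \<nu> X \<noteq> {}"
begin

definition Fo :: "'o \<Rightarrow> ('n, 'e, 'u) rset" where
  "Fo X = \<lparr>pts = (\<lambda>\<nu>. if \<nu> \<in> verts G then P \<nu> X else {}), rel = (\<lambda>k. if k \<in> arcs G then R k X else {})\<rparr>"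

definition Fa :: "'a \<Rightarrow> ('n, 'e, 'u) rmap" where
  "Fa f = mk G (Fo (Dom C f)) (Fo (Cod C f)) (\<lambda>\<nu>. A \<nu> f)"

lemma Fo_mem [simp]:
  "x \<in> pts (Fo X) \<nu> \<longleftrightarrow> \<nu> \<in> verts G \<and> x \<in> P \<nu> X"
  "(x, y) \<in> rel (Fo X) k \<longleftrightarrow> k \<in> arcs G \<and> (x, y) \<in> R k X"
  by (auto simp: Fo_def)

lemma Fo_rset: "Fo X \<in> rsets G"
  using R_sub by (intro rsetsI) (auto simp: Fo_def)

lemma Fa:
  assumes "f \<in> Arr C"
  shows "Fa f \<in> rmaps G" "src (Fa f) = Fo (Dom C f)" "trg (Fa f) = Fo (Cod C f)"
  unfolding Fa_def using A_in R_A assms by (auto intro!: mk_rmaps Fo_rset)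

lemma Fa_fn: "\<nu> \<in> verts G \<Longrightarrow> x \<in> P \<nu> (Dom C f) \<Longrightarrow> fn (Fa f) \<nu> x = A \<nu> f x"
  unfolding Fa_def using mk_fn[OF Fo_rset] by simp

lemma rep_functor: "category_functor C RR Fo Fa"
proof unfold_locales
  show "X \<in> Obj C \<Longrightarrow> Fo X \<in> Obj RR" for X using Fo_rset by simp
  show "f \<in> Hom C X Y \<Longrightarrow> Fa f \<in> Hom RR (Fo X) (Fo Y)" for f X Y using Fa[of f] by (auto simp: Hom_def)
  show "Fa (Ident C X) = Ident RR (Fo X)" if X: "X \<in> Obj C" for X
  proof (rule rmap_eqI)
    have I: "Ident C X \<in> Arr C" "Dom C (Ident C X) = X" "Cod C (Ident C X) = X" using E.ident_arr[OF X] .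
    note F = Fa[OF I(1), unfolded I(2,3)]
    show "Fa (Ident C X) \<in> rmaps G" "Ident RR (Fo X) \<in> rmaps G" "src (Fa (Ident C X)) = src (Ident RR (Fo X))"
      "trg (Fa (Ident C X)) = trg (Ident RR (Fo X))" using F Ident_rmaps[OF Fo_rset] by simp_all
    show "fn (Fa (Ident C X)) \<nu> x = fn (Ident RR (Fo X)) \<nu> x" if "x \<in> pts (src (Fa (Ident C X))) \<nu>" for \<nu> x
      using that F Fa_fn[of \<nu> x "Ident C X"] I Ident_fn[OF Fo_rset, of x X \<nu>] A_ident[of \<nu> X x] X by simp
  qed
  show "Fa (g \<cdot> f) = Fa g \<cdot>\<^bsub>RR\<^esub> Fa f" if fg: "f \<in> Hom C X Y" "g \<in> Hom C Y Z" for f g X Y Z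
  proof (rule rmap_eqI)
    have f: "f \<in> Arr C" "Dom C f = X" "Cod C f = Y" "g \<in> Arr C" "Dom C g = Y" "Cod C g = Z" using fg by (auto simp: Hom_def)
    have gf: "g \<cdot> f \<in> Arr C" "Dom C (g \<cdot> f) = X" "Cod C (g \<cdot> f) = Z" using f by simp_all
    show "Fa (g \<cdot> f) \<in> rmaps G" "Fa g \<cdot>\<^bsub>RR\<^esub> Fa f \<in> rmaps G" "src (Fa (g \<cdot> f)) = src (Fa g \<cdot>\<^bsub>RR\<^esub> Fa f)"
      "trg (Fa (g \<cdot> f)) = trg (Fa g \<cdot>\<^bsub>RR\<^esub> Fa f)"
      using Fa[OF f(1)] Fa[OF f(4)] Fa[OF gf(1)] gf f by (auto intro: Comp_rmaps)
    show "fn (Fa (g \<cdot> f)) \<nu> x = fn (Fa g \<cdot>\<^bsub>RR\<^esub> Fa f) \<nu> x" if "x \<in> pts (src (Fa (g \<cdot> f))) \<nu>" for \<nu> x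
    proof -
      have x: "\<nu> \<in> verts G" "x \<in> P \<nu> X" using that Fa[OF gf(1)] gf(2) by simp_all
      have "fn (Fa g \<cdot>\<^bsub>RR\<^esub> Fa f) \<nu> x = fn (Fa g) \<nu> (fn (Fa f) \<nu> x)" using Comp_fn[OF Fa(1)[OF f(1)]] Fa(2)[OF f(1)] x f by simp
      then show ?thesis using Fa_fn[of \<nu> x "g \<cdot> f"] Fa_fn[of \<nu> x f] Fa_fn[of \<nu> "A \<nu> f x" g] x gf f A_in[of \<nu> f x] A_comp[of \<nu> f g x] by simp
    qed
  qed
qed

text \<open>The universal property is checked elementwise: \<open>P_lim\<close> and
  \<open>P_lim_uniq\<close> give the mediating function node by node, and \<open>R_lim\<close> makes
  it a morphism.\<close>

lemma functor_limits: "preserves_finite_limits C RR Fo Fa"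
  unfolding preserves_finite_limits_def
proof (intro allI impI)
  fix J :: "(nat, nat) cat" and Do Da L l
  assume "finite_diagram J C Do Da \<and> is_limit J C Do Da L l"
  then have J: "finite_diagram J C Do Da" and lim: "is_limit J C Do Da L l" by auto
  interpret F: category_functor J C Do Da using J by (simp add: finite_diagram_def)
  have l: "l i \<in> Arr C" "Dom C (l i) = L" "Cod C (l i) = Do i" if "i \<in> Obj J" for i
    using lim that by (auto simp: is_limit_def is_cone_def Hom_def)
  have lc: "Da u \<cdot> l (Dom J u) = l (Cod J u)" if "u \<in> Arr J" for u using lim that by (auto simp: is_limit_def is_cone_def)
  have Jo: "Dom J u \<in> Obj J" "Cod J u \<in> Obj J" if "u \<in> Arr J" for u
    using that F.source.dom_obj F.source.cod_obj by auto
  have Da: "Da u \<in> Arr C" "Dom C (Da u) = Do (Dom J u)" "Cod C (Da u) = Do (Cod J u)" if "u \<in> Arr J" for u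
    using F.map_hom[of u "Dom J u" "Cod J u"] that by (auto simp: Hom_def)
  interpret Fu: category_functor C RR Fo Fa by (rule rep_functor)
  show "is_limit J RR (Fo \<circ> Do) (Fa \<circ> Da) (Fo L) (Fa \<circ> l)"
    unfolding is_limit_def
  proof (intro conjI allI impI)
    show "is_cone J RR (Fo \<circ> Do) (Fa \<circ> Da) (Fo L) (Fa \<circ> l)"
      unfolding is_cone_def
    proof (intro conjI ballI)
      show "Fo L \<in> Obj RR" using Fo_rset by simp
      show "(Fa \<circ> l) i \<in> Hom RR (Fo L) ((Fo \<circ> Do) i)" if "i \<in> Obj J" for i
        using Fa[OF l(1)[OF that]] l[OF that] by (simp add: Hom_def)
      show "(Fa \<circ> Da) u \<cdot>\<^bsub>RR\<^esub> (Fa \<circ> l) (Dom J u) = (Fa \<circ> l) (Cod J u)" if u: "u \<in> Arr J" for u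
        using Fu.map_comp[of "l (Dom J u)" L "Do (Dom J u)" "Da u" "Do (Cod J u)"] l[OF Jo(1)[OF u]] Da[OF u] lc[OF u]
        by (simp add: Hom_def)
    qed
    fix W x assume "is_cone J RR (Fo \<circ> Do) (Fa \<circ> Da) W x"
    then have W: "W \<in> rsets G" and x: "\<And>i. i \<in> Obj J \<Longrightarrow> x i \<in> rmaps G" "\<And>i. i \<in> Obj J \<Longrightarrow> src (x i) = W"
      "\<And>i. i \<in> Obj J \<Longrightarrow> trg (x i) = Fo (Do i)"
      and c: "\<And>u. u \<in> Arr J \<Longrightarrow> Fa (Da u) \<cdot>\<^bsub>RR\<^esub> x (Dom J u) = x (Cod J u)" by (auto simp: is_cone_def Hom_def)
    have xp: "fn (x i) \<nu> w \<in> P \<nu> (Do i)" if "i \<in> Obj J" "w \<in> pts W \<nu>" for i \<nu> w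
      using rmapsD(3)[OF x(1)[OF that(1)], of w \<nu>] x(2,3)[OF that(1)] that(2) by simp
    have "\<exists>p\<in>P \<nu> L. \<forall>i\<in>Obj J. A \<nu> (l i) p = fn (x i) \<nu> w" if w: "w \<in> pts W \<nu>" for \<nu> w
    proof (rule P_lim[OF rsetsD(1)[OF W w] J lim])
      show "\<forall>i\<in>Obj J. fn (x i) \<nu> w \<in> P \<nu> (Do i)" using xp w by blast
      show "\<forall>u\<in>Arr J. A \<nu> (Da u) (fn (x (Dom J u)) \<nu> w) = fn (x (Cod J u)) \<nu> w"
      proof
        fix u assume u: "u \<in> Arr J"
        show "A \<nu> (Da u) (fn (x (Dom J u)) \<nu> w) = fn (x (Cod J u)) \<nu> w"
          using Comp_fn[OF x(1)[OF Jo(1)[OF u]], of w \<nu> "Fa (Da u)"] x(2)[OF Jo(1)[OF u]] c[OF u] w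
            Fa_fn[OF rsetsD(1)[OF W w], of "fn (x (Dom J u)) \<nu> w" "Da u"] xp[OF Jo(1)[OF u] w] Da(2)[OF u] by simp
      qed
    qed
    note ex = this[unfolded Bex_def]
    define \<phi> where "\<phi> \<nu> w = (SOME p. p \<in> P \<nu> L \<and> (\<forall>i\<in>Obj J. A \<nu> (l i) p = fn (x i) \<nu> w))" for \<nu> w
    have \<phi>: "\<phi> \<nu> w \<in> P \<nu> L" "\<And>i. i \<in> Obj J \<Longrightarrow> A \<nu> (l i) (\<phi> \<nu> w) = fn (x i) \<nu> w" if "w \<in> pts W \<nu>" for \<nu> w
      using someI_ex[OF ex[OF that]] unfolding \<phi>_def[symmetric] by blast+
    define h where "h = mk G W (Fo L) \<phi>"
    have h: "h \<in> rmaps G" "src h = W" "trg h = Fo L"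
      unfolding h_def
    proof (rule mk_rmaps[OF W Fo_rset])
      show "\<phi> \<nu> w \<in> pts (Fo L) \<nu>" if "w \<in> pts W \<nu>" for \<nu> w using \<phi>(1)[OF that] rsetsD(1)[OF W that] by simp
      fix k s t assume st: "(s, t) \<in> rel W k"
      note p = rsetsD(2,3,4)[OF W st]
      have "(A (tail G k) (l i) (\<phi> (tail G k) s), A (head G k) (l i) (\<phi> (head G k) t)) \<in> R k (Do i)" if i: "i \<in> Obj J" for i
        unfolding \<phi>(2)[OF p(2) i] \<phi>(2)[OF p(3) i] using rmapsD(4)[OF x(1)[OF i], of s t k] x(2,3)[OF i] st by simp
      then have "(\<phi> (tail G k) s, \<phi> (head G k) t) \<in> R k L" using R_lim[OF p(1) J lim \<phi>(1)[OF p(2)] \<phi>(1)[OF p(3)]] by blast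
      then show "(\<phi> (tail G k) s, \<phi> (head G k) t) \<in> rel (Fo L) k" using p(1) by simp
    qed simp_all
    have hf: "fn h \<nu> w = \<phi> \<nu> w" if "w \<in> pts W \<nu>" for \<nu> w unfolding h_def using mk_fn[OF W that] .
    have lf: "fn (Fa (l i)) \<nu> p = A \<nu> (l i) p" if "i \<in> Obj J" "\<nu> \<in> verts G" "p \<in> P \<nu> L" for i \<nu> p
      using Fa_fn[OF that(2), of p "l i"] that(3) l(2)[OF that(1)] by simp
    have hl: "Fa (l i) \<cdot>\<^bsub>RR\<^esub> h = x i" if i: "i \<in> Obj J" for i
    proof (rule rmap_eqI)
      show "Fa (l i) \<cdot>\<^bsub>RR\<^esub> h \<in> rmaps G" by (rule Comp_rmaps[OF h(1) Fa(1)[OF l(1)[OF i]]]) (simp add: Fa(2)[OF l(1)[OF i]] l(2)[OF i] h(3))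
      show "fn (Fa (l i) \<cdot>\<^bsub>RR\<^esub> h) \<nu> w = fn (x i) \<nu> w" if "w \<in> pts (src (Fa (l i) \<cdot>\<^bsub>RR\<^esub> h)) \<nu>" for \<nu> w
      proof -
        have w: "w \<in> pts W \<nu>" using that h(2) by simp
        show ?thesis using Comp_fn[OF h(1), of w \<nu> "Fa (l i)"] h(2) w hf[OF w] lf[OF i rsetsD(1)[OF W w] \<phi>(1)[OF w]] \<phi>(2)[OF w i] by simp
      qed
    qed (use x[OF i] h Fa(3)[OF l(1)[OF i]] l(3)[OF i] in simp_all)
    show "\<exists>!h. h \<in> Hom RR W (Fo L) \<and> (\<forall>i\<in>Obj J. (Fa \<circ> l) i \<cdot>\<^bsub>RR\<^esub> h = x i)"
    proof (rule ex1I[of _ h])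
      show "h \<in> Hom RR W (Fo L) \<and> (\<forall>i\<in>Obj J. (Fa \<circ> l) i \<cdot>\<^bsub>RR\<^esub> h = x i)" using h hl by (simp add: Hom_def)
      fix h' assume h': "h' \<in> Hom RR W (Fo L) \<and> (\<forall>i\<in>Obj J. (Fa \<circ> l) i \<cdot>\<^bsub>RR\<^esub> h' = x i)"
      then have h'': "h' \<in> rmaps G" "src h' = W" "trg h' = Fo L" by (auto simp: Hom_def)
      show "h' = h"
      proof (rule rmap_eqI[OF h''(1) h(1)])
        fix \<nu> w assume "w \<in> pts (src h') \<nu>"
        then have w: "w \<in> pts W \<nu>" using h'' by simp
        have v: "\<nu> \<in> verts G" using rsetsD(1)[OF W w] .
        have p: "fn h' \<nu> w \<in> P \<nu> L" using rmapsD(3)[OF h''(1), of w \<nu>] h'' w by simp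
        have "A \<nu> (l i) (fn h' \<nu> w) = A \<nu> (l i) (\<phi> \<nu> w)" if i: "i \<in> Obj J" for i
          using Comp_fn[OF h''(1), of w \<nu> "Fa (l i)"] h''(2) w h' i lf[OF i v p] \<phi>(2)[OF w i] by simp
        then have "fn h' \<nu> w = \<phi> \<nu> w" using P_lim_uniq[OF v J lim p \<phi>(1)[OF w]] by blast
        then show "fn h' \<nu> w = fn h \<nu> w" using hf[OF w] by simp
      qed (use h h'' in simp_all)
    qed
  qed
qed

lemma Fa_Mon: "m \<in> Mon C \<Longrightarrow> Fa m \<in> rmono G"
proof -
  assume m: "m \<in> Mon C"
  then have mA: "m \<in> Arr C" by simp
  show ?thesis
  proof (rule rmonoI[OF Fa(1)[OF mA]])
    show "x = y" if "x \<in> pts (src (Fa m)) \<nu>" "y \<in> pts (src (Fa m)) \<nu>" "fn (Fa m) \<nu> x = fn (Fa m) \<nu> y" for \<nu> x y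
      using that Fa(2)[OF mA] Fa_fn[of \<nu> _ m] P_mon[OF _ m, of \<nu> x y] by simp
    show "(s, t) \<in> rel (src (Fa m)) k" if st: "s \<in> pts (src (Fa m)) (tail G k)" "t \<in> pts (src (Fa m)) (head G k)"
      "(fn (Fa m) (tail G k) s, fn (Fa m) (head G k) t) \<in> rel (trg (Fa m)) k" for k s t
      using st Fa(2,3)[OF mA] Fa_fn[of "tail G k" s m] Fa_fn[of "head G k" t m] R_mon[of k m s t] m by simp
  qed
qed

lemma Fa_Mperp: "e \<in> Mperp C \<Longrightarrow> Fa e \<in> Mperp RR"
proof -
  assume e: "e \<in> Mperp C"
  then have eA: "e \<in> Arr C" by simp
  have "x \<in> img (Fa e) \<nu>" if x: "x \<in> pts (trg (Fa e)) \<nu>" for x \<nu>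
  proof -
    have "\<nu> \<in> verts G" "x \<in> P \<nu> (Cod C e)" using x Fa(3)[OF eA] by simp_all
    moreover from P_perp[OF this(1) e this(2)] obtain y where "y \<in> P \<nu> (Dom C e)" "A \<nu> e y = x" by blast
    ultimately show ?thesis unfolding img_def using Fa(2)[OF eA] Fa_fn[of \<nu> y e] by force
  qed
  then show ?thesis unfolding Mperp_iff using Fa(1)[OF eA] img_sub[OF Fa(1)[OF eA]] by blast
qed

lemma Fa_img: "f \<in> Arr C \<Longrightarrow> img (Fa f) \<nu> = (if \<nu> \<in> verts G then A \<nu> f ` P \<nu> (Dom C f) else {})"
  using Fa(2)[of f] Fa_fn[of \<nu> _ f] by (auto simp: img_def Fo_def)

lemma img_mono:
  assumes "factors_through C h m" "m \<in> Arr C"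
  shows "img (Fa h) \<nu> \<subseteq> img (Fa m) \<nu>"
proof -
  obtain k where k: "k \<in> Arr C" "Dom C k = Dom C h" "Cod C k = Dom C m" "m \<cdot> k = h" "Cod C h = Cod C m" "h \<in> Arr C"
    using assms by (rule E.factors_throughE)
  have "A \<nu> h x \<in> A \<nu> m ` P \<nu> (Dom C m)" if "\<nu> \<in> verts G" "x \<in> P \<nu> (Dom C h)" for x
    using A_comp[OF that(1) k(1) assms(2)] A_in[OF that(1) k(1)] k that by auto
  then show ?thesis unfolding Fa_img[OF k(6)] Fa_img[OF assms(2)] by auto
qed

text \<open>Equivalent arrows have equivalent images under the functor, so the union that defines
  \<open>map_sub\<close> collapses to a single class.\<close>

lemma map_sub:
  assumes S: "S \<in> carrier (Sub C X)"
  shows "map_sub RR Fa S \<in> carrier (Sub RR (Fo X))" "m \<in> S \<Longrightarrow> sub_pts (map_sub RR Fa S) \<nu> = img (Fa m) \<nu>"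
proof -
  have eq: "map_sub RR Fa S = subobj RR (Fa m)" if m: "m \<in> S" for m
  proof -
    have "subobj RR (Fa n) = subobj RR (Fa m)" if n: "n \<in> S" for n
    proof -
      have nm: "n \<in> Mon C" "m \<in> Mon C" "Cod C n = X" "Cod C m = X" using E.Sub_mem[OF S n] E.Sub_mem[OF S m] by auto
      have A: "n \<in> Arr C" "m \<in> Arr C" using nm by simp_all
      have "factors_through C n m" "factors_through C m n"
        using E.below_self[OF S n] E.below_self[OF S m] E.below_mem[OF S] n m by blast+
      then have "img (Fa n) \<nu> = img (Fa m) \<nu>" for \<nu> using img_mono A by blast
      then have "factors_through RR (Fa n) (Fa m)" "factors_through RR (Fa m) (Fa n)"
        using factors_iff[OF Fa_Mon Fa(1)] nm A Fa(3) by simp_all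
      then show ?thesis using R.subobj_eqI[of "Fa n" "Fa m"] Fa_Mon nm by simp
    qed
    then show ?thesis unfolding map_sub_def using m by blast
  qed
  obtain m0 where m0: "m0 \<in> S" using E.Sub_ex[OF S] .
  have c: "subobj RR (Fa m) \<in> carrier (Sub RR (Fo X))" "Fa m \<in> subobj RR (Fa m)" if m: "m \<in> S" for m
  proof -
    have m': "m \<in> Mon C" "m \<in> Arr C" "Cod C m = X" using E.Sub_mem[OF S m] by auto
    have "Fa m \<in> Mon RR" "Cod RR (Fa m) = Fo X" using Fa_Mon[OF m'(1)] Fa(3)[OF m'(2)] m'(3) by simp_all
    then show "subobj RR (Fa m) \<in> carrier (Sub RR (Fo X))" "Fa m \<in> subobj RR (Fa m)" by (rule R.SubI, intro R.subobj_self)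
  qed
  show "map_sub RR Fa S \<in> carrier (Sub RR (Fo X))" unfolding eq[OF m0] using c(1)[OF m0] .
  show "sub_pts (map_sub RR Fa S) \<nu> = img (Fa m) \<nu>" if "m \<in> S"
    unfolding eq[OF that] using sub_pts_mem[OF c[OF that]] .
qed

lemma map_sub_mono:
  assumes S: "S \<in> carrier (Sub C X)" and T: "T \<in> carrier (Sub C X)" and le: "S \<sqsubseteq>\<^bsub>Sub C X\<^esub> T"
  shows "sub_pts (map_sub RR Fa S) \<nu> \<subseteq> sub_pts (map_sub RR Fa T) \<nu>"
proof -
  obtain m n where m: "m \<in> S" "n \<in> T" using E.Sub_ex[OF S] E.Sub_ex[OF T] by metis
  have "factors_through C m n" using E.Sub_le_mem[OF S T m(1)] E.below_mem[OF T m(2)] le by simp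
  then show ?thesis unfolding map_sub(2)[OF S m(1)] map_sub(2)[OF T m(2)] using img_mono E.Sub_mem(1)[OF T m(2)] by simp
qed

lemma map_sub_join:
  assumes "is_join C X S T L"
  shows "sub_pts (map_sub RR Fa L) \<nu> \<subseteq> sub_pts (map_sub RR Fa S) \<nu> \<union> sub_pts (map_sub RR Fa T) \<nu>"
proof -
  have c: "S \<in> carrier (Sub C X)" "T \<in> carrier (Sub C X)" "L \<in> carrier (Sub C X)" using assms by (auto simp: is_join_def)
  obtain m1 where m1: "m1 \<in> S" using E.Sub_ex[OF c(1)] .
  obtain m2 where m2: "m2 \<in> T" using E.Sub_ex[OF c(2)] .
  obtain m where m: "m \<in> L" using E.Sub_ex[OF c(3)] .
  note d = E.Sub_mem[OF c(1) m1] E.Sub_mem[OF c(2) m2] E.Sub_mem[OF c(3) m]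
  have A: "m1 \<in> Arr C" "m2 \<in> Arr C" "m \<in> Arr C" using d by simp_all
  have j: "is_join C X (subobj C m1) (subobj C m2) (subobj C m)" using assms d by simp
  show ?thesis
    unfolding map_sub(2)[OF c(1) m1] map_sub(2)[OF c(2) m2] map_sub(2)[OF c(3) m] Fa_img[OF A(1)] Fa_img[OF A(2)] Fa_img[OF A(3)]
    using P_join[OF _ j d(1,4,7)] by auto
qed

text \<open>One inclusion is monotonicity. The other goes by induction on the finite set, with
  \<open>P_null\<close> for the empty join and \<open>P_join\<close> for each further
  member.\<close>

lemma map_sub_joins:
  assumes X: "X \<in> Obj C"
  shows "preserves_finite_joins (Sub C X) (Sub RR (Fo X)) (map_sub RR Fa)"
  unfolding preserves_finite_joins_def
proof (intro conjI allI impI)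
  show "map_sub RR Fa \<in> carrier (Sub C X) \<rightarrow> carrier (Sub RR (Fo X))" using map_sub(1) by blast
  have sub: "sub_pts (map_sub RR Fa s) \<nu> \<subseteq> (\<Union>S\<in>B. sub_pts (map_sub RR Fa S) \<nu>)"
    if "finite B" "B \<subseteq> carrier (Sub C X)" "least (Sub C X) s (Upper (Sub C X) B)" for B s \<nu>
    using that
  proof (induction B arbitrary: s rule: finite_induct)
    case empty
    then have s: "s \<in> carrier (Sub C X)" "\<And>V. V \<in> carrier (Sub C X) \<Longrightarrow> s \<sqsubseteq>\<^bsub>Sub C X\<^esub> V" by (simp_all add: E.lub_iff)
    obtain m where m: "m \<in> s" using E.Sub_ex[OF s(1)] .
    have mA: "m \<in> Arr C" using E.Sub_mem(1)[OF s(1) m] by simp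
    have "null C (Dom C m)" using E.bot_null[OF s E.below_self[OF s(1) m]] .
    then show ?case unfolding map_sub(2)[OF s(1) m] Fa_img[OF mA] using P_null by auto
  next
    case (insert a B)
    have B: "a \<in> carrier (Sub C X)" "B \<subseteq> carrier (Sub C X)" using insert.prems by auto
    obtain s' where s': "least (Sub C X) s' (Upper (Sub C X) B)"
      using E.finite_joins[OF X] insert.hyps B unfolding has_finite_joins_def by blast
    have "is_join C X a s' s"
      unfolding is_join_def using s'[unfolded E.lub_iff[OF B(2)]] insert.prems(2)[unfolded E.lub_iff[OF insert.prems(1)]] B(1) by auto
    from map_sub_join[OF this] insert.IH[OF B(2) s'] show ?case by blast
  qed
  fix B s assume B: "finite B \<and> B \<subseteq> carrier (Sub C X) \<and> least (Sub C X) s (Upper (Sub C X) B)"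
  then have s: "s \<in> carrier (Sub C X)" "\<And>V. V \<in> carrier (Sub C X) \<Longrightarrow> s \<sqsubseteq>\<^bsub>Sub C X\<^esub> V \<longleftrightarrow> (\<forall>a\<in>B. a \<sqsubseteq>\<^bsub>Sub C X\<^esub> V)"
    using E.lub_iff by blast+
  have im: "map_sub RR Fa ` B \<subseteq> carrier (Sub RR (Fo X))" using B map_sub(1) by blast
  have "a \<sqsubseteq>\<^bsub>Sub C X\<^esub> s" if "a \<in> B" for a using s(2)[OF s(1)] E.Sub_refl[OF s(1)] that by blast
  then have "(\<Union>S\<in>B. sub_pts (map_sub RR Fa S) \<nu>) \<subseteq> sub_pts (map_sub RR Fa s) \<nu>" for \<nu>
    using map_sub_mono[OF _ s(1)] B by blast
  then have "sub_pts (map_sub RR Fa s) \<nu> = (\<Union>S\<in>map_sub RR Fa ` B. sub_pts S \<nu>)" for \<nu>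
    using sub[of B s \<nu>] B by auto
  then show "least (Sub RR (Fo X)) (map_sub RR Fa s) (Upper (Sub RR (Fo X)) (map_sub RR Fa ` B))"
    unfolding lub_pts[OF im Fo_rset] using map_sub(1)[OF s(1)] by blast
qed

lemma map_sub_dia:
  assumes X: "X \<in> Obj C" and S: "S \<in> carrier (Sub C X)"
  shows "map_sub RR Fa (Dia C X S) = Dia RR (Fo X) (map_sub RR Fa S)"
proof (rule Sub_eq_pts)
  have D: "Dia C X S \<in> carrier (Sub C X)" using S X by simp
  show "map_sub RR Fa (Dia C X S) \<in> carrier (Sub RR (Fo X))" by (rule map_sub(1)[OF D])
  show "Dia RR (Fo X) (map_sub RR Fa S) \<in> carrier (Sub RR (Fo X))" by (rule Dia_pts(1)[OF map_sub(1)[OF S]])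
  fix \<nu>
  obtain d where d: "d \<in> Dia C X S" using E.Sub_ex[OF D] .
  obtain m where m: "m \<in> S" using E.Sub_ex[OF S] .
  note d' = E.Sub_mem[OF D d] and m' = E.Sub_mem[OF S m]
  have A: "d \<in> Arr C" "m \<in> Arr C" using d' m' by simp_all
  have im: "sub_pts (map_sub RR Fa S) \<nu> = (if \<nu> \<in> verts G then A \<nu> m ` P \<nu> (Dom C m) else {})" for \<nu>
    unfolding map_sub(2)[OF S m] Fa_img[OF A(2)] ..
  have "d \<in> Dia C (Cod C m) (subobj C m)" using d m' by simp
  from P_dia[OF _ m'(1) this]
  have "\<nu> \<in> verts G \<Longrightarrow> A \<nu> d ` P \<nu> (Dom C d) =
       {x \<in> P \<nu> X. \<exists>k\<in>arcs G. tail G k = \<nu> \<and> (\<exists>y\<in>P (head G k) (Dom C m). (x, A (head G k) m y) \<in> R k X)}"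
    unfolding m'(2) .
  then show "sub_pts (map_sub RR Fa (Dia C X S)) \<nu> = sub_pts (Dia RR (Fo X) (map_sub RR Fa S)) \<nu>"
    unfolding map_sub(2)[OF D d] Fa_img[OF A(1)] Dia_pts(2)[OF map_sub(1)[OF S]] dia_pts_def im
    by (cases "\<nu> \<in> verts G") (auto simp: image_iff)
qed

lemma Fa_Quo: "q \<in> Quo C \<Longrightarrow> Fa q \<in> rquot G"
proof -
  assume q: "q \<in> Quo C"
  then have qM: "q \<in> Mperp C" using E.quo_Mperp by blast
  then have qA: "q \<in> Arr C" by simp
  have "\<exists>s' t'. (s', t') \<in> rel (src (Fa q)) k \<and> fn (Fa q) (tail G k) s' = s \<and> fn (Fa q) (head G k) t' = t"
    if "(s, t) \<in> rel (trg (Fa q)) k" for s t k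
  proof -
    have k: "k \<in> arcs G" "(s, t) \<in> R k (Cod C q)" using that Fa(3)[OF qA] by simp_all
    obtain x y where xy: "(x, y) \<in> R k (Dom C q)" "A (tail G k) q x = s" "A (head G k) q y = t" using R_quo[OF k(1) q k(2)] by blast
    have "x \<in> P (tail G k) (Dom C q)" "y \<in> P (head G k) (Dom C q)" "tail G k \<in> verts G" "head G k \<in> verts G"
      using R_sub[OF k(1) xy(1)] k(1) by simp_all
    then show ?thesis using xy k(1) Fa(2)[OF qA] Fa_fn[of _ _ q] by (intro exI[of _ x] exI[of _ y]) simp
  qed
  moreover have "fn (Fa q) \<nu> ` pts (src (Fa q)) \<nu> = pts (trg (Fa q)) \<nu>" for \<nu>
    using Fa_Mperp[OF qM] unfolding Mperp_iff img_def by blast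
  ultimately show ?thesis using Fa(1)[OF qA] by (simp add: rquot_def)
qed

text \<open>Let \<open>T'\<close> be the complement of \<open>T\<close>, and let \<open>p\<close>
  represent its restriction to \<open>Dom C m\<close>. If \<open>Dom C p\<close> were not null, some
  node would have a point there; \<open>m . p\<close> would send it into \<open>S\<close>, hence
  into \<open>T\<close> by hypothesis, and also into \<open>T'\<close>, against
  \<open>P_disj\<close>. So the restriction of \<open>T'\<close> is null and that of
  \<open>T\<close> is total.\<close>

lemma map_sub_reflects_le:
  assumes S: "S \<in> carrier (Sub C X)" and T: "T \<in> carrier (Sub C X)" and X: "X \<in> Obj C"
    and le: "\<And>\<nu>. sub_pts (map_sub RR Fa S) \<nu> \<subseteq> sub_pts (map_sub RR Fa T) \<nu>"
  shows "S \<sqsubseteq>\<^bsub>Sub C X\<^esub> T"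
proof -
  obtain m where m: "m \<in> S" using E.Sub_ex[OF S] .
  note m' = E.Sub_mem[OF S m]
  have mA: "m \<in> Arr C" using m' by simp
  let ?Y = "Dom C m"
  obtain T' where T': "is_compl C X T T'" using E.compl_ex[OF T X] .
  have Tc: "T' \<in> carrier (Sub C X)" and jT: "is_join C X T T' (subobj C (Ident C X))" using T' by (auto simp: is_compl_def is_join_def)
  have j: "is_join C ?Y (pull C m T) (pull C m T') (subobj C (Ident C ?Y))" by (rule E.pull_cover[OF mA refl m'(2) jT])
  have c: "pull C m T \<in> carrier (Sub C ?Y)" "pull C m T' \<in> carrier (Sub C ?Y)" using mA T Tc m'(2) by simp_all
  obtain p where p: "p \<in> pull C m T'" using E.Sub_ex[OF c(2)] .
  note p' = E.Sub_mem[OF c(2) p]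
  have pA: "p \<in> Arr C" using p' by simp
  have Tm: "T \<in> carrier (Sub C (Cod C m))" "T' \<in> carrier (Sub C (Cod C m))" using T Tc m'(2) by simp_all
  have mp: "below C (m \<cdot> p) T'" using E.below_self[OF c(2) p] E.below_pull[OF mA Tm(2)] by simp
  have "null C (Dom C p)"
  proof (rule ccontr)
    assume "\<not> null C (Dom C p)"
    then obtain \<nu> y where v: "\<nu> \<in> verts G" "y \<in> P \<nu> (Dom C p)" using P_conservative[of "Dom C p"] pA by auto
    let ?x = "A \<nu> (m \<cdot> p) y"
    have mpA: "m \<cdot> p \<in> Arr C" "Dom C (m \<cdot> p) = Dom C p" using mA pA p'(2) by simp_all
    have xi: "?x \<in> img (Fa (m \<cdot> p)) \<nu>" unfolding Fa_img[OF mpA(1)] using v mpA(2) by auto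
    have "factors_through C (m \<cdot> p) m" using mA pA p'(2) by (intro E.factors_throughI[of _ p]) simp_all
    then have "?x \<in> sub_pts (map_sub RR Fa S) \<nu>" unfolding map_sub(2)[OF S m] using img_mono[OF _ mA] xi by blast
    then have xT: "?x \<in> sub_pts (map_sub RR Fa T) \<nu>" using le by blast
    obtain t where t: "t \<in> T" using E.Sub_ex[OF T] .
    obtain t' where t': "t' \<in> T'" using E.Sub_ex[OF Tc] .
    note d = E.Sub_mem[OF T t] and d' = E.Sub_mem[OF Tc t']
    have A: "t \<in> Arr C" "t' \<in> Arr C" using d d' by simp_all
    have "?x \<in> A \<nu> t ` P \<nu> (Dom C t)" using xT v(1) unfolding map_sub(2)[OF T t] Fa_img[OF A(1)] by simp
    moreover have "factors_through C (m \<cdot> p) t'" using mp E.below_mem[OF Tc t'] by simp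
    then have "?x \<in> A \<nu> t' ` P \<nu> (Dom C t')" using img_mono[OF _ A(2), of "m \<cdot> p" \<nu>] xi v(1) unfolding Fa_img[OF A(2)] by (simp add: subset_iff)
    moreover have "is_compl C X (subobj C t) (subobj C t')" using T' d d' by simp
    ultimately obtain z z' where "z \<in> P \<nu> (Dom C t)" "?x = A \<nu> t z" "z' \<in> P \<nu> (Dom C t')" "?x = A \<nu> t' z'"
      and "is_compl C X (subobj C t) (subobj C t')" by blast
    then show False using P_disj[OF v(1) _ d(1) d'(1)] by metis
  qed
  then have "below C p (pull C m T)" using E.null_below[of p "pull C m T"] pA p'(2) c(1) by simp
  then have "pull C m T' \<sqsubseteq>\<^bsub>Sub C ?Y\<^esub> pull C m T" using E.Sub_le_mem[OF c(2,1) p] by simp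
  then have "subobj C (Ident C ?Y) \<sqsubseteq>\<^bsub>Sub C ?Y\<^esub> pull C m T" using j c(1) E.Sub_refl[OF c(1)] unfolding is_join_def by blast
  moreover have Y: "?Y \<in> Obj C" using mA by simp
  ultimately have "below C (Ident C ?Y) (pull C m T)"
    using E.Sub_le_mem[OF E.SubI[OF E.ident_mon[OF Y] E.ident_arr(3)[OF Y]] c(1) E.subobj_self[OF E.ident_mon[OF Y]]] by simp
  then have "below C m T" using E.below_pull[OF mA Tm(1)] mA by simp
  then show ?thesis using E.Sub_le_mem[OF S T m] by simp
qed

theorem rep_morphism:
  "boolean_modal_category_with_quotients_morphism C RR Fo Fa" "M_conservative C RR Fa"
proof -
  interpret T: boolean_modal_category_with_quotients RR by (rule Rel_bmcq)
  interpret F: category_functor C RR Fo Fa by (rule rep_functor)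
  show "boolean_modal_category_with_quotients_morphism C RR Fo Fa"
  proof unfold_locales
    show "preserves_finite_limits C RR Fo Fa" by (rule functor_limits)
    show "Fa ` Mon C \<subseteq> Mon RR" using Fa_Mon by auto
    show "Fa ` Mperp C \<subseteq> Mperp RR" using Fa_Mperp by auto
    show "X \<in> Obj C \<Longrightarrow> preserves_finite_joins (Sub C X) (Sub RR (Fo X)) (map_sub RR Fa)" for X by (rule map_sub_joins)
    show "X \<in> Obj C \<Longrightarrow> S \<in> carrier (Sub C X) \<Longrightarrow> map_sub RR Fa (Dia C X S) = Dia RR (Fo X) (map_sub RR Fa S)" for X S
      by (rule map_sub_dia)
    show "Fa ` Quo C \<subseteq> Quo RR" using Fa_Quo by auto
  qed
  show "M_conservative C RR Fa"
    unfolding M_conservative_def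
  proof (intro ballI inj_onI)
    fix X S T assume a: "X \<in> Obj C" "S \<in> carrier (Sub C X)" "T \<in> carrier (Sub C X)" "map_sub RR Fa S = map_sub RR Fa T"
    show "S = T" using map_sub_reflects_le[OF a(2,3,1)] map_sub_reflects_le[OF a(3,2,1)] a(4)
      by (intro E.Sub_antisym[OF a(2,3)]) simp_all
  qed
qed

end

section \<open>The representation\<close>

lemma card_of_Times_le:
  includes cardinal_syntax
  assumes "infinite C" "|A| \<le>o |C|" "|B| \<le>o |C|"
  shows "|A \<times> B| \<le>o |C|"
  by (rule card_of_Times_ordLeq_infinite_Field) (use assms in \<open>simp_all add: Field_card_of card_of_card_order_on\<close>)

text \<open>A sequence of sets is determined by the set of pairs \<open>(n, w)\<close> with
  \<open>w\<close> in its \<open>n\<close>th member, so coding sequences in the universe costs only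
  a coding of pairs one power set lower. The summand \<open>nat\<close> makes that level infinite
  even for finite \<open>'a\<close>.\<close>

lemma univ_tuples:
  includes cardinal_syntax
  shows "\<exists>t :: (nat \<Rightarrow> 'a univ) \<Rightarrow> 'a univ. inj t"
proof -
  let ?W = "UNIV :: (nat + 'a) set set set"
  have "inj (\<lambda>n. {{Inl n}} :: (nat + 'a) set set)" by (auto intro: injI)
  then have "infinite (UNIV :: (nat + 'a) set set set)" "|UNIV :: nat set| \<le>o |UNIV :: (nat + 'a) set set set|"
    using card_of_ordLeq[of "UNIV :: nat set" ?W] infinite_iff_card_of_nat[of ?W] by blast+
  then have "|UNIV \<times> UNIV :: (nat \<times> (nat + 'a) set set) set| \<le>o |UNIV :: (nat + 'a) set set set|"
    by (intro card_of_Times_le) (simp_all add: card_of_refl ordIso_imp_ordLeq)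
  then obtain e :: "nat \<times> (nat + 'a) set set \<Rightarrow> (nat + 'a) set set" where e: "inj e"
    using card_of_ordLeq[of "UNIV \<times> UNIV :: (nat \<times> (nat + 'a) set set) set" ?W] by auto
  have "inj (\<lambda>f. e ` {(n, w). w \<in> f n})"
  proof (rule injI)
    fix f g :: "nat \<Rightarrow> 'a univ"
    assume "e ` {(n, w). w \<in> f n} = e ` {(n, w). w \<in> g n}"
    then have "{(n, w). w \<in> f n} = {(n, w). w \<in> g n}" by (simp add: inj_image_eq_iff[OF e])
    then show "f = g" by (auto simp: set_eq_iff fun_eq_iff)
  qed
  then show ?thesis by blast
qed

text \<open>The ultraproduct will be indexed by sets of arrows, hence the argument type
  \<open>'a set\<close>. A family is coded by its graph, a set of tuples: the tuples fit into two
  power sets over \<open>nat + 'a\<close>, where \<open>'a set\<close> embeds through singletons of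
  images under \<open>Inr\<close>, and the graph takes the third power set.\<close>

lemma univ_families:
  includes cardinal_syntax
  shows "\<exists>c :: ('a set \<Rightarrow> nat \<Rightarrow> nat \<times> 'a) \<Rightarrow> 'a univ. inj c"
proof -
  let ?W = "UNIV :: (nat + 'a) set set set"
  have "inj (\<lambda>n. {{Inl n}} :: (nat + 'a) set set)" by (auto intro: injI)
  then have N: "infinite ?W" "|UNIV :: nat set| \<le>o |?W|"
    using card_of_ordLeq[of "UNIV :: nat set" ?W] infinite_iff_card_of_nat[of ?W] by blast+
  have "inj (\<lambda>x. {{Inr x}} :: (nat + 'a) set set)" by (auto intro: injI)
  then have A: "|UNIV :: 'a set| \<le>o |?W|" using card_of_ordLeq[of "UNIV :: 'a set" ?W] by blast
  have "inj (\<lambda>\<Phi>. {Inr ` \<Phi>} :: (nat + 'a) set set)" by (intro injI) (auto simp: inj_image_eq_iff)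
  then have S: "|UNIV :: 'a set set| \<le>o |?W|" using card_of_ordLeq[of "UNIV :: 'a set set" ?W] by blast
  have "|UNIV \<times> UNIV \<times> UNIV \<times> UNIV :: ('a set \<times> nat \<times> nat \<times> 'a) set| \<le>o |?W|"
    by (intro card_of_Times_le N S A)
  then obtain e :: "'a set \<times> nat \<times> nat \<times> 'a \<Rightarrow> (nat + 'a) set set" where e: "inj e"
    using card_of_ordLeq[of "UNIV \<times> UNIV \<times> UNIV \<times> UNIV :: ('a set \<times> nat \<times> nat \<times> 'a) set" ?W] by auto
  have "inj (\<lambda>F. e ` {(\<Phi>, n, y). y = F \<Phi> n})"
  proof (rule injI)
    fix F H :: "'a set \<Rightarrow> nat \<Rightarrow> nat \<times> 'a"
    assume "e ` {(\<Phi>, n, y). y = F \<Phi> n} = e ` {(\<Phi>, n, y). y = H \<Phi> n}"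
    then have "{(\<Phi>, n, y). y = F \<Phi> n} = {(\<Phi>, n, y). y = H \<Phi> n}" by (simp add: inj_image_eq_iff[OF e])
    from this[symmetric] have "(\<Phi>, n, F \<Phi> n) \<in> {(\<Phi>, n, y). y = H \<Phi> n}" for \<Phi> n by simp
    then show "F = H" by (simp add: fun_eq_iff)
  qed
  then show ?thesis by blast
qed

text \<open>Everything is reduced to the two previous codings: the two indices of a tower are merged
  by \<open>prod_decode\<close> and its values padded with 0, and an arc becomes a sequence of codes
  of its components.\<close>

lemma univ_codes:
  obtains tup :: "(nat \<Rightarrow> 'a univ) \<Rightarrow> 'a univ" and cp :: "('a set \<Rightarrow> nat \<times> 'a) \<Rightarrow> 'a univ"
    and cn :: "('a set \<Rightarrow> nat \<Rightarrow> nat \<Rightarrow> 'a) \<Rightarrow> 'a univ"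
    and ce :: "('a set \<Rightarrow> nat \<Rightarrow> nat \<Rightarrow> 'a) \<times> ('a set \<Rightarrow> nat \<Rightarrow> nat \<Rightarrow> 'a) \<times>
      ('a set \<Rightarrow> (nat \<Rightarrow> nat \<times> 'a) \<times> (nat \<Rightarrow> 'a)) \<Rightarrow> 'a univ"
  where "inj tup" "inj cp" "inj cn" "inj ce"
proof -
  obtain t :: "(nat \<Rightarrow> 'a univ) \<Rightarrow> 'a univ" where t: "inj t" using univ_tuples by blast
  obtain c :: "('a set \<Rightarrow> nat \<Rightarrow> nat \<times> 'a) \<Rightarrow> 'a univ" where c: "inj c" using univ_families by blast
  define cn where "cn \<alpha> = c (\<lambda>\<Phi> n. (0, \<alpha> \<Phi> (fst (prod_decode n)) (snd (prod_decode n))))" for \<alpha>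
  have cn: "inj cn"
  proof (rule injI)
    fix \<alpha> \<beta> assume "cn \<alpha> = cn \<beta>"
    then have "(0::nat, \<alpha> \<Phi> (fst (prod_decode n)) (snd (prod_decode n))) = (0, \<beta> \<Phi> (fst (prod_decode n)) (snd (prod_decode n)))" for \<Phi> n
      unfolding cn_def by (metis (no_types, lifting) injD[OF c])
    from this[of _ "prod_encode (i, j)" for i j] show "\<alpha> = \<beta>" by (intro ext) simp
  qed
  have cp: "inj (\<lambda>p. c (\<lambda>\<Phi> n. p \<Phi>))"
    by (intro injI) (drule injD[OF c], simp add: fun_eq_iff)
  \<comment> \<open>The presentation of the relation is split into its two sequences, which gives
    four components in all; from index 3 on the sequence is constant.\<close>
  define s where "s x n = (if n = 0 then cn (fst x) else if n = 1 then cn (fst (snd x)) else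
    if n = 2 then c (\<lambda>\<Phi>. fst (snd (snd x) \<Phi>)) else c (\<lambda>\<Phi> i. (0, snd (snd (snd x) \<Phi>) i)))" for x and n :: nat
  have "inj (\<lambda>x. t (s x))"
  proof (rule injI)
    fix x y assume "t (s x) = t (s y)"
    then have eq: "s x n = s y n" for n using injD[OF t] by metis
    have "cn (fst x) = cn (fst y)" "cn (fst (snd x)) = cn (fst (snd y))" using eq[of 0] eq[of 1] by (simp_all add: s_def)
    then have "fst x = fst y" "fst (snd x) = fst (snd y)" by (blast intro: injD[OF cn])+
    moreover have "(\<lambda>\<Phi>. fst (snd (snd x) \<Phi>)) = (\<lambda>\<Phi>. fst (snd (snd y) \<Phi>))"
      using eq[of 2] by (intro injD[OF c]) (simp add: s_def)
    moreover have "(\<lambda>\<Phi> i. (0::nat, snd (snd (snd x) \<Phi>) i)) = (\<lambda>\<Phi> i. (0, snd (snd (snd y) \<Phi>) i))"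
      using eq[of 3] by (intro injD[OF c]) (simp add: s_def)
    ultimately show "x = y" by (simp add: fun_eq_iff prod_eq_iff)
  qed
  from that[OF t cp cn this] show ?thesis .
qed

section \<open>The graph of coded models and relations\<close>

locale coded_ultra = ultra C U Sg
  for C :: "('o, 'a) modal_quot_cat" (structure) and U :: "'i filter" and Sg :: "'i \<Rightarrow> 'a set" +
  fixes tup :: "(nat \<Rightarrow> 'u) \<Rightarrow> 'u" and pa pb :: 'u and cp :: "('i \<Rightarrow> nat \<times> 'a) \<Rightarrow> 'u"
    and cn :: "('i \<Rightarrow> nat \<Rightarrow> nat \<Rightarrow> 'a) \<Rightarrow> 'n"
    and ce :: "('i \<Rightarrow> nat \<Rightarrow> nat \<Rightarrow> 'a) \<times> ('i \<Rightarrow> nat \<Rightarrow> nat \<Rightarrow> 'a) \<times> ('i \<Rightarrow> (nat \<Rightarrow> nat \<times> 'a) \<times> (nat \<Rightarrow> 'a)) \<Rightarrow> 'e"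
  assumes inj_tup: "inj tup" and pa_pb: "pa \<noteq> pb" and inj_cp: "inj cp" and inj_cn: "inj cn" and inj_ce: "inj ce"
begin

text \<open>The inverse of the injective \<open>ce\<close> recovers the endpoints of an arc;
  different presentations \<open>\<kappa>\<close> between the same nodes give different
  arcs.\<close>

definition Gr :: "('n, 'e) pre_digraph" where
  "Gr = \<lparr>verts = cn ` {\<alpha>. unode \<alpha>}, arcs = ce ` {(\<alpha>, \<beta>, \<kappa>). unode \<alpha> \<and> unode \<beta> \<and> uedge \<alpha> \<beta> \<kappa>},
    tail = (\<lambda>k. cn (fst (inv ce k))), head = (\<lambda>k. cn (fst (snd (inv ce k))))\<rparr>"

text \<open>Points are families up to \<open>ueq\<close>. The chosen \<open>q\<close> depends only
  on the class of \<open>p\<close>, so \<open>nm\<close> codes the quotient inside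
  \<open>'u\<close>, and \<open>inv cp\<close> recovers a representative.\<close>

definition nm :: "('i \<Rightarrow> nat \<Rightarrow> nat \<Rightarrow> 'a) \<Rightarrow> 'o \<Rightarrow> ('i \<Rightarrow> nat \<times> 'a) \<Rightarrow> 'u" where
  "nm \<alpha> X p = cp (SOME q. upnt \<alpha> X q \<and> ueq \<alpha> p q)"

definition Pt :: "'n \<Rightarrow> 'o \<Rightarrow> 'u set" where
  "Pt \<nu> X = nm (inv cn \<nu>) X ` {p. upnt (inv cn \<nu>) X p}"

definition Ac :: "'n \<Rightarrow> 'a \<Rightarrow> 'u \<Rightarrow> 'u" where
  "Ac \<nu> f x = nm (inv cn \<nu>) (Cod C f) (uact f (inv cp x))"

definition Re :: "'e \<Rightarrow> 'o \<Rightarrow> ('u \<times> 'u) set" where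
  "Re k X = (case inv ce k of (\<alpha>, \<beta>, \<kappa>) \<Rightarrow>
     {(nm \<alpha> X p, nm \<beta> X p') | p p'. upnt \<alpha> X p \<and> upnt \<beta> X p' \<and> url \<alpha> \<beta> \<kappa> X p p'})"

lemma vertE:
  assumes "\<nu> \<in> verts Gr"
  obtains \<alpha> where "\<nu> = cn \<alpha>" "unode \<alpha>"
  using assms by (auto simp: Gr_def)

lemma arcE:
  assumes "k \<in> arcs Gr"
  obtains \<alpha> \<beta> \<kappa> where "k = ce (\<alpha>, \<beta>, \<kappa>)" "unode \<alpha>" "unode \<beta>" "uedge \<alpha> \<beta> \<kappa>"
    "tail Gr k = cn \<alpha>" "head Gr k = cn \<beta>"
  using assms by (auto simp: Gr_def inv_f_f[OF inj_ce])

lemma arcI: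
  assumes "unode \<alpha>" "unode \<beta>" "uedge \<alpha> \<beta> \<kappa>"
  shows "ce (\<alpha>, \<beta>, \<kappa>) \<in> arcs Gr" "tail Gr (ce (\<alpha>, \<beta>, \<kappa>)) = cn \<alpha>" "head Gr (ce (\<alpha>, \<beta>, \<kappa>)) = cn \<beta>"
  using assms by (auto simp: Gr_def inv_f_f[OF inj_ce])

lemma nm_eq:
  assumes "upnt \<alpha> X p" "upnt \<alpha> X q"
  shows "nm \<alpha> X p = nm \<alpha> X q \<longleftrightarrow> ueq \<alpha> p q"
proof
  assume "nm \<alpha> X p = nm \<alpha> X q"
  then have "(SOME r. upnt \<alpha> X r \<and> ueq \<alpha> p r) = (SOME r. upnt \<alpha> X r \<and> ueq \<alpha> q r)"
    unfolding nm_def by (rule injD[OF inj_cp])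
  moreover have "ueq \<alpha> p (SOME r. upnt \<alpha> X r \<and> ueq \<alpha> p r)" "ueq \<alpha> q (SOME r. upnt \<alpha> X r \<and> ueq \<alpha> q r)"
    using someI[of "\<lambda>r. upnt \<alpha> X r \<and> ueq \<alpha> p r" p] someI[of "\<lambda>r. upnt \<alpha> X r \<and> ueq \<alpha> q r" q] assms by simp_all
  ultimately show "ueq \<alpha> p q" using ueq_trans ueq_sym by metis
next
  assume "ueq \<alpha> p q"
  then have "ueq \<alpha> p r \<longleftrightarrow> ueq \<alpha> q r" for r using ueq_trans ueq_sym by blast
  then show "nm \<alpha> X p = nm \<alpha> X q" unfolding nm_def by simp
qed

lemma Pt_iff: "x \<in> Pt (cn \<alpha>) X \<longleftrightarrow> (\<exists>p. upnt \<alpha> X p \<and> x = nm \<alpha> X p)"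
  by (auto simp: Pt_def inv_f_f[OF inj_cn])

lemma Ac_nm:
  assumes "unode \<alpha>" "upnt \<alpha> (Dom C f) p" "f \<in> Arr C"
  shows "Ac (cn \<alpha>) f (nm \<alpha> (Dom C f) p) = nm \<alpha> (Cod C f) (uact f p)"
proof -
  define q where "q = (SOME q. upnt \<alpha> (Dom C f) q \<and> ueq \<alpha> p q)"
  have q: "upnt \<alpha> (Dom C f) q" "ueq \<alpha> p q"
    using someI[of "\<lambda>r. upnt \<alpha> (Dom C f) r \<and> ueq \<alpha> p r" p] assms(2) unfolding q_def by simp_all
  have "Ac (cn \<alpha>) f (nm \<alpha> (Dom C f) p) = nm \<alpha> (Cod C f) (uact f q)"
    unfolding Ac_def nm_def[of \<alpha> "Dom C f" p] q_def[symmetric] inv_f_f[OF inj_cp] inv_f_f[OF inj_cn] ..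
  then show ?thesis
    using nm_eq[OF uact_pnt[OF q(1) assms(3) refl] uact_pnt[OF assms(2,3) refl]]
      uact_eq[OF assms(1) q(1) assms(2) ueq_sym[OF q(2)] assms(3) refl] by simp
qed

lemma Re_iff: "(x, y) \<in> Re (ce (\<alpha>, \<beta>, \<kappa>)) X \<longleftrightarrow>
    (\<exists>p p'. upnt \<alpha> X p \<and> upnt \<beta> X p' \<and> url \<alpha> \<beta> \<kappa> X p p' \<and> x = nm \<alpha> X p \<and> y = nm \<beta> X p')"
  by (auto simp: Re_def inv_f_f[OF inj_ce])

lemma Re_nm:
  assumes "upnt \<alpha> X p" "upnt \<beta> X p'"
  shows "(nm \<alpha> X p, nm \<beta> X p') \<in> Re (ce (\<alpha>, \<beta>, \<kappa>)) X \<longleftrightarrow> url \<alpha> \<beta> \<kappa> X p p'"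
proof
  assume "(nm \<alpha> X p, nm \<beta> X p') \<in> Re (ce (\<alpha>, \<beta>, \<kappa>)) X"
  then obtain q q' where q: "upnt \<alpha> X q" "upnt \<beta> X q'" "url \<alpha> \<beta> \<kappa> X q q'" "nm \<alpha> X q = nm \<alpha> X p" "nm \<beta> X q' = nm \<beta> X p'"
    unfolding Re_iff by metis
  show "url \<alpha> \<beta> \<kappa> X p p'" using url_ueq[OF q(3)] q(4,5) nm_eq[OF q(1) assms(1)] nm_eq[OF q(2) assms(2)] by simp
qed (use assms Re_iff in blast)

text \<open>Equality of codes is \<open>ueq\<close>, so membership in the image of \<open>m\<close>
  is the existence of a preimage that \<open>u_lift\<close> describes.\<close>

lemma Ac_image:
  assumes a: "unode \<alpha>" and m: "m \<in> Mon C" and p: "upnt \<alpha> (Cod C m) p"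
  shows "nm \<alpha> (Cod C m) p \<in> Ac (cn \<alpha>) m ` Pt (cn \<alpha>) (Dom C m) \<longleftrightarrow> USat \<alpha> p (subobj C m)"
proof -
  have mA: "m \<in> Arr C" using m by simp
  have "nm \<alpha> (Cod C m) p \<in> Ac (cn \<alpha>) m ` Pt (cn \<alpha>) (Dom C m) \<longleftrightarrow>
      (\<exists>q. upnt \<alpha> (Dom C m) q \<and> nm \<alpha> (Cod C m) p = Ac (cn \<alpha>) m (nm \<alpha> (Dom C m) q))"
    unfolding image_iff Bex_def Pt_iff by blast
  also have "\<dots> \<longleftrightarrow> (\<exists>q. upnt \<alpha> (Dom C m) q \<and> nm \<alpha> (Cod C m) p = nm \<alpha> (Cod C m) (uact m q))"
    by (intro ex_cong1 conj_cong refl) (simp add: Ac_nm[OF a _ mA])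
  also have "\<dots> \<longleftrightarrow> (\<exists>q. upnt \<alpha> (Dom C m) q \<and> ueq \<alpha> (uact m q) p)"
    using nm_eq[OF p uact_pnt[OF _ mA refl]] ueq_sym by blast
  also have "\<dots> \<longleftrightarrow> USat \<alpha> p (subobj C m)"
    using u_lift[OF a p SubI[OF m refl] subobj_self[OF m]] by simp
  finally show ?thesis .
qed

lemma Ac_Pt:
  assumes "unode \<alpha>" "f \<in> Arr C" "x \<in> Pt (cn \<alpha>) (Dom C f)"
  shows "Ac (cn \<alpha>) f x \<in> Pt (cn \<alpha>) (Cod C f)"
proof -
  obtain p where p: "upnt \<alpha> (Dom C f) p" "x = nm \<alpha> (Dom C f) p" using assms(3) Pt_iff by blast
  then show ?thesis unfolding p(2) Ac_nm[OF assms(1) p(1) assms(2)] Pt_iff using uact_pnt[OF p(1) assms(2) refl] by blast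
qed

lemma limD:
  assumes "finite_diagram J C Do Da" "is_limit J C Do Da L l"
  shows "i \<in> Obj J \<Longrightarrow> l i \<in> Arr C" "i \<in> Obj J \<Longrightarrow> Dom C (l i) = L" "i \<in> Obj J \<Longrightarrow> Cod C (l i) = Do i"
    "u \<in> Arr J \<Longrightarrow> Da u \<in> Arr C" "u \<in> Arr J \<Longrightarrow> Dom C (Da u) = Do (Dom J u)" "u \<in> Arr J \<Longrightarrow> Cod C (Da u) = Do (Cod J u)"
    "u \<in> Arr J \<Longrightarrow> Dom J u \<in> Obj J" "u \<in> Arr J \<Longrightarrow> Cod J u \<in> Obj J"
proof -
  interpret F: category_functor J C Do Da using assms(1) by (simp add: finite_diagram_def)
  show "i \<in> Obj J \<Longrightarrow> l i \<in> Arr C" "i \<in> Obj J \<Longrightarrow> Dom C (l i) = L" "i \<in> Obj J \<Longrightarrow> Cod C (l i) = Do i"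
    using assms(2) by (auto simp: is_limit_def is_cone_def Hom_def)
  show "u \<in> Arr J \<Longrightarrow> Da u \<in> Arr C" "u \<in> Arr J \<Longrightarrow> Dom C (Da u) = Do (Dom J u)" "u \<in> Arr J \<Longrightarrow> Cod C (Da u) = Do (Cod J u)"
    using F.map_hom[of u "Dom J u" "Cod J u"] by (auto simp: Hom_def)
  show "u \<in> Arr J \<Longrightarrow> Dom J u \<in> Obj J" "u \<in> Arr J \<Longrightarrow> Cod J u \<in> Obj J"
    using F.source.dom_obj F.source.cod_obj by auto
qed

lemma Pt_lim:
  assumes a: "unode \<alpha>" and J: "finite_diagram J C Do Da" and lim: "is_limit J C Do Da L l"
    and z: "\<forall>i\<in>Obj J. z i \<in> Pt (cn \<alpha>) (Do i)" and c: "\<forall>u\<in>Arr J. Ac (cn \<alpha>) (Da u) (z (Dom J u)) = z (Cod J u)"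
  shows "\<exists>x\<in>Pt (cn \<alpha>) L. \<forall>i\<in>Obj J. Ac (cn \<alpha>) (l i) x = z i"
proof -
  note d = limD[OF J lim]
  have "\<forall>i\<in>Obj J. \<exists>p. upnt \<alpha> (Do i) p \<and> z i = nm \<alpha> (Do i) p" using z Pt_iff by blast
  from bchoice[OF this] obtain w where w: "\<And>i. i \<in> Obj J \<Longrightarrow> upnt \<alpha> (Do i) (w i)" "\<And>i. i \<in> Obj J \<Longrightarrow> z i = nm \<alpha> (Do i) (w i)"
    by blast
  have "ueq \<alpha> (uact (Da u) (w (Dom J u))) (w (Cod J u))" if u: "u \<in> Arr J" for u
  proof -
    have p: "upnt \<alpha> (Dom C (Da u)) (w (Dom J u))" using w(1)[OF d(7)[OF u]] d(5)[OF u] by simp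
    have "nm \<alpha> (Cod C (Da u)) (uact (Da u) (w (Dom J u))) = nm \<alpha> (Do (Cod J u)) (w (Cod J u))"
      using Ac_nm[OF a p d(4)[OF u]] c[rule_format, OF u] w(2)[OF d(7)[OF u]] w(2)[OF d(8)[OF u]] d(5)[OF u] by simp
    then show ?thesis using nm_eq[OF uact_pnt[OF p d(4)[OF u] refl, unfolded d(6)[OF u]] w(1)[OF d(8)[OF u]]] d(6)[OF u] by simp
  qed
  from u_limit[OF a J lim w(1) this] obtain p where p: "upnt \<alpha> L p" "\<And>i. i \<in> Obj J \<Longrightarrow> ueq \<alpha> (uact (l i) p) (w i)" by blast
  have "Ac (cn \<alpha>) (l i) (nm \<alpha> L p) = z i" if i: "i \<in> Obj J" for i
  proof -
    have p': "upnt \<alpha> (Dom C (l i)) p" using p(1) d(2)[OF i] by simp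
    show ?thesis using Ac_nm[OF a p' d(1)[OF i]] nm_eq[OF uact_pnt[OF p' d(1)[OF i] refl, unfolded d(3)[OF i]] w(1)[OF i]] p(2)[OF i] w(2)[OF i] d(2,3)[OF i]
      by simp
  qed
  then show ?thesis using p(1) Pt_iff by blast
qed

lemma Ac_lim_eq:
  assumes a: "unode \<alpha>" and f: "f \<in> Arr C" "Dom C f = L" and p: "upnt \<alpha> L p" "upnt \<alpha> L q"
  shows "Ac (cn \<alpha>) f (nm \<alpha> L p) = Ac (cn \<alpha>) f (nm \<alpha> L q) \<longleftrightarrow> ueq \<alpha> (uact f p) (uact f q)"
  using Ac_nm[OF a _ f(1)] nm_eq[OF uact_pnt[OF p(1) f] uact_pnt[OF p(2) f]] p f(2) by simp

lemma Re_Ac: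
  assumes a: "unode \<alpha>" "unode \<beta>" and f: "f \<in> Arr C" "Dom C f = L" and p: "upnt \<alpha> L p" "upnt \<beta> L q"
  shows "(Ac (cn \<alpha>) f (nm \<alpha> L p), Ac (cn \<beta>) f (nm \<beta> L q)) \<in> Re (ce (\<alpha>, \<beta>, \<kappa>)) (Cod C f) \<longleftrightarrow>
    url \<alpha> \<beta> \<kappa> (Cod C f) (uact f p) (uact f q)"
  using Ac_nm[OF a(1) _ f(1)] Ac_nm[OF a(2) _ f(1)] Re_nm[OF uact_pnt[OF p(1) f] uact_pnt[OF p(2) f]] p f(2) by simp

text \<open>From left to right the successor comes from \<open>u_dia\<close>; from right to left the
  modality clause of \<open>edge\<close>, transferred as \<open>u_dia_converse\<close>, applies.
  Injectivity of \<open>cn\<close> identifies the source of an arc with the given node.\<close>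

lemma Pt_dia:
  assumes a: "unode \<alpha>" and m: "m \<in> Mon C" and d: "d \<in> Dia C (Cod C m) (subobj C m)"
  shows "Ac (cn \<alpha>) d ` Pt (cn \<alpha>) (Dom C d) = {x \<in> Pt (cn \<alpha>) (Cod C m).
    \<exists>k\<in>arcs Gr. tail Gr k = cn \<alpha> \<and> (\<exists>y\<in>Pt (head Gr k) (Dom C m). (x, Ac (head Gr k) m y) \<in> Re k (Cod C m))}"
    (is "?L = {x \<in> Pt (cn \<alpha>) ?X. ?R x}")
proof -
  have mA: "m \<in> Arr C" using m by simp
  have S: "subobj C m \<in> carrier (Sub C ?X)" "m \<in> subobj C m" using SubI[OF m refl] subobj_self[OF m] .
  have D: "Dia C ?X (subobj C m) \<in> carrier (Sub C ?X)" using S mA by simp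
  note d' = Sub_mem[OF D d]
  have dA: "d \<in> Arr C" using d' by simp
  have sub: "?L \<subseteq> Pt (cn \<alpha>) ?X" using Ac_Pt[OF a dA] d'(2) by auto
  have iff: "nm \<alpha> ?X p \<in> ?L \<longleftrightarrow> ?R (nm \<alpha> ?X p)" if p: "upnt \<alpha> ?X p" for p
  proof -
    have "upnt \<alpha> (Cod C d) p" using p d'(2) by simp
    from Ac_image[OF a d'(1) this] have L: "nm \<alpha> ?X p \<in> ?L \<longleftrightarrow> USat \<alpha> p (Dia C ?X (subobj C m))" unfolding d'(2,3) .
    show ?thesis unfolding L
    proof
      assume "USat \<alpha> p (Dia C ?X (subobj C m))"
      from u_dia[OF a p S(1) this] obtain \<beta> \<kappa> p' where b: "unode \<beta>" "uedge \<alpha> \<beta> \<kappa>" "upnt \<beta> ?X p'" "USat \<beta> p' (subobj C m)" "url \<alpha> \<beta> \<kappa> ?X p p'"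
        by blast
      note k = arcI[OF a b(1,2)]
      from Ac_image[OF b(1) m b(3)] b(4) obtain y where y: "y \<in> Pt (cn \<beta>) (Dom C m)" "nm \<beta> ?X p' = Ac (cn \<beta>) m y" by blast
      have "(nm \<alpha> ?X p, Ac (cn \<beta>) m y) \<in> Re (ce (\<alpha>, \<beta>, \<kappa>)) ?X" unfolding y(2)[symmetric] using Re_nm[OF p b(3)] b(5) by simp
      then show "?R (nm \<alpha> ?X p)" using y(1) k by (intro bexI[OF _ k(1)]) auto
    next
      assume "?R (nm \<alpha> ?X p)"
      then obtain k y where k: "k \<in> arcs Gr" "tail Gr k = cn \<alpha>" "y \<in> Pt (head Gr k) (Dom C m)" "(nm \<alpha> ?X p, Ac (head Gr k) m y) \<in> Re k ?X" by blast
      from k(1) obtain \<alpha>' \<beta> \<kappa> where b: "k = ce (\<alpha>', \<beta>, \<kappa>)" "unode \<alpha>'" "unode \<beta>" "uedge \<alpha>' \<beta> \<kappa>" "tail Gr k = cn \<alpha>'" "head Gr k = cn \<beta>"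
        by (rule arcE)
      have a': "\<alpha>' = \<alpha>" using b(5) k(2) injD[OF inj_cn] by simp
      have y': "y \<in> Pt (cn \<beta>) (Dom C m)" "(nm \<alpha> ?X p, Ac (cn \<beta>) m y) \<in> Re (ce (\<alpha>, \<beta>, \<kappa>)) ?X" using k(3,4) b(6) b(1) a' by simp_all
      obtain q where q: "upnt \<beta> (Dom C m) q" "y = nm \<beta> (Dom C m) q" using y'(1) Pt_iff by blast
      have q': "upnt \<beta> ?X (uact m q)" by (rule uact_pnt[OF q(1) mA refl])
      have r: "url \<alpha> \<beta> \<kappa> ?X p (uact m q)" using y'(2) Re_nm[OF p q'] Ac_nm[OF b(3) q(1) mA] q(2) by simp
      have "USat \<beta> (uact m q) (subobj C m)" using u_lift[OF b(3) q' S] q(1) by (blast intro: ueq_refl)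
      from u_dia_converse[OF b(4)[unfolded a'] S(1) this r] show "USat \<alpha> p (Dia C ?X (subobj C m))" .
    qed
  qed
  show ?thesis
  proof (rule Set.set_eqI)
    fix x
    show "x \<in> ?L \<longleftrightarrow> x \<in> {x \<in> Pt (cn \<alpha>) ?X. ?R x}"
    proof (cases "x \<in> Pt (cn \<alpha>) ?X")
      case True
      then obtain p where p: "upnt \<alpha> ?X p" "x = nm \<alpha> ?X p" using Pt_iff by blast
      show ?thesis unfolding mem_Collect_eq using iff[OF p(1), folded p(2)] True by blast
    qed (use sub in blast)
  qed
qed

lemma rep: "rep Gr tup pa pb C Pt Ac Re"
proof unfold_locales
  show "tail Gr k \<in> verts Gr" "head Gr k \<in> verts Gr" if "k \<in> arcs Gr" for k
    using that by (auto simp: Gr_def inv_f_f[OF inj_ce])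
  show "inj tup" "pa \<noteq> pb" by (rule inj_tup, rule pa_pb)
  fix \<nu> assume "\<nu> \<in> verts Gr"
  then obtain \<alpha> where a: "\<nu> = cn \<alpha>" "unode \<alpha>" by (rule vertE)
  show "Ac \<nu> f x \<in> Pt \<nu> (Cod C f)" if "f \<in> Arr C" "x \<in> Pt \<nu> (Dom C f)" for f x
    using Ac_Pt[OF a(2) that(1)] that(2) a(1) by simp
  show "Ac \<nu> (Ident C X) x = x" if X: "X \<in> Obj C" and x: "x \<in> Pt \<nu> X" for X x
  proof -
    note i = ident_arr[OF X]
    obtain p where p: "upnt \<alpha> X p" "x = nm \<alpha> X p" using x Pt_iff a(1) by blast
    show ?thesis using Ac_nm[OF a(2) _ i(1)] nm_eq[OF uact_pnt[OF p(1) i(1,2), unfolded i(3)] p(1)] uact_ident[OF p(1)] p a(1) i by simp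
  qed
  show "Ac \<nu> (g \<cdot> f) x = Ac \<nu> g (Ac \<nu> f x)" if f: "f \<in> Arr C" "g \<in> Arr C" "Dom C g = Cod C f" and x: "x \<in> Pt \<nu> (Dom C f)" for f g x
  proof -
    obtain p where p: "upnt \<alpha> (Dom C f) p" "x = nm \<alpha> (Dom C f) p" using x Pt_iff a(1) by blast
    have gf: "g \<cdot> f \<in> Arr C" "Dom C (g \<cdot> f) = Dom C f" "Cod C (g \<cdot> f) = Cod C g" using f by simp_all
    have fp: "upnt \<alpha> (Dom C g) (uact f p)" using uact_pnt[OF p(1) f(1) refl] f(3) by simp
    have 1: "Ac \<nu> (g \<cdot> f) x = nm \<alpha> (Cod C g) (uact (g \<cdot> f) p)" using Ac_nm[OF a(2) _ gf(1)] p a(1) gf(2,3) by simp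
    have 2: "Ac \<nu> g (Ac \<nu> f x) = nm \<alpha> (Cod C g) (uact g (uact f p))"
      using Ac_nm[OF a(2) p(1) f(1)] Ac_nm[OF a(2) fp f(2)] p(2) a(1) f(3) by simp
    show ?thesis unfolding 1 2
      using nm_eq[OF uact_pnt[OF p(1) gf(1,2), unfolded gf(3)] uact_pnt[OF fp f(2) refl]] uact_comp[OF p(1) f(1) refl f(2,3)] by simp
  qed
  show "\<exists>x\<in>Pt \<nu> L. \<forall>i\<in>Obj J. Ac \<nu> (l i) x = z i"
    if "finite_diagram J C Do Da" "is_limit J C Do Da L l" "\<forall>i\<in>Obj J. z i \<in> Pt \<nu> (Do i)"
      "\<forall>u\<in>Arr J. Ac \<nu> (Da u) (z (Dom J u)) = z (Cod J u)" for J :: "(nat, nat) cat" and Do Da L l z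
    using Pt_lim[OF a(2) that(1,2)] that(3,4) a(1) by blast
  show "x = y"
    if J: "finite_diagram J C Do Da" "is_limit J C Do Da L l" and xy: "x \<in> Pt \<nu> L" "y \<in> Pt \<nu> L"
      and e: "\<forall>i\<in>Obj J. Ac \<nu> (l i) x = Ac \<nu> (l i) y" for J :: "(nat, nat) cat" and Do Da L l x y
  proof -
    obtain p q where p: "upnt \<alpha> L p" "x = nm \<alpha> L p" "upnt \<alpha> L q" "y = nm \<alpha> L q" using xy Pt_iff a(1) by blast
    note d = limD(1,2)[OF J]
    have "ueq \<alpha> (uact (l i) p) (uact (l i) q)" if "i \<in> Obj J" for i
      using Ac_lim_eq[OF a(2) d[OF that] p(1,3)] e that p(2,4) a(1) by simp
    from u_limit_mono[OF a(2) J p(1,3) this] show ?thesis using nm_eq[OF p(1,3)] p(2,4) by simp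
  qed
  show "\<exists>y\<in>Pt \<nu> (Dom C e). Ac \<nu> e y = x" if e: "e \<in> Mperp C" and x: "x \<in> Pt \<nu> (Cod C e)" for e x
  proof -
    have eA: "e \<in> Arr C" using e by simp
    obtain p where p: "upnt \<alpha> (Cod C e) p" "x = nm \<alpha> (Cod C e) p" using x Pt_iff a(1) by blast
    from u_perp[OF a(2) e p(1)] obtain q where q: "upnt \<alpha> (Dom C e) q" "ueq \<alpha> (uact e q) p" by blast
    have "Ac \<nu> e (nm \<alpha> (Dom C e) q) = x" using Ac_nm[OF a(2) q(1) eA] nm_eq[OF uact_pnt[OF q(1) eA refl] p(1)] q(2) p(2) a(1) by simp
    then show ?thesis using q(1) Pt_iff a(1) by blast
  qed
  show "x = y" if m: "m \<in> Mon C" and xy: "x \<in> Pt \<nu> (Dom C m)" "y \<in> Pt \<nu> (Dom C m)" "Ac \<nu> m x = Ac \<nu> m y" for m x y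
  proof -
    obtain p q where p: "upnt \<alpha> (Dom C m) p" "x = nm \<alpha> (Dom C m) p" "upnt \<alpha> (Dom C m) q" "y = nm \<alpha> (Dom C m) q"
      using xy(1,2) Pt_iff a(1) by blast
    show ?thesis using Ac_lim_eq[OF a(2) mon_arr[OF m] refl p(1,3)] u_mon[OF a(2) m p(1,3)] nm_eq[OF p(1,3)] xy(3) p(2,4) a(1) by simp
  qed
  show "Ac \<nu> m x \<in> Ac \<nu> m1 ` Pt \<nu> (Dom C m1) \<union> Ac \<nu> m2 ` Pt \<nu> (Dom C m2)"
    if j: "is_join C X (subobj C m1) (subobj C m2) (subobj C m)" and m: "m1 \<in> Mon C" "m2 \<in> Mon C" "m \<in> Mon C"
      and x: "x \<in> Pt \<nu> (Dom C m)" for X m1 m2 m x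
  proof -
    have X: "Cod C m1 = X" "Cod C m2 = X" "Cod C m = X"
      using j m Sub_mem(2)[OF _ subobj_self] unfolding is_join_def by blast+
    obtain p where p: "upnt \<alpha> (Dom C m) p" "x = nm \<alpha> (Dom C m) p" using x Pt_iff a(1) by blast
    have q: "upnt \<alpha> X (uact m p)" "Ac \<nu> m x = nm \<alpha> X (uact m p)"
      using uact_pnt[OF p(1) mon_arr[OF m(3)] refl] Ac_nm[OF a(2) p(1) mon_arr[OF m(3)]] p(2) a(1) X(3) by simp_all
    note im = Ac_image[OF a(2) m(1), unfolded X, OF q(1)] Ac_image[OF a(2) m(2), unfolded X, OF q(1)] Ac_image[OF a(2) m(3), unfolded X, OF q(1)]
    have "nm \<alpha> X (uact m p) \<in> Ac (cn \<alpha>) m ` Pt (cn \<alpha>) (Dom C m)"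
      unfolding q(2)[symmetric] unfolding a(1) using x[unfolded a(1)] by (rule imageI)
    then show ?thesis using u_join[OF a(2) j q(1)] im unfolding q(2) unfolding a(1) by blast
  qed
  show "Ac \<nu> m1 x \<noteq> Ac \<nu> m2 y"
    if c: "is_compl C X (subobj C m1) (subobj C m2)" and m: "m1 \<in> Mon C" "m2 \<in> Mon C"
      and xy: "x \<in> Pt \<nu> (Dom C m1)" "y \<in> Pt \<nu> (Dom C m2)" for X m1 m2 x y
  proof
    assume e: "Ac \<nu> m1 x = Ac \<nu> m2 y"
    have X: "Cod C m1 = X" "Cod C m2 = X"
      using c m Sub_mem(2)[OF _ subobj_self] unfolding is_compl_def is_join_def by blast+
    have "Ac \<nu> m1 x \<in> Pt (cn \<alpha>) X" using Ac_Pt[OF a(2) mon_arr[OF m(1)]] xy(1) a(1) X(1) by simp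
    then obtain p where p: "upnt \<alpha> X p" "Ac \<nu> m1 x = nm \<alpha> X p" using Pt_iff by blast
    note im = Ac_image[OF a(2) m(1), unfolded X, OF p(1)] Ac_image[OF a(2) m(2), unfolded X, OF p(1)]
    have "nm \<alpha> X p \<in> Ac (cn \<alpha>) m1 ` Pt (cn \<alpha>) (Dom C m1)" "nm \<alpha> X p \<in> Ac (cn \<alpha>) m2 ` Pt (cn \<alpha>) (Dom C m2)"
      using p(2) e xy unfolding a(1) by (metis imageI)+
    then show False using u_disj[OF a(2) p(1) c] im by simp
  qed
  show "Pt \<nu> X = {}" if "null C X" for X using u_null[OF a(2) that] Pt_iff a(1) by blast
  show "Ac \<nu> d ` Pt \<nu> (Dom C d) = {x \<in> Pt \<nu> (Cod C m).
      \<exists>k\<in>arcs Gr. tail Gr k = \<nu> \<and> (\<exists>y\<in>Pt (head Gr k) (Dom C m). (x, Ac (head Gr k) m y) \<in> Re k (Cod C m))}"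
    if "m \<in> Mon C" "d \<in> Dia C (Cod C m) (subobj C m)" for m d
    unfolding a(1) by (rule Pt_dia[OF a(2) that])
next
  fix k assume "k \<in> arcs Gr"
  then obtain \<alpha> \<beta> \<kappa> where k: "k = ce (\<alpha>, \<beta>, \<kappa>)" "unode \<alpha>" "unode \<beta>" "uedge \<alpha> \<beta> \<kappa>" "tail Gr k = cn \<alpha>" "head Gr k = cn \<beta>"
    by (rule arcE)
  show "x \<in> Pt (tail Gr k) X \<and> y \<in> Pt (head Gr k) X" if "(x, y) \<in> Re k X" for x y X
    using that unfolding k(5,6) unfolding k(1) Re_iff Pt_iff by blast
  show "(Ac (tail Gr k) f x, Ac (head Gr k) f y) \<in> Re k (Cod C f)" if f: "f \<in> Arr C" and r: "(x, y) \<in> Re k (Dom C f)" for f x y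
  proof -
    obtain p q where p: "upnt \<alpha> (Dom C f) p" "upnt \<beta> (Dom C f) q" "url \<alpha> \<beta> \<kappa> (Dom C f) p q" "x = nm \<alpha> (Dom C f) p" "y = nm \<beta> (Dom C f) q"
      using r unfolding k(1) Re_iff by blast
    show ?thesis unfolding k(5,6) p(4,5) unfolding k(1)
      using Re_Ac[OF k(2,3) f refl p(1,2)] u_rel_act[OF k(4,2,3) p(1,2,3) f refl] by simp
  qed
  show "(x, y) \<in> Re k L"
    if J: "finite_diagram J C Do Da" "is_limit J C Do Da L l" and xy: "x \<in> Pt (tail Gr k) L" "y \<in> Pt (head Gr k) L"
      and r: "\<forall>i\<in>Obj J. (Ac (tail Gr k) (l i) x, Ac (head Gr k) (l i) y) \<in> Re k (Do i)" for J :: "(nat, nat) cat" and Do Da L l x y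
  proof -
    obtain p q where p: "upnt \<alpha> L p" "upnt \<beta> L q" "x = nm \<alpha> L p" "y = nm \<beta> L q" using xy unfolding k(5,6) Pt_iff by blast
    note d = limD(1,2,3)[OF J]
    have "url \<alpha> \<beta> \<kappa> (Do i) (uact (l i) p) (uact (l i) q)" if i: "i \<in> Obj J" for i
    proof -
      have "(Ac (cn \<alpha>) (l i) x, Ac (cn \<beta>) (l i) y) \<in> Re (ce (\<alpha>, \<beta>, \<kappa>)) (Do i)" using r i unfolding k(5,6) unfolding k(1) by blast
      then show ?thesis using Re_Ac[OF k(2,3) d(1,2)[OF i] p(1,2)] p(3,4) d(3)[OF i] by simp
    qed
    from u_rel_limit[OF k(4) J p(1,2) this] show ?thesis unfolding k(1) p(3,4) Re_nm[OF p(1,2)] .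
  qed
  show "(x, y) \<in> Re k (Dom C m)"
    if m: "m \<in> Mon C" and xy: "x \<in> Pt (tail Gr k) (Dom C m)" "y \<in> Pt (head Gr k) (Dom C m)"
      and r: "(Ac (tail Gr k) m x, Ac (head Gr k) m y) \<in> Re k (Cod C m)" for m x y
  proof -
    obtain p q where p: "upnt \<alpha> (Dom C m) p" "upnt \<beta> (Dom C m) q" "x = nm \<alpha> (Dom C m) p" "y = nm \<beta> (Dom C m) q"
      using xy unfolding k(5,6) Pt_iff by blast
    have "url \<alpha> \<beta> \<kappa> (Cod C m) (uact m p) (uact m q)"
      using r Re_Ac[OF k(2,3) mon_arr[OF m] refl p(1,2)] unfolding k(5,6) p(3,4) unfolding k(1) by blast
    from u_rel_mon[OF k(4) m p(1,2) this] show ?thesis unfolding k(1) p(3,4) Re_nm[OF p(1,2)] .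
  qed
  show "\<exists>x' y'. (x', y') \<in> Re k (Dom C q) \<and> Ac (tail Gr k) q x' = x \<and> Ac (head Gr k) q y' = y"
    if q: "q \<in> Quo C" and r: "(x, y) \<in> Re k (Cod C q)" for q x y
  proof -
    have qA: "q \<in> Arr C" using q quo_Mperp Mperp_arr by blast
    obtain p p' where p: "upnt \<alpha> (Cod C q) p" "upnt \<beta> (Cod C q) p'" "url \<alpha> \<beta> \<kappa> (Cod C q) p p'" "x = nm \<alpha> (Cod C q) p" "y = nm \<beta> (Cod C q) p'"
      using r unfolding k(1) Re_iff by blast
    from u_rel_quo[OF k(4) q p(3)] obtain s s' where s: "upnt \<alpha> (Dom C q) s" "upnt \<beta> (Dom C q) s'" "url \<alpha> \<beta> \<kappa> (Dom C q) s s'"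
      "ueq \<alpha> (uact q s) p" "ueq \<beta> (uact q s') p'" by blast
    have "Ac (cn \<alpha>) q (nm \<alpha> (Dom C q) s) = x" "Ac (cn \<beta>) q (nm \<beta> (Dom C q) s') = y"
      using Ac_nm[OF k(2) s(1) qA] Ac_nm[OF k(3) s(2) qA] nm_eq[OF uact_pnt[OF s(1) qA refl] p(1)]
        nm_eq[OF uact_pnt[OF s(2) qA refl] p(2)] s(4,5) p(4,5) by simp_all
    moreover have "(nm \<alpha> (Dom C q) s, nm \<beta> (Dom C q) s') \<in> Re k (Dom C q)" unfolding k(1) Re_nm[OF s(1,2)] by (rule s(3))
    ultimately show ?thesis unfolding k(5,6) by blast
  qed
next
  show "\<exists>\<nu>\<in>verts Gr. Pt \<nu> X \<noteq> {}" if X: "X \<in> Obj C" "\<not> null C X" for X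
  proof -
    obtain \<alpha> p where "unode \<alpha>" "upnt \<alpha> X p" using u_conservative[OF X] by blast
    then show ?thesis using Pt_iff[of _ \<alpha> X] by (intro bexI[of _ "cn \<alpha>"]) (auto simp: Gr_def)
  qed
qed

end

theorem mainTheorem1:
  fixes E :: "('o, 'a) modal_quot_cat"
  assumes "boolean_modal_category_with_quotients E"
  shows "\<exists>(G :: ('a univ, 'a univ) pre_digraph)
          (Fo :: 'o \<Rightarrow> ('a univ, 'a univ, 'a univ) rset)
          (Fa :: 'a \<Rightarrow> ('a univ, 'a univ, 'a univ) rmap).
           wf_digraph G \<and>
           boolean_modal_category_with_quotients_morphism E (Rel G) Fo Fa \<and>
           M_conservative E (Rel G) Fa"
proof -
  interpret E: boolean_modal_category_with_quotients E by (rule assms)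
  have "\<exists>\<Sigma>. \<Phi> \<subseteq> \<Sigma> \<and> fragment E \<Sigma>" if "finite \<Phi>" "\<Phi> \<subseteq> Arr E" for \<Phi>
    using E.fragment_exists[OF countable_finite[OF that(1)] that(2)] by blast
  then obtain Sg where Sg: "\<And>\<Phi>. finite \<Phi> \<Longrightarrow> \<Phi> \<subseteq> Arr E \<Longrightarrow> \<Phi> \<subseteq> Sg \<Phi> \<and> fragment E (Sg \<Phi>)" by metis
  \<comment> \<open>For the filter \<open>finite_subsets_at_top\<close>, almost all finite sets
    contain any given arrow; refining it to an ultrafilter keeps this.\<close>
  obtain U where U: "U \<le> finite_subsets_at_top (Arr E)" "U \<noteq> bot"
    "\<And>P. eventually P U \<or> eventually (\<lambda>x. \<not> P x) U"
    by (rule ultrafilter_below[OF finite_subsets_at_top_neq_bot[of "Arr E"]]) blast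
  have ev: "eventually P U" if "eventually P (finite_subsets_at_top (Arr E))" for P
    using that U(1) by (rule filter_leD[rotated])
  interpret ultra E U Sg
  proof unfold_locales
    show "\<forall>\<^sub>F \<Phi> in U. fragment E (Sg \<Phi>)"
      using Sg by (intro ev eventually_finite_subsets_at_top_weakI) blast
    show "\<forall>\<^sub>F \<Phi> in U. f \<in> Sg \<Phi>" if "f \<in> Arr E" for f
      using Sg that by (intro ev) (force simp: eventually_finite_subsets_at_top intro!: exI[of _ "{f}"])
  qed (rule U)+
  obtain tup :: "(nat \<Rightarrow> 'a univ) \<Rightarrow> 'a univ" and cp :: "('a set \<Rightarrow> nat \<times> 'a) \<Rightarrow> 'a univ"
    and cn :: "('a set \<Rightarrow> nat \<Rightarrow> nat \<Rightarrow> 'a) \<Rightarrow> 'a univ"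
    and ce :: "('a set \<Rightarrow> nat \<Rightarrow> nat \<Rightarrow> 'a) \<times> ('a set \<Rightarrow> nat \<Rightarrow> nat \<Rightarrow> 'a) \<times>
      ('a set \<Rightarrow> (nat \<Rightarrow> nat \<times> 'a) \<times> (nat \<Rightarrow> 'a)) \<Rightarrow> 'a univ"
    where codes: "inj tup" "inj cp" "inj cn" "inj ce" using univ_codes .
  \<comment> \<open>\<open>{}\<close> and \<open>UNIV\<close> serve as the two distinct elements
    that label the ends of the test edge.\<close>
  interpret coded_ultra E U Sg tup "{}" UNIV cp cn ce
    by unfold_locales (use codes in simp_all)
  interpret r: rep Gr tup "{}" UNIV E Pt Ac Re by (rule rep)
  show ?thesis using r.rep_morphism r.wf_digraph_axioms by blast
qed



end
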